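(* As sets of functions on $(\operatorname{clos}\mathbb{C}_+)^2$, $$\mathfrak{M}_{\rm A}(\mathbb{C}_+^2)\cap {\rm C}^{\rm S}_{{\rm A},\infty}(\mathbb{C}_+^2)={\rm C}_{{\rm A},\infty}\otimes_{\rm h}{\rm C}_{{\rm A},\infty},$$ and $$\|\Phi\|_{{\rm C}_{{\rm A},\infty}\otimes_{\rm h}{\rm C}_{{\rm A},\infty}}=\|\Phi\|_{\mathfrak{M}(\mathbb{R}^2)}\quad\text{for every }\Phi\in{\rm C}_{{\rm A},\infty}\otimes_{\rm h}{\rm C}_{{\rm A},\infty},$$ where $\|\Phi\|_{\mathfrak{M}(\mathbb{R}^2)}$ denotes the norm of the restriction $\Phi|\mathbb{R}^2$.
   Context: Notation: $\mathbb{C}_+=\{\zeta\in\mathbb{C}:\operatorname{Im}\zeta>0\}$, $\operatorname{clos}\mathbb{C}_+=\{\zeta\in\mathbb{C}:\operatorname{Im}\zeta\ge0\}$; $H^\infty(\mathbb{C}_+)$ and $H^\infty(\mathbb{C}_+^2)$ are the spaces of bounded holomorphic functions on $\mathbb{C}_+$ and $\mathbb{C}_+\times\mathbb{C}_+$. Schur multipliers. Let $E_1,E_2$ be Borel spectral measures (projection-valued measures) on $\mathbb{R}$ acting on a Hilbert space. Let $\boldsymbol{S}_1$, $\boldsymbol{S}_2$ (written $S_1$, $S_2$ below) be the trace class and the Hilbert–Schmidt class on it. Let ${\rm E}$ be the spectral measure on the Hilbert space $S_2$ determined on measurable rectangles by ${\rm E}(\Lambda\times\Delta)Q=E_1(\Lambda)QE_2(\Delta)$,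 $Q\in S_2$. For a bounded measurable $\Phi$ on $\mathbb{R}^2$ and $Q\in S_2$ put $\iint\Phi\,dE_1\,Q\,dE_2=\left(\int\Phi\,d{\rm E}\right)Q$. $\Phi$ is a Schur multiplier with respect to $E_1,E_2$ if $Q\in S_1$ implies $\iint\Phi\,dE_1Q\,dE_2\in S_1$; its norm $\|\Phi\|_{\mathfrak{M}_{E_1,E_2}}$ is the norm of the transformer $Q\mapsto\iint\Phi\,dE_1Q\,dE_2$ on $S_1$. The class $\mathfrak{M}(\mathbb{R}^2)$ of Borel Schur multipliers consists of the functions on $\mathbb{R}^2$ that are Schur multipliers with respect to arbitrary Borel spectral measures $E_1,E_2$ on $\mathbb{R}$, and $\|\Phi\|_{\mathfrak{M}(\mathbb{R}^2)}=\sup_{E_1,E_2}\|\Phi\|_{\mathfrak{M}_{E_1,E_2}}$. Analytic Schur multipliers. $H^\infty_{\rm r}(\mathbb{C}_+^2)$ is the space of functions $\Phi$ on $(\operatorname{clos}\mathbb{C}_+)^2$ such that $\Phi|\mathbb{C}_+^2\in H^\infty(\mathbb{C}_+^2)$ and $\lim_{t\to0^+}\Phi(z+t{\rm i},w)=\lim_{t\to0^+}\Phi(z,w+t{\rm i})=\Phi(z,w)$ for all $z,w\in\operatorname{clos}\mathbb{C}_+$. $\mathfrak{M}_{\rm A}(\mathbb{C}_+^2)$ is the class of $\Phi\in H^\infty_{\rm r}(\mathbb{C}_+^2)$ with $\Phi|\mathbb{R}^2\in\mathfrak{M}(\mathbb{R}^2)$. Function spaces. ${\rm C}_{{\rm A},\infty}={\rm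 C}_{{\rm A},\infty}(\mathbb{C}_+)$ is the space of functions in $H^\infty(\mathbb{C}_+)$ whose boundary-value function is continuous on $\mathbb{R}$, i.e. (identifying a function with its extension) bounded continuous functions on $\operatorname{clos}\mathbb{C}_+$ that are holomorphic in $\mathbb{C}_+$. ${\rm C}^{\rm S}_{{\rm A},\infty}(\mathbb{C}_+^2)$ is the space of functions $f$ on $(\operatorname{clos}\mathbb{C}_+)^2$ with $f|\mathbb{C}_+^2\in H^\infty(\mathbb{C}_+^2)$ and $f(z,\cdot),f(\cdot,z)\in{\rm C}_{{\rm A},\infty}$ for all $z\in\operatorname{clos}\mathbb{C}_+$. Haagerup tensor product. For a space $X$ of bounded functions on $\operatorname{clos}\mathbb{C}_+$, $X\otimes_{\rm h}X$ is the class of functions $\Phi$ on $(\operatorname{clos}\mathbb{C}_+)^2$ of the form $\Phi(z,w)=\sum_{n\ge0}\varphi_n(z)\psi_n(w)$ with $\varphi_n,\psi_n\in X$ such that $\sum_n|\varphi_n|^2$ and $\sum_n|\psi_n|^2$ are bounded on $\operatorname{clos}\mathbb{C}_+$; its norm $\|\Phi\|_{X\otimes_{\rm h}X}$ is the infimum of $\sup\left(\sum_n|\varphi_n|^2\right)^{1/2}\cdot\sup\left(\sum_n|\psi_n|^2\right)^{1/2}$ (suprema over $\operatorname{clos}\mathbb{C}_+$) over all such representations. *)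

theory Defs
  imports "HOL-Analysis.Analysis" "HOL-Algebra.Module"
begin

section \<open>Complex Hilbert spaces and their operators\<close>

text \<open>Hilbert spaces are structures on a carrier set, so that one can quantify over all of them
  (with carrier inside a given type) and so that the Hilbert-Schmidt class of a Hilbert space is
  again a Hilbert space in the same sense.  They extend the module records of HOL-Algebra; the
  fields \<open>mult\<close> and \<open>one\<close>, which these inherit from ring records, play no role.\<close>

definition complex_ring :: "complex ring" where
  "complex_ring = \<lparr>carrier = UNIV, mult = (*), one = 1, zero = 0, add = (+)\<rparr>"

record 'v hilbert = "(complex, 'v) module" +
  ip :: "'v \<Rightarrow> 'v \<Rightarrow> complex"

definition hnorm :: "'v hilbert \<Rightarrow> 'v \<Rightarrow> real" where
  "hnorm H x = sqrt (Re (ip H x x))"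

locale complex_hilbert = Module.module complex_ring H for H :: "'v hilbert" +
  assumes ip_add_left:
      "\<lbrakk>x \<in> carrier H; y \<in> carrier H; z \<in> carrier H\<rbrakk>
        \<Longrightarrow> ip H (x \<oplus>\<^bsub>H\<^esub> y) z = ip H x z + ip H y z"
    and ip_smult_left:
      "\<lbrakk>x \<in> carrier H; y \<in> carrier H\<rbrakk> \<Longrightarrow> ip H (a \<odot>\<^bsub>H\<^esub> x) y = a * ip H x y"
    and ip_commute:
      "\<lbrakk>x \<in> carrier H; y \<in> carrier H\<rbrakk> \<Longrightarrow> ip H y x = cnj (ip H x y)"
    and ip_pos:
      "\<lbrakk>x \<in> carrier H; x \<noteq> \<zero>\<^bsub>H\<^esub>\<rbrakk> \<Longrightarrow> Re (ip H x x) > 0"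
    and complete:
      "\<lbrakk>\<And>n. X n \<in> carrier H;
        \<And>e. e > 0 \<Longrightarrow> \<exists>N. \<forall>m\<ge>N. \<forall>n\<ge>N. hnorm H (X m \<ominus>\<^bsub>H\<^esub> X n) < e\<rbrakk>
        \<Longrightarrow> \<exists>x\<in>carrier H. (\<lambda>n. hnorm H (X n \<ominus>\<^bsub>H\<^esub> x)) \<longlonglongrightarrow> 0"

definition orthonormal_basis :: "'v hilbert \<Rightarrow> 'v set \<Rightarrow> bool" where
  "orthonormal_basis H B \<longleftrightarrow>
     B \<subseteq> carrier H \<and>
     (\<forall>e\<in>B. \<forall>f\<in>B. ip H e f = (if e = f then 1 else 0)) \<and>
     (\<forall>x\<in>carrier H. (\<forall>e\<in>B. ip H x e = 0) \<longrightarrow> x = \<zero>\<^bsub>H\<^esub>)"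

text \<open>The quantities defined through this choice do not depend on it.\<close>

definition some_basis :: "'v hilbert \<Rightarrow> 'v set" where
  "some_basis H = (SOME B. orthonormal_basis H B)"

text \<open>Operators are extensional functions on the carrier, so that operators that agree on the
  space are equal; accordingly the product of operators is \<^term>\<open>compose (carrier H)\<close>.\<close>

definition bounded_ops :: "'v hilbert \<Rightarrow> ('v \<Rightarrow> 'v) set" where
  "bounded_ops H = {T \<in> carrier H \<rightarrow>\<^sub>E carrier H.
     (\<forall>x\<in>carrier H. \<forall>y\<in>carrier H. T (x \<oplus>\<^bsub>H\<^esub> y) = T x \<oplus>\<^bsub>H\<^esub> T y) \<and>
     (\<forall>a. \<forall>x\<in>carrier H. T (a \<odot>\<^bsub>H\<^esub> x) = a \<odot>\<^bsub>H\<^esub> T x) \<and>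
     (\<exists>C. \<forall>x\<in>carrier H. hnorm H (T x) \<le> C * hnorm H x)}"

definition adjoint_op :: "'v hilbert \<Rightarrow> ('v \<Rightarrow> 'v) \<Rightarrow> ('v \<Rightarrow> 'v)" where
  "adjoint_op H T = (THE S. S \<in> bounded_ops H \<and>
     (\<forall>x\<in>carrier H. \<forall>y\<in>carrier H. ip H (T x) y = ip H x (S y)))"

definition positive_op :: "'v hilbert \<Rightarrow> ('v \<Rightarrow> 'v) \<Rightarrow> bool" where
  "positive_op H T \<longleftrightarrow> T \<in> bounded_ops H \<and>
     (\<forall>x\<in>carrier H. Im (ip H (T x) x) = 0 \<and> Re (ip H (T x) x) \<ge> 0)"

definition projections :: "'v hilbert \<Rightarrow> ('v \<Rightarrow> 'v) set" where
  "projections H = {P \<in> bounded_ops H. compose (carrier H) P P = P \<and> adjoint_op H P = P}"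

definition abs_op :: "'v hilbert \<Rightarrow> ('v \<Rightarrow> 'v) \<Rightarrow> ('v \<Rightarrow> 'v)" where
  "abs_op H T = (THE A. positive_op H A \<and>
     compose (carrier H) A A = compose (carrier H) (adjoint_op H T) T)"

definition trace_norm :: "'v hilbert \<Rightarrow> ('v \<Rightarrow> 'v) \<Rightarrow> ennreal" where
  "trace_norm H T = (\<Sum>\<^sub>\<infinity>e\<in>some_basis H. ennreal (Re (ip H (abs_op H T e) e)))"

definition trace_class :: "'v hilbert \<Rightarrow> ('v \<Rightarrow> 'v) set" where
  "trace_class H = {T \<in> bounded_ops H. trace_norm H T < \<infinity>}"

definition hilbert_schmidt :: "'v hilbert \<Rightarrow> ('v \<Rightarrow> 'v) hilbert" where
  "hilbert_schmidt H = \<lparr>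
     carrier = {T \<in> bounded_ops H. (\<lambda>e. (hnorm H (T e))\<^sup>2) summable_on some_basis H},
     mult = undefined, one = undefined,
     zero = (\<lambda>x\<in>carrier H. \<zero>\<^bsub>H\<^esub>),
     add = (\<lambda>S T. \<lambda>x\<in>carrier H. S x \<oplus>\<^bsub>H\<^esub> T x),
     smult = (\<lambda>a T. \<lambda>x\<in>carrier H. a \<odot>\<^bsub>H\<^esub> T x),
     ip = (\<lambda>S T. \<Sum>\<^sub>\<infinity>e\<in>some_basis H. ip H (S e) (T e))\<rparr>"

section \<open>Spectral measures and double operator integrals\<close>

definition spectral_measure :: "'s measure \<Rightarrow> 'v hilbert \<Rightarrow> ('s set \<Rightarrow> 'v \<Rightarrow> 'v) \<Rightarrow> bool" where
  "spectral_measure M H E \<longleftrightarrow>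
     (\<forall>S\<in>sets M. E S \<in> projections H) \<and>
     E (space M) = (\<lambda>x\<in>carrier H. x) \<and>
     (\<forall>S\<in>sets M. \<forall>T\<in>sets M. E (S \<inter> T) = compose (carrier H) (E S) (E T)) \<and>
     (\<forall>A :: nat \<Rightarrow> 's set. range A \<subseteq> sets M \<longrightarrow> disjoint_family A \<longrightarrow>
        (\<forall>x\<in>carrier H. \<forall>y\<in>carrier H.
           (\<lambda>n. ip H (E (A n) x) y) sums ip H (E (\<Union>n. A n) x) y))"

definition scalar_measure ::
    "'s measure \<Rightarrow> 'v hilbert \<Rightarrow> ('s set \<Rightarrow> 'v \<Rightarrow> 'v) \<Rightarrow> 'v \<Rightarrow> 's measure" where
  "scalar_measure M H E x = measure_of (space M) (sets M) (\<lambda>S. ennreal (Re (ip H (E S x) x)))"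

text \<open>The space is complex, so a bounded operator is determined by its quadratic form.\<close>

definition spectral_integral ::
    "'s measure \<Rightarrow> 'v hilbert \<Rightarrow> ('s set \<Rightarrow> 'v \<Rightarrow> 'v) \<Rightarrow> ('s \<Rightarrow> complex) \<Rightarrow> ('v \<Rightarrow> 'v)" where
  "spectral_integral M H E \<Phi> = (THE T. T \<in> bounded_ops H \<and>
     (\<forall>x\<in>carrier H. ip H (T x) x = integral\<^sup>L (scalar_measure M H E x) \<Phi>))"

text \<open>Such a spectral measure exists and is unique on Borel sets; its values on other sets, which
  are arbitrary, do not enter spectral integrals.\<close>

definition double_spectral_measure ::
    "'v hilbert \<Rightarrow> (real set \<Rightarrow> 'v \<Rightarrow> 'v) \<Rightarrow> (real set \<Rightarrow> 'v \<Rightarrow> 'v)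
      \<Rightarrow> ((real \<times> real) set \<Rightarrow> ('v \<Rightarrow> 'v) \<Rightarrow> ('v \<Rightarrow> 'v))" where
  "double_spectral_measure H E1 E2 = (SOME E. spectral_measure borel (hilbert_schmidt H) E \<and>
     (\<forall>L\<in>sets borel. \<forall>D\<in>sets borel. \<forall>Q\<in>carrier (hilbert_schmidt H).
        E (L \<times> D) Q = compose (carrier H) (E1 L) (compose (carrier H) Q (E2 D))))"

definition double_operator_integral ::
    "'v hilbert \<Rightarrow> (real set \<Rightarrow> 'v \<Rightarrow> 'v) \<Rightarrow> (real set \<Rightarrow> 'v \<Rightarrow> 'v)
      \<Rightarrow> (real \<times> real \<Rightarrow> complex) \<Rightarrow> ('v \<Rightarrow> 'v) \<Rightarrow> ('v \<Rightarrow> 'v)" where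
  "double_operator_integral H E1 E2 \<Phi> Q =
     spectral_integral borel (hilbert_schmidt H) (double_spectral_measure H E1 E2) \<Phi> Q"

section \<open>Schur multipliers\<close>

definition is_schur_multiplier ::
    "'v hilbert \<Rightarrow> (real set \<Rightarrow> 'v \<Rightarrow> 'v) \<Rightarrow> (real set \<Rightarrow> 'v \<Rightarrow> 'v)
      \<Rightarrow> (real \<times> real \<Rightarrow> complex) \<Rightarrow> bool" where
  "is_schur_multiplier H E1 E2 \<Phi> \<longleftrightarrow>
     (\<forall>Q\<in>trace_class H. double_operator_integral H E1 E2 \<Phi> Q \<in> trace_class H)"

definition schur_norm_wrt ::
    "'v hilbert \<Rightarrow> (real set \<Rightarrow> 'v \<Rightarrow> 'v) \<Rightarrow> (real set \<Rightarrow> 'v \<Rightarrow> 'v)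
      \<Rightarrow> (real \<times> real \<Rightarrow> complex) \<Rightarrow> ennreal" where
  "schur_norm_wrt H E1 E2 \<Phi> =
     (SUP Q\<in>{Q \<in> trace_class H. trace_norm H Q \<le> 1}.
        trace_norm H (double_operator_integral H E1 E2 \<Phi> Q))"

text \<open>The type \<open>'v\<close> is a universe: the Hilbert spaces considered below are all those whose
  underlying set is a subset of \<open>'v\<close>.\<close>

definition borel_schur_multipliers :: "'v itself \<Rightarrow> (real \<times> real \<Rightarrow> complex) set" where
  "borel_schur_multipliers (U :: 'v itself) = {\<Phi> \<in> borel_measurable borel. bounded (range \<Phi>) \<and>
     (\<forall>(H :: 'v hilbert) E1 E2. complex_hilbert H \<longrightarrow>
        spectral_measure borel H E1 \<longrightarrow> spectral_measure borel H E2 \<longrightarrow>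
        is_schur_multiplier H E1 E2 \<Phi>)}"

definition schur_norm :: "'v itself \<Rightarrow> (real \<times> real \<Rightarrow> complex) \<Rightarrow> ennreal" where
  "schur_norm (U :: 'v itself) \<Phi> = Sup {schur_norm_wrt H E1 E2 \<Phi> | (H :: 'v hilbert) E1 E2.
     complex_hilbert H \<and> spectral_measure borel H E1 \<and> spectral_measure borel H E2}"

section \<open>Spaces of functions on the closed upper half-plane and its square\<close>

definition upper_hp :: "complex set" where
  "upper_hp = {z. Im z > 0}"

definition closed_upper_hp :: "complex set" where
  "closed_upper_hp = {z. Im z \<ge> 0}"

text \<open>Functions on the closed half-plane or on its square are represented by total functions.
  Every condition below concerns only the values on these domains, and every class of functions
  contains all total functions that represent its members.\<close>

text \<open>Holomorphy in two variables is complex differentiability: the real derivative exists and is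
  complex linear.\<close>

definition holomorphic2_on :: "(complex \<times> complex \<Rightarrow> complex) \<Rightarrow> (complex \<times> complex) set \<Rightarrow> bool"
  where "holomorphic2_on \<Phi> S \<longleftrightarrow>
     (\<forall>p\<in>S. \<exists>a b. (\<Phi> has_derivative (\<lambda>(h, k). a * h + b * k)) (at p within S))"

definition H_inf2 :: "(complex \<times> complex \<Rightarrow> complex) set" where
  "H_inf2 = {\<Phi>. holomorphic2_on \<Phi> (upper_hp \<times> upper_hp) \<and>
     bounded (\<Phi> ` (upper_hp \<times> upper_hp))}"

definition H_inf2_r :: "(complex \<times> complex \<Rightarrow> complex) set" where
  "H_inf2_r = {\<Phi> \<in> H_inf2. \<forall>z\<in>closed_upper_hp. \<forall>w\<in>closed_upper_hp.
     ((\<lambda>t::real. \<Phi> (z + of_real t * \<i>, w)) \<longlongrightarrow> \<Phi> (z, w)) (at_right 0) \<and>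
     ((\<lambda>t::real. \<Phi> (z, w + of_real t * \<i>)) \<longlongrightarrow> \<Phi> (z, w)) (at_right 0)}"

definition restrict_real2 :: "(complex \<times> complex \<Rightarrow> complex) \<Rightarrow> (real \<times> real \<Rightarrow> complex)" where
  "restrict_real2 \<Phi> = (\<lambda>(x, y). \<Phi> (of_real x, of_real y))"

definition analytic_schur_multipliers ::
    "'v itself \<Rightarrow> (complex \<times> complex \<Rightarrow> complex) set" where
  "analytic_schur_multipliers U =
     {\<Phi> \<in> H_inf2_r. restrict_real2 \<Phi> \<in> borel_schur_multipliers U}"

definition CA_inf :: "(complex \<Rightarrow> complex) set" where
  "CA_inf = {f. f holomorphic_on upper_hp \<and> continuous_on closed_upper_hp f \<and>
     bounded (f ` closed_upper_hp)}"

definition CSA_inf :: "(complex \<times> complex \<Rightarrow> complex) set" where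
  "CSA_inf = {\<Phi> \<in> H_inf2. \<forall>z\<in>closed_upper_hp.
     (\<lambda>w. \<Phi> (z, w)) \<in> CA_inf \<and> (\<lambda>w. \<Phi> (w, z)) \<in> CA_inf}"

section \<open>The Haagerup tensor product\<close>

definition square_bounded :: "(nat \<Rightarrow> complex \<Rightarrow> complex) \<Rightarrow> bool" where
  "square_bounded \<phi> \<longleftrightarrow> (\<exists>C. \<forall>z\<in>closed_upper_hp.
     summable (\<lambda>n. (cmod (\<phi> n z))\<^sup>2) \<and> (\<Sum>n. (cmod (\<phi> n z))\<^sup>2) \<le> C)"

definition square_sup :: "(nat \<Rightarrow> complex \<Rightarrow> complex) \<Rightarrow> real" where
  "square_sup \<phi> = (SUP z\<in>closed_upper_hp. sqrt (\<Sum>n. (cmod (\<phi> n z))\<^sup>2))"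

definition haagerup_rep ::
    "(complex \<Rightarrow> complex) set \<Rightarrow> (complex \<times> complex \<Rightarrow> complex)
      \<Rightarrow> (nat \<Rightarrow> complex \<Rightarrow> complex) \<Rightarrow> (nat \<Rightarrow> complex \<Rightarrow> complex) \<Rightarrow> bool" where
  "haagerup_rep X \<Phi> \<phi> \<psi> \<longleftrightarrow>
     range \<phi> \<subseteq> X \<and> range \<psi> \<subseteq> X \<and> square_bounded \<phi> \<and> square_bounded \<psi> \<and>
     (\<forall>z\<in>closed_upper_hp. \<forall>w\<in>closed_upper_hp. (\<lambda>n. \<phi> n z * \<psi> n w) sums \<Phi> (z, w))"

definition haagerup_tensor ::
    "(complex \<Rightarrow> complex) set \<Rightarrow> (complex \<times> complex \<Rightarrow> complex) set" where
  "haagerup_tensor X = {\<Phi>. \<exists>\<phi> \<psi>. haagerup_rep X \<Phi> \<phi> \<psi>}"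

definition haagerup_norm ::
    "(complex \<Rightarrow> complex) set \<Rightarrow> (complex \<times> complex \<Rightarrow> complex) \<Rightarrow> real" where
  "haagerup_norm X \<Phi> = Inf {square_sup \<phi> * square_sup \<psi> | \<phi> \<psi>. haagerup_rep X \<Phi> \<phi> \<psi>}"

end

theory Submission
  imports Defs "HOL-Complex_Analysis.Complex_Analysis"
begin

text \<open>If \<open>\<Phi> = \<Sum>\<^sub>n \<phi>\<^sub>n \<otimes> \<psi>\<^sub>n\<close>, the double operator integral of \<open>Q\<close> is
  \<open>\<Sum>\<^sub>n \<phi>\<^sub>n(E\<^sub>1) Q \<psi>\<^sub>n(E\<^sub>2)\<close>, and factoring \<open>Q\<close> into two Hilbert-Schmidt operators bounds its trace
  norm through the Cauchy-Schwarz inequality.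

  Conversely, discrete spectral measures on sequence space turn a Schur multiplier into a multiplier
  of matrices \<open>\<Phi> (x\<^sub>i, x\<^sub>j)\<close> for a dense sequence of reals.  Applied to rank one matrices \<open>d e\<^sup>*\<close>, and after
  a minimax argument over the weights \<open>d\<close> and \<open>e\<close>, the trace norm bound yields positive semidefinite
  completions with diagonal bounded by the multiplier norm, hence vectors with
  \<open>\<Phi> (x\<^sub>i, x\<^sub>j) = \<langle>u\<^sub>i, v\<^sub>j\<rangle>\<close>.  As \<open>\<Phi>\<close> is separately analytic, the maximum principle and the Riesz
  representation theorem extend \<open>u\<close> and \<open>v\<close> to analytic families on the closed half-plane with the
  same bounds, and their coordinates are the functions of a Haagerup representation.\<close>

text \<open>Membership in \<open>borel_schur_multipliers\<close> carries no norm bound: it only says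
  that each transformer maps the trace class into itself. The uniform bound comes from a gliding
  hump, which packs finite test matrices violating ever larger constants into one operator. Minimax
  enters because a trace norm bound yields, for each pair of weights \<open>d\<close>,
  \<open>e\<close>, its own completion of the weighted matrix with small traces, whereas one
  completion with every diagonal entry small has to serve all weights at once; the completions form
  a convex set. The extension to the half-plane goes one variable at a time, as
  \<open>\<Phi>\<close> is only known to be separately continuous: \<open>v\<close> is extended
  first, against the fixed vectors \<open>u i\<close>, and then \<open>u\<close>, against all values
  of the extended \<open>v\<close>. Since the inner product is antilinear in its second slot,
  \<open>v\<close> is extended as an analytic function of the reflected variable. The injection of
  the reals into \<open>'v\<close> puts sequence space into the universe over which the Schur norm
  is taken.\<close>

lemma complex_ring_simps [simp]:
  "carrier complex_ring = UNIV" "mult complex_ring = (*)" "one complex_ring = 1"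
  "zero complex_ring = 0" "add complex_ring = (+)"
  by (auto simp: complex_ring_def)

lemma cring_complex_ring: "cring complex_ring"
proof (rule cringI)
  show "abelian_group complex_ring"
    by (rule abelian_groupI) (auto simp: algebra_simps intro: exI[of _ "- x" for x :: complex] ab_left_minus)
  show "comm_monoid complex_ring" by (rule comm_monoidI) (auto simp: algebra_simps)
qed (auto simp: algebra_simps)

section \<open>Geometry of a Hilbert space given by a carrier set\<close>

context complex_hilbert begin

abbreviation hcar ("\<H>") where "\<H> \<equiv> carrier H"
abbreviation hadd (infixl "\<boxplus>" 65) where "x \<boxplus> y \<equiv> x \<oplus>\<^bsub>H\<^esub> y"
abbreviation hsub (infixl "\<boxminus>" 65) where "x \<boxminus> y \<equiv> x \<ominus>\<^bsub>H\<^esub> y"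
abbreviation hscale (infixr "\<star>" 70) where "a \<star> x \<equiv> a \<odot>\<^bsub>H\<^esub> x"
abbreviation hip ("\<langle>_, _\<rangle>") where "\<langle>x, y\<rangle> \<equiv> ip H x y"
abbreviation hnrm ("\<parallel>_\<parallel>") where "\<parallel>x\<parallel> \<equiv> hnorm H x"
abbreviation hzero ("\<zero>\<^sub>H") where "\<zero>\<^sub>H \<equiv> \<zero>\<^bsub>H\<^esub>"

lemma scale_closed [simp, intro]: "x \<in> \<H> \<Longrightarrow> a \<star> x \<in> \<H>"
  using smult_closed[of a x] by simp

lemma uminus_eq: assumes "x \<in> \<H>" shows "\<ominus>\<^bsub>H\<^esub> x = (-1) \<star> x"
proof (rule M.minus_equality)
  have "(-1) \<star> x \<boxplus> 1 \<star> x = (-1 + 1) \<star> x" using assms smult_l_distr[of "-1" 1 x] by simp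
  then show "(-1) \<star> x \<boxplus> x = \<zero>\<^sub>H" using assms smult_l_null[of x] smult_one[of x] by simp
qed (use assms in auto)

lemma sub_eq: "x \<in> \<H> \<Longrightarrow> y \<in> \<H> \<Longrightarrow> x \<boxminus> y = x \<boxplus> (-1) \<star> y"
  by (simp add: a_minus_def uminus_eq)

lemma ip_add_right: "\<lbrakk>x \<in> \<H>; y \<in> \<H>; z \<in> \<H>\<rbrakk> \<Longrightarrow> \<langle>z, x \<boxplus> y\<rangle> = \<langle>z, x\<rangle> + \<langle>z, y\<rangle>"
  by (metis M.a_closed complex_cnj_add ip_add_left ip_commute)

lemma ip_smult_right: "\<lbrakk>x \<in> \<H>; y \<in> \<H>\<rbrakk> \<Longrightarrow> \<langle>x, a \<star> y\<rangle> = cnj a * \<langle>x, y\<rangle>"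
  by (metis scale_closed complex_cnj_mult ip_smult_left ip_commute)

lemma ip_sub_left: "\<lbrakk>x \<in> \<H>; y \<in> \<H>; z \<in> \<H>\<rbrakk> \<Longrightarrow> \<langle>x \<boxminus> y, z\<rangle> = \<langle>x, z\<rangle> - \<langle>y, z\<rangle>"
  by (simp add: sub_eq ip_add_left ip_smult_left)

lemma ip_sub_right: "\<lbrakk>x \<in> \<H>; y \<in> \<H>; z \<in> \<H>\<rbrakk> \<Longrightarrow> \<langle>z, x \<boxminus> y\<rangle> = \<langle>z, x\<rangle> - \<langle>z, y\<rangle>"
  by (simp add: sub_eq ip_add_right ip_smult_right)

lemma ip_zero_left [simp]: "x \<in> \<H> \<Longrightarrow> \<langle>\<zero>\<^sub>H, x\<rangle> = 0"
  using ip_add_left[of "\<zero>\<^sub>H" "\<zero>\<^sub>H" x] by simp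

lemma ip_zero_right [simp]: "x \<in> \<H> \<Longrightarrow> \<langle>x, \<zero>\<^sub>H\<rangle> = 0"
  using ip_add_right[of "\<zero>\<^sub>H" "\<zero>\<^sub>H" x] by simp

lemmas ips = ip_add_left ip_add_right ip_smult_left ip_smult_right ip_sub_left ip_sub_right

lemma sub_closed [simp, intro]: "x \<in> \<H> \<Longrightarrow> y \<in> \<H> \<Longrightarrow> x \<boxminus> y \<in> \<H>"
  by (rule M.minus_closed)

lemma ip_self: "x \<in> \<H> \<Longrightarrow> \<langle>x, x\<rangle> = of_real (\<parallel>x\<parallel>\<^sup>2)"
proof -
  assume x: "x \<in> \<H>"
  have "Re \<langle>x, x\<rangle> \<ge> 0" using ip_pos[OF x] x by (cases "x = \<zero>\<^sub>H") auto
  moreover have "Im \<langle>x, x\<rangle> = 0" using ip_commute[OF x x] by (simp add: complex_eq_iff)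
  ultimately show ?thesis by (simp add: hnorm_def complex_eq_iff)
qed

lemma norm_sq: "x \<in> \<H> \<Longrightarrow> \<parallel>x\<parallel>\<^sup>2 = Re \<langle>x, x\<rangle>" by (simp add: ip_self)

lemma norm_ge_0 [simp]: "x \<in> \<H> \<Longrightarrow> \<parallel>x\<parallel> \<ge> 0"
  unfolding hnorm_def by (subst ip_self) simp_all

lemma norm_zero [simp]: "\<parallel>\<zero>\<^sub>H\<parallel> = 0" by (simp add: hnorm_def)

lemma norm_eq_0: "x \<in> \<H> \<Longrightarrow> \<parallel>x\<parallel> = 0 \<longleftrightarrow> x = \<zero>\<^sub>H"
  by (metis ip_pos norm_sq norm_zero less_irrefl zero_eq_power2)

lemma sub_eq_0: "x \<in> \<H> \<Longrightarrow> y \<in> \<H> \<Longrightarrow> x \<boxminus> y = \<zero>\<^sub>H \<longleftrightarrow> x = y"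
  by (metis M.a_inv_closed M.minus_equality M.minus_minus M.r_neg a_minus_def)

lemma vec_eqI: assumes "x \<in> \<H>" "y \<in> \<H>" "\<And>z. z \<in> \<H> \<Longrightarrow> \<langle>x, z\<rangle> = \<langle>y, z\<rangle>" shows "x = y"
proof -
  have "\<langle>x \<boxminus> y, x \<boxminus> y\<rangle> = 0" using assms by (simp add: ip_sub_left)
  then have "\<parallel>x \<boxminus> y\<parallel> = 0" using assms by (simp add: hnorm_def)
  then show ?thesis using assms by (simp add: norm_eq_0 sub_eq_0)
qed

lemma vec_eqI2: assumes "x \<in> \<H>" "y \<in> \<H>" "\<And>z. z \<in> \<H> \<Longrightarrow> \<langle>z, x\<rangle> = \<langle>z, y\<rangle>" shows "x = y"
  by (rule vec_eqI) (use assms in \<open>auto simp: ip_commute[of _ x] ip_commute[of _ y]\<close>)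

text \<open>Stated for an arbitrary semidefinite form, because it serves both for the inner product
  and for \<open>\<langle>T x, y\<rangle>\<close> with a positive operator \<open>T\<close>, where a
  zero of the quadratic form need not be the zero vector.\<close>

lemma semi_cauchy_schwarz:
  assumes add: "\<And>x y z. \<lbrakk>x \<in> \<H>; y \<in> \<H>; z \<in> \<H>\<rbrakk> \<Longrightarrow> B (x \<boxplus> y) z = B x z + B y z"
    and sc: "\<And>a x y. \<lbrakk>x \<in> \<H>; y \<in> \<H>\<rbrakk> \<Longrightarrow> B (a \<star> x) y = a * B x y"
    and herm: "\<And>x y. \<lbrakk>x \<in> \<H>; y \<in> \<H>\<rbrakk> \<Longrightarrow> B y x = cnj (B x y)"
    and pos: "\<And>x. x \<in> \<H> \<Longrightarrow> Re (B x x) \<ge> 0"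
    and xy: "x \<in> \<H>" "y \<in> \<H>"
  shows "(cmod (B x y))\<^sup>2 \<le> Re (B x x) * Re (B y y)"
proof -
  define c where "c = B x y"
  have add': "B z (u \<boxplus> v) = B z u + B z v" if "z \<in> \<H>" "u \<in> \<H>" "v \<in> \<H>" for z u v
    using that by (simp add: herm[of _ z] add)
  have sc': "B z (a \<star> u) = cnj a * B z u" if "z \<in> \<H>" "u \<in> \<H>" for z a u
    using that by (simp add: herm[of _ z] sc)
  have im: "Im (B z z) = 0" if "z \<in> \<H>" for z using herm[OF that that] by (simp add: complex_eq_iff)
  have q: "0 \<le> Re (B x x) - 2 * t * (cmod c)\<^sup>2 + t\<^sup>2 * (cmod c)\<^sup>2 * Re (B y y)" for t :: real
  proof -
    define s where "s = - of_real t * c"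
    have "B (x \<boxplus> s \<star> y) (x \<boxplus> s \<star> y) = B x x + cnj s * c + s * cnj c + s * cnj s * B y y"
      using xy by (simp add: add add' sc sc' c_def herm[of x y] algebra_simps)
    moreover have "0 \<le> Re (B (x \<boxplus> s \<star> y) (x \<boxplus> s \<star> y))" using xy by (intro pos) auto
    moreover have "Re (cnj s * c) = - t * (cmod c)\<^sup>2" "Re (s * cnj c) = - t * (cmod c)\<^sup>2"
      unfolding s_def cmod_power2 by (simp_all add: power2_eq_square algebra_simps)
    moreover have "s * cnj s = of_real (t\<^sup>2 * (cmod c)\<^sup>2)"
      unfolding complex_norm_square[of s, symmetric] by (simp add: s_def norm_mult power_mult_distrib)
    ultimately show ?thesis using im[OF xy(2)] by (simp add: algebra_simps)
  qed
  show ?thesis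
  proof (cases "Re (B y y) = 0")
    case True
    \<comment> \<open>The quadratic polynomial in \<open>t\<close> degenerates to an affine one,
      which stays nonnegative on the whole line only if its slope vanishes.\<close>
    have "c = 0"
    proof (rule ccontr)
      assume "c \<noteq> 0"
      then show False using q[of "(Re (B x x) + 1) / (2 * (cmod c)\<^sup>2)"] True by (simp add: field_simps)
    qed
    then show ?thesis using True by (simp add: c_def)
  next
    case False
    then have "Re (B y y) > 0" using pos[OF xy(2)] by simp
    \<comment> \<open>The minimizer of the quadratic polynomial in \<open>t\<close>.\<close>
    then show ?thesis using q[of "1 / Re (B y y)"] unfolding c_def[symmetric]
      by (simp add: field_simps power2_eq_square)
  qed
qed

lemma cauchy_schwarz: assumes "x \<in> \<H>" "y \<in> \<H>" shows "cmod \<langle>x, y\<rangle> \<le> \<parallel>x\<parallel> * \<parallel>y\<parallel>"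
proof -
  have "(cmod \<langle>x, y\<rangle>)\<^sup>2 \<le> Re \<langle>x, x\<rangle> * Re \<langle>y, y\<rangle>"
    by (rule semi_cauchy_schwarz; (rule ip_commute)?) (use assms in \<open>auto simp: ips ip_self\<close>)
  then have "(cmod \<langle>x, y\<rangle>)\<^sup>2 \<le> (\<parallel>x\<parallel> * \<parallel>y\<parallel>)\<^sup>2" using assms by (simp add: norm_sq[symmetric] power_mult_distrib)
  then show ?thesis using assms by (auto intro: power2_le_imp_le)
qed

lemma norm_scale [simp]: "x \<in> \<H> \<Longrightarrow> \<parallel>a \<star> x\<parallel> = cmod a * \<parallel>x\<parallel>"
proof -
  assume x: "x \<in> \<H>"
  have "\<langle>a \<star> x, a \<star> x\<rangle> = (a * cnj a) * \<langle>x, x\<rangle>" using x by (simp add: ips)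
  also have "\<dots> = of_real ((cmod a * \<parallel>x\<parallel>)\<^sup>2)"
    unfolding complex_norm_square[symmetric] ip_self[OF x] by (simp add: power_mult_distrib)
  finally have "\<langle>a \<star> x, a \<star> x\<rangle> = of_real ((cmod a * \<parallel>x\<parallel>)\<^sup>2)" .
  then show ?thesis using x by (simp add: hnorm_def[of H "a \<star> x"] )
qed

lemma norm_add_sq: "x \<in> \<H> \<Longrightarrow> y \<in> \<H> \<Longrightarrow> \<parallel>x \<boxplus> y\<parallel>\<^sup>2 = \<parallel>x\<parallel>\<^sup>2 + 2 * Re \<langle>x, y\<rangle> + \<parallel>y\<parallel>\<^sup>2"
  by (simp add: norm_sq ips ip_commute[of x y])

lemma norm_sub_sq: "x \<in> \<H> \<Longrightarrow> y \<in> \<H> \<Longrightarrow> \<parallel>x \<boxminus> y\<parallel>\<^sup>2 = \<parallel>x\<parallel>\<^sup>2 - 2 * Re \<langle>x, y\<rangle> + \<parallel>y\<parallel>\<^sup>2"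
  by (simp add: norm_sq ips ip_commute[of x y])

lemma norm_add_le: assumes "x \<in> \<H>" "y \<in> \<H>" shows "\<parallel>x \<boxplus> y\<parallel> \<le> \<parallel>x\<parallel> + \<parallel>y\<parallel>"
proof -
  have "Re \<langle>x, y\<rangle> \<le> \<parallel>x\<parallel> * \<parallel>y\<parallel>" using cauchy_schwarz[OF assms] complex_Re_le_cmod order_trans by blast
  then have "\<parallel>x \<boxplus> y\<parallel>\<^sup>2 \<le> (\<parallel>x\<parallel> + \<parallel>y\<parallel>)\<^sup>2" using assms by (simp add: norm_add_sq power2_sum)
  then show ?thesis using assms by (auto intro: power2_le_imp_le)
qed

lemma norm_sub_commute: "x \<in> \<H> \<Longrightarrow> y \<in> \<H> \<Longrightarrow> \<parallel>x \<boxminus> y\<parallel> = \<parallel>y \<boxminus> x\<parallel>"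
proof -
  assume a: "x \<in> \<H>" "y \<in> \<H>"
  have "\<parallel>x \<boxminus> y\<parallel>\<^sup>2 = \<parallel>y \<boxminus> x\<parallel>\<^sup>2" using a by (simp add: norm_sub_sq ip_commute[of x y])
  then show ?thesis using a by simp
qed

lemma norm_triangle: assumes "x \<in> \<H>" "y \<in> \<H>" "z \<in> \<H>" shows "\<parallel>x \<boxminus> z\<parallel> \<le> \<parallel>x \<boxminus> y\<parallel> + \<parallel>y \<boxminus> z\<parallel>"
proof -
  have "x \<boxminus> z = (x \<boxminus> y) \<boxplus> (y \<boxminus> z)" by (rule vec_eqI) (use assms in \<open>auto simp: ips\<close>)
  then show ?thesis using norm_add_le[of "x \<boxminus> y" "y \<boxminus> z"] assms by simp
qed

lemma norm_triangle2: assumes "x \<in> \<H>" "y \<in> \<H>" shows "\<bar>\<parallel>x\<parallel> - \<parallel>y\<parallel>\<bar> \<le> \<parallel>x \<boxminus> y\<parallel>"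
proof -
  have "x \<boxminus> \<zero>\<^sub>H = x" "y \<boxminus> \<zero>\<^sub>H = y" by (rule vec_eqI; use assms in \<open>auto simp: ips\<close>)+
  then show ?thesis using norm_triangle[of x y "\<zero>\<^sub>H"] norm_triangle[of y x "\<zero>\<^sub>H"] assms norm_sub_commute[of x y] by simp
qed

definition hlim :: "(nat \<Rightarrow> 'v) \<Rightarrow> 'v \<Rightarrow> bool" where
  "hlim X x \<longleftrightarrow> (\<lambda>n. \<parallel>X n \<boxminus> x\<parallel>) \<longlonglongrightarrow> 0"

lemma hlim_ip: assumes "hlim X x" "\<And>n. X n \<in> \<H>" "x \<in> \<H>" "y \<in> \<H>"
  shows "(\<lambda>n. \<langle>X n, y\<rangle>) \<longlonglongrightarrow> \<langle>x, y\<rangle>" "(\<lambda>n. \<langle>y, X n\<rangle>) \<longlonglongrightarrow> \<langle>y, x\<rangle>"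
proof -
  have "(\<lambda>n. \<parallel>X n \<boxminus> x\<parallel> * \<parallel>y\<parallel>) \<longlonglongrightarrow> 0" by (rule tendsto_mult_left_zero[OF assms(1)[unfolded hlim_def]])
  moreover have "norm (\<langle>X n, y\<rangle> - \<langle>x, y\<rangle>) \<le> \<parallel>X n \<boxminus> x\<parallel> * \<parallel>y\<parallel>" for n
    using cauchy_schwarz[of "X n \<boxminus> x" y] assms by (simp add: ips)
  ultimately show *: "(\<lambda>n. \<langle>X n, y\<rangle>) \<longlonglongrightarrow> \<langle>x, y\<rangle>"
    by (intro LIM_zero_cancel[of "\<lambda>n. \<langle>X n, y\<rangle>"] Lim_null_comparison[where f="\<lambda>n. \<langle>X n, y\<rangle> - \<langle>x, y\<rangle>"] always_eventually allI)
  have "(\<lambda>n. cnj \<langle>X n, y\<rangle>) \<longlonglongrightarrow> cnj \<langle>x, y\<rangle>" using * by (intro tendsto_intros)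
  then show "(\<lambda>n. \<langle>y, X n\<rangle>) \<longlonglongrightarrow> \<langle>y, x\<rangle>" using assms by (simp add: ip_commute[symmetric])
qed

lemma hlim_norm: assumes "hlim X x" "\<And>n. X n \<in> \<H>" "x \<in> \<H>"
  shows "(\<lambda>n. \<parallel>X n\<parallel>) \<longlonglongrightarrow> \<parallel>x\<parallel>"
  by (rule LIM_zero_cancel, rule Lim_null_comparison[OF _ assms(1)[unfolded hlim_def]])
     (simp add: assms norm_triangle2)

definition subsp :: "'v set \<Rightarrow> bool" where
  "subsp V \<longleftrightarrow> V \<subseteq> \<H> \<and> \<zero>\<^sub>H \<in> V \<and> (\<forall>x\<in>V. \<forall>y\<in>V. x \<boxplus> y \<in> V) \<and> (\<forall>a. \<forall>x\<in>V. a \<star> x \<in> V)"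

lemma subsp_car [simp]: "subsp \<H>" by (auto simp: subsp_def)

text \<open>The subspace \<open>V\<close> need not be closed; the representing vector lies in its
  closure, and the sequence \<open>X\<close> records this. The vector is found as the limit of a
  minimizing sequence for \<open>\<parallel>v\<parallel>\<^sup>2 - 2 * Re (f v)\<close>, which
  equals \<open>\<parallel>v \<boxminus> z\<parallel>\<^sup>2 -
  \<parallel>z\<parallel>\<^sup>2\<close> for the vector \<open>z\<close> that is sought.\<close>

lemma riesz_sub:
  assumes V: "subsp V"
    and add: "\<And>x y. \<lbrakk>x \<in> V; y \<in> V\<rbrakk> \<Longrightarrow> f (x \<boxplus> y) = f x + f y"
    and sc: "\<And>a x. x \<in> V \<Longrightarrow> f (a \<star> x) = a * f x"
    and bd: "\<And>x. x \<in> V \<Longrightarrow> cmod (f x) \<le> c * \<parallel>x\<parallel>" and c: "c \<ge> 0"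
  obtains z X where "z \<in> \<H>" "\<And>n. X n \<in> V" "hlim X z" "\<And>v. v \<in> V \<Longrightarrow> f v = \<langle>v, z\<rangle>" "\<parallel>z\<parallel> \<le> c"
proof -
  have VH: "x \<in> V \<Longrightarrow> x \<in> \<H>" for x using V by (auto simp: subsp_def)
  have Vc: "x \<in> V \<Longrightarrow> y \<in> V \<Longrightarrow> x \<boxplus> y \<in> V" "x \<in> V \<Longrightarrow> a \<star> x \<in> V" for x y a using V by (auto simp: subsp_def)
  define J where "J v = \<parallel>v\<parallel>\<^sup>2 - 2 * Re (f v)" for v
  define m where "m = Inf (J ` V)"
  have "J v \<ge> - c\<^sup>2" if "v \<in> V" for v
  proof -
    have "Re (f v) \<le> c * \<parallel>v\<parallel>" using bd[OF that] complex_Re_le_cmod order_trans by blast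
    then have "J v \<ge> (\<parallel>v\<parallel> - c)\<^sup>2 - c\<^sup>2" by (simp add: J_def power2_diff mult.commute)
    then show ?thesis by (smt (verit) zero_le_power2)
  qed
  then have bb: "bdd_below (J ` V)" by (auto intro!: bdd_belowI2)
  have m: "m \<le> J v" if "v \<in> V" for v unfolding m_def using bb that by (auto intro: cInf_lower)
  have "\<exists>v\<in>V. J v < m + 1 / real (Suc n)" for n
  proof -
    have "J ` V \<noteq> {}" using V by (auto simp: subsp_def)
    then have "\<exists>y\<in>J ` V. y < m + 1 / real (Suc n)" unfolding m_def by (intro cInf_lessD) auto
    then show ?thesis by auto
  qed
  then obtain X where X: "\<And>n. X n \<in> V" "\<And>n. J (X n) < m + 1 / real (Suc n)" by metis
  have XH: "X n \<in> \<H>" for n using X VH by auto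
  \<comment> \<open>The parallelogram law with the midpoint, which makes minimizing sequences
    Cauchy.\<close>
  have par: "\<parallel>x \<boxminus> y\<parallel>\<^sup>2 = 2 * J x + 2 * J y - 4 * J ((1/2) \<star> (x \<boxplus> y))" if "x \<in> V" "y \<in> V" for x y
  proof -
    have "f ((1/2) \<star> (x \<boxplus> y)) = (f x + f y) / 2" using that by (simp add: sc Vc add)
    moreover have "\<parallel>(1/2) \<star> (x \<boxplus> y)\<parallel>\<^sup>2 = \<parallel>x \<boxplus> y\<parallel>\<^sup>2 / 4" using that by (simp add: VH power_divide norm_divide)
    ultimately have "J ((1/2) \<star> (x \<boxplus> y)) = \<parallel>x \<boxplus> y\<parallel>\<^sup>2 / 4 - (Re (f x) + Re (f y))" unfolding J_def by (simp only:) (simp add: field_simps)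
    then show ?thesis using norm_sub_sq[OF VH VH, OF that] norm_add_sq[OF VH VH, OF that]
      unfolding J_def[of x] J_def[of y] by (simp only:) (simp add: add_divide_distrib algebra_simps)
  qed
  have dist: "\<parallel>X k \<boxminus> X l\<parallel>\<^sup>2 \<le> 2 / real (Suc k) + 2 / real (Suc l)" for k l
  proof -
    have "m \<le> J ((1/2) \<star> (X k \<boxplus> X l))" using m Vc X(1) by blast
    moreover have "2 / real (Suc n) = 2 * (1 / real (Suc n))" for n by simp
    ultimately show ?thesis using par[OF X(1)[of k] X(1)[of l]] X(2)[of k] X(2)[of l] by (smt (verit))
  qed
  have "\<exists>x\<in>\<H>. (\<lambda>n. \<parallel>X n \<boxminus> x\<parallel>) \<longlonglongrightarrow> 0"
  proof (rule complete[OF XH])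
    fix e :: real assume e: "e > 0"
    obtain N :: nat where N: "real N > 4 / e\<^sup>2" using reals_Archimedean2 by blast
    have "N > 0" using N e by (smt (verit) divide_nonneg_nonneg of_nat_0_less_iff zero_le_power2)
    have "\<parallel>X k \<boxminus> X l\<parallel> < e" if "k \<ge> N" "l \<ge> N" for k l
    proof -
      have "2 / real (Suc k) < 2 / N" "2 / real (Suc l) < 2 / N" using that \<open>N > 0\<close> by (auto intro!: divide_strict_left_mono)
      then have "\<parallel>X k \<boxminus> X l\<parallel>\<^sup>2 < 4 / N" using dist[of k l] by linarith
      also have "4 / N < e\<^sup>2" using N e \<open>N > 0\<close> by (simp add: field_simps)
      finally show ?thesis using e by (auto intro: power2_less_imp_less)
    qed
    then show "\<exists>N. \<forall>m\<ge>N. \<forall>n\<ge>N. \<parallel>X m \<boxminus> X n\<parallel> < e" by blast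
  qed
  then obtain z where z: "z \<in> \<H>" "hlim X z" by (auto simp: hlim_def)
  have rep: "f v = \<langle>v, z\<rangle>" if v: "v \<in> V" for v
  proof -
    \<comment> \<open>First variation. Moving \<open>X n\<close> by \<open>t \<star> v\<close> would
      push \<open>J\<close> below its infimum unless the defect \<open>d\<close> vanishes; the
      factor \<open>s\<close> keeps the term quadratic in \<open>t\<close> smaller than the linear
      one.\<close>
    define d where "d = \<langle>v, z\<rangle> - f v"
    define s where "s = 1 / (1 + \<parallel>v\<parallel>\<^sup>2)"
    have s0: "s > 0" by (simp add: s_def add_pos_nonneg)
    define t where "t = - of_real s * cnj d"
    have lim: "(\<lambda>n. 2 * Re (t * \<langle>v, X n\<rangle>) + (cmod t)\<^sup>2 * \<parallel>v\<parallel>\<^sup>2 - 2 * Re (t * f v) + 1 / real (Suc n))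
       \<longlonglongrightarrow> 2 * Re (t * \<langle>v, z\<rangle>) + (cmod t)\<^sup>2 * \<parallel>v\<parallel>\<^sup>2 - 2 * Re (t * f v) + 0"
      by (intro tendsto_intros hlim_ip(2) z XH VH v LIMSEQ_inverse_real_of_nat[unfolded inverse_eq_divide])
    have pos: "0 \<le> 2 * Re (t * \<langle>v, X n\<rangle>) + (cmod t)\<^sup>2 * \<parallel>v\<parallel>\<^sup>2 - 2 * Re (t * f v) + 1 / real (Suc n)" for n
    proof -
      have mem: "X n \<boxplus> t \<star> v \<in> V" using X v Vc by auto
      have "J (X n \<boxplus> t \<star> v) = J (X n) + 2 * Re (t * \<langle>v, X n\<rangle>) + (cmod t)\<^sup>2 * \<parallel>v\<parallel>\<^sup>2 - 2 * Re (t * f v)"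
        using v X by (simp add: J_def add sc Vc norm_add_sq VH XH ip_smult_right power_mult_distrib ip_commute[of "v" "X n"])
      then show ?thesis using m[OF mem] X(2)[of n] by linarith
    qed
    have "0 \<le> 2 * Re (t * \<langle>v, z\<rangle>) + (cmod t)\<^sup>2 * \<parallel>v\<parallel>\<^sup>2 - 2 * Re (t * f v)"
      using LIMSEQ_le_const[OF lim] pos by fastforce
    also have "\<dots> = 2 * Re (t * d) + (cmod t)\<^sup>2 * \<parallel>v\<parallel>\<^sup>2" by (simp add: d_def algebra_simps)
    also have "Re (t * d) = - s * (cmod d)\<^sup>2" unfolding cmod_power2 t_def by (simp add: power2_eq_square algebra_simps)
    also have "(cmod t)\<^sup>2 = s\<^sup>2 * (cmod d)\<^sup>2" using s0 by (simp add: t_def norm_mult power_mult_distrib)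
    finally have "0 \<le> s * (cmod d)\<^sup>2 * (s * \<parallel>v\<parallel>\<^sup>2 - 2)" by (simp add: power2_eq_square algebra_simps)
    moreover have "s * \<parallel>v\<parallel>\<^sup>2 \<le> 1" by (simp add: s_def divide_simps add_pos_nonneg)
    ultimately have "d = 0" using s0 by (smt (verit) mult_pos_neg zero_less_mult_iff norm_eq_zero zero_less_power2 zero_le_mult_iff)
    then show ?thesis by (simp add: d_def)
  qed
  have l1: "(\<lambda>n. c * \<parallel>X n\<parallel>) \<longlonglongrightarrow> c * \<parallel>z\<parallel>" by (intro tendsto_intros hlim_norm z XH)
  have l2: "(\<lambda>n. cmod \<langle>X n, z\<rangle>) \<longlonglongrightarrow> cmod \<langle>z, z\<rangle>" by (intro tendsto_intros hlim_ip z XH)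
  have "cmod \<langle>z, z\<rangle> \<le> c * \<parallel>z\<parallel>" by (rule LIMSEQ_le[OF l2 l1]) (use rep X bd in fastforce)
  then have "\<parallel>z\<parallel> * \<parallel>z\<parallel> \<le> c * \<parallel>z\<parallel>" using z by (simp add: ip_self power2_eq_square norm_mult)
  then have "\<parallel>z\<parallel> \<le> c" using z c norm_ge_0[OF z(1)] by (metis mult_le_cancel_right order_le_less)
  then show thesis using that[OF z(1) X(1) z(2) rep] by blast
qed

text \<open>The density principle of this development: a property holds for every vector once the
  vectors that have it form a closed subspace whose orthogonal complement is trivial.\<close>

lemma total_subsp:
  assumes V: "subsp V" and cl: "\<And>X z. \<lbrakk>\<And>n. X n \<in> V; z \<in> \<H>; hlim X z\<rbrakk> \<Longrightarrow> z \<in> V"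
    and tot: "\<And>x. \<lbrakk>x \<in> \<H>; \<And>v. v \<in> V \<Longrightarrow> \<langle>v, x\<rangle> = 0\<rbrakk> \<Longrightarrow> x = \<zero>\<^sub>H"
  shows "V = \<H>"
proof -
  have VH: "x \<in> V \<Longrightarrow> x \<in> \<H>" for x using V by (auto simp: subsp_def)
  have "x \<in> V" if x: "x \<in> \<H>" for x
  proof -
    obtain z X where z: "z \<in> \<H>" "\<And>n. X n \<in> V" "hlim X z" "\<And>v. v \<in> V \<Longrightarrow> \<langle>v, x\<rangle> = \<langle>v, z\<rangle>"
      by (rule riesz_sub[OF V, of "\<lambda>v. \<langle>v, x\<rangle>" "\<parallel>x\<parallel>"])
         (use x VH cauchy_schwarz in \<open>auto simp: ips mult.commute\<close>)
    have "x \<boxminus> z = \<zero>\<^sub>H" by (rule tot) (use x z VH in \<open>auto simp: ips\<close>)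
    then have "x = z" using x z by (simp add: sub_eq_0)
    then show ?thesis using cl z by blast
  qed
  then show ?thesis using VH by blast
qed

end

section \<open>Bounded operators, sesquilinear forms and adjoints\<close>

context complex_hilbert begin

abbreviation hops ("\<B>") where "\<B> \<equiv> bounded_ops H"
abbreviation hadj where "hadj T \<equiv> adjoint_op H T"

lemma op_closed [simp, intro]: "T \<in> \<B> \<Longrightarrow> x \<in> \<H> \<Longrightarrow> T x \<in> \<H>"
  by (auto simp: bounded_ops_def)

lemma op_add: "\<lbrakk>T \<in> \<B>; x \<in> \<H>; y \<in> \<H>\<rbrakk> \<Longrightarrow> T (x \<boxplus> y) = T x \<boxplus> T y"
  by (auto simp: bounded_ops_def)

lemma op_scale: "\<lbrakk>T \<in> \<B>; x \<in> \<H>\<rbrakk> \<Longrightarrow> T (a \<star> x) = a \<star> T x"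
  by (auto simp: bounded_ops_def)

lemma op_sub: "\<lbrakk>T \<in> \<B>; x \<in> \<H>; y \<in> \<H>\<rbrakk> \<Longrightarrow> T (x \<boxminus> y) = T x \<boxminus> T y"
  by (simp add: sub_eq op_add op_scale)

lemma scale_simps [simp]: "x \<in> \<H> \<Longrightarrow> 0 \<star> x = \<zero>\<^sub>H" "x \<in> \<H> \<Longrightarrow> 1 \<star> x = x"
  "x \<in> \<H> \<Longrightarrow> x \<boxminus> x = \<zero>\<^sub>H" "x \<in> \<H> \<Longrightarrow> a \<star> b \<star> x = (a * b) \<star> x"
  using smult_l_null[of x] smult_one[of x] smult_assoc1[of a b x] by (auto simp: sub_eq_0)

lemma op_zero: assumes "T \<in> \<B>" shows "T \<zero>\<^sub>H = \<zero>\<^sub>H"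
  using op_scale[OF assms, of "\<zero>\<^sub>H" 0] assms by simp

lemmas opl = op_add op_scale op_sub

lemma op_bound: assumes "T \<in> \<B>" obtains c where "c > 0" "\<And>x. x \<in> \<H> \<Longrightarrow> \<parallel>T x\<parallel> \<le> c * \<parallel>x\<parallel>"
proof -
  have "\<exists>c. \<forall>x\<in>\<H>. \<parallel>T x\<parallel> \<le> c * \<parallel>x\<parallel>" using assms by (auto simp: bounded_ops_def)
  then obtain c where c: "\<And>x. x \<in> \<H> \<Longrightarrow> \<parallel>T x\<parallel> \<le> c * \<parallel>x\<parallel>" by blast
  have "\<parallel>T x\<parallel> \<le> (\<bar>c\<bar> + 1) * \<parallel>x\<parallel>" if "x \<in> \<H>" for x
    by (rule order_trans[OF c[OF that] mult_right_mono]) (use that in auto)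
  then show ?thesis by (intro that[of "\<bar>c\<bar> + 1"]) auto
qed

lemma opI:
  assumes "\<And>x. x \<in> \<H> \<Longrightarrow> f x \<in> \<H>" "\<And>x y. \<lbrakk>x \<in> \<H>; y \<in> \<H>\<rbrakk> \<Longrightarrow> f (x \<boxplus> y) = f x \<boxplus> f y"
    "\<And>a x. x \<in> \<H> \<Longrightarrow> f (a \<star> x) = a \<star> f x" "\<And>x. x \<in> \<H> \<Longrightarrow> \<parallel>f x\<parallel> \<le> c * \<parallel>x\<parallel>"
  shows "restrict f \<H> \<in> \<B>"
  using assms unfolding bounded_ops_def by (auto intro: exI[of _ c])

lemma op_ext: assumes "S \<in> \<B>" "T \<in> \<B>" "\<And>x. x \<in> \<H> \<Longrightarrow> S x = T x" shows "S = T"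
proof (rule extensionalityI[of _ \<H>])
  show "S \<in> extensional \<H>" "T \<in> extensional \<H>"
    using assms(1,2) unfolding bounded_ops_def PiE_def by blast+
qed (rule assms(3))

lemma op_eqI: assumes "S \<in> \<B>" "T \<in> \<B>" "\<And>x y. x \<in> \<H> \<Longrightarrow> y \<in> \<H> \<Longrightarrow> \<langle>S x, y\<rangle> = \<langle>T x, y\<rangle>" shows "S = T"
  by (rule op_ext) (use assms in \<open>auto intro: vec_eqI\<close>)

lemma polarization:
  assumes T: "T \<in> \<B>" and xy: "x \<in> \<H>" "y \<in> \<H>"
  shows "4 * \<langle>T x, y\<rangle> = \<langle>T (x \<boxplus> y), x \<boxplus> y\<rangle> - \<langle>T (x \<boxminus> y), x \<boxminus> y\<rangle>
    + \<i> * \<langle>T (x \<boxplus> \<i> \<star> y), x \<boxplus> \<i> \<star> y\<rangle> - \<i> * \<langle>T (x \<boxminus> \<i> \<star> y), x \<boxminus> \<i> \<star> y\<rangle>"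
  using assms by (simp add: opl ips algebra_simps)

lemma op_eqI_quad: assumes "S \<in> \<B>" "T \<in> \<B>" "\<And>x. x \<in> \<H> \<Longrightarrow> \<langle>S x, x\<rangle> = \<langle>T x, x\<rangle>" shows "S = T"
proof (rule op_eqI[OF assms(1,2)])
  fix x y assume "x \<in> \<H>" "y \<in> \<H>"
  then have "4 * \<langle>S x, y\<rangle> = 4 * \<langle>T x, y\<rangle>"
    unfolding polarization[OF assms(1) \<open>x \<in> \<H>\<close> \<open>y \<in> \<H>\<close>] polarization[OF assms(2) \<open>x \<in> \<H>\<close> \<open>y \<in> \<H>\<close>] by (simp add: assms(3))
  then show "\<langle>S x, y\<rangle> = \<langle>T x, y\<rangle>" by simp
qed

lemma parallelogram: "x \<in> \<H> \<Longrightarrow> y \<in> \<H> \<Longrightarrow> \<parallel>x \<boxplus> y\<parallel>\<^sup>2 + \<parallel>x \<boxminus> y\<parallel>\<^sup>2 = 2 * \<parallel>x\<parallel>\<^sup>2 + 2 * \<parallel>y\<parallel>\<^sup>2"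
  by (simp add: norm_add_sq norm_sub_sq)

text \<open>Polarization on unit vectors gives four terms, which the parallelogram law controls in
  pairs; homogeneity then reaches arbitrary vectors. The factor 2 lost here is harmless, since the
  bound only serves to show that limit forms are bounded.\<close>

lemma quad_bound:
  assumes T: "T \<in> \<B>" and bd: "\<And>x. x \<in> \<H> \<Longrightarrow> cmod \<langle>T x, x\<rangle> \<le> c * \<parallel>x\<parallel>\<^sup>2" and c: "c \<ge> 0"
    and xy: "x \<in> \<H>" "y \<in> \<H>"
  shows "cmod \<langle>T x, y\<rangle> \<le> 2 * c * \<parallel>x\<parallel> * \<parallel>y\<parallel>"
proof -
  have *: "cmod \<langle>T x, y\<rangle> \<le> c * (\<parallel>x\<parallel>\<^sup>2 + \<parallel>y\<parallel>\<^sup>2)" if xy: "x \<in> \<H>" "y \<in> \<H>" for x y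
  proof -
    have "4 * cmod \<langle>T x, y\<rangle> = cmod (4 * \<langle>T x, y\<rangle>)" by (simp add: norm_mult)
    also have "\<dots> \<le> cmod \<langle>T (x \<boxplus> y), x \<boxplus> y\<rangle> + cmod \<langle>T (x \<boxminus> y), x \<boxminus> y\<rangle>
      + cmod \<langle>T (x \<boxplus> \<i> \<star> y), x \<boxplus> \<i> \<star> y\<rangle> + cmod \<langle>T (x \<boxminus> \<i> \<star> y), x \<boxminus> \<i> \<star> y\<rangle>"
      unfolding polarization[OF T xy]
      by (intro norm_triangle_le_diff norm_triangle_le add_mono) (simp_all add: norm_mult)
    also have "\<dots> \<le> c * \<parallel>x \<boxplus> y\<parallel>\<^sup>2 + c * \<parallel>x \<boxminus> y\<parallel>\<^sup>2 + c * \<parallel>x \<boxplus> \<i> \<star> y\<parallel>\<^sup>2 + c * \<parallel>x \<boxminus> \<i> \<star> y\<parallel>\<^sup>2"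
      by (intro add_mono bd) (use xy in auto)
    also have "\<dots> = c * ((\<parallel>x \<boxplus> y\<parallel>\<^sup>2 + \<parallel>x \<boxminus> y\<parallel>\<^sup>2) + (\<parallel>x \<boxplus> \<i> \<star> y\<parallel>\<^sup>2 + \<parallel>x \<boxminus> \<i> \<star> y\<parallel>\<^sup>2))"
      by (simp add: algebra_simps)
    also have "\<dots> = 4 * (c * (\<parallel>x\<parallel>\<^sup>2 + \<parallel>y\<parallel>\<^sup>2))"
      unfolding parallelogram[OF xy] parallelogram[OF xy(1) scale_closed[OF xy(2)]] using xy by (simp add: algebra_simps)
    finally show ?thesis by simp
  qed
  show ?thesis
  proof (cases "\<parallel>x\<parallel> = 0 \<or> \<parallel>y\<parallel> = 0")
    case True
    then show ?thesis using xy T by (auto simp: norm_eq_0 op_zero)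
  next
    case False
    then have p: "\<parallel>x\<parallel> > 0" "\<parallel>y\<parallel> > 0" using norm_ge_0[OF xy(1)] norm_ge_0[OF xy(2)] by linarith+
    define u where "u = of_real (1 / \<parallel>x\<parallel>) \<star> x"
    define v where "v = of_real (1 / \<parallel>y\<parallel>) \<star> y"
    have uv: "u \<in> \<H>" "v \<in> \<H>" "\<parallel>u\<parallel> = 1" "\<parallel>v\<parallel> = 1" using xy p by (auto simp: u_def v_def norm_divide)
    have eqs: "x = of_real \<parallel>x\<parallel> \<star> u" "y = of_real \<parallel>y\<parallel> \<star> v"
      unfolding u_def v_def by (rule vec_eqI; use xy p in \<open>auto simp: ips\<close>)+
    have "\<langle>T (of_real a \<star> u), of_real b \<star> v\<rangle> = of_real (a * b) * \<langle>T u, v\<rangle>" for a b :: real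
      using T uv by (simp add: opl ips)
    from this[of "\<parallel>x\<parallel>" "\<parallel>y\<parallel>", folded eqs] have "\<langle>T x, y\<rangle> = of_real (\<parallel>x\<parallel> * \<parallel>y\<parallel>) * \<langle>T u, v\<rangle>" .
    then have "cmod \<langle>T x, y\<rangle> = \<parallel>x\<parallel> * \<parallel>y\<parallel> * cmod \<langle>T u, v\<rangle>" using p by (simp add: norm_mult)
    also have "\<dots> \<le> \<parallel>x\<parallel> * \<parallel>y\<parallel> * (c * 2)" using *[OF uv(1,2)] p uv by (intro mult_left_mono) auto
    finally show ?thesis by (simp add: algebra_simps)
  qed
qed

text \<open>The form is given only for first arguments in the subspace \<open>V\<close>, which
  determines the vector \<open>S y\<close> up to the orthogonal complement of \<open>V\<close>.
  Choosing it in the closure of \<open>V\<close> makes it unique, hence linear in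
  \<open>y\<close>.\<close>

lemma form_op:
  assumes V: "subsp V"
    and add1: "\<And>x y z. \<lbrakk>x \<in> V; y \<in> V; z \<in> \<H>\<rbrakk> \<Longrightarrow> B (x \<boxplus> y) z = B x z + B y z"
    and sc1: "\<And>a x z. \<lbrakk>x \<in> V; z \<in> \<H>\<rbrakk> \<Longrightarrow> B (a \<star> x) z = a * B x z"
    and add2: "\<And>x y z. \<lbrakk>x \<in> V; y \<in> \<H>; z \<in> \<H>\<rbrakk> \<Longrightarrow> B x (y \<boxplus> z) = B x y + B x z"
    and sc2: "\<And>a x z. \<lbrakk>x \<in> V; z \<in> \<H>\<rbrakk> \<Longrightarrow> B x (a \<star> z) = cnj a * B x z"
    and bd: "\<And>x z. \<lbrakk>x \<in> V; z \<in> \<H>\<rbrakk> \<Longrightarrow> cmod (B x z) \<le> c * \<parallel>x\<parallel> * \<parallel>z\<parallel>" and c: "c \<ge> 0"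
  obtains S where "S \<in> \<B>" "\<And>y. y \<in> \<H> \<Longrightarrow> \<parallel>S y\<parallel> \<le> c * \<parallel>y\<parallel>" "\<And>x y. x \<in> V \<Longrightarrow> y \<in> \<H> \<Longrightarrow> \<langle>x, S y\<rangle> = B x y"
proof -
  have VH: "x \<in> V \<Longrightarrow> x \<in> \<H>" for x using V by (auto simp: subsp_def)
  \<comment> \<open>The last conjunct says without sequences that \<open>z\<close> lies in the
    closure of \<open>V\<close>: it is orthogonal to everything that is orthogonal to
    \<open>V\<close>. This is what forces additivity and homogeneity below.\<close>
  define P where "P y z \<longleftrightarrow> z \<in> \<H> \<and> \<parallel>z\<parallel> \<le> c * \<parallel>y\<parallel> \<and> (\<forall>v\<in>V. \<langle>v, z\<rangle> = B v y) \<and> (\<forall>w\<in>\<H>. (\<forall>v\<in>V. \<langle>v, w\<rangle> = 0) \<longrightarrow> \<langle>z, w\<rangle> = 0)" for y z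
  have "\<exists>z. P y z" if y: "y \<in> \<H>" for y
  proof -
    obtain z X where z: "z \<in> \<H>" "\<And>n. X n \<in> V" "hlim X z" "\<And>v. v \<in> V \<Longrightarrow> B v y = \<langle>v, z\<rangle>" "\<parallel>z\<parallel> \<le> c * \<parallel>y\<parallel>"
      by (rule riesz_sub[OF V, of "\<lambda>v. B v y" "c * \<parallel>y\<parallel>"]) (use y add1 sc1 bd c in \<open>auto simp: ac_simps\<close>)
    have "\<langle>z, w\<rangle> = 0" if "w \<in> \<H>" "\<forall>v\<in>V. \<langle>v, w\<rangle> = 0" for w
      using hlim_ip(1)[OF z(3) _ z(1) that(1)] VH z(2) that(2) by (simp add: LIMSEQ_const_iff)
    then show ?thesis using z by (auto simp: P_def)
  qed
  then obtain S where S: "\<And>y. y \<in> \<H> \<Longrightarrow> P y (S y)" by metis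
  have SH: "S y \<in> \<H>" and Sb: "\<parallel>S y\<parallel> \<le> c * \<parallel>y\<parallel>" and SB: "v \<in> V \<Longrightarrow> \<langle>v, S y\<rangle> = B v y"
    and So: "\<lbrakk>w \<in> \<H>; \<And>v. v \<in> V \<Longrightarrow> \<langle>v, w\<rangle> = 0\<rbrakk> \<Longrightarrow> \<langle>S y, w\<rangle> = 0" if "y \<in> \<H>" for y v w
    using S[OF that] by (auto simp: P_def)
  have "S (y \<boxplus> z) = S y \<boxplus> S z" if yz: "y \<in> \<H>" "z \<in> \<H>" for y z
  proof -
    define w where "w = S (y \<boxplus> z) \<boxminus> (S y \<boxplus> S z)"
    have w: "w \<in> \<H>" using yz SH by (auto simp: w_def)
    have "\<langle>v, w\<rangle> = 0" if "v \<in> V" for v using that yz by (simp add: w_def ips SH VH SB add2)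
    then have "\<langle>S (y \<boxplus> z), w\<rangle> = 0" "\<langle>S y, w\<rangle> = 0" "\<langle>S z, w\<rangle> = 0" using So w yz by auto
    then have "\<langle>w, w\<rangle> = 0" by (subst w_def) (use w yz SH in \<open>simp add: ips\<close>)
    then have "w = \<zero>\<^sub>H" using w by (simp add: ip_self norm_eq_0)
    then show ?thesis using yz SH by (simp add: w_def sub_eq_0)
  qed
  moreover have "S (a \<star> y) = a \<star> S y" if yz: "y \<in> \<H>" for y a
  proof -
    define w where "w = S (a \<star> y) \<boxminus> (a \<star> S y)"
    have w: "w \<in> \<H>" using yz SH by (auto simp: w_def)
    have "\<langle>v, w\<rangle> = 0" if "v \<in> V" for v using that yz by (simp add: w_def ips SH VH SB sc2)
    then have "\<langle>S (a \<star> y), w\<rangle> = 0" "\<langle>S y, w\<rangle> = 0" using So w yz by auto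
    then have "\<langle>w, w\<rangle> = 0" by (subst w_def) (use w yz SH in \<open>simp add: ips\<close>)
    then have "w = \<zero>\<^sub>H" using w by (simp add: ip_self norm_eq_0)
    then show ?thesis using yz SH by (simp add: w_def sub_eq_0)
  qed
  ultimately have "restrict S \<H> \<in> \<B>" using SH Sb by (intro opI[where c=c]) auto
  then show thesis by (rule that) (use Sb SB in auto)
qed

lemma form_op_left:
  assumes add1: "\<And>x y z. \<lbrakk>x \<in> \<H>; y \<in> \<H>; z \<in> \<H>\<rbrakk> \<Longrightarrow> B (x \<boxplus> y) z = B x z + B y z"
    and sc1: "\<And>a x z. \<lbrakk>x \<in> \<H>; z \<in> \<H>\<rbrakk> \<Longrightarrow> B (a \<star> x) z = a * B x z"
    and add2: "\<And>x y z. \<lbrakk>x \<in> \<H>; y \<in> \<H>; z \<in> \<H>\<rbrakk> \<Longrightarrow> B x (y \<boxplus> z) = B x y + B x z"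
    and sc2: "\<And>a x z. \<lbrakk>x \<in> \<H>; z \<in> \<H>\<rbrakk> \<Longrightarrow> B x (a \<star> z) = cnj a * B x z"
    and bd: "\<And>x z. \<lbrakk>x \<in> \<H>; z \<in> \<H>\<rbrakk> \<Longrightarrow> cmod (B x z) \<le> c * \<parallel>x\<parallel> * \<parallel>z\<parallel>" and c: "c \<ge> 0"
  obtains T where "T \<in> \<B>" "\<And>x. x \<in> \<H> \<Longrightarrow> \<parallel>T x\<parallel> \<le> c * \<parallel>x\<parallel>" "\<And>x y. x \<in> \<H> \<Longrightarrow> y \<in> \<H> \<Longrightarrow> \<langle>T x, y\<rangle> = B x y"
proof -
  have bd2: "cmod (B z x) \<le> c * \<parallel>x\<parallel> * \<parallel>z\<parallel>" if "x \<in> \<H>" "z \<in> \<H>" for x z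
    using bd[OF that(2,1)] by (simp add: ac_simps)
  obtain S where S: "S \<in> \<B>" "\<And>y. y \<in> \<H> \<Longrightarrow> \<parallel>S y\<parallel> \<le> c * \<parallel>y\<parallel>"
    "\<And>x y. x \<in> \<H> \<Longrightarrow> y \<in> \<H> \<Longrightarrow> \<langle>x, S y\<rangle> = cnj (B y x)"
    by (rule form_op[OF subsp_car, of "\<lambda>x y. cnj (B y x)" c])
       (auto simp: add1 sc1 add2 sc2 c bd2)
  have "\<langle>S x, y\<rangle> = B x y" if "x \<in> \<H>" "y \<in> \<H>" for x y
    using S(3)[OF that(2,1)] that S(1) by (simp add: ip_commute[of y "S x"])
  then show thesis using that[OF S(1,2)] by blast
qed

lemma adjI:
  assumes "T \<in> \<B>" "S \<in> \<B>" "\<And>x y. x \<in> \<H> \<Longrightarrow> y \<in> \<H> \<Longrightarrow> \<langle>T x, y\<rangle> = \<langle>x, S y\<rangle>"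
  shows "hadj T = S"
  unfolding adjoint_op_def
proof (rule the_equality)
  fix R assume R: "R \<in> \<B> \<and> (\<forall>x\<in>\<H>. \<forall>y\<in>\<H>. \<langle>T x, y\<rangle> = \<langle>x, R y\<rangle>)"
  show "R = S" by (rule op_ext) (use R assms in \<open>auto intro!: vec_eqI2\<close>)
qed (use assms in auto)

lemma adj_ex: assumes "T \<in> \<B>"
  obtains S where "S \<in> \<B>" "\<And>x y. x \<in> \<H> \<Longrightarrow> y \<in> \<H> \<Longrightarrow> \<langle>T x, y\<rangle> = \<langle>x, S y\<rangle>" "hadj T = S"
proof -
  obtain c where c: "c > 0" "\<And>x. x \<in> \<H> \<Longrightarrow> \<parallel>T x\<parallel> \<le> c * \<parallel>x\<parallel>" using op_bound[OF assms] by blast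
  have "cmod \<langle>T x, y\<rangle> \<le> c * \<parallel>x\<parallel> * \<parallel>y\<parallel>" if "x \<in> \<H>" "y \<in> \<H>" for x y
    using cauchy_schwarz[of "T x" y] c(2)[OF that(1)] that assms norm_ge_0[OF that(2)]
    by (meson mult_right_mono op_closed order_trans)
  then obtain S where "S \<in> \<B>" "\<And>x y. x \<in> \<H> \<Longrightarrow> y \<in> \<H> \<Longrightarrow> \<langle>x, S y\<rangle> = \<langle>T x, y\<rangle>"
    by (rule form_op[OF subsp_car, of "\<lambda>x y. \<langle>T x, y\<rangle>" c, rotated 4]) (use assms c in \<open>auto simp: ips opl\<close>)
  then show thesis using that adjI[OF assms] by metis
qed

lemma adj_closed [simp, intro]: "T \<in> \<B> \<Longrightarrow> hadj T \<in> \<B>"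
  by (metis adj_ex)

lemma adj_ip: "\<lbrakk>T \<in> \<B>; x \<in> \<H>; y \<in> \<H>\<rbrakk> \<Longrightarrow> \<langle>x, hadj T y\<rangle> = \<langle>T x, y\<rangle>"
  by (metis adj_ex)

lemma adj_ip2: "\<lbrakk>T \<in> \<B>; x \<in> \<H>; y \<in> \<H>\<rbrakk> \<Longrightarrow> \<langle>hadj T x, y\<rangle> = \<langle>x, T y\<rangle>"
  by (metis adj_ip adj_closed ip_commute op_closed)

lemma adj_adj [simp]: "T \<in> \<B> \<Longrightarrow> hadj (hadj T) = T"
  by (rule adjI) (auto simp: adj_ip2)

lemma op_norm_dual:
  assumes T: "T \<in> \<B>" and x: "x \<in> \<H>" and c: "c \<ge> 0" and bd: "\<And>y. y \<in> \<H> \<Longrightarrow> cmod \<langle>T x, y\<rangle> \<le> c * \<parallel>y\<parallel>"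
  shows "\<parallel>T x\<parallel> \<le> c"
proof -
  have "\<parallel>T x\<parallel> * \<parallel>T x\<parallel> \<le> c * \<parallel>T x\<parallel>" using bd[of "T x"] T x by (simp add: ip_self power2_eq_square norm_mult)
  then show ?thesis using c norm_ge_0[of "T x"] T x by (metis mult_le_cancel_right op_closed order_le_less)
qed

lemma adj_bound:
  assumes T: "T \<in> \<B>" and c: "c \<ge> 0" and bd: "\<And>x. x \<in> \<H> \<Longrightarrow> \<parallel>T x\<parallel> \<le> c * \<parallel>x\<parallel>" and y: "y \<in> \<H>"
  shows "\<parallel>hadj T y\<parallel> \<le> c * \<parallel>y\<parallel>"
proof (rule op_norm_dual[of "hadj T"])
  fix x assume x: "x \<in> \<H>"
  have "cmod \<langle>hadj T y, x\<rangle> \<le> \<parallel>y\<parallel> * \<parallel>T x\<parallel>" using cauchy_schwarz[of y "T x"] T x y by (simp add: adj_ip2)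
  also have "\<dots> \<le> \<parallel>y\<parallel> * (c * \<parallel>x\<parallel>)" using bd[OF x] y by (simp add: mult_left_mono)
  finally show "cmod \<langle>hadj T y, x\<rangle> \<le> c * \<parallel>y\<parallel> * \<parallel>x\<parallel>" by (simp add: ac_simps)
qed (use T c y in auto)

text \<open>Convergence of quadratic forms suffices, because polarization recovers the full form.
  Through this lemma limits of functions and countable unions of sets give rise to
  operators.\<close>

lemma weak_limit_op:
  assumes T: "\<And>n. T n \<in> \<B>" and bd: "\<And>n x. x \<in> \<H> \<Longrightarrow> cmod \<langle>T n x, x\<rangle> \<le> c * \<parallel>x\<parallel>\<^sup>2" and c: "c \<ge> 0"
    and lim: "\<And>x. x \<in> \<H> \<Longrightarrow> (\<lambda>n. \<langle>T n x, x\<rangle>) \<longlonglongrightarrow> q x"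
  obtains S where "S \<in> \<B>" "\<And>x. x \<in> \<H> \<Longrightarrow> \<langle>S x, x\<rangle> = q x"
    "\<And>x y. x \<in> \<H> \<Longrightarrow> y \<in> \<H> \<Longrightarrow> (\<lambda>n. \<langle>T n x, y\<rangle>) \<longlonglongrightarrow> \<langle>S x, y\<rangle>"
proof -
  define B where "B x y = (q (x \<boxplus> y) - q (x \<boxminus> y) + \<i> * q (x \<boxplus> \<i> \<star> y) - \<i> * q (x \<boxminus> \<i> \<star> y)) / 4" for x y
  have TB: "(\<lambda>n. \<langle>T n x, y\<rangle>) \<longlonglongrightarrow> B x y" if xy: "x \<in> \<H>" "y \<in> \<H>" for x y
  proof -
    have "\<langle>T n x, y\<rangle> = (\<langle>T n (x \<boxplus> y), x \<boxplus> y\<rangle> - \<langle>T n (x \<boxminus> y), x \<boxminus> y\<rangle>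
      + \<i> * \<langle>T n (x \<boxplus> \<i> \<star> y), x \<boxplus> \<i> \<star> y\<rangle> - \<i> * \<langle>T n (x \<boxminus> \<i> \<star> y), x \<boxminus> \<i> \<star> y\<rangle>) / 4" for n
      unfolding polarization[OF T xy, symmetric] by simp
    moreover have "(\<lambda>n. (\<langle>T n (x \<boxplus> y), x \<boxplus> y\<rangle> - \<langle>T n (x \<boxminus> y), x \<boxminus> y\<rangle>
      + \<i> * \<langle>T n (x \<boxplus> \<i> \<star> y), x \<boxplus> \<i> \<star> y\<rangle> - \<i> * \<langle>T n (x \<boxminus> \<i> \<star> y), x \<boxminus> \<i> \<star> y\<rangle>) / 4) \<longlonglongrightarrow> B x y"
      unfolding B_def by (intro tendsto_intros lim) (use xy in auto)
    ultimately show ?thesis by (simp only:)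
  qed
  obtain S where S: "S \<in> \<B>" "\<And>x y. x \<in> \<H> \<Longrightarrow> y \<in> \<H> \<Longrightarrow> \<langle>S x, y\<rangle> = B x y"
  proof (rule form_op_left[of B "2 * c"])
    fix x y z assume xyz: "x \<in> \<H>" "y \<in> \<H>" "z \<in> \<H>"
    have "(\<lambda>n. \<langle>T n x, z\<rangle> + \<langle>T n y, z\<rangle>) \<longlonglongrightarrow> B x z + B y z" by (intro tendsto_intros TB xyz)
    then show "B (x \<boxplus> y) z = B x z + B y z"
      using TB[of "x \<boxplus> y" z] xyz T by (simp add: ips opl LIMSEQ_unique)
    have "(\<lambda>n. \<langle>T n x, y\<rangle> + \<langle>T n x, z\<rangle>) \<longlonglongrightarrow> B x y + B x z" by (intro tendsto_intros TB xyz)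
    then show "B x (y \<boxplus> z) = B x y + B x z"
      using TB[of x "y \<boxplus> z"] xyz T by (simp add: ips opl LIMSEQ_unique)
  next
    fix a x z assume xyz: "x \<in> \<H>" "z \<in> \<H>"
    have "(\<lambda>n. a * \<langle>T n x, z\<rangle>) \<longlonglongrightarrow> a * B x z" by (intro tendsto_intros TB xyz)
    then show "B (a \<star> x) z = a * B x z"
      using TB[of "a \<star> x" z] xyz T by (simp add: ips opl LIMSEQ_unique)
    have "(\<lambda>n. cnj a * \<langle>T n x, z\<rangle>) \<longlonglongrightarrow> cnj a * B x z" by (intro tendsto_intros TB xyz)
    then show "B x (a \<star> z) = cnj a * B x z"
      using TB[of x "a \<star> z"] xyz T by (simp add: ips opl LIMSEQ_unique)
  next
    fix x z assume xz: "x \<in> \<H>" "z \<in> \<H>"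
    have "(\<lambda>n. cmod \<langle>T n x, z\<rangle>) \<longlonglongrightarrow> cmod (B x z)" by (intro tendsto_intros TB xz)
    then show "cmod (B x z) \<le> 2 * c * \<parallel>x\<parallel> * \<parallel>z\<parallel>"
      by (rule LIMSEQ_le_const2) (use quad_bound[OF T bd c xz] in auto)
  qed (use c that in auto)
  have "\<langle>S x, x\<rangle> = q x" if "x \<in> \<H>" for x
    using LIMSEQ_unique[OF TB[OF that that] lim[OF that]] S(2)[OF that that] by simp
  then show thesis by (rule that[OF S(1)]) (simp_all add: S(2) TB)
qed

definition opadd where "opadd S T = (\<lambda>x\<in>\<H>. S x \<boxplus> T x)"
definition opsc where "opsc a T = (\<lambda>x\<in>\<H>. a \<star> T x)"
definition opid where "opid = (\<lambda>x\<in>\<H>. x)"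

lemma opadd_closed [simp, intro]: assumes "S \<in> \<B>" "T \<in> \<B>" shows "opadd S T \<in> \<B>"
proof -
  obtain c where c: "\<And>x. x \<in> \<H> \<Longrightarrow> \<parallel>S x\<parallel> \<le> c * \<parallel>x\<parallel>" using op_bound[OF assms(1)] by blast
  obtain d where d: "\<And>x. x \<in> \<H> \<Longrightarrow> \<parallel>T x\<parallel> \<le> d * \<parallel>x\<parallel>" using op_bound[OF assms(2)] by blast
  have "\<parallel>S x \<boxplus> T x\<parallel> \<le> (c + d) * \<parallel>x\<parallel>" if "x \<in> \<H>" for x
    using norm_add_le[of "S x" "T x"] c[OF that] d[OF that] assms that by (simp add: algebra_simps)
  then show ?thesis unfolding opadd_def
    by (intro opI[where c="c + d"]) (use assms in \<open>auto simp: opl M.a_ac smult_r_distr\<close>)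
qed

lemma opsc_closed [simp, intro]: assumes "T \<in> \<B>" shows "opsc a T \<in> \<B>"
proof -
  obtain d where d: "\<And>x. x \<in> \<H> \<Longrightarrow> \<parallel>T x\<parallel> \<le> d * \<parallel>x\<parallel>" using op_bound[OF assms(1)] by blast
  have "\<parallel>a \<star> T x\<parallel> \<le> (cmod a * d) * \<parallel>x\<parallel>" if "x \<in> \<H>" for x
    using d[OF that] assms that by (simp add: mult.assoc mult_left_mono)
  then show ?thesis unfolding opsc_def
  proof (intro opI[where c="cmod a * d"])
    fix b x assume "x \<in> \<H>"
    then show "a \<star> T (b \<star> x) = b \<star> a \<star> T x"
      using assms by (simp add: opl mult.commute)
  qed (use assms in \<open>auto simp: opl smult_r_distr\<close>)
qed

lemma opid_closed [simp, intro]: "opid \<in> \<B>"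
  unfolding opid_def by (rule opI[where c=1]) auto

lemma comp_closed [simp, intro]: assumes "S \<in> \<B>" "T \<in> \<B>" shows "compose \<H> S T \<in> \<B>"
proof -
  obtain c where c: "c > 0" "\<And>x. x \<in> \<H> \<Longrightarrow> \<parallel>S x\<parallel> \<le> c * \<parallel>x\<parallel>" using op_bound[OF assms(1)] by blast
  obtain d where d: "\<And>x. x \<in> \<H> \<Longrightarrow> \<parallel>T x\<parallel> \<le> d * \<parallel>x\<parallel>" using op_bound[OF assms(2)] by blast
  have "\<parallel>S (T x)\<parallel> \<le> (c * d) * \<parallel>x\<parallel>" if "x \<in> \<H>" for x
    unfolding mult.assoc by (rule order_trans[OF c(2) mult_left_mono[OF d]]) (use assms that c(1) in auto)
  then show ?thesis unfolding compose_def
    by (intro opI[where c="c * d"]) (use assms in \<open>auto simp: opl\<close>)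
qed

lemma op_apps [simp]: "x \<in> \<H> \<Longrightarrow> opadd S T x = S x \<boxplus> T x" "x \<in> \<H> \<Longrightarrow> opsc a T x = a \<star> T x"
  "x \<in> \<H> \<Longrightarrow> opid x = x" "x \<in> \<H> \<Longrightarrow> compose \<H> S T x = S (T x)"
  by (auto simp: opadd_def opsc_def opid_def compose_def)

text \<open>The adjoint has the conjugate quadratic form, and over the complex numbers the quadratic
  form determines the operator.\<close>

lemma real_quad_selfadj:
  assumes T: "T \<in> \<B>" and "\<And>x. x \<in> \<H> \<Longrightarrow> Im \<langle>T x, x\<rangle> = 0" and xy: "x \<in> \<H>" "y \<in> \<H>"
  shows "\<langle>T x, y\<rangle> = \<langle>x, T y\<rangle>"
proof -
  have "\<langle>hadj T x, x\<rangle> = \<langle>T x, x\<rangle>" if "x \<in> \<H>" for x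
    using ip_commute[of "T x" x] assms(2)[OF that] that T by (simp add: adj_ip2 complex_eq_iff)
  then have "hadj T = T" using T by (intro op_eqI_quad) auto
  then show ?thesis using adj_ip[OF T xy] by simp
qed

lemma positive_cs:
  assumes T: "T \<in> \<B>" and p: "\<And>x. x \<in> \<H> \<Longrightarrow> Im \<langle>T x, x\<rangle> = 0" "\<And>x. x \<in> \<H> \<Longrightarrow> Re \<langle>T x, x\<rangle> \<ge> 0"
    and xy: "x \<in> \<H>" "y \<in> \<H>"
  shows "(cmod \<langle>T x, y\<rangle>)\<^sup>2 \<le> Re \<langle>T x, x\<rangle> * Re \<langle>T y, y\<rangle>"
proof (rule semi_cauchy_schwarz)
  fix x y assume xy: "x \<in> \<H>" "y \<in> \<H>"
  show "\<langle>T y, x\<rangle> = cnj \<langle>T x, y\<rangle>"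
    using real_quad_selfadj[OF T p(1) xy(2,1)] ip_commute[of "T x" y] xy T by simp
qed (use assms in \<open>auto simp: ips opl\<close>)

lemma projD:
  assumes "P \<in> projections H"
  shows "P \<in> \<B>" "\<And>x. x \<in> \<H> \<Longrightarrow> P (P x) = P x" "\<And>x y. x \<in> \<H> \<Longrightarrow> y \<in> \<H> \<Longrightarrow> \<langle>P x, y\<rangle> = \<langle>x, P y\<rangle>"
    "\<And>x. x \<in> \<H> \<Longrightarrow> \<langle>P x, x\<rangle> = of_real (\<parallel>P x\<parallel>\<^sup>2)" "\<And>x. x \<in> \<H> \<Longrightarrow> \<parallel>P x\<parallel> \<le> \<parallel>x\<parallel>"
proof -
  show P: "P \<in> \<B>" using assms by (auto simp: projections_def)
  show PP: "P (P x) = P x" if "x \<in> \<H>" for x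
    using assms that by (auto simp: projections_def fun_eq_iff dest!: spec[of _ x])
  show sa: "\<langle>P x, y\<rangle> = \<langle>x, P y\<rangle>" if "x \<in> \<H>" "y \<in> \<H>" for x y
    using adj_ip[OF P that] assms by (simp add: projections_def)
  show q: "\<langle>P x, x\<rangle> = of_real (\<parallel>P x\<parallel>\<^sup>2)" if "x \<in> \<H>" for x
    using sa[of "P x" x] PP[OF that] that P by (simp add: ip_self)
  show "\<parallel>P x\<parallel> \<le> \<parallel>x\<parallel>" if x: "x \<in> \<H>" for x
  proof -
    have "\<parallel>P x\<parallel> * \<parallel>P x\<parallel> \<le> \<parallel>P x\<parallel> * \<parallel>x\<parallel>" using cauchy_schwarz[of "P x" x] x P unfolding q[OF x] by (simp add: power2_eq_square norm_mult)
    then show ?thesis using norm_ge_0[of "P x"] norm_ge_0[of x] x P by (metis mult_le_cancel_left order_le_less op_closed)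
  qed
qed

lemma projI:
  assumes "P \<in> \<B>" "\<And>x. x \<in> \<H> \<Longrightarrow> P (P x) = P x" "\<And>x y. x \<in> \<H> \<Longrightarrow> y \<in> \<H> \<Longrightarrow> \<langle>P x, y\<rangle> = \<langle>x, P y\<rangle>"
  shows "P \<in> projections H"
  unfolding projections_def using assms by (auto intro!: adjI op_ext[OF comp_closed])

end

context complex_hilbert begin

subsection \<open>Orthonormal bases\<close>

definition onset where "onset B \<longleftrightarrow> B \<subseteq> \<H> \<and> (\<forall>e\<in>B. \<forall>f\<in>B. \<langle>e, f\<rangle> = (if e = f then 1 else 0))"

definition psum where "psum F x = finsum H (\<lambda>e. \<langle>x, e\<rangle> \<star> e) F"

lemma ip_finsum: assumes "finite A" "\<And>i. i \<in> A \<Longrightarrow> f i \<in> \<H>" "y \<in> \<H>"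
  shows "\<langle>finsum H f A, y\<rangle> = (\<Sum>i\<in>A. \<langle>f i, y\<rangle>)"
  using assms by (induction A rule: finite_induct) (auto simp: ip_add_left Pi_def M.finsum_closed)

lemma psum_closed: "\<lbrakk>F \<subseteq> \<H>; x \<in> \<H>\<rbrakk> \<Longrightarrow> psum F x \<in> \<H>"
  unfolding psum_def by (rule M.finsum_closed) auto

lemma psum_ip: "\<lbrakk>finite F; F \<subseteq> \<H>; x \<in> \<H>; y \<in> \<H>\<rbrakk> \<Longrightarrow> \<langle>psum F x, y\<rangle> = (\<Sum>e\<in>F. \<langle>x, e\<rangle> * \<langle>e, y\<rangle>)"
  unfolding psum_def by (subst ip_finsum) (auto simp: ip_smult_left subset_iff intro!: sum.cong)

lemma norm_sub_psum:
  assumes F: "finite F" "onset F" and x: "x \<in> \<H>"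
  shows "\<parallel>x \<boxminus> psum F x\<parallel>\<^sup>2 = \<parallel>x\<parallel>\<^sup>2 - (\<Sum>e\<in>F. (cmod \<langle>x, e\<rangle>)\<^sup>2)"
proof -
  have FH: "F \<subseteq> \<H>" using F by (auto simp: onset_def)
  define p where "p = psum F x"
  have p: "p \<in> \<H>" unfolding p_def by (rule psum_closed[OF FH x])
  have px: "\<langle>p, x\<rangle> = of_real (\<Sum>e\<in>F. (cmod \<langle>x, e\<rangle>)\<^sup>2)"
    unfolding p_def psum_ip[OF F(1) FH x x] of_real_sum
    by (rule sum.cong) (use FH x in \<open>auto simp only: complex_norm_square ip_commute[of x] subset_iff\<close>)
  have "\<langle>p, e\<rangle> = \<langle>x, e\<rangle>" if "e \<in> F" for e
  proof -
    have "\<langle>p, e\<rangle> = (\<Sum>f\<in>F. \<langle>x, f\<rangle> * \<langle>f, e\<rangle>)" unfolding p_def using psum_ip[OF F(1) FH x] that FH by auto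
    also have "\<dots> = (\<Sum>f\<in>F. if f = e then \<langle>x, f\<rangle> else 0)" using F(2) that by (intro sum.cong) (auto simp: onset_def)
    finally show ?thesis using F that by simp
  qed
  then have "\<langle>e, p\<rangle> = \<langle>e, x\<rangle>" if "e \<in> F" for e
    using ip_commute[of p e] ip_commute[of x e] p x FH that by auto
  then have "\<langle>p, p\<rangle> = \<langle>p, x\<rangle>"
    using psum_ip[OF F(1) FH x p] psum_ip[OF F(1) FH x x] unfolding p_def[symmetric] by simp
  then show ?thesis unfolding p_def[symmetric] using x p px
    by (simp add: norm_sub_sq norm_sq[OF p] ip_commute[of p x])
qed

lemma bessel: "\<lbrakk>finite F; onset F; x \<in> \<H>\<rbrakk> \<Longrightarrow> (\<Sum>e\<in>F. (cmod \<langle>x, e\<rangle>)\<^sup>2) \<le> \<parallel>x\<parallel>\<^sup>2"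
  using norm_sub_psum[of F x] by (smt (verit) zero_le_power2)

lemma onset_subset: "onset B \<Longrightarrow> F \<subseteq> B \<Longrightarrow> onset F" unfolding onset_def by (meson subsetD subset_trans)

lemma basis_onset: "orthonormal_basis H B \<Longrightarrow> onset B" by (auto simp: orthonormal_basis_def onset_def)

text \<open>The vectors approximated by finite Fourier sums form a closed subspace that contains the
  basis, so \<open>total_subsp\<close> applies. Convergence along the net of finite sets follows
  from approximation by single sets, since the remainder decreases as the set grows.\<close>

lemma psum_lim:
  assumes B: "orthonormal_basis H B" and x: "x \<in> \<H>"
  shows "((\<lambda>F. \<parallel>x \<boxminus> psum F x\<parallel>) \<longlongrightarrow> 0) (finite_subsets_at_top B)"
proof -
  note on = basis_onset[OF B]
  define r where "r F x = \<parallel>x \<boxminus> psum F x\<parallel>" for F x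
  have FH: "F \<subseteq> \<H>" if "F \<subseteq> B" for F using on that by (auto simp: onset_def)
  have pc: "psum F x \<in> \<H>" if "F \<subseteq> B" "x \<in> \<H>" for F x using psum_closed FH that by auto
  have r0: "r F x \<ge> 0" if "F \<subseteq> B" "x \<in> \<H>" for F x unfolding r_def by (intro norm_ge_0 sub_closed pc that)
  have r2: "(r F x)\<^sup>2 = \<parallel>x\<parallel>\<^sup>2 - (\<Sum>e\<in>F. (cmod \<langle>x, e\<rangle>)\<^sup>2)" if "finite F" "F \<subseteq> B" "x \<in> \<H>" for F x
    unfolding r_def using norm_sub_psum that onset_subset[OF on] by auto
  have rle: "r F x \<le> \<parallel>x\<parallel>" if "finite F" "F \<subseteq> B" "x \<in> \<H>" for F x
    by (rule power2_le_imp_le) (use r2[OF that] that in \<open>auto simp: sum_nonneg\<close>)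
  have rmono: "r G x \<le> r F x" if "finite G" "F \<subseteq> G" "G \<subseteq> B" "x \<in> \<H>" for F G x
  proof (rule power2_le_imp_le)
    have "(\<Sum>e\<in>F. (cmod \<langle>x, e\<rangle>)\<^sup>2) \<le> (\<Sum>e\<in>G. (cmod \<langle>x, e\<rangle>)\<^sup>2)" using that by (intro sum_mono2) auto
    then show "(r G x)\<^sup>2 \<le> (r F x)\<^sup>2" using r2[of G x] r2[of F x] that finite_subset[OF that(2,1)] by auto
  qed (use r0 that in auto)
  have radd: "r F (x \<boxplus> y) \<le> r F x + r F y" if "finite F" "F \<subseteq> B" "x \<in> \<H>" "y \<in> \<H>" for F x y
  proof -
    have "(x \<boxplus> y) \<boxminus> psum F (x \<boxplus> y) = (x \<boxminus> psum F x) \<boxplus> (y \<boxminus> psum F y)"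
      by (rule vec_eqI) (use that FH[OF that(2)] in
        \<open>auto simp: ips pc psum_ip subset_iff sum.distrib[symmetric] algebra_simps intro!: sum.cong\<close>)
    then show ?thesis unfolding r_def using norm_add_le[of "x \<boxminus> psum F x" "y \<boxminus> psum F y"] that pc by simp
  qed
  have rsc: "r F (a \<star> x) = cmod a * r F x" if "finite F" "F \<subseteq> B" "x \<in> \<H>" for F a x
  proof -
    have "(a \<star> x) \<boxminus> psum F (a \<star> x) = a \<star> (x \<boxminus> psum F x)"
      by (rule vec_eqI) (use that FH[OF that(2)] in
        \<open>auto simp: ips pc psum_ip subset_iff sum_distrib_left algebra_simps intro!: sum.cong\<close>)
    then show ?thesis unfolding r_def using that pc by simp
  qed
  define V where "V = {x\<in>\<H>. \<forall>\<epsilon>>0. \<exists>F. finite F \<and> F \<subseteq> B \<and> r F x < \<epsilon>}"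
  have VI: "x \<in> V" if "x \<in> \<H>" "\<And>\<epsilon>. \<epsilon> > 0 \<Longrightarrow> \<exists>F. finite F \<and> F \<subseteq> B \<and> r F x < \<epsilon>" for x using that by (auto simp: V_def)
  have VD: "\<exists>F. finite F \<and> F \<subseteq> B \<and> r F x < \<epsilon>" if "x \<in> V" "\<epsilon> > 0" for x \<epsilon>
    using that unfolding V_def by blast
  have "V = \<H>"
  proof (rule total_subsp)
    show "subsp V" unfolding subsp_def
    proof (intro conjI ballI allI)
      show "V \<subseteq> \<H>" by (auto simp: V_def)
      show "\<zero>\<^sub>H \<in> V"
        using rle[of "{}" "\<zero>\<^sub>H"] by (intro VI) (auto intro!: exI[of _ "{}"] elim!: le_less_trans)
    next
      fix x y assume xy: "x \<in> V" "y \<in> V"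
      then have xyH: "x \<in> \<H>" "y \<in> \<H>" by (auto simp: V_def)
      show "x \<boxplus> y \<in> V"
      proof (rule VI)
        fix \<epsilon> :: real assume "\<epsilon> > 0"
        then obtain F G where F: "finite F" "F \<subseteq> B" "r F x < \<epsilon>/2" and G: "finite G" "G \<subseteq> B" "r G y < \<epsilon>/2"
          using VD[OF xy(1), of "\<epsilon>/2"] VD[OF xy(2), of "\<epsilon>/2"] by auto
        have "r (F \<union> G) x \<le> r F x" "r (F \<union> G) y \<le> r G y" by (rule rmono; use F G xyH in simp)+
        moreover have "r (F \<union> G) (x \<boxplus> y) \<le> r (F \<union> G) x + r (F \<union> G) y"
          by (rule radd; use F G xyH in simp)
        ultimately have "r (F \<union> G) (x \<boxplus> y) < \<epsilon>" using F G by linarith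
        then show "\<exists>F. finite F \<and> F \<subseteq> B \<and> r F (x \<boxplus> y) < \<epsilon>" using F G by (intro exI[of _ "F \<union> G"]) auto
      qed (use xyH in auto)
    next
      fix a x assume x: "x \<in> V"
      then have xH: "x \<in> \<H>" by (auto simp: V_def)
      show "a \<star> x \<in> V"
      proof (rule VI)
        fix \<epsilon> :: real assume e: "\<epsilon> > 0"
        then obtain F where F: "finite F" "F \<subseteq> B" "r F x < \<epsilon> / (1 + cmod a)"
          using VD[OF x, of "\<epsilon> / (1 + cmod a)"] by (auto simp: add_pos_nonneg)
        have "cmod a * r F x \<le> (1 + cmod a) * r F x" using r0[OF F(2) xH] by (simp add: mult_right_mono)
        also have "\<dots> < \<epsilon>" using F(3) by (simp add: pos_less_divide_eq add_pos_nonneg mult.commute)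
        finally show "\<exists>F. finite F \<and> F \<subseteq> B \<and> r F (a \<star> x) < \<epsilon>" using F rsc[OF F(1,2) xH, of a] by (intro exI[of _ F]) auto
      qed (use xH in auto)
    qed
  next
    fix X z assume X: "\<And>n. X n \<in> V" and z: "z \<in> \<H>" and lim: "hlim X z"
    have XH: "X n \<in> \<H>" for n using X by (auto simp: V_def)
    show "z \<in> V"
    proof (rule VI[OF z])
      fix \<epsilon> :: real assume e: "\<epsilon> > 0"
      have "\<forall>\<^sub>F n in sequentially. \<parallel>X n \<boxminus> z\<parallel> < \<epsilon>/2"
        using lim e unfolding hlim_def by (intro order_tendstoD(2)[of _ 0]) auto
      then obtain n where n: "\<parallel>X n \<boxminus> z\<parallel> < \<epsilon>/2" by (auto simp: eventually_sequentially)
      obtain F where F: "finite F" "F \<subseteq> B" "r F (X n) < \<epsilon>/2" using VD[OF X[of n], of "\<epsilon>/2"] e by auto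
      have "z = X n \<boxplus> (z \<boxminus> X n)" by (rule vec_eqI) (use z XH in \<open>auto simp: ips\<close>)
      then have "r F z \<le> r F (X n) + r F (z \<boxminus> X n)" using radd[OF F(1,2) XH[of n], of "z \<boxminus> X n"] z XH by simp
      also have "r F (z \<boxminus> X n) \<le> \<parallel>X n \<boxminus> z\<parallel>" using rle[OF F(1,2), of "z \<boxminus> X n"] z XH norm_sub_commute by simp
      finally show "\<exists>F. finite F \<and> F \<subseteq> B \<and> r F z < \<epsilon>" using n F by (intro exI[of _ F]) auto
    qed
  next
    fix x assume x: "x \<in> \<H>" and o: "\<And>v. v \<in> V \<Longrightarrow> \<langle>v, x\<rangle> = 0"
    have "e \<in> V" if e: "e \<in> B" for e
    proof -
      have eH: "e \<in> \<H>" and "\<langle>e, e\<rangle> = 1" using e on by (auto simp: onset_def)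
      then have "(r {e} e)\<^sup>2 = 0" using r2[of "{e}" e] e by (simp add: norm_sq)
      then show ?thesis using e eH by (intro VI) (auto intro!: exI[of _ "{e}"])
    qed
    then have "\<langle>x, e\<rangle> = 0" if "e \<in> B" for e
      using o[of e] that x on ip_commute[of e x] by (auto simp: onset_def)
    then show "x = \<zero>\<^sub>H" using B x by (auto simp: orthonormal_basis_def)
  qed
  then have xV: "x \<in> V" using x by simp
  show ?thesis
  proof (rule tendstoI)
    fix \<epsilon> :: real assume "\<epsilon> > 0"
    then obtain F where F: "finite F" "F \<subseteq> B" "r F x < \<epsilon>" using xV by (auto simp: V_def)
    have "dist \<parallel>x \<boxminus> psum G x\<parallel> 0 < \<epsilon>" if "finite G" "F \<subseteq> G" "G \<subseteq> B" for G
      using rmono[OF that x] F(3) r0[OF that(3) x] by (simp add: r_def)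
    then show "\<forall>\<^sub>F G in finite_subsets_at_top B. dist \<parallel>x \<boxminus> psum G x\<parallel> 0 < \<epsilon>"
      unfolding eventually_finite_subsets_at_top using F by blast
  qed
qed

lemma parseval_ip:
  assumes B: "orthonormal_basis H B" and xy: "x \<in> \<H>" "y \<in> \<H>"
  shows "((\<lambda>e. \<langle>x, e\<rangle> * \<langle>e, y\<rangle>) has_sum \<langle>x, y\<rangle>) B"
  unfolding has_sum_def
proof (rule LIM_zero_cancel, rule Lim_null_comparison)
  have BH: "B \<subseteq> \<H>" using B by (auto simp: orthonormal_basis_def)
  show "((\<lambda>F. \<parallel>x \<boxminus> psum F x\<parallel> * \<parallel>y\<parallel>) \<longlongrightarrow> 0) (finite_subsets_at_top B)"
    by (rule tendsto_mult_left_zero[OF psum_lim[OF B xy(1)]])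
  have "norm ((\<Sum>e\<in>F. \<langle>x, e\<rangle> * \<langle>e, y\<rangle>) - \<langle>x, y\<rangle>) \<le> \<parallel>x \<boxminus> psum F x\<parallel> * \<parallel>y\<parallel>" if "finite F" "F \<subseteq> B" for F
  proof -
    have F: "F \<subseteq> \<H>" using that BH by auto
    show ?thesis using cauchy_schwarz[of "x \<boxminus> psum F x" y] psum_closed[OF F xy(1)] xy psum_ip[OF that(1) F xy]
      by (simp add: ips norm_minus_commute)
  qed
  then show "\<forall>\<^sub>F F in finite_subsets_at_top B. norm ((\<Sum>e\<in>F. \<langle>x, e\<rangle> * \<langle>e, y\<rangle>) - \<langle>x, y\<rangle>) \<le> \<parallel>x \<boxminus> psum F x\<parallel> * \<parallel>y\<parallel>"
    by (auto simp: eventually_finite_subsets_at_top intro!: exI[of _ "{}"])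
qed

lemma parseval:
  assumes B: "orthonormal_basis H B" and x: "x \<in> \<H>"
  shows "((\<lambda>e. (cmod \<langle>x, e\<rangle>)\<^sup>2) has_sum \<parallel>x\<parallel>\<^sup>2) B"
proof -
  have BH: "B \<subseteq> \<H>" using B by (auto simp: orthonormal_basis_def)
  have "((\<lambda>e. Re (\<langle>x, e\<rangle> * \<langle>e, x\<rangle>)) has_sum Re \<langle>x, x\<rangle>) B"
    by (rule has_sum_Re[OF parseval_ip[OF B x x]])
  moreover have "Re (\<langle>x, e\<rangle> * \<langle>e, x\<rangle>) = (cmod \<langle>x, e\<rangle>)\<^sup>2" if "e \<in> B" for e
    unfolding cmod_power2 using ip_commute[of x e, OF x subsetD[OF BH that]] by (simp add: power2_eq_square)
  ultimately show ?thesis unfolding norm_sq[OF x] by (simp cong: has_sum_cong)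
qed

text \<open>A maximal orthonormal set, provided by Zorn's lemma, is total: a nonzero vector
  orthogonal to it could be normalized and added. Hence \<open>some_basis\<close> is a
  basis.\<close>

lemma basis_exists: "\<exists>B. orthonormal_basis H B"
proof -
  have "\<exists>M\<in>{B. onset B}. \<forall>X\<in>{B. onset B}. M \<subseteq> X \<longrightarrow> X = M"
  proof (rule subset_Zorn_nonempty)
    show "{B. onset B} \<noteq> {}" by (auto simp: onset_def intro: exI[of _ "{}"])
    fix \<C> assume c: "\<C> \<noteq> {}" "subset.chain {B. onset B} \<C>"
    have "onset (\<Union>\<C>)" unfolding onset_def
    proof (intro conjI ballI)
      show "\<Union>\<C> \<subseteq> \<H>" using c by (auto simp: subset.chain_def onset_def)
      fix e f assume "e \<in> \<Union>\<C>" "f \<in> \<Union>\<C>"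
      then obtain A D where AD: "A \<in> \<C>" "e \<in> A" "D \<in> \<C>" "f \<in> D" by auto
      then have "A \<subseteq> D \<or> D \<subseteq> A" using c unfolding subset.chain_def by auto
      then obtain E where "E \<in> \<C>" "e \<in> E" "f \<in> E" using AD by blast
      then show "\<langle>e, f\<rangle> = (if e = f then 1 else 0)" using c by (auto simp: subset.chain_def onset_def)
    qed
    then show "\<Union>\<C> \<in> {B. onset B}" by simp
  qed
  then obtain B where B: "onset B" and max: "\<And>X. onset X \<Longrightarrow> B \<subseteq> X \<Longrightarrow> X = B" by auto
  have "x = \<zero>\<^sub>H" if x: "x \<in> \<H>" "\<forall>e\<in>B. \<langle>x, e\<rangle> = 0" for x
  proof (rule ccontr)
    assume "x \<noteq> \<zero>\<^sub>H"
    then have n: "\<parallel>x\<parallel> > 0" using norm_eq_0 norm_ge_0 x by (metis order_le_less)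
    define u where "u = of_real (1 / \<parallel>x\<parallel>) \<star> x"
    have uH: "u \<in> \<H>" using x by (simp add: u_def)
    moreover have "\<parallel>u\<parallel> = 1" using x n by (simp add: u_def norm_divide)
    moreover have "\<langle>u, e\<rangle> = 0" if "e \<in> B" for e
      using x that B by (simp add: u_def onset_def ip_smult_left subset_iff)
    ultimately have u: "u \<in> \<H>" "\<langle>u, u\<rangle> = 1" "\<forall>e\<in>B. \<langle>u, e\<rangle> = 0" by (auto simp: ip_self)
    have "\<langle>e, u\<rangle> = 0" if "e \<in> B" for e
      using that u ip_commute[of u e] B unfolding onset_def by auto
    then have u': "\<forall>e\<in>B. \<langle>e, u\<rangle> = 0" by blast
    have "u \<notin> B" using u by auto
    then have "onset (insert u B)" using B u u' unfolding onset_def by auto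
    then have "u \<in> B" using max[of "insert u B"] by blast
    then show False using u by auto
  qed
  then have "\<forall>x\<in>\<H>. (\<forall>e\<in>B. \<langle>x, e\<rangle> = 0) \<longrightarrow> x = \<zero>\<^sub>H" by blast
  then show ?thesis using B unfolding orthonormal_basis_def onset_def by blast
qed

abbreviation sb where "sb \<equiv> some_basis H"

lemma sb: "orthonormal_basis H sb"
  unfolding some_basis_def by (rule someI_ex[OF basis_exists])

lemma sb_on: "onset sb" by (rule basis_onset[OF sb])

lemma sb_H [simp, intro]: "e \<in> sb \<Longrightarrow> e \<in> \<H>" using sb_on by (auto simp: onset_def)

end

subsection \<open>Positive square roots and polar decomposition\<close>

text \<open>The coefficients of the power series of \<open>sqrt (1 - t)\<close>.\<close>

definition sqrt_coeff :: "nat \<Rightarrow> real" where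
  "sqrt_coeff n = (-1) ^ n * ((1/2) gchoose n)"

lemma sqrt_coeff_0 [simp]: "sqrt_coeff 0 = 1"
  by (simp add: sqrt_coeff_def)

lemma sqrt_coeff_nonpos: "n > 0 \<Longrightarrow> sqrt_coeff n \<le> 0"
proof -
  assume "n > 0"
  then obtain m where n: "n = Suc m" by (cases n) auto
  have "sqrt_coeff n = (-1) ^ n * ((-1) ^ n * pochhammer (- (1/2)) n / fact n)"
    unfolding sqrt_coeff_def gbinomial_pochhammer ..
  also have "\<dots> = pochhammer (- (1/2)) n / fact n" by (simp flip: power_mult_distrib mult.assoc)
  also have "pochhammer (- (1/2)) n = - (1/2) * pochhammer (1/2::real) m" by (simp add: n pochhammer_rec)
  finally show ?thesis using pochhammer_nonneg[of "1/2::real" m] by (simp add: divide_le_0_iff)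
qed

text \<open>Alternating partial sums of binomial coefficients collapse to a single coefficient with
  upper index \<open>1/2 - 1 = -1/2\<close>, whose sign is explicit.\<close>

lemma sum_sqrt_coeff_nonneg: "(\<Sum>k\<le>n. sqrt_coeff k) \<ge> 0"
proof -
  have "(\<Sum>k\<le>n. sqrt_coeff k) = (-1) ^ n * ((1/2 - 1) gchoose n)"
    unfolding sqrt_coeff_def using gbinomial_sum_lower_neg[of "1/2::real" n] by (simp add: mult.commute)
  also have "\<dots> = (-1) ^ n * ((-1) ^ n * pochhammer (1/2) n / fact n)"
    unfolding gbinomial_pochhammer by simp
  also have "\<dots> = pochhammer (1/2) n / fact n" by (simp flip: power_mult_distrib mult.assoc)
  finally show ?thesis using pochhammer_nonneg[of "1/2::real" n] by simp
qed

text \<open>Vandermonde's identity with upper indices \<open>1/2 + 1/2 = 1\<close>: the square of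
  the power series is \<open>1 - t\<close>.\<close>

lemma sqrt_coeff_conv:
  "(\<Sum>j\<le>n. sqrt_coeff j * sqrt_coeff (n - j)) = (if n = 0 then 1 else if n = 1 then -1 else 0)"
proof -
  have "(\<Sum>j\<le>n. sqrt_coeff j * sqrt_coeff (n - j)) = (\<Sum>j\<le>n. (-1) ^ n * (((1/2) gchoose j) * ((1/2) gchoose (n - j))))"
  proof (rule sum.cong)
    fix j assume "j \<in> {..n}"
    then have "(-1) ^ n = (-1) ^ j * (-1::real) ^ (n - j)" by (simp flip: power_add)
    then show "sqrt_coeff j * sqrt_coeff (n - j) = (-1) ^ n * (((1/2) gchoose j) * ((1/2) gchoose (n - j)))"
      by (simp add: sqrt_coeff_def)
  qed simp
  also have "\<dots> = (-1) ^ n * ((1/2 + 1/2 :: real) gchoose n)"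
    unfolding sum_distrib_left[symmetric] by (simp add: atLeast0AtMost gbinomial_Vandermonde flip: atLeast0AtMost)
  also have "(1/2 + 1/2 :: real) gchoose n = of_nat (1 choose n)" by (simp add: binomial_gbinomial)
  finally show ?thesis by (cases n; cases "n - 1") (auto simp: binomial_eq_0)
qed

lemma summable_sqrt_coeff: "summable (\<lambda>n. \<bar>sqrt_coeff n\<bar>)"
proof (rule summableI_nonneg_bounded[where x=2])
  fix n
  \<comment> \<open>All coefficients except the leading 1 are nonpositive, so taking absolute values
    amounts to subtracting the sum from twice that 1.\<close>
  have eq: "(\<Sum>k\<le>n. \<bar>sqrt_coeff k\<bar>) = 2 - (\<Sum>k\<le>n. sqrt_coeff k)" for n
    using sqrt_coeff_nonpos by (induction n) auto
  have "(\<Sum>i<n. \<bar>sqrt_coeff i\<bar>) \<le> (\<Sum>k\<le>n. \<bar>sqrt_coeff k\<bar>)" by (rule sum_mono2) auto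
  then show "(\<Sum>i<n. \<bar>sqrt_coeff i\<bar>) \<le> 2" using eq[of n] sum_sqrt_coeff_nonneg[of n] by linarith
qed simp

lemma suminf_sqrt_coeff_nonneg: "(\<Sum>n. sqrt_coeff n) \<ge> 0"
proof -
  have "(\<lambda>n. \<Sum>k\<le>n. sqrt_coeff k) \<longlonglongrightarrow> (\<Sum>n. sqrt_coeff n)"
    by (rule summable_LIMSEQ'[OF summable_rabs_cancel[OF summable_sqrt_coeff]])
  then show ?thesis by (rule LIMSEQ_le_const) (use sum_sqrt_coeff_nonneg in auto)
qed

text \<open>Absolute summability over pairs allows regrouping by diagonals, as in a Cauchy product.
  It turns the square of the operator series into convolutions of its coefficients.\<close>

lemma double_series_diagonal:
  fixes f :: "nat \<times> nat \<Rightarrow> complex"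
  assumes f: "(\<lambda>p. norm (f p)) summable_on UNIV"
  shows "(\<Sum>\<^sub>\<infinity>n. \<Sum>\<^sub>\<infinity>j. f (n, j)) = (\<Sum>\<^sub>\<infinity>k. \<Sum>j\<le>k. f (j, k - j))"
proof -
  let ?h = "\<lambda>(k, j). (j, k - j)"
  let ?S = "SIGMA k:UNIV. {..k::nat}"
  have bij: "bij_betw ?h ?S UNIV"
    by (rule bij_betw_byWitness[where f'="\<lambda>(n, j). (n + j, n)"]) auto
  have s: "f summable_on (SIGMA n:UNIV. UNIV)" using abs_summable_summable[OF f] by simp
  have sh: "(\<lambda>p. f (?h p)) summable_on ?S" using summable_on_reindex_bij_betw[OF bij, of f] s by simp
  have "(\<Sum>\<^sub>\<infinity>n. \<Sum>\<^sub>\<infinity>j. f (n, j)) = infsum f (SIGMA n:UNIV. UNIV)"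
    using infsum_Sigma_banach[OF s] by simp
  also have "\<dots> = infsum (\<lambda>p. f (?h p)) ?S" using infsum_reindex_bij_betw[OF bij, of f] by simp
  also have "\<dots> = (\<Sum>\<^sub>\<infinity>k. \<Sum>\<^sub>\<infinity>j\<in>{..k}. f (?h (k, j)))"
    by (rule infsum_Sigma_banach[OF sh, symmetric])
  finally show ?thesis by simp
qed

context complex_hilbert begin

lemma funpow_closed: "K \<in> \<B> \<Longrightarrow> x \<in> \<H> \<Longrightarrow> (K ^^ n) x \<in> \<H>"
  by (induction n) auto

text \<open>The square root of \<open>I - K\<close>, obtained by putting \<open>K\<close> into the
  power series of \<open>sqrt (1 - t)\<close>, which is read weakly through matrix elements. The
  last conclusion, that the root commutes with whatever commutes with \<open>K\<close>, is the basis
  for the uniqueness of positive roots.\<close>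

lemma contraction_series:
  assumes K: "K \<in> \<B>" "\<And>x. x \<in> \<H> \<Longrightarrow> \<parallel>K x\<parallel> \<le> \<parallel>x\<parallel>" "\<And>x y. x \<in> \<H> \<Longrightarrow> y \<in> \<H> \<Longrightarrow> \<langle>K x, y\<rangle> = \<langle>x, K y\<rangle>"
  obtains A where "A \<in> \<B>" "\<And>x. x \<in> \<H> \<Longrightarrow> Im \<langle>A x, x\<rangle> = 0" "\<And>x. x \<in> \<H> \<Longrightarrow> Re \<langle>A x, x\<rangle> \<ge> 0"
    "\<And>x. x \<in> \<H> \<Longrightarrow> A (A x) = x \<boxminus> K x"
    "\<And>R x. \<lbrakk>R \<in> \<B>; \<And>x. x \<in> \<H> \<Longrightarrow> R (K x) = K (R x); x \<in> \<H>\<rbrakk> \<Longrightarrow> R (A x) = A (R x)"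
proof -
  note Kc = funpow_closed[OF K(1)]
  have nrm: "\<parallel>(K ^^ n) x\<parallel> \<le> \<parallel>x\<parallel>" if x: "x \<in> \<H>" for n x
  proof (induction n)
    case (Suc n) then show ?case using K(2)[OF Kc[OF x, of n]] by simp
  qed simp
  have sa: "\<langle>(K ^^ n) x, y\<rangle> = \<langle>x, (K ^^ n) y\<rangle>" if "x \<in> \<H>" "y \<in> \<H>" for n x y
    using that
  proof (induction n arbitrary: y)
    case (Suc n)
    have "\<langle>(K ^^ Suc n) x, y\<rangle> = \<langle>(K ^^ n) x, K y\<rangle>" using K(3) Kc Suc.prems by simp
    also have "\<dots> = \<langle>x, (K ^^ n) (K y)\<rangle>" using Suc K(1) by blast
    also have "(K ^^ n) (K y) = (K ^^ Suc n) y" by (simp add: funpow_swap1)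
    finally show ?case .
  qed simp
  define c where "c n = complex_of_real (sqrt_coeff n)" for n
  have cs: "summable (\<lambda>n. cmod (c n))" using summable_sqrt_coeff by (simp add: c_def)
  have mb: "cmod \<langle>(K ^^ n) x, y\<rangle> \<le> \<parallel>x\<parallel> * \<parallel>y\<parallel>" if "x \<in> \<H>" "y \<in> \<H>" for n x y
    using cauchy_schwarz[OF Kc[OF that(1)] that(2), of n] nrm[OF that(1), of n] norm_ge_0[OF that(2)]
    by (meson mult_right_mono order_trans)
  have tb: "cmod (c n * \<langle>(K ^^ n) x, y\<rangle>) \<le> cmod (c n) * (\<parallel>x\<parallel> * \<parallel>y\<parallel>)" if "x \<in> \<H>" "y \<in> \<H>" for n x y
    unfolding norm_mult by (intro mult_left_mono mb that) simp
  have ts: "summable (\<lambda>n. cmod (c n * \<langle>(K ^^ n) x, y\<rangle>))" if "x \<in> \<H>" "y \<in> \<H>" for x y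
    by (rule summable_comparison_test'[OF summable_mult2[OF cs]]) (use tb[OF that] in simp)
  note ts' = summable_norm_cancel[OF ts]
  have pl: "(K ^^ n) (x \<boxplus> y) = (K ^^ n) x \<boxplus> (K ^^ n) y" "(K ^^ n) (a \<star> x) = a \<star> (K ^^ n) x" if "x \<in> \<H>" "y \<in> \<H>" for n x y a
    using that Kc by (induction n) (auto simp: opl[OF K(1)])
  obtain A where A: "A \<in> \<B>" "\<And>x y. x \<in> \<H> \<Longrightarrow> y \<in> \<H> \<Longrightarrow> \<langle>A x, y\<rangle> = (\<Sum>n. c n * \<langle>(K ^^ n) x, y\<rangle>)"
  proof (rule form_op_left[of "\<lambda>x y. \<Sum>n. c n * \<langle>(K ^^ n) x, y\<rangle>" "\<Sum>n. cmod (c n)"])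
    fix x y z assume xyz: "x \<in> \<H>" "y \<in> \<H>" "z \<in> \<H>"
    show "(\<Sum>n. c n * \<langle>(K ^^ n) (x \<boxplus> y), z\<rangle>) = (\<Sum>n. c n * \<langle>(K ^^ n) x, z\<rangle>) + (\<Sum>n. c n * \<langle>(K ^^ n) y, z\<rangle>)"
      by (subst suminf_add) (use xyz ts' Kc in \<open>auto simp: pl ips algebra_simps\<close>)
    show "(\<Sum>n. c n * \<langle>(K ^^ n) x, y \<boxplus> z\<rangle>) = (\<Sum>n. c n * \<langle>(K ^^ n) x, y\<rangle>) + (\<Sum>n. c n * \<langle>(K ^^ n) x, z\<rangle>)"
      by (subst suminf_add) (use xyz ts' Kc in \<open>auto simp: ips algebra_simps\<close>)
  next
    fix a x z assume xz: "x \<in> \<H>" "z \<in> \<H>"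
    show "(\<Sum>n. c n * \<langle>(K ^^ n) (a \<star> x), z\<rangle>) = a * (\<Sum>n. c n * \<langle>(K ^^ n) x, z\<rangle>)"
      by (subst suminf_mult[symmetric]) (use xz ts' Kc in \<open>auto simp: pl(2)[OF xz] ips algebra_simps\<close>)
    show "(\<Sum>n. c n * \<langle>(K ^^ n) x, a \<star> z\<rangle>) = cnj a * (\<Sum>n. c n * \<langle>(K ^^ n) x, z\<rangle>)"
      by (subst suminf_mult[symmetric]) (use xz ts' Kc in \<open>auto simp: ips algebra_simps\<close>)
  next
    fix x z assume xz: "x \<in> \<H>" "z \<in> \<H>"
    have "cmod (\<Sum>n. c n * \<langle>(K ^^ n) x, z\<rangle>) \<le> (\<Sum>n. cmod (c n * \<langle>(K ^^ n) x, z\<rangle>))" by (rule summable_norm[OF ts[OF xz]])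
    also have "\<dots> \<le> (\<Sum>n. cmod (c n) * (\<parallel>x\<parallel> * \<parallel>z\<parallel>))" by (rule suminf_le[OF tb[OF xz] ts[OF xz] summable_mult2[OF cs]])
    also have "\<dots> = (\<Sum>n. cmod (c n)) * \<parallel>x\<parallel> * \<parallel>z\<parallel>" using suminf_mult2[OF cs, of "\<parallel>x\<parallel> * \<parallel>z\<parallel>"] by simp
    finally show "cmod (\<Sum>n. c n * \<langle>(K ^^ n) x, z\<rangle>) \<le> (\<Sum>n. cmod (c n)) * \<parallel>x\<parallel> * \<parallel>z\<parallel>" .
  qed (use that in \<open>auto intro: suminf_nonneg cs\<close>)
  have Im0: "Im \<langle>(K ^^ n) x, x\<rangle> = 0" if "x \<in> \<H>" for n x
    using sa[OF that that, of n] ip_commute[OF Kc[OF that] that, of n] by (simp add: complex_eq_iff)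
  have A1: "Im \<langle>A x, x\<rangle> = 0" if x: "x \<in> \<H>" for x
  proof -
    have "Im \<langle>A x, x\<rangle> = (\<Sum>n. Im (c n * \<langle>(K ^^ n) x, x\<rangle>))" unfolding A(2)[OF x x] by (rule Im_suminf[OF ts'[OF x x]])
    then show ?thesis by (simp add: c_def Im0[OF x])
  qed
  have A2: "Re \<langle>A x, x\<rangle> \<ge> 0" if x: "x \<in> \<H>" for x
  proof -
    have sr: "summable sqrt_coeff" by (rule summable_rabs_cancel[OF summable_sqrt_coeff])
    \<comment> \<open>All coefficients but the first are nonpositive and
      \<open>\<langle>(K ^^ n) x, x\<rangle>\<close> has real part at most
      \<open>\<parallel>x\<parallel>\<^sup>2\<close>, so replacing each matrix element by
      \<open>\<parallel>x\<parallel>\<^sup>2\<close> only lowers the series.\<close>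
    have "0 \<le> (\<Sum>n. sqrt_coeff n) * \<parallel>x\<parallel>\<^sup>2" using suminf_sqrt_coeff_nonneg by simp
    also have "\<dots> = (\<Sum>n. sqrt_coeff n * \<parallel>x\<parallel>\<^sup>2)" by (rule suminf_mult2[OF sr])
    also have "\<dots> \<le> (\<Sum>n. Re (c n * \<langle>(K ^^ n) x, x\<rangle>))"
    proof (rule suminf_le[OF _ summable_mult2[OF sr] summable_Re[OF ts'[OF x x]]])
      fix n
      have "Re \<langle>(K ^^ n) x, x\<rangle> \<le> \<parallel>x\<parallel>\<^sup>2"
        using mb[OF x x, of n] complex_Re_le_cmod[of "\<langle>(K ^^ n) x, x\<rangle>"] by (simp add: power2_eq_square)
      then have "n > 0 \<Longrightarrow> sqrt_coeff n * \<parallel>x\<parallel>\<^sup>2 \<le> sqrt_coeff n * Re \<langle>(K ^^ n) x, x\<rangle>"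
        using sqrt_coeff_nonpos[of n] by (simp add: mult_left_mono_neg)
      moreover have "n = 0 \<Longrightarrow> sqrt_coeff n * \<parallel>x\<parallel>\<^sup>2 = sqrt_coeff n * Re \<langle>(K ^^ n) x, x\<rangle>"
        using x by (simp add: norm_sq)
      ultimately show "sqrt_coeff n * \<parallel>x\<parallel>\<^sup>2 \<le> Re (c n * \<langle>(K ^^ n) x, x\<rangle>)" by (cases "n = 0") (auto simp: c_def)
    qed
    also have "\<dots> = Re \<langle>A x, x\<rangle>" unfolding A(2)[OF x x] by (rule Re_suminf[OF ts'[OF x x], symmetric])
    finally show ?thesis .
  qed
  have comm: "R (A x) = A (R x)" if R: "R \<in> \<B>" "\<And>x. x \<in> \<H> \<Longrightarrow> R (K x) = K (R x)" and x: "x \<in> \<H>" for R x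
  proof (rule vec_eqI)
    fix y assume y: "y \<in> \<H>"
    have RK: "(K ^^ n) (R x) = R ((K ^^ n) x)" for n using R x Kc by (induction n) auto
    have "\<langle>A (R x), y\<rangle> = (\<Sum>n. c n * \<langle>(K ^^ n) x, hadj R y\<rangle>)" using R x y Kc by (simp add: A(2) RK adj_ip)
    also have "\<dots> = \<langle>R (A x), y\<rangle>" using R x y A(1) by (simp add: A(2)[symmetric] adj_ip)
    finally show "\<langle>R (A x), y\<rangle> = \<langle>A (R x), y\<rangle>" by simp
  qed (use R x A(1) in auto)
  have sq: "A (A x) = x \<boxminus> K x" if x: "x \<in> \<H>" for x
  proof (rule vec_eqI)
    fix y assume y: "y \<in> \<H>"
    \<comment> \<open>The double series for \<open>A (A x)\<close>; summed along diagonals, its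
      coefficients are the convolutions in \<open>sqrt_coeff_conv\<close>, and only the first two
      survive.\<close>
    define f where "f = (\<lambda>(n, j). c n * (c j * \<langle>(K ^^ (n + j)) x, y\<rangle>))"
    have ch: "((\<lambda>j. cmod (c j)) has_sum (\<Sum>j. cmod (c j))) UNIV"
      by (rule norm_summable_imp_has_sum) (use cs in auto)
    have "(\<lambda>(n, j). cmod (c n) * cmod (c j)) summable_on (SIGMA n:UNIV. UNIV)"
    proof (rule summable_on_SigmaI)
      show "((\<lambda>j. case (n, j) of (n, j) \<Rightarrow> cmod (c n) * cmod (c j)) has_sum cmod (c n) * (\<Sum>j. cmod (c j))) UNIV" for n
        using has_sum_cmult_right[OF ch] by simp
      show "(\<lambda>n. cmod (c n) * (\<Sum>j. cmod (c j))) summable_on UNIV"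
        by (intro summable_on_cmult_left has_sum_imp_summable[OF ch])
    qed auto
    then have g: "(\<lambda>(n, j). cmod (c n) * cmod (c j)) summable_on UNIV" by simp
    have fs: "(\<lambda>p. norm (f p)) summable_on UNIV"
    proof (rule summable_on_comparison_test)
      show "(\<lambda>p. (case p of (n, j) \<Rightarrow> cmod (c n) * cmod (c j)) * (\<parallel>x\<parallel> * \<parallel>y\<parallel>)) summable_on UNIV"
        by (rule summable_on_cmult_left[OF g])
      show "norm (f p) \<le> (case p of (n, j) \<Rightarrow> cmod (c n) * cmod (c j)) * (\<parallel>x\<parallel> * \<parallel>y\<parallel>)" for p
      proof (cases p)
        case (Pair n j)
        have "cmod (c n) * cmod (c j) * cmod \<langle>(K ^^ (n + j)) x, y\<rangle> \<le> cmod (c n) * cmod (c j) * (\<parallel>x\<parallel> * \<parallel>y\<parallel>)"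
          by (intro mult_left_mono mb x y) auto
        then show ?thesis using Pair by (simp add: f_def norm_mult mult.assoc)
      qed
    qed auto
    have sm: "summable (\<lambda>n. norm (c n * z n))" if "\<And>n. cmod (z n) \<le> M" for z M
      by (rule summable_comparison_test'[OF summable_mult2[OF cs, of M]]) (use that in \<open>auto simp: norm_mult intro!: mult_left_mono\<close>)
    have in1: "\<langle>(K ^^ n) (A x), y\<rangle> = (\<Sum>\<^sub>\<infinity>j. c j * \<langle>(K ^^ (n + j)) x, y\<rangle>)" for n
    proof -
      have "\<langle>(K ^^ n) (A x), y\<rangle> = (\<Sum>j. c j * \<langle>(K ^^ j) x, (K ^^ n) y\<rangle>)"
        using sa[of "A x" y n] A x y Kc by simp
      also have "\<dots> = (\<Sum>j. c j * \<langle>(K ^^ (n + j)) x, y\<rangle>)"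
        using sa[OF Kc[OF x] y, of n] by (simp add: funpow_add)
      also have "\<dots> = (\<Sum>\<^sub>\<infinity>j. c j * \<langle>(K ^^ (n + j)) x, y\<rangle>)"
        by (rule infsumI[symmetric], rule norm_summable_imp_has_sum[OF sm summable_sums[OF summable_norm_cancel[OF sm]]])
           (rule mb[OF x y])+
      finally show ?thesis .
    qed
    have "\<langle>A (A x), y\<rangle> = (\<Sum>n. c n * \<langle>(K ^^ n) (A x), y\<rangle>)" using A x y by simp
    also have "\<dots> = (\<Sum>\<^sub>\<infinity>n. c n * \<langle>(K ^^ n) (A x), y\<rangle>)"
      using ts[of "A x" y] ts'[of "A x" y] A(1) x y by (intro infsumI[symmetric] norm_summable_imp_has_sum) auto
    also have "\<dots> = (\<Sum>\<^sub>\<infinity>n. \<Sum>\<^sub>\<infinity>j. f (n, j))" by (simp add: in1 f_def infsum_cmult_right')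
    also have "\<dots> = (\<Sum>\<^sub>\<infinity>k. \<Sum>j\<le>k. f (j, k - j))" by (rule double_series_diagonal[OF fs])
    also have "\<dots> = (\<Sum>\<^sub>\<infinity>k. of_real (if k = 0 then 1 else if k = 1 then -1 else 0) * \<langle>(K ^^ k) x, y\<rangle>)"
    proof (rule infsum_cong)
      fix k :: nat
      have "(\<Sum>j\<le>k. f (j, k - j)) = (\<Sum>j\<le>k. of_real (sqrt_coeff j * sqrt_coeff (k - j)) * \<langle>(K ^^ k) x, y\<rangle>)"
        by (rule sum.cong) (auto simp: f_def c_def)
      then show "(\<Sum>j\<le>k. f (j, k - j)) = of_real (if k = 0 then 1 else if k = 1 then -1 else 0) * \<langle>(K ^^ k) x, y\<rangle>"
        unfolding sqrt_coeff_conv[symmetric] by (simp add: sum_distrib_right)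
    qed
    also have "\<dots> = (\<Sum>\<^sub>\<infinity>k\<in>{0, 1}. of_real (if k = 0 then 1 else if k = 1 then -1 else 0) * \<langle>(K ^^ k) x, y\<rangle>)"
      by (rule infsum_cong_neutral) auto
    also have "\<dots> = \<langle>x \<boxminus> K x, y\<rangle>" using x y K(1) by (simp add: ips)
    finally show "\<langle>A (A x), y\<rangle> = \<langle>x \<boxminus> K x, y\<rangle>" .
  qed (use x A K in auto)
  show thesis by (rule that[OF A(1) A1 A2 sq comm])
qed

text \<open>Cauchy-Schwarz for the form of \<open>T\<close>, applied to \<open>x\<close> and
  \<open>T x\<close>. It gives the sharp operator bound of a positive operator from its quadratic
  form, where polarization would lose a factor 2.\<close>

lemma positive_contraction:
  assumes T: "T \<in> \<B>" and p: "\<And>x. x \<in> \<H> \<Longrightarrow> Im \<langle>T x, x\<rangle> = 0" "\<And>x. x \<in> \<H> \<Longrightarrow> Re \<langle>T x, x\<rangle> \<ge> 0"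
    and le: "\<And>x. x \<in> \<H> \<Longrightarrow> Re \<langle>T x, x\<rangle> \<le> c * \<parallel>x\<parallel>\<^sup>2" and c: "c > 0" and x: "x \<in> \<H>"
  shows "\<parallel>T x\<parallel>\<^sup>2 \<le> c * Re \<langle>T x, x\<rangle>"
proof -
  define t where "t = \<parallel>T x\<parallel>\<^sup>2"
  have "(cmod \<langle>T x, T x\<rangle>)\<^sup>2 \<le> Re \<langle>T x, x\<rangle> * Re \<langle>T (T x), T x\<rangle>" by (rule positive_cs[OF T p]) (use T x in auto)
  also have "\<dots> \<le> Re \<langle>T x, x\<rangle> * (c * t)" unfolding t_def by (intro mult_left_mono le p) (use T x in auto)
  also have "(cmod \<langle>T x, T x\<rangle>)\<^sup>2 = t * t" using T x by (simp add: ip_self t_def power2_eq_square norm_mult)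
  finally have "t * t \<le> (c * Re \<langle>T x, x\<rangle>) * t" by (simp add: ac_simps)
  moreover have "t \<ge> 0" "c * Re \<langle>T x, x\<rangle> \<ge> 0" using p(2)[OF x] c by (auto simp: t_def)
  ultimately show ?thesis unfolding t_def[symmetric] by (cases "t = 0") auto
qed

lemma positive_sqrt:
  assumes S: "S \<in> \<B>" and p: "\<And>x. x \<in> \<H> \<Longrightarrow> Im \<langle>S x, x\<rangle> = 0" "\<And>x. x \<in> \<H> \<Longrightarrow> Re \<langle>S x, x\<rangle> \<ge> 0"
  obtains A where "positive_op H A" "\<And>x. x \<in> \<H> \<Longrightarrow> A (A x) = S x"
    "\<And>R x. \<lbrakk>R \<in> \<B>; \<And>x. x \<in> \<H> \<Longrightarrow> R (S x) = S (R x); x \<in> \<H>\<rbrakk> \<Longrightarrow> R (A x) = A (R x)"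
proof -
  obtain c where c: "c > 0" "\<And>x. x \<in> \<H> \<Longrightarrow> \<parallel>S x\<parallel> \<le> c * \<parallel>x\<parallel>" using op_bound[OF S] by blast
  have Sle: "Re \<langle>S x, x\<rangle> \<le> c * \<parallel>x\<parallel>\<^sup>2" if x: "x \<in> \<H>" for x
  proof -
    have "Re \<langle>S x, x\<rangle> \<le> cmod \<langle>S x, x\<rangle>" by (rule complex_Re_le_cmod)
    also have "\<dots> \<le> \<parallel>S x\<parallel> * \<parallel>x\<parallel>" by (rule cauchy_schwarz) (use S x in auto)
    also have "\<dots> \<le> (c * \<parallel>x\<parallel>) * \<parallel>x\<parallel>" by (rule mult_right_mono[OF c(2)]) (use x in auto)
    finally show ?thesis by (simp add: power2_eq_square mult.assoc)
  qed
  \<comment> \<open>With \<open>c\<close> bounding \<open>S\<close>, the operator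
    \<open>K = I - S / c\<close> is a positive contraction, and \<open>sqrt c\<close> times the root
    of \<open>I - K\<close> is the root of \<open>S\<close>.\<close>
  define K where "K = opadd opid (opsc (- of_real (1 / c)) S)"
  have K: "K \<in> \<B>" using S by (auto simp: K_def)
  have Kx: "K x = x \<boxplus> (- of_real (1 / c)) \<star> S x" if "x \<in> \<H>" for x using that by (simp add: K_def)
  have Kq: "\<langle>K x, x\<rangle> = of_real (\<parallel>x\<parallel>\<^sup>2 - Re \<langle>S x, x\<rangle> / c)" if "x \<in> \<H>" for x
    using that S p(1)[OF that] by (simp add: Kx ips ip_self complex_eq_iff)
  have K1: "Im \<langle>K x, x\<rangle> = 0" "Re \<langle>K x, x\<rangle> \<ge> 0" "Re \<langle>K x, x\<rangle> \<le> 1 * \<parallel>x\<parallel>\<^sup>2" if "x \<in> \<H>" for x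
    using Sle[OF that] p(2)[OF that] c(1) unfolding Kq[OF that] by (auto simp: field_simps)
  have "\<parallel>K x\<parallel>\<^sup>2 \<le> \<parallel>x\<parallel>\<^sup>2" if "x \<in> \<H>" for x
    using positive_contraction[OF K K1 zero_less_one that] K1(3)[OF that] by simp
  then have Kc: "\<parallel>K x\<parallel> \<le> \<parallel>x\<parallel>" if "x \<in> \<H>" for x
    using that by (auto intro: power2_le_imp_le)
  obtain A where A: "A \<in> \<B>" "\<And>x. x \<in> \<H> \<Longrightarrow> Im \<langle>A x, x\<rangle> = 0" "\<And>x. x \<in> \<H> \<Longrightarrow> Re \<langle>A x, x\<rangle> \<ge> 0"
    "\<And>x. x \<in> \<H> \<Longrightarrow> A (A x) = x \<boxminus> K x"
    "\<And>R x. \<lbrakk>R \<in> \<B>; \<And>x. x \<in> \<H> \<Longrightarrow> R (K x) = K (R x); x \<in> \<H>\<rbrakk> \<Longrightarrow> R (A x) = A (R x)"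
  proof (rule contraction_series[OF K Kc real_quad_selfadj[OF K K1(1)]])
    fix A assume "A \<in> \<B>" "\<And>x. x \<in> \<H> \<Longrightarrow> Im \<langle>A x, x\<rangle> = 0" "\<And>x. x \<in> \<H> \<Longrightarrow> Re \<langle>A x, x\<rangle> \<ge> 0"
      "\<And>x. x \<in> \<H> \<Longrightarrow> A (A x) = x \<boxminus> K x"
      "\<And>R x. \<lbrakk>R \<in> \<B>; \<And>x. x \<in> \<H> \<Longrightarrow> R (K x) = K (R x); x \<in> \<H>\<rbrakk> \<Longrightarrow> R (A x) = A (R x)"
    then show thesis by (rule that)
  qed
  define s where "s = complex_of_real (sqrt c)"
  have s: "Im s = 0" "Re s \<ge> 0" "s * s = of_real c" using c(1) by (auto simp: s_def simp flip: of_real_mult)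
  show thesis
  proof (rule that[of "opsc s A"])
    show "positive_op H (opsc s A)" unfolding positive_op_def using A s by (auto simp: ips)
    show "opsc s A (opsc s A x) = S x" if x: "x \<in> \<H>" for x
    proof -
      have "opsc s A (opsc s A x) = (s * s) \<star> (x \<boxminus> K x)" using x A(1) K by (simp add: opl A(4))
      also have "\<dots> = S x" by (rule vec_eqI) (use x S K c(1) in \<open>auto simp: Kx ips s field_simps\<close>)
      finally show ?thesis .
    qed
    fix R x assume R: "R \<in> \<B>" "\<And>x. x \<in> \<H> \<Longrightarrow> R (S x) = S (R x)" and x: "x \<in> \<H>"
    have "R (K x) = K (R x)" if "x \<in> \<H>" for x using that R S by (simp add: Kx opl)
    then show "R (opsc s A x) = opsc s A (R x)" using A(5)[OF R(1) _ x] R(1) x A(1) by (simp add: opl)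
  qed
qed

text \<open>For \<open>y = A x \<boxminus> B x\<close> commutation gives
  \<open>A y \<boxplus> B y = 0\<close>, so both nonnegative forms vanish at \<open>y\<close>.
  Cauchy-Schwarz then annihilates \<open>\<langle>A y, x\<rangle>\<close> and
  \<open>\<langle>B y, x\<rangle>\<close>, whose difference is
  \<open>\<parallel>y\<parallel>\<^sup>2\<close>.\<close>

lemma commuting_sqrt_unique:
  assumes A: "positive_op H A" and B: "positive_op H B"
    and c: "\<And>x. x \<in> \<H> \<Longrightarrow> A (B x) = B (A x)" and sq: "\<And>x. x \<in> \<H> \<Longrightarrow> A (A x) = B (B x)"
  shows "A = B"
proof -
  have AB: "A \<in> \<B>" "B \<in> \<B>" using A B by (auto simp: positive_op_def)
  have pA: "Im \<langle>A x, x\<rangle> = 0" "Re \<langle>A x, x\<rangle> \<ge> 0" and pB: "Im \<langle>B x, x\<rangle> = 0" "Re \<langle>B x, x\<rangle> \<ge> 0" if "x \<in> \<H>" for x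
    using A B that by (auto simp: positive_op_def)
  show ?thesis
  proof (rule op_ext[OF AB])
    fix x assume x: "x \<in> \<H>"
    define y where "y = A x \<boxminus> B x"
    have y: "y \<in> \<H>" using x AB by (auto simp: y_def)
    have "\<langle>A y, y\<rangle> + \<langle>B y, y\<rangle> = \<langle>A y \<boxplus> B y, y\<rangle>" using y AB by (simp add: ips)
    also have "A y \<boxplus> B y = \<zero>\<^sub>H"
      by (rule vec_eqI) (use x AB in \<open>auto simp: y_def opl ips c sq\<close>)
    finally have "Re \<langle>A y, y\<rangle> = 0" "Re \<langle>B y, y\<rangle> = 0"
      using pA(2)[OF y] pB(2)[OF y] y by (auto simp: complex_eq_iff)
    then have "\<langle>A y, x\<rangle> = 0" "\<langle>B y, x\<rangle> = 0"
      using positive_cs[OF AB(1) pA y x] positive_cs[OF AB(2) pB y x] by auto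
    moreover have "\<langle>y, y\<rangle> = \<langle>A y, x\<rangle> - \<langle>B y, x\<rangle>"
      using x y AB real_quad_selfadj[OF AB(1) pA(1) y x] real_quad_selfadj[OF AB(2) pB(1) y x]
      by (subst (2) y_def) (simp add: ips)
    ultimately have "y = \<zero>\<^sub>H" using y by (simp add: ip_self norm_eq_0)
    then show "A x = B x" using x AB by (simp add: y_def sub_eq_0)
  qed
qed

text \<open>The description in \<open>abs_op\<close> denotes something: a competing positive root
  commutes with its own square, hence with the root that was constructed, and uniqueness among
  commuting roots applies.\<close>

lemma abs_op:
  assumes T: "T \<in> \<B>"
  shows "positive_op H (abs_op H T)" "\<And>x. x \<in> \<H> \<Longrightarrow> \<parallel>abs_op H T x\<parallel> = \<parallel>T x\<parallel>"
proof -
  define S where "S = compose \<H> (hadj T) T"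
  have S: "S \<in> \<B>" using T by (auto simp: S_def)
  have Sq: "\<langle>S x, x\<rangle> = of_real (\<parallel>T x\<parallel>\<^sup>2)" if "x \<in> \<H>" for x
    using T that by (simp add: S_def adj_ip2 ip_self)
  obtain A where A: "positive_op H A" "\<And>x. x \<in> \<H> \<Longrightarrow> A (A x) = S x"
    "\<And>R x. \<lbrakk>R \<in> \<B>; \<And>x. x \<in> \<H> \<Longrightarrow> R (S x) = S (R x); x \<in> \<H>\<rbrakk> \<Longrightarrow> R (A x) = A (R x)"
    by (rule positive_sqrt[OF S]) (auto simp: Sq)
  have AB: "A \<in> \<B>" using A by (auto simp: positive_op_def)
  have "abs_op H T = A" unfolding abs_op_def S_def[symmetric]
  proof (rule the_equality)
    show "positive_op H A \<and> compose \<H> A A = S" using A(1,2) AB S by (auto intro!: op_ext)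
    fix B assume B0: "positive_op H B \<and> compose \<H> B B = S"
    then have B: "positive_op H B" "B \<in> \<B>" by (auto simp: positive_op_def)
    have BS: "B (B x) = S x" if "x \<in> \<H>" for x using B0 op_apps(4)[OF that, of B B] by simp
    have "B (A x) = A (B x)" if "x \<in> \<H>" for x
      by (rule A(3)) (use B that in \<open>auto simp: BS[symmetric]\<close>)
    then show "B = A" by (rule commuting_sqrt_unique[OF B(1) A(1)]) (simp_all add: BS A(2))
  qed
  moreover have "\<parallel>A x\<parallel> = \<parallel>T x\<parallel>" if x: "x \<in> \<H>" for x
  proof -
    have "\<langle>A x, A x\<rangle> = \<langle>S x, x\<rangle>"
      using real_quad_selfadj[OF AB, of "A x" x] A(1,2) AB x by (auto simp: positive_op_def)
    then have "\<parallel>A x\<parallel>\<^sup>2 = \<parallel>T x\<parallel>\<^sup>2" using x AB unfolding Sq[OF x] by (simp add: norm_sq)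
    then show ?thesis using x AB T by simp
  qed
  ultimately show "positive_op H (abs_op H T)" "\<And>x. x \<in> \<H> \<Longrightarrow> \<parallel>abs_op H T x\<parallel> = \<parallel>T x\<parallel>" using A(1) by auto
qed

text \<open>The map taking \<open>T x\<close> to \<open>R x\<close> is a well-defined contraction on
  the range of \<open>T\<close>, and \<open>S\<close> is its adjoint. Applied to an operator and its
  modulus, in either order, the lemma takes the place of the polar decomposition.\<close>

lemma douglas:
  assumes RT: "R \<in> \<B>" "T \<in> \<B>" and le: "\<And>x. x \<in> \<H> \<Longrightarrow> \<parallel>R x\<parallel> \<le> \<parallel>T x\<parallel>"
  obtains S where "S \<in> \<B>" "\<And>y. y \<in> \<H> \<Longrightarrow> \<parallel>S y\<parallel> \<le> \<parallel>y\<parallel>" "\<And>x y. x \<in> \<H> \<Longrightarrow> y \<in> \<H> \<Longrightarrow> \<langle>T x, S y\<rangle> = \<langle>R x, y\<rangle>"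
proof -
  define V where "V = T ` \<H>"
  \<comment> \<open>An arbitrary preimage under \<open>T\<close>; by \<open>wd\<close> the value of
    \<open>R\<close> there does not depend on which one is taken.\<close>
  define g where "g v = (SOME x. x \<in> \<H> \<and> T x = v)" for v
  have wd: "R x = R x'" if "x \<in> \<H>" "x' \<in> \<H>" "T x = T x'" for x x'
  proof -
    have "\<parallel>R x \<boxminus> R x'\<parallel> \<le> 0" using le[of "x \<boxminus> x'"] that RT by (simp add: opl)
    then have "\<parallel>R x \<boxminus> R x'\<parallel> = 0" using norm_ge_0[of "R x \<boxminus> R x'"] that RT by (simp add: order_antisym)
    then show ?thesis using that RT by (simp add: norm_eq_0 sub_eq_0)
  qed
  have "g (T x) \<in> \<H> \<and> T (g (T x)) = T x" if "x \<in> \<H>" for x unfolding g_def by (rule someI2[of _ x]) (use that in auto)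
  then have Rg: "R (g (T x)) = R x" if "x \<in> \<H>" for x using wd that by blast
  have V: "subsp V" unfolding subsp_def V_def
  proof (intro conjI ballI allI)
    show "T ` \<H> \<subseteq> \<H>" "\<zero>\<^sub>H \<in> T ` \<H>" using RT op_zero[OF RT(2)] by (auto intro!: image_eqI[of _ _ "\<zero>\<^sub>H"])
    fix a x y assume "x \<in> T ` \<H>" "y \<in> T ` \<H>"
    then obtain u v where "u \<in> \<H>" "v \<in> \<H>" "x = T u" "y = T v" by auto
    then show "x \<boxplus> y \<in> T ` \<H>" using RT by (auto simp: opl intro!: image_eqI[of _ _ "u \<boxplus> v"])
  next
    fix a x assume "x \<in> T ` \<H>"
    then obtain u where "u \<in> \<H>" "x = T u" by auto
    then show "a \<star> x \<in> T ` \<H>" using RT by (auto simp: opl intro!: image_eqI[of _ _ "a \<star> u"])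
  qed
  obtain S where S: "S \<in> \<B>" "\<And>y. y \<in> \<H> \<Longrightarrow> \<parallel>S y\<parallel> \<le> 1 * \<parallel>y\<parallel>" "\<And>x y. x \<in> V \<Longrightarrow> y \<in> \<H> \<Longrightarrow> \<langle>x, S y\<rangle> = \<langle>R (g x), y\<rangle>"
  proof (rule form_op[OF V, of "\<lambda>v y. \<langle>R (g v), y\<rangle>" 1])
    fix x y z assume "x \<in> V" "y \<in> V" "z \<in> \<H>"
    then obtain u v where uv: "u \<in> \<H>" "v \<in> \<H>" "x = T u" "y = T v" by (auto simp: V_def)
    then have "R (g (x \<boxplus> y)) = R (u \<boxplus> v)" using Rg[of "u \<boxplus> v"] RT by (simp add: opl)
    then show "\<langle>R (g (x \<boxplus> y)), z\<rangle> = \<langle>R (g x), z\<rangle> + \<langle>R (g y), z\<rangle>" using uv Rg RT \<open>z \<in> \<H>\<close> by (simp add: opl ips)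
  next
    fix a x z assume "x \<in> V" "z \<in> \<H>"
    then obtain u where uv: "u \<in> \<H>" "x = T u" by (auto simp: V_def)
    then have "R (g (a \<star> x)) = R (a \<star> u)" using Rg[of "a \<star> u"] RT by (simp add: opl)
    then show "\<langle>R (g (a \<star> x)), z\<rangle> = a * \<langle>R (g x), z\<rangle>" using uv Rg RT \<open>z \<in> \<H>\<close> by (simp add: opl ips)
  next
    fix x z assume "x \<in> V" and z: "z \<in> \<H>"
    then obtain u where uv: "u \<in> \<H>" "x = T u" by (auto simp: V_def)
    have "cmod \<langle>R u, z\<rangle> \<le> \<parallel>R u\<parallel> * \<parallel>z\<parallel>" by (rule cauchy_schwarz) (use uv RT z in auto)
    also have "\<dots> \<le> \<parallel>x\<parallel> * \<parallel>z\<parallel>" using le[OF uv(1)] uv z by (simp add: mult_right_mono)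
    finally show "cmod \<langle>R (g x), z\<rangle> \<le> 1 * \<parallel>x\<parallel> * \<parallel>z\<parallel>" using uv Rg by simp
  qed (use that Rg RT in \<open>auto simp: V_def ips\<close>)
  show thesis by (rule that[OF S(1)]) (use S Rg in \<open>auto simp: V_def\<close>)
qed

end

lemma has_sum_finite_sum:
  fixes f :: "'i \<Rightarrow> 'a \<Rightarrow> 'b :: topological_comm_monoid_add"
  assumes "finite I" "\<And>i. i \<in> I \<Longrightarrow> (f i has_sum s i) A"
  shows "((\<lambda>x. \<Sum>i\<in>I. f i x) has_sum (\<Sum>i\<in>I. s i)) A"
  using assms by (induction I rule: finite_induct) (auto intro!: has_sum_add has_sum_0)

subsection \<open>The trace norm\<close>

context complex_hilbert begin

text \<open>This bound passes to weak limits and, by the polar decomposition, controls the trace norm.\<close>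

definition trace_bound :: "('v \<Rightarrow> 'v) \<Rightarrow> real \<Rightarrow> bool" where
  "trace_bound T c \<longleftrightarrow> (\<forall>F S. finite F \<longrightarrow> F \<subseteq> sb \<longrightarrow> S \<in> \<B> \<longrightarrow> (\<forall>y\<in>\<H>. \<parallel>S y\<parallel> \<le> \<parallel>y\<parallel>) \<longrightarrow>
     cmod (\<Sum>e\<in>F. \<langle>T e, S e\<rangle>) \<le> c)"

text \<open>Testing with the contraction \<open>S\<close> for which
  \<open>\<langle>T x, S y\<rangle> = \<langle>A x, y\<rangle>\<close>, with \<open>A\<close> the
  modulus of \<open>T\<close>, turns the tested sums into partial sums of the trace of
  \<open>A\<close>.\<close>

lemma trace_bound_trace_norm:
  assumes T: "T \<in> \<B>" and b: "trace_bound T c"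
  shows "trace_norm H T \<le> ennreal c"
proof -
  define A where "A = abs_op H T"
  have A: "A \<in> \<B>" "\<And>x. x \<in> \<H> \<Longrightarrow> 0 \<le> Re \<langle>A x, x\<rangle>" "\<And>x. x \<in> \<H> \<Longrightarrow> \<parallel>A x\<parallel> \<le> \<parallel>T x\<parallel>"
    using abs_op[OF T] by (auto simp: A_def positive_op_def)
  obtain S where S: "S \<in> \<B>" "\<And>y. y \<in> \<H> \<Longrightarrow> \<parallel>S y\<parallel> \<le> \<parallel>y\<parallel>" "\<And>x y. x \<in> \<H> \<Longrightarrow> y \<in> \<H> \<Longrightarrow> \<langle>T x, S y\<rangle> = \<langle>A x, y\<rangle>"
    using douglas[OF A(1) T A(3)] by metis
  show ?thesis unfolding trace_norm_def A_def[symmetric]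
  proof (rule infsum_le_finite_sums)
    show "(\<lambda>e. ennreal (Re \<langle>A e, e\<rangle>)) summable_on sb" by (rule nonneg_summable_on_complete) simp
    fix F assume F: "finite F" "F \<subseteq> sb"
    then have FH: "e \<in> \<H>" if "e \<in> F" for e using that by auto
    have "(\<Sum>e\<in>F. Re \<langle>A e, e\<rangle>) = Re (\<Sum>e\<in>F. \<langle>T e, S e\<rangle>)" using FH by (simp add: S(3))
    also have "\<dots> \<le> cmod (\<Sum>e\<in>F. \<langle>T e, S e\<rangle>)" by (rule complex_Re_le_cmod)
    also have "\<dots> \<le> c" using b S F unfolding trace_bound_def by blast
    finally show "(\<Sum>e\<in>F. ennreal (Re \<langle>A e, e\<rangle>)) \<le> ennreal c"
      using FH A(2) by (subst sum_ennreal) (auto intro: ennreal_leI)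
  qed
qed

lemma trace_finite_sum:
  assumes T: "T \<in> \<B>" and tr: "trace_norm H T \<le> ennreal c" and c: "c \<ge> 0" and F: "finite F" "F \<subseteq> sb"
  shows "(\<Sum>e\<in>F. Re \<langle>abs_op H T e, e\<rangle>) \<le> c"
proof -
  have p: "0 \<le> Re \<langle>abs_op H T e, e\<rangle>" if "e \<in> F" for e
    using abs_op(1)[OF T] that F by (auto simp: positive_op_def)
  have "(\<Sum>e\<in>F. ennreal (Re \<langle>abs_op H T e, e\<rangle>)) \<le> trace_norm H T" unfolding trace_norm_def
    unfolding infsum_finite[OF F(1), symmetric]
    by (rule infsum_mono_neutral) (use F in \<open>auto intro: nonneg_summable_on_complete\<close>)
  then have "ennreal (\<Sum>e\<in>F. Re \<langle>abs_op H T e, e\<rangle>) \<le> ennreal c" using tr p by (simp add: sum_ennreal)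
  then show ?thesis using c by (simp add: ennreal_le_iff)
qed

text \<open>For the modulus \<open>A\<close> one has \<open>\<parallel>T e\<parallel>\<^sup>2 =
  \<parallel>A e\<parallel>\<^sup>2\<close>, which is at most a constant times
  \<open>\<langle>A e, e\<rangle>\<close>. This places the trace class inside the Hilbert-Schmidt
  class, where double operator integrals are defined.\<close>

lemma trace_class_square_summable:
  assumes T: "T \<in> \<B>" and tr: "trace_norm H T \<le> ennreal c" and c: "c \<ge> 0"
  shows "(\<lambda>e. \<parallel>T e\<parallel>\<^sup>2) summable_on sb"
proof -
  define A where "A = abs_op H T"
  have A: "A \<in> \<B>" "\<And>x. x \<in> \<H> \<Longrightarrow> Im \<langle>A x, x\<rangle> = 0" "\<And>x. x \<in> \<H> \<Longrightarrow> 0 \<le> Re \<langle>A x, x\<rangle>" "\<And>x. x \<in> \<H> \<Longrightarrow> \<parallel>A x\<parallel> = \<parallel>T x\<parallel>"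
    using abs_op[OF T] by (auto simp: A_def positive_op_def)
  obtain k where k: "k > 0" "\<And>x. x \<in> \<H> \<Longrightarrow> \<parallel>A x\<parallel> \<le> k * \<parallel>x\<parallel>" using op_bound[OF A(1)] by blast
  have Ale: "Re \<langle>A x, x\<rangle> \<le> k * \<parallel>x\<parallel>\<^sup>2" if x: "x \<in> \<H>" for x
  proof -
    have "Re \<langle>A x, x\<rangle> \<le> cmod \<langle>A x, x\<rangle>" by (rule complex_Re_le_cmod)
    also have "\<dots> \<le> \<parallel>A x\<parallel> * \<parallel>x\<parallel>" by (rule cauchy_schwarz) (use A x in auto)
    also have "\<dots> \<le> (k * \<parallel>x\<parallel>) * \<parallel>x\<parallel>" by (rule mult_right_mono[OF k(2)]) (use x in auto)
    finally show ?thesis by (simp add: power2_eq_square mult.assoc)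
  qed
  show ?thesis
  proof (rule nonneg_bdd_above_summable_on)
    show "bdd_above (sum (\<lambda>e. \<parallel>T e\<parallel>\<^sup>2) ` {F. F \<subseteq> sb \<and> finite F})"
    proof (rule bdd_aboveI2)
      fix F assume F: "F \<in> {F. F \<subseteq> sb \<and> finite F}"
      have "(\<Sum>e\<in>F. \<parallel>T e\<parallel>\<^sup>2) \<le> (\<Sum>e\<in>F. k * Re \<langle>A e, e\<rangle>)"
      proof (rule sum_mono)
        fix e assume "e \<in> F"
        then have e: "e \<in> \<H>" using F by auto
        show "\<parallel>T e\<parallel>\<^sup>2 \<le> k * Re \<langle>A e, e\<rangle>" using positive_contraction[OF A(1-3) Ale k(1) e] A(4)[OF e] by simp
      qed
      also have "\<dots> = k * (\<Sum>e\<in>F. Re \<langle>A e, e\<rangle>)" by (simp add: sum_distrib_left)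
      also have "\<dots> \<le> k * c" using trace_finite_sum[OF T tr c, of F] F k(1) by (simp add: A_def mult_left_mono)
      finally show "(\<Sum>e\<in>F. \<parallel>T e\<parallel>\<^sup>2) \<le> k * c" .
    qed
  qed auto
qed

text \<open>Writing \<open>T = U A\<close> with \<open>A = \<bar>T\<bar>\<close> and \<open>R = A\<^sup>1\<^sup>/\<^sup>2\<close>, the vectors are \<open>U R e\<close> and \<open>R e\<close>.\<close>

lemma trace_class_rep:
  assumes T: "T \<in> \<B>" and tr: "trace_norm H T \<le> ennreal c" and c: "c \<ge> 0"
  obtains \<xi> \<eta> where "\<And>e. e \<in> sb \<Longrightarrow> \<xi> e \<in> \<H>" "\<And>e. e \<in> sb \<Longrightarrow> \<eta> e \<in> \<H>"
    "\<And>F. \<lbrakk>finite F; F \<subseteq> sb\<rbrakk> \<Longrightarrow> (\<Sum>e\<in>F. \<parallel>\<xi> e\<parallel>\<^sup>2) \<le> c"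
    "\<And>F. \<lbrakk>finite F; F \<subseteq> sb\<rbrakk> \<Longrightarrow> (\<Sum>e\<in>F. \<parallel>\<eta> e\<parallel>\<^sup>2) \<le> c"
    "\<And>x y. \<lbrakk>x \<in> \<H>; y \<in> \<H>\<rbrakk> \<Longrightarrow> ((\<lambda>e. \<langle>x, \<eta> e\<rangle> * \<langle>\<xi> e, y\<rangle>) has_sum \<langle>T x, y\<rangle>) sb"
proof -
  define A where "A = abs_op H T"
  have A: "A \<in> \<B>" "\<And>x. x \<in> \<H> \<Longrightarrow> Im \<langle>A x, x\<rangle> = 0" "\<And>x. x \<in> \<H> \<Longrightarrow> 0 \<le> Re \<langle>A x, x\<rangle>" "\<And>x. x \<in> \<H> \<Longrightarrow> \<parallel>T x\<parallel> \<le> \<parallel>A x\<parallel>"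
    using abs_op[OF T] by (auto simp: A_def positive_op_def)
  obtain S where S: "S \<in> \<B>" "\<And>y. y \<in> \<H> \<Longrightarrow> \<parallel>S y\<parallel> \<le> \<parallel>y\<parallel>" "\<And>x y. x \<in> \<H> \<Longrightarrow> y \<in> \<H> \<Longrightarrow> \<langle>A x, S y\<rangle> = \<langle>T x, y\<rangle>"
    using douglas[OF T A(1) A(4)] by metis
  obtain R where R: "positive_op H R" "\<And>x. x \<in> \<H> \<Longrightarrow> R (R x) = A x"
    using positive_sqrt[OF A(1-3)] by metis
  have RB: "R \<in> \<B>" and Rsa: "\<And>x y. x \<in> \<H> \<Longrightarrow> y \<in> \<H> \<Longrightarrow> \<langle>R x, y\<rangle> = \<langle>x, R y\<rangle>"
    using R(1) real_quad_selfadj[of R] by (auto simp: positive_op_def)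
  have Rn: "\<parallel>R e\<parallel>\<^sup>2 = Re \<langle>A e, e\<rangle>" if "e \<in> \<H>" for e
    using Rsa[of "R e" e] R(2)[OF that] that RB by (simp add: norm_sq)
  have eta: "(\<Sum>e\<in>F. \<parallel>R e\<parallel>\<^sup>2) \<le> c" if F: "finite F" "F \<subseteq> sb" for F
    using trace_finite_sum[OF T tr c F] F(2) Rn unfolding A_def[symmetric] by (simp add: subset_iff)
  have xin: "\<parallel>hadj S (R e)\<parallel>\<^sup>2 \<le> \<parallel>R e\<parallel>\<^sup>2" if "e \<in> \<H>" for e
    using adj_bound[OF S(1), of 1 "R e"] S(2) that RB by (simp add: power_mono S(1))
  show thesis
  proof (rule that[of "\<lambda>e. hadj S (R e)" "\<lambda>e. R e"])
    fix F assume F: "finite F" "F \<subseteq> sb"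
    have "(\<Sum>e\<in>F. \<parallel>hadj S (R e)\<parallel>\<^sup>2) \<le> (\<Sum>e\<in>F. \<parallel>R e\<parallel>\<^sup>2)" by (rule sum_mono) (use F xin in auto)
    then show "(\<Sum>e\<in>F. \<parallel>hadj S (R e)\<parallel>\<^sup>2) \<le> c" using eta[OF F] by simp
    show "(\<Sum>e\<in>F. \<parallel>R e\<parallel>\<^sup>2) \<le> c" by (rule eta[OF F])
  next
    fix x y assume xy: "x \<in> \<H>" "y \<in> \<H>"
    have "((\<lambda>e. \<langle>R x, e\<rangle> * \<langle>e, R (S y)\<rangle>) has_sum \<langle>R x, R (S y)\<rangle>) sb"
      by (rule parseval_ip[OF sb]) (use xy RB S in auto)
    moreover have "\<langle>R x, R (S y)\<rangle> = \<langle>T x, y\<rangle>" using Rsa[of "R x" "S y"] xy RB S R(2) by simp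
    moreover have "\<langle>R x, e\<rangle> * \<langle>e, R (S y)\<rangle> = \<langle>x, R e\<rangle> * \<langle>hadj S (R e), y\<rangle>" if "e \<in> sb" for e
      using Rsa[of x e] Rsa[of e "S y"] that xy RB S by (simp add: adj_ip2)
    ultimately show "((\<lambda>e. \<langle>x, R e\<rangle> * \<langle>hadj S (R e), y\<rangle>) has_sum \<langle>T x, y\<rangle>) sb"
      by (smt (verit) has_sum_cong)
  qed (use RB S in auto)
qed

lemma trace_bound_limit:
  assumes T: "\<And>n. trace_bound (T n) c" and lim: "\<And>x y. x \<in> \<H> \<Longrightarrow> y \<in> \<H> \<Longrightarrow> (\<lambda>n. \<langle>T n x, y\<rangle>) \<longlonglongrightarrow> \<langle>S x, y\<rangle>"
  shows "trace_bound S c"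
  unfolding trace_bound_def
proof (intro allI impI)
  fix F W assume F: "finite F" "F \<subseteq> sb" and W: "W \<in> \<B>" "\<forall>y\<in>\<H>. \<parallel>W y\<parallel> \<le> \<parallel>y\<parallel>"
  have "(\<lambda>n. cmod (\<Sum>e\<in>F. \<langle>T n e, W e\<rangle>)) \<longlonglongrightarrow> cmod (\<Sum>e\<in>F. \<langle>S e, W e\<rangle>)"
    by (intro tendsto_norm tendsto_sum lim) (use F W in auto)
  then show "cmod (\<Sum>e\<in>F. \<langle>S e, W e\<rangle>) \<le> c"
    by (rule LIMSEQ_le_const2) (use T F W in \<open>auto simp: trace_bound_def\<close>)
qed

subsection \<open>The Hilbert-Schmidt class\<close>

abbreviation hsc ("\<HH>") where "\<HH> \<equiv> hilbert_schmidt H"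

lemma hs_simps:
  "carrier \<HH> = {T \<in> \<B>. (\<lambda>e. \<parallel>T e\<parallel>\<^sup>2) summable_on sb}" "zero \<HH> = (\<lambda>x\<in>\<H>. \<zero>\<^sub>H)"
  "add \<HH> S T = opadd S T" "smult \<HH> a T = opsc a T" "ip \<HH> S T = (\<Sum>\<^sub>\<infinity>e\<in>sb. \<langle>S e, T e\<rangle>)"
  by (auto simp: hilbert_schmidt_def opadd_def opsc_def)

lemma hsD: "T \<in> carrier \<HH> \<Longrightarrow> T \<in> \<B>" "T \<in> carrier \<HH> \<Longrightarrow> (\<lambda>e. \<parallel>T e\<parallel>\<^sup>2) summable_on sb"
  by (auto simp: hs_simps)

lemma hsI: assumes "T \<in> \<B>" "\<And>F. finite F \<Longrightarrow> F \<subseteq> sb \<Longrightarrow> (\<Sum>e\<in>F. \<parallel>T e\<parallel>\<^sup>2) \<le> c"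
  shows "T \<in> carrier \<HH>" "(\<Sum>\<^sub>\<infinity>e\<in>sb. \<parallel>T e\<parallel>\<^sup>2) \<le> c"
proof -
  have s: "(\<lambda>e. \<parallel>T e\<parallel>\<^sup>2) summable_on sb"
    by (rule nonneg_bdd_above_summable_on) (use assms in \<open>auto intro!: bdd_aboveI2[of _ _ c]\<close>)
  then show "T \<in> carrier \<HH>" using assms by (simp add: hs_simps)
  show "(\<Sum>\<^sub>\<infinity>e\<in>sb. \<parallel>T e\<parallel>\<^sup>2) \<le> c" by (rule infsum_le_finite_sums[OF s]) (use assms in auto)
qed

lemma hs_finite_le: "\<lbrakk>T \<in> carrier \<HH>; finite F; F \<subseteq> sb\<rbrakk> \<Longrightarrow> (\<Sum>e\<in>F. \<parallel>T e\<parallel>\<^sup>2) \<le> (\<Sum>\<^sub>\<infinity>e\<in>sb. \<parallel>T e\<parallel>\<^sup>2)"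
  by (rule finite_sum_le_infsum) (auto dest: hsD)

text \<open>Both sides are sums of \<open>(cmod \<langle>T e, g\<rangle>)\<^sup>2\<close> over pairs
  of basis vectors. An inequality is enough at first, because applying it to the adjoint gives the
  reverse one.\<close>

lemma hs_adj_aux:
  assumes T: "T \<in> carrier \<HH>"
  shows "hadj T \<in> carrier \<HH> \<and> (\<Sum>\<^sub>\<infinity>e\<in>sb. \<parallel>hadj T e\<parallel>\<^sup>2) \<le> (\<Sum>\<^sub>\<infinity>e\<in>sb. \<parallel>T e\<parallel>\<^sup>2)"
proof -
  note TB = hsD(1)[OF T]
  have "(\<Sum>g\<in>G. \<parallel>hadj T g\<parallel>\<^sup>2) \<le> (\<Sum>\<^sub>\<infinity>e\<in>sb. \<parallel>T e\<parallel>\<^sup>2)" if G: "finite G" "G \<subseteq> sb" for G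
  proof -
    have "((\<lambda>e. \<Sum>g\<in>G. (cmod \<langle>hadj T g, e\<rangle>)\<^sup>2) has_sum (\<Sum>g\<in>G. \<parallel>hadj T g\<parallel>\<^sup>2)) sb"
      by (rule has_sum_finite_sum) (use G TB in \<open>auto intro!: parseval[OF sb]\<close>)
    then show ?thesis
    proof (rule has_sum_mono[OF _ has_sum_infsum[OF hsD(2)[OF T]]])
      fix e assume e: "e \<in> sb"
      have "cmod \<langle>hadj T g, e\<rangle> = cmod \<langle>T e, g\<rangle>" if "g \<in> G" for g
        using ip_commute[of "T e" g] e that G TB by (auto simp: adj_ip2)
      then have "(\<Sum>g\<in>G. (cmod \<langle>hadj T g, e\<rangle>)\<^sup>2) = (\<Sum>g\<in>G. (cmod \<langle>T e, g\<rangle>)\<^sup>2)" by simp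
      also have "\<dots> \<le> \<parallel>T e\<parallel>\<^sup>2" by (rule bessel) (use G e TB onset_subset[OF sb_on] in auto)
      finally show "(\<Sum>g\<in>G. (cmod \<langle>hadj T g, e\<rangle>)\<^sup>2) \<le> \<parallel>T e\<parallel>\<^sup>2" .
    qed
  qed
  then show ?thesis using hsI[of "hadj T"] TB by auto
qed

lemma hs_adj: assumes T: "T \<in> carrier \<HH>"
  shows "hadj T \<in> carrier \<HH>" "(\<Sum>\<^sub>\<infinity>e\<in>sb. \<parallel>hadj T e\<parallel>\<^sup>2) = (\<Sum>\<^sub>\<infinity>e\<in>sb. \<parallel>T e\<parallel>\<^sup>2)"
  using hs_adj_aux[OF T] hs_adj_aux[of "hadj T"] hsD(1)[OF T] by auto

text \<open>Parseval for \<open>T x\<close>, each coordinate being the inner product of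
  \<open>x\<close> with \<open>hadj T e\<close> up to conjugation, and then Cauchy-Schwarz term by
  term.\<close>

lemma hs_op_bound:
  assumes T: "T \<in> carrier \<HH>" and x: "x \<in> \<H>"
  shows "\<parallel>T x\<parallel>\<^sup>2 \<le> (\<Sum>\<^sub>\<infinity>e\<in>sb. \<parallel>T e\<parallel>\<^sup>2) * \<parallel>x\<parallel>\<^sup>2"
proof -
  note TB = hsD(1)[OF T]
  have hT: "((\<lambda>e. \<parallel>hadj T e\<parallel>\<^sup>2 * \<parallel>x\<parallel>\<^sup>2) has_sum (\<Sum>\<^sub>\<infinity>e\<in>sb. \<parallel>T e\<parallel>\<^sup>2) * \<parallel>x\<parallel>\<^sup>2) sb"
    unfolding hs_adj(2)[OF T, symmetric]
    by (rule has_sum_cmult_left[OF has_sum_infsum[OF hsD(2)[OF hs_adj(1)[OF T]]]])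
  show ?thesis
  proof (rule has_sum_mono[OF parseval[OF sb, of "T x"] hT])
    fix e assume e: "e \<in> sb"
    have "cmod \<langle>T x, e\<rangle> = cmod \<langle>hadj T e, x\<rangle>" using ip_commute[of "T x" e] e x TB by (simp add: adj_ip2)
    also have "\<dots> \<le> \<parallel>hadj T e\<parallel> * \<parallel>x\<parallel>" by (rule cauchy_schwarz) (use e x TB in auto)
    finally show "(cmod \<langle>T x, e\<rangle>)\<^sup>2 \<le> \<parallel>hadj T e\<parallel>\<^sup>2 * \<parallel>x\<parallel>\<^sup>2" by (simp add: power_mono flip: power_mult_distrib)
  qed (use x TB in auto)
qed

lemma hs_add: assumes "S \<in> carrier \<HH>" "T \<in> carrier \<HH>" shows "opadd S T \<in> carrier \<HH>"
proof -
  note B = assms[THEN hsD(1)]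
  have "(\<lambda>e. 2 * \<parallel>S e\<parallel>\<^sup>2 + 2 * \<parallel>T e\<parallel>\<^sup>2) summable_on sb"
    by (intro summable_on_add summable_on_cmult_right hsD assms)
  then have "(\<lambda>e. \<parallel>opadd S T e\<parallel>\<^sup>2) summable_on sb"
  proof (rule summable_on_comparison_test)
    fix e assume "e \<in> sb"
    then have e: "S e \<in> \<H>" "T e \<in> \<H>" "e \<in> \<H>" using B by auto
    show "\<parallel>opadd S T e\<parallel>\<^sup>2 \<le> 2 * \<parallel>S e\<parallel>\<^sup>2 + 2 * \<parallel>T e\<parallel>\<^sup>2"
      unfolding op_apps(1)[OF e(3)] using parallelogram[OF e(1,2)] by (smt (verit) zero_le_power2)
  qed auto
  then show ?thesis using B by (auto simp: hs_simps)
qed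

lemma hs_comp_left: assumes "P \<in> \<B>" "T \<in> carrier \<HH>" shows "compose \<H> P T \<in> carrier \<HH>"
proof -
  note B = assms(2)[THEN hsD(1)]
  obtain c where c: "c > 0" "\<And>x. x \<in> \<H> \<Longrightarrow> \<parallel>P x\<parallel> \<le> c * \<parallel>x\<parallel>" using op_bound[OF assms(1)] by blast
  have "(\<lambda>e. c\<^sup>2 * \<parallel>T e\<parallel>\<^sup>2) summable_on sb" by (intro summable_on_cmult_right hsD assms)
  then have "(\<lambda>e. \<parallel>compose \<H> P T e\<parallel>\<^sup>2) summable_on sb"
  proof (rule summable_on_comparison_test)
    fix e assume "e \<in> sb"
    then have e: "T e \<in> \<H>" "e \<in> \<H>" using B by auto
    show "\<parallel>compose \<H> P T e\<parallel>\<^sup>2 \<le> c\<^sup>2 * \<parallel>T e\<parallel>\<^sup>2"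
      using c(2)[OF e(1)] e assms by (simp add: power_mono flip: power_mult_distrib)
  qed auto
  then show ?thesis using B assms by (auto simp: hs_simps)
qed

lemma hs_scale: assumes "T \<in> carrier \<HH>" shows "opsc a T \<in> carrier \<HH>"
proof -
  have "opsc a T = compose \<H> (opsc a opid) T"
    by (rule op_ext) (use hsD[OF assms] in auto)
  then show ?thesis using hs_comp_left[OF _ assms, of "opsc a opid"] by auto
qed

lemma adj_comp: "\<lbrakk>S \<in> \<B>; T \<in> \<B>\<rbrakk> \<Longrightarrow> hadj (compose \<H> S T) = compose \<H> (hadj T) (hadj S)"
  by (rule adjI) (auto simp: adj_ip)

lemma hs_comp_right: assumes "P \<in> \<B>" "T \<in> carrier \<HH>" shows "compose \<H> T P \<in> carrier \<HH>"
proof -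
  note B = assms(2)[THEN hsD(1)]
  have "compose \<H> T P = hadj (compose \<H> (hadj P) (hadj T))" using B assms by (simp add: adj_comp)
  then show ?thesis using hs_adj(1)[OF hs_comp_left[OF adj_closed[OF assms(1)] hs_adj(1)[OF assms(2)]]] by simp
qed

lemma zero_op: "(\<lambda>x\<in>\<H>. \<zero>\<^sub>H) \<in> \<B>"
  by (rule opI[where c=0]) (auto simp: smult_r_null[of a for a, simplified])

end

context complex_hilbert begin

lemma hs_zero: "(\<lambda>x\<in>\<H>. \<zero>\<^sub>H) \<in> carrier \<HH>"
  by (rule hsI(1)[OF zero_op, where c=0]) (auto simp: subset_iff intro!: sum_nonpos)

lemma neg_add: "x \<in> \<H> \<Longrightarrow> (-1) \<star> x \<boxplus> x = \<zero>\<^sub>H"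
  using M.l_neg[of x] by (simp add: uminus_eq)

lemma hs_module: "module complex_ring \<HH>"
proof (rule moduleI[OF cring_complex_ring])
  have z: "opadd (\<lambda>x\<in>\<H>. \<zero>\<^sub>H) T = T" if "T \<in> carrier \<HH>" for T
    by (rule op_ext) (use hsD[OF that] zero_op in auto)
  show "abelian_group \<HH>"
  proof (rule abelian_groupI)
    fix S assume S: "S \<in> carrier \<HH>"
    have "opadd (opsc (-1) S) S = (\<lambda>x\<in>\<H>. \<zero>\<^sub>H)"
      by (rule op_ext) (use hsD(1)[OF S] zero_op in \<open>auto simp: neg_add\<close>)
    then show "\<exists>T\<in>carrier \<HH>. add \<HH> T S = zero \<HH>"
      using hs_scale[OF S, of "-1"] by (intro bexI[of _ "opsc (-1) S"]) (auto simp: hs_simps(2,3))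
  qed (auto simp: hs_simps(2,3) hs_add hs_zero z hsD(1) intro!: op_ext M.a_assoc M.a_comm)
qed (auto simp: hs_simps(3,4) hs_scale hsD(1) intro!: op_ext smult_l_distr[of a b for a b, simplified] smult_r_distr[of a for a, simplified])

lemma hs_sub: assumes "S \<in> carrier \<HH>" "T \<in> carrier \<HH>"
  shows "S \<ominus>\<^bsub>\<HH>\<^esub> T = opadd S (opsc (-1) T)"
proof -
  interpret HS: module complex_ring \<HH> by (rule hs_module)
  have "opadd (opsc (-1) T) T = (\<lambda>x\<in>\<H>. \<zero>\<^sub>H)"
    by (rule op_ext) (use hsD(1)[OF assms(2)] zero_op in \<open>auto simp: neg_add\<close>)
  then have "\<ominus>\<^bsub>\<HH>\<^esub> T = opsc (-1) T"
    by (intro HS.M.minus_equality) (auto simp: hs_simps(2,3) hs_scale assms)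
  then show ?thesis by (simp add: a_minus_def hs_simps(3))
qed

lemma hs_sub_app: "\<lbrakk>S \<in> carrier \<HH>; T \<in> carrier \<HH>; x \<in> \<H>\<rbrakk> \<Longrightarrow> (S \<ominus>\<^bsub>\<HH>\<^esub> T) x = S x \<boxminus> T x"
  using hsD(1)[of S] hsD(1)[of T] by (simp add: hs_sub sub_eq)

lemma hs_ip_has_sum: assumes "S \<in> carrier \<HH>" "T \<in> carrier \<HH>"
  shows "((\<lambda>e. \<langle>S e, T e\<rangle>) has_sum ip \<HH> S T) sb"
proof -
  note B = assms[THEN hsD(1)]
  have "(\<lambda>e. \<parallel>S e\<parallel>\<^sup>2 + \<parallel>T e\<parallel>\<^sup>2) summable_on sb" by (intro summable_on_add hsD assms)
  then have "(\<lambda>e. norm \<langle>S e, T e\<rangle>) summable_on sb"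
  proof (rule summable_on_comparison_test)
    fix e assume "e \<in> sb"
    then have e: "S e \<in> \<H>" "T e \<in> \<H>" using B by auto
    have "2 * (\<parallel>S e\<parallel> * \<parallel>T e\<parallel>) \<le> \<parallel>S e\<parallel>\<^sup>2 + \<parallel>T e\<parallel>\<^sup>2"
      using zero_le_power2[of "\<parallel>S e\<parallel> - \<parallel>T e\<parallel>"] by (simp add: power2_diff)
    then show "norm \<langle>S e, T e\<rangle> \<le> \<parallel>S e\<parallel>\<^sup>2 + \<parallel>T e\<parallel>\<^sup>2"
      using cauchy_schwarz[OF e] zero_le_power2[of "\<parallel>S e\<parallel>"] zero_le_power2[of "\<parallel>T e\<parallel>"] by linarith
  qed auto
  then show ?thesis unfolding hs_simps(5) by (rule has_sum_infsum[OF abs_summable_summable])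
qed

lemma hs_norm: assumes "T \<in> carrier \<HH>" shows "hnorm \<HH> T = sqrt (\<Sum>\<^sub>\<infinity>e\<in>sb. \<parallel>T e\<parallel>\<^sup>2)"
proof -
  have "((\<lambda>e. Re \<langle>T e, T e\<rangle>) has_sum Re (ip \<HH> T T)) sb" by (rule has_sum_Re[OF hs_ip_has_sum[OF assms assms]])
  moreover have "Re \<langle>T e, T e\<rangle> = \<parallel>T e\<parallel>\<^sup>2" if "e \<in> sb" for e using that hsD[OF assms] by (auto simp: norm_sq)
  ultimately have "((\<lambda>e. \<parallel>T e\<parallel>\<^sup>2) has_sum Re (ip \<HH> T T)) sb" by (simp cong: has_sum_cong)
  then show ?thesis by (simp add: hnorm_def infsumI)
qed

lemma hs_norm_sq: "T \<in> carrier \<HH> \<Longrightarrow> (hnorm \<HH> T)\<^sup>2 = (\<Sum>\<^sub>\<infinity>e\<in>sb. \<parallel>T e\<parallel>\<^sup>2)"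
  by (simp add: hs_norm infsum_nonneg)

text \<open>A Cauchy sequence converges pointwise because the Hilbert-Schmidt norm dominates the
  operator norm. Its tail estimates pass to the limit on finite sets of basis vectors, which yields
  both membership of the limit and convergence in norm.\<close>

lemma hs_complete:
  assumes X: "\<And>n. X n \<in> carrier \<HH>"
    and cauchy: "\<And>e. e > 0 \<Longrightarrow> \<exists>N. \<forall>m\<ge>N. \<forall>n\<ge>N. hnorm \<HH> (X m \<ominus>\<^bsub>\<HH>\<^esub> X n) < e"
  shows "\<exists>T\<in>carrier \<HH>. (\<lambda>n. hnorm \<HH> (X n \<ominus>\<^bsub>\<HH>\<^esub> T)) \<longlonglongrightarrow> 0"
proof -
  interpret HS: module complex_ring \<HH> by (rule hs_module)
  note XB = X[THEN hsD(1)]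
  have dc: "X m \<ominus>\<^bsub>\<HH>\<^esub> X n \<in> carrier \<HH>" for m n using X by simp
  have bd: "\<parallel>X m x \<boxminus> X n x\<parallel> \<le> hnorm \<HH> (X m \<ominus>\<^bsub>\<HH>\<^esub> X n) * \<parallel>x\<parallel>" if x: "x \<in> \<H>" for m n x
  proof (rule power2_le_imp_le)
    show "(\<parallel>X m x \<boxminus> X n x\<parallel>)\<^sup>2 \<le> (hnorm \<HH> (X m \<ominus>\<^bsub>\<HH>\<^esub> X n) * \<parallel>x\<parallel>)\<^sup>2"
      using hs_op_bound[OF dc x, of m n] X x by (simp add: power_mult_distrib hs_norm_sq[OF dc] hs_sub_app)
  qed (use x in \<open>simp add: hs_norm[OF dc] infsum_nonneg\<close>)
  have "\<exists>l\<in>\<H>. hlim (\<lambda>n. X n x) l" if x: "x \<in> \<H>" for x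
    unfolding hlim_def
  proof (rule complete)
    fix e :: real assume e: "e > 0"
    obtain N where N: "\<And>m n. m \<ge> N \<Longrightarrow> n \<ge> N \<Longrightarrow> hnorm \<HH> (X m \<ominus>\<^bsub>\<HH>\<^esub> X n) < e / (1 + \<parallel>x\<parallel>)"
      using cauchy[of "e / (1 + \<parallel>x\<parallel>)"] e x by (auto simp: add_pos_nonneg)
    have "\<parallel>X m x \<boxminus> X n x\<parallel> < e" if "m \<ge> N" "n \<ge> N" for m n
    proof -
      have "\<parallel>X m x \<boxminus> X n x\<parallel> \<le> hnorm \<HH> (X m \<ominus>\<^bsub>\<HH>\<^esub> X n) * \<parallel>x\<parallel>" by (rule bd[OF x])
      also have "\<dots> \<le> hnorm \<HH> (X m \<ominus>\<^bsub>\<HH>\<^esub> X n) * (1 + \<parallel>x\<parallel>)" by (rule mult_left_mono) (auto simp: hs_norm[OF dc] infsum_nonneg)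
      also have "\<dots> < e" using N[OF that] x by (simp add: pos_less_divide_eq add_pos_nonneg)
      finally show ?thesis .
    qed
    then show "\<exists>N. \<forall>m\<ge>N. \<forall>n\<ge>N. \<parallel>X m x \<boxminus> X n x\<parallel> < e" by blast
  qed (use x XB in auto)
  then obtain L where L: "\<And>x. x \<in> \<H> \<Longrightarrow> L x \<in> \<H>" "\<And>x. x \<in> \<H> \<Longrightarrow> hlim (\<lambda>n. X n x) (L x)" by metis
  have ips_lim: "(\<lambda>n. \<langle>X n x, z\<rangle>) \<longlonglongrightarrow> \<langle>L x, z\<rangle>" if "x \<in> \<H>" "z \<in> \<H>" for x z
    by (rule hlim_ip[OF L(2)]) (use that L XB in auto)
  have Ladd: "L (x \<boxplus> y) = L x \<boxplus> L y" if "x \<in> \<H>" "y \<in> \<H>" for x y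
  proof (rule vec_eqI)
    fix z assume z: "z \<in> \<H>"
    have "(\<lambda>n. \<langle>X n x, z\<rangle> + \<langle>X n y, z\<rangle>) \<longlonglongrightarrow> \<langle>L x, z\<rangle> + \<langle>L y, z\<rangle>" by (intro tendsto_add ips_lim that z)
    then show "\<langle>L (x \<boxplus> y), z\<rangle> = \<langle>L x \<boxplus> L y, z\<rangle>"
      using ips_lim[of "x \<boxplus> y" z] that z XB L by (simp add: opl ips LIMSEQ_unique)
  qed (use that L in auto)
  have Lsc: "L (a \<star> x) = a \<star> L x" if "x \<in> \<H>" for a x
  proof (rule vec_eqI)
    fix z assume z: "z \<in> \<H>"
    have "(\<lambda>n. a * \<langle>X n x, z\<rangle>) \<longlonglongrightarrow> a * \<langle>L x, z\<rangle>" by (intro tendsto_mult tendsto_const ips_lim that z)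
    then show "\<langle>L (a \<star> x), z\<rangle> = \<langle>a \<star> L x, z\<rangle>"
      using ips_lim[of "a \<star> x" z] that z XB L by (simp add: opl ips LIMSEQ_unique)
  qed (use that L in auto)
  have nlim: "(\<lambda>m. \<parallel>X m x \<boxminus> X n x\<parallel>) \<longlonglongrightarrow> \<parallel>L x \<boxminus> X n x\<parallel>" if x: "x \<in> \<H>" for n x
  proof (rule hlim_norm)
    have "(X m x \<boxminus> X n x) \<boxminus> (L x \<boxminus> X n x) = X m x \<boxminus> L x" for m
      by (rule vec_eqI) (use x XB L in \<open>auto simp: ips\<close>)
    then show "hlim (\<lambda>m. X m x \<boxminus> X n x) (L x \<boxminus> X n x)" using L(2)[OF x] by (simp add: hlim_def)
  qed (use x XB L in auto)
  have close: "\<parallel>L x \<boxminus> X n x\<parallel> \<le> e * \<parallel>x\<parallel>"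
    if N: "\<And>m. m \<ge> n \<Longrightarrow> hnorm \<HH> (X m \<ominus>\<^bsub>\<HH>\<^esub> X n) < e" and x: "x \<in> \<H>" for n e x
  proof (rule LIMSEQ_le_const2[OF nlim[OF x]], intro exI[of _ n] allI impI)
    fix m assume "n \<le> m"
    then have "hnorm \<HH> (X m \<ominus>\<^bsub>\<HH>\<^esub> X n) * \<parallel>x\<parallel> \<le> e * \<parallel>x\<parallel>" using N x by (intro mult_right_mono) (auto simp: less_imp_le)
    then show "\<parallel>X m x \<boxminus> X n x\<parallel> \<le> e * \<parallel>x\<parallel>" using bd[OF x, of m n] by simp
  qed
  obtain N1 where N1: "\<And>m n. m \<ge> N1 \<Longrightarrow> n \<ge> N1 \<Longrightarrow> hnorm \<HH> (X m \<ominus>\<^bsub>\<HH>\<^esub> X n) < 1" using cauchy[of 1] by auto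
  obtain d where d: "\<And>x. x \<in> \<H> \<Longrightarrow> \<parallel>X N1 x\<parallel> \<le> d * \<parallel>x\<parallel>" using op_bound[OF XB[of N1]] by blast
  \<comment> \<open>From index \<open>N1\<close> on the sequence moves by less than 1 in norm, so
    the limit differs from \<open>X N1\<close>, which is bounded by \<open>d\<close>, by at most
    \<open>\<parallel>x\<parallel>\<close> at \<open>x\<close>.\<close>
  have LB: "restrict L \<H> \<in> \<B>"
  proof (rule opI[where c="1 + d"])
    fix x assume x: "x \<in> \<H>"
    have "L x = (L x \<boxminus> X N1 x) \<boxplus> X N1 x" by (rule vec_eqI) (use x L XB in \<open>auto simp: ips\<close>)
    then have "\<parallel>L x\<parallel> \<le> \<parallel>L x \<boxminus> X N1 x\<parallel> + \<parallel>X N1 x\<parallel>" using norm_add_le[of "L x \<boxminus> X N1 x" "X N1 x"] x L XB by simp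
    then show "\<parallel>L x\<parallel> \<le> (1 + d) * \<parallel>x\<parallel>" using close[of N1 1 x] N1 d[OF x] x by (simp add: algebra_simps)
  qed (use L Ladd Lsc in auto)
  define T where "T = restrict L \<H>"
  have TB: "T \<in> \<B>" using LB by (simp add: T_def)
  have D: "opadd T (opsc (-1) (X n)) \<in> carrier \<HH> \<and> (\<Sum>\<^sub>\<infinity>g\<in>sb. \<parallel>opadd T (opsc (-1) (X n)) g\<parallel>\<^sup>2) \<le> e\<^sup>2"
    if N: "\<And>m. m \<ge> n \<Longrightarrow> hnorm \<HH> (X m \<ominus>\<^bsub>\<HH>\<^esub> X n) < e" for n e
  proof -
    have "(\<Sum>g\<in>F. \<parallel>opadd T (opsc (-1) (X n)) g\<parallel>\<^sup>2) \<le> e\<^sup>2" if F: "finite F" "F \<subseteq> sb" for F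
    proof -
      have FH: "g \<in> \<H>" if "g \<in> F" for g using that F by auto
      have "(\<lambda>m. \<Sum>g\<in>F. \<parallel>X m g \<boxminus> X n g\<parallel>\<^sup>2) \<longlonglongrightarrow> (\<Sum>g\<in>F. \<parallel>L g \<boxminus> X n g\<parallel>\<^sup>2)"
        by (intro tendsto_sum tendsto_power nlim FH)
      then have "(\<Sum>g\<in>F. \<parallel>L g \<boxminus> X n g\<parallel>\<^sup>2) \<le> e\<^sup>2"
      proof (rule LIMSEQ_le_const2, intro exI[of _ n] allI impI)
        fix m assume m: "n \<le> m"
        have "(\<Sum>g\<in>F. \<parallel>X m g \<boxminus> X n g\<parallel>\<^sup>2) = (\<Sum>g\<in>F. \<parallel>(X m \<ominus>\<^bsub>\<HH>\<^esub> X n) g\<parallel>\<^sup>2)" using X FH by (simp add: hs_sub_app)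
        also have "\<dots> \<le> (hnorm \<HH> (X m \<ominus>\<^bsub>\<HH>\<^esub> X n))\<^sup>2" unfolding hs_norm_sq[OF dc] by (rule hs_finite_le[OF dc F])
        also have "\<dots> \<le> e\<^sup>2" using N[OF m] by (intro power_mono) (auto simp: hs_norm[OF dc] infsum_nonneg)
        finally show "(\<Sum>g\<in>F. \<parallel>X m g \<boxminus> X n g\<parallel>\<^sup>2) \<le> e\<^sup>2" .
      qed
      moreover have "opadd T (opsc (-1) (X n)) g = L g \<boxminus> X n g" if "g \<in> F" for g
        using FH[OF that] L XB by (simp add: T_def sub_eq)
      ultimately show ?thesis by simp
    qed
    then show ?thesis using hsI[of "opadd T (opsc (-1) (X n))" "e\<^sup>2"] TB XB by auto
  qed
  have "opadd T (opsc (-1) (X N1)) \<in> carrier \<HH>" using D[of N1 1] N1 by auto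
  then have "opadd (opadd T (opsc (-1) (X N1))) (X N1) \<in> carrier \<HH>" by (rule hs_add[OF _ X])
  also have "opadd (opadd T (opsc (-1) (X N1))) (X N1) = T"
    by (rule op_ext) (use TB XB in \<open>auto intro!: vec_eqI simp: ips\<close>)
  finally have TH: "T \<in> carrier \<HH>" .
  have "(\<lambda>n. hnorm \<HH> (X n \<ominus>\<^bsub>\<HH>\<^esub> T)) \<longlonglongrightarrow> 0"
  proof (rule LIMSEQ_I)
    fix r :: real assume "r > 0"
    then obtain N where N: "\<And>m n. m \<ge> N \<Longrightarrow> n \<ge> N \<Longrightarrow> hnorm \<HH> (X m \<ominus>\<^bsub>\<HH>\<^esub> X n) < r / 2" using cauchy[of "r / 2"] by auto
    have "norm (hnorm \<HH> (X n \<ominus>\<^bsub>\<HH>\<^esub> T) - 0) < r" if n: "n \<ge> N" for n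
    proof -
      have dT: "X n \<ominus>\<^bsub>\<HH>\<^esub> T \<in> carrier \<HH>" using X TH by simp
      have "(\<Sum>\<^sub>\<infinity>g\<in>sb. \<parallel>(X n \<ominus>\<^bsub>\<HH>\<^esub> T) g\<parallel>\<^sup>2) = (\<Sum>\<^sub>\<infinity>g\<in>sb. \<parallel>opadd T (opsc (-1) (X n)) g\<parallel>\<^sup>2)"
        using X TH XB TB by (intro infsum_cong) (simp add: hs_sub_app norm_sub_commute flip: sub_eq)
      also have "\<dots> \<le> (r/2)\<^sup>2" using D[of n "r/2"] N n by auto
      finally have "hnorm \<HH> (X n \<ominus>\<^bsub>\<HH>\<^esub> T) \<le> r / 2"
        unfolding hs_norm[OF dT] using \<open>r > 0\<close> by (intro real_le_lsqrt) (auto intro: infsum_nonneg)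
      moreover have "0 \<le> hnorm \<HH> (X n \<ominus>\<^bsub>\<HH>\<^esub> T)" unfolding hs_norm[OF dT] by (simp add: infsum_nonneg)
      ultimately show ?thesis using \<open>r > 0\<close> by simp
    qed
    then show "\<exists>N. \<forall>n\<ge>N. norm (hnorm \<HH> (X n \<ominus>\<^bsub>\<HH>\<^esub> T) - 0) < r" by blast
  qed
  then show ?thesis using TH by blast
qed

lemma hs_hilbert: "complex_hilbert \<HH>"
proof (rule complex_hilbert.intro[OF hs_module], unfold_locales)
  fix S T R assume "S \<in> carrier \<HH>" "T \<in> carrier \<HH>" "R \<in> carrier \<HH>"
  note h = this and B = this[THEN hsD(1)]
  have "((\<lambda>e. \<langle>S e, R e\<rangle> + \<langle>T e, R e\<rangle>) has_sum (ip \<HH> S R + ip \<HH> T R)) sb" by (intro has_sum_add hs_ip_has_sum h)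
  moreover have "\<langle>S e, R e\<rangle> + \<langle>T e, R e\<rangle> = \<langle>opadd S T e, R e\<rangle>" if "e \<in> sb" for e using that B by (simp add: ips)
  ultimately have "((\<lambda>e. \<langle>opadd S T e, R e\<rangle>) has_sum (ip \<HH> S R + ip \<HH> T R)) sb" by (simp cong: has_sum_cong)
  then show "ip \<HH> (S \<oplus>\<^bsub>\<HH>\<^esub> T) R = ip \<HH> S R + ip \<HH> T R" unfolding hs_simps(3) hs_simps(5)[of "opadd S T"] by (rule infsumI)
next
  fix S T a assume "S \<in> carrier \<HH>" "T \<in> carrier \<HH>"
  note h = this and B = this[THEN hsD(1)]
  have "((\<lambda>e. a * \<langle>S e, T e\<rangle>) has_sum (a * ip \<HH> S T)) sb" by (intro has_sum_cmult_right hs_ip_has_sum h)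
  moreover have "a * \<langle>S e, T e\<rangle> = \<langle>opsc a S e, T e\<rangle>" if "e \<in> sb" for e using that B by (simp add: ips)
  ultimately have "((\<lambda>e. \<langle>opsc a S e, T e\<rangle>) has_sum (a * ip \<HH> S T)) sb" by (simp cong: has_sum_cong)
  then show "ip \<HH> (a \<odot>\<^bsub>\<HH>\<^esub> S) T = a * ip \<HH> S T" unfolding hs_simps(4) hs_simps(5)[of "opsc a S"] by (rule infsumI)
  have "((\<lambda>e. cnj \<langle>S e, T e\<rangle>) has_sum (cnj (ip \<HH> S T))) sb" by (subst has_sum_cnj_iff) (intro hs_ip_has_sum h)
  moreover have "cnj \<langle>S e, T e\<rangle> = \<langle>T e, S e\<rangle>" if "e \<in> sb" for e using that B ip_commute[of "S e" "T e"] by simp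
  ultimately have "((\<lambda>e. \<langle>T e, S e\<rangle>) has_sum (cnj (ip \<HH> S T))) sb" by (simp cong: has_sum_cong)
  then show "ip \<HH> T S = cnj (ip \<HH> S T)" unfolding hs_simps(5)[of T] by (rule infsumI)
next
  fix S assume S: "S \<in> carrier \<HH>" "S \<noteq> \<zero>\<^bsub>\<HH>\<^esub>"
  show "0 < Re (ip \<HH> S S)"
  proof (rule ccontr)
    assume "\<not> 0 < Re (ip \<HH> S S)"
    then have "hnorm \<HH> S \<le> 0" by (simp add: hnorm_def)
    then have "(\<Sum>\<^sub>\<infinity>e\<in>sb. \<parallel>S e\<parallel>\<^sup>2) \<le> 0" by (simp add: hs_norm[OF S(1)])
    moreover have "(\<Sum>\<^sub>\<infinity>e\<in>sb. \<parallel>S e\<parallel>\<^sup>2) \<ge> 0" by (rule infsum_nonneg) simp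
    ultimately have "\<parallel>S x\<parallel>\<^sup>2 \<le> 0" if "x \<in> \<H>" for x using hs_op_bound[OF S(1) that] by simp
    then have "S x = \<zero>\<^sub>H" if "x \<in> \<H>" for x using that hsD[OF S(1)] by (simp flip: norm_eq_0)
    then have "S = (\<lambda>x\<in>\<H>. \<zero>\<^sub>H)" by (intro op_ext[OF hsD(1)[OF S(1)] zero_op]) auto
    then show False using S(2) by (simp add: hs_simps)
  qed
next
  fix X :: "nat \<Rightarrow> 'v \<Rightarrow> 'v"
  assume "\<And>n. X n \<in> carrier \<HH>" "\<And>e. e > 0 \<Longrightarrow> \<exists>N. \<forall>m\<ge>N. \<forall>n\<ge>N. hnorm \<HH> (X m \<ominus>\<^bsub>\<HH>\<^esub> X n) < e"
  then show "\<exists>x\<in>carrier \<HH>. (\<lambda>n. hnorm \<HH> (X n \<ominus>\<^bsub>\<HH>\<^esub> x)) \<longlonglongrightarrow> 0" by (rule hs_complete)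
qed

end

subsection \<open>Spectral integrals\<close>

definition bmeas :: "('s::topological_space \<Rightarrow> complex) \<Rightarrow> bool" where
  "bmeas f \<longleftrightarrow> f \<in> borel_measurable borel \<and> (\<exists>K. \<forall>x. cmod (f x) \<le> K)"

lemma bmeasI: "\<lbrakk>f \<in> borel_measurable borel; \<And>x. cmod (f x) \<le> K\<rbrakk> \<Longrightarrow> bmeas f"
  by (auto simp: bmeas_def)

lemma bmeas_measurable: "bmeas f \<Longrightarrow> f \<in> borel_measurable borel" by (simp add: bmeas_def)

lemma bmeas_ind: "S \<in> sets borel \<Longrightarrow> bmeas (indicator S)"
  by (rule bmeasI[of _ 1]) (auto simp: indicator_def)

lemma bmeas_add: assumes "bmeas f" "bmeas g" shows "bmeas (\<lambda>x. f x + g x)"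
proof -
  obtain K L where "\<And>x. cmod (f x) \<le> K" "\<And>x. cmod (g x) \<le> L" using assms by (auto simp: bmeas_def)
  then have "cmod (f x + g x) \<le> K + L" for x by (rule norm_triangle_mono)
  then show ?thesis using assms by (intro bmeasI) (auto simp: bmeas_def)
qed

lemma bmeas_mult: assumes "bmeas f" "bmeas g" shows "bmeas (\<lambda>x. f x * g x)"
proof -
  obtain K L where k: "\<And>x. cmod (f x) \<le> K" "\<And>x. cmod (g x) \<le> L" using assms by (auto simp: bmeas_def)
  have "cmod (f x * g x) \<le> K * L" for x unfolding norm_mult
    by (rule mult_mono[OF k]) (use order_trans[OF norm_ge_zero k(1)] in auto)
  then show ?thesis using assms by (intro bmeasI) (auto simp: bmeas_def)
qed

lemma bmeas_const: "bmeas (\<lambda>x. c)" by (rule bmeasI[of _ "cmod c"]) auto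

lemma bmeas_cnj: "bmeas f \<Longrightarrow> bmeas (\<lambda>x. cnj (f x))"
  unfolding bmeas_def by (auto intro: borel_measurable_continuous_on[OF continuous_on_cnj[OF continuous_on_id]])

lemma bmeas_sum: "(\<And>i. i \<in> I \<Longrightarrow> bmeas (f i)) \<Longrightarrow> bmeas (\<lambda>x. \<Sum>i\<in>I. f i x)"
  by (induction I rule: infinite_finite_induct) (auto intro: bmeas_add bmeas_const)

text \<open>A bounded measurable function is a pointwise limit of simple functions dominated by
  twice its own bound. The limit case therefore comes with a common bound, as dominated convergence
  requires.\<close>

lemma bmeas_induct [consumes 1, case_names ind add mult lim]:
  fixes f :: "'s::topological_space \<Rightarrow> complex"
  assumes f: "bmeas f"
    and ind: "\<And>S. S \<in> sets borel \<Longrightarrow> P (indicator S)"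
    and add: "\<And>f g. \<lbrakk>bmeas f; bmeas g; P f; P g\<rbrakk> \<Longrightarrow> P (\<lambda>x. f x + g x)"
    and mult: "\<And>c f. \<lbrakk>bmeas f; P f\<rbrakk> \<Longrightarrow> P (\<lambda>x. c * f x)"
    and lim: "\<And>F f K. \<lbrakk>\<And>n. bmeas (F n); \<And>n x. cmod (F n x) \<le> K; \<And>n. P (F n); bmeas f; \<And>x. (\<lambda>n. F n x) \<longlonglongrightarrow> f x\<rbrakk> \<Longrightarrow> P f"
  shows "P f"
proof -
  obtain K where K: "\<And>x. cmod (f x) \<le> K" using f by (auto simp: bmeas_def)
  obtain F where F: "\<And>i. simple_function borel (F i)" "\<And>x. (\<lambda>i. F i x) \<longlonglongrightarrow> f x" "\<And>i x. dist (F i x) 0 \<le> 2 * dist (f x) 0"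
    using borel_measurable_implies_sequence_metric[OF bmeas_measurable[OF f], of 0] by auto
  have Fb: "cmod (F i x) \<le> 2 * K" for i x using F(3)[of i x] K[of x] by simp
  have Fm: "bmeas (F i)" for i by (rule bmeasI[OF borel_measurable_simple_function[OF F(1)] Fb])
  have "P (F i)" for i
  proof -
    have fin: "finite (range (F i))" and ms: "F i -` {y} \<in> sets borel" for y
      using F(1)[of i] simple_functionD(2)[OF F(1)[of i], of "{y}"] by (auto simp: simple_function_def)
    have "P (\<lambda>x. \<Sum>y\<in>Y. y * indicator (F i -` {y}) x) \<and> bmeas (\<lambda>x. \<Sum>y\<in>Y. y * indicator (F i -` {y}) x)" if "finite Y" for Y
      using that
    proof (induction Y rule: finite_induct)
      case empty
      have "P (\<lambda>x. 0 * indicator {} x)" by (intro mult ind bmeas_ind) auto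
      then show ?case by (simp add: bmeas_const)
    next
      case (insert y Y)
      have b: "bmeas (\<lambda>x. y * indicator (F i -` {y}) x)" by (intro bmeas_mult bmeas_const bmeas_ind ms)
      have "P (\<lambda>x. y * indicator (F i -` {y}) x + (\<Sum>y\<in>Y. y * indicator (F i -` {y}) x))"
        using insert b by (intro add mult ind bmeas_ind ms) auto
      then show ?case unfolding sum.insert[OF insert.hyps(1,2)] using insert.IH bmeas_add[OF b] by blast
    qed
    from this[OF fin] have "P (\<lambda>x. \<Sum>y\<in>range (F i). y * indicator (F i -` {y}) x)" by blast
    moreover have "(\<Sum>y\<in>range (F i). y * indicator (F i -` {y}) x) = F i x" for x
      using fin by (simp add: indicator_def sum.delta' if_distrib[of "\<lambda>t. _ * t"] cong: if_cong)
    ultimately show ?thesis by simp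
  qed
  then show ?thesis by (rule lim[OF Fm Fb _ f F(2)])
qed

lemma (in finite_measure) integral_indicator_complex:
  assumes "S \<in> sets M" shows "integral\<^sup>L M (indicator S) = complex_of_real (measure M S)"
proof -
  have "(\<lambda>s. indicator S s *\<^sub>R (1::complex)) = indicator S" by (auto simp: indicator_def)
  then show ?thesis
    using has_bochner_integral_integral_eq[OF has_bochner_integral_indicator[OF assms, of "1::complex"]]
    by (simp add: emeasure_eq_measure of_real_def)
qed

context complex_hilbert begin

lemma spec_proj: "\<lbrakk>spectral_measure M H E; S \<in> sets M\<rbrakk> \<Longrightarrow> E S \<in> projections H"
  by (simp add: spectral_measure_def)

lemma spec_op: "\<lbrakk>spectral_measure M H E; S \<in> sets M\<rbrakk> \<Longrightarrow> E S \<in> \<B>"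
  by (rule projD(1)[OF spec_proj])

lemma spec_space: "\<lbrakk>spectral_measure M H E; x \<in> \<H>\<rbrakk> \<Longrightarrow> E (space M) x = x"
  by (simp add: spectral_measure_def)

lemma spec_int: "\<lbrakk>spectral_measure M H E; S \<in> sets M; T \<in> sets M; x \<in> \<H>\<rbrakk> \<Longrightarrow> E (S \<inter> T) x = E S (E T x)"
  by (simp add: spectral_measure_def)

lemma spec_sums: "\<lbrakk>spectral_measure M H E; range A \<subseteq> sets M; disjoint_family A; x \<in> \<H>; y \<in> \<H>\<rbrakk>
  \<Longrightarrow> (\<lambda>n. \<langle>E (A n) x, y\<rangle>) sums \<langle>E (\<Union>n. A n) x, y\<rangle>"
  unfolding spectral_measure_def by blast

text \<open>Additivity over a sequence of empty sets makes a constant series converge, so its terms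
  vanish.\<close>

lemma spec_empty: assumes E: "spectral_measure M H E" and x: "x \<in> \<H>" shows "E {} x = \<zero>\<^sub>H"
proof -
  have s: "(\<lambda>n::nat. \<langle>E {} x, x\<rangle>) sums \<langle>E {} x, x\<rangle>"
    using spec_sums[OF E, of "\<lambda>_. {}" x x] x by (auto simp: disjoint_family_on_def)
  have "\<langle>E {} x, x\<rangle> = 0" using sums_summable[OF s] by (simp add: summable_const_iff)
  then show ?thesis using projD(1,4)[OF spec_proj[OF E, of "{}"]] x by (simp add: norm_eq_0)
qed

text \<open>\<open>measure_of\<close> yields the intended values only for countably additive set
  functions; here additivity is the weak additivity of \<open>E\<close>, and the values are squared
  norms since each \<open>E S\<close> is an orthogonal projection.\<close>

lemma scalar_measure_facts:
  assumes E: "spectral_measure M H E" and x: "x \<in> \<H>"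
  shows "space (scalar_measure M H E x) = space M" "sets (scalar_measure M H E x) = sets M"
    "\<And>S. S \<in> sets M \<Longrightarrow> emeasure (scalar_measure M H E x) S = ennreal (\<parallel>E S x\<parallel>\<^sup>2)"
    "finite_measure (scalar_measure M H E x)"
    "\<And>S. S \<in> sets M \<Longrightarrow> measure (scalar_measure M H E x) S = \<parallel>E S x\<parallel>\<^sup>2"
proof -
  let ?\<mu> = "\<lambda>S. ennreal (Re \<langle>E S x, x\<rangle>)"
  show sp: "space (scalar_measure M H E x) = space M" and st: "sets (scalar_measure M H E x) = sets M"
    unfolding scalar_measure_def by (auto simp: sets.space_closed sets.sigma_sets_eq)
  have pos: "Re \<langle>E S x, x\<rangle> = \<parallel>E S x\<parallel>\<^sup>2" if "S \<in> sets M" for S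
    using projD(4)[OF spec_proj[OF E that] x] by simp
  have ca: "countably_additive (sets M) ?\<mu>" unfolding countably_additive_def
  proof (intro allI impI)
    fix A :: "nat \<Rightarrow> _" assume A: "range A \<subseteq> sets M" "disjoint_family A" "(\<Union>i. A i) \<in> sets M"
    have "(\<lambda>n. Re \<langle>E (A n) x, x\<rangle>) sums Re \<langle>E (\<Union>n. A n) x, x\<rangle>" by (rule sums_Re[OF spec_sums[OF E A(1,2) x x]])
    moreover have "Re \<langle>E (A n) x, x\<rangle> \<ge> 0" "Re \<langle>E (\<Union>n. A n) x, x\<rangle> \<ge> 0" for n using A by (simp_all add: pos range_subsetD)
    ultimately have "(\<lambda>n. ?\<mu> (A n)) sums ?\<mu> (\<Union>n. A n)" by (simp add: sums_ennreal)
    then show "(\<Sum>n. ?\<mu> (A n)) = ?\<mu> (\<Union>n. A n)" by (rule sums_unique[symmetric])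
  qed
  show em: "emeasure (scalar_measure M H E x) S = ennreal (\<parallel>E S x\<parallel>\<^sup>2)" if S: "S \<in> sets M" for S
    unfolding scalar_measure_def
    by (subst emeasure_measure_of_sigma[OF sets.sigma_algebra_axioms _ ca S])
       (auto simp: positive_def spec_empty[OF E x] x pos[OF S])
  show "finite_measure (scalar_measure M H E x)" by (rule finite_measureI) (simp add: sp em)
  show "measure (scalar_measure M H E x) S = \<parallel>E S x\<parallel>\<^sup>2" if "S \<in> sets M" for S
    unfolding measure_def em[OF that] by simp
qed

end

text \<open>Generic in the underlying topological space, because it is instantiated on the line for
  \<open>E1\<close> and \<open>E2\<close> and on the plane for the double spectral measure.\<close>

locale spectral = complex_hilbert H for H :: "'v hilbert" +
  fixes E :: "'s::topological_space set \<Rightarrow> 'v \<Rightarrow> 'v"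
  assumes E: "spectral_measure borel H E"
begin

abbreviation "smu \<equiv> scalar_measure borel H E"
abbreviation "J \<equiv> spectral_integral borel H E"

lemma smu_facts: assumes "x \<in> \<H>"
  shows "space (smu x) = UNIV" "sets (smu x) = sets borel" "finite_measure (smu x)"
    "\<And>S. S \<in> sets borel \<Longrightarrow> measure (smu x) S = \<parallel>E S x\<parallel>\<^sup>2" "measure (smu x) UNIV = \<parallel>x\<parallel>\<^sup>2"
  using scalar_measure_facts[OF E assms] spec_space[OF E assms] by auto

lemma smu_measurable: "x \<in> \<H> \<Longrightarrow> borel_measurable (smu x) = borel_measurable borel"
  by (rule measurable_cong_sets) (auto simp: smu_facts)

lemma smu_integrable: assumes f: "bmeas f" and x: "x \<in> \<H>" shows "integrable (smu x) f"
proof -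
  interpret finite_measure "smu x" by (rule smu_facts[OF x])
  obtain K where "\<And>x. cmod (f x) \<le> K" using f by (auto simp: bmeas_def)
  then show ?thesis using f x by (intro integrable_const_bound[where B=K]) (auto simp: smu_measurable bmeas_def)
qed

lemma smu_integral_bound:
  assumes f: "bmeas f" "\<And>s. cmod (f s) \<le> K" and x: "x \<in> \<H>"
  shows "cmod (integral\<^sup>L (smu x) f) \<le> K * \<parallel>x\<parallel>\<^sup>2"
proof -
  interpret finite_measure "smu x" by (rule smu_facts[OF x])
  have "cmod (integral\<^sup>L (smu x) f) \<le> (\<integral>s. cmod (f s) \<partial>smu x)" by (rule integral_norm_bound)
  also have "\<dots> \<le> (\<integral>s. K \<partial>smu x)"
    by (rule integral_mono) (use smu_integrable[OF f(1) x] f(2) in auto)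
  also have "\<dots> = K * \<parallel>x\<parallel>\<^sup>2" using smu_facts[OF x] by simp
  finally show ?thesis .
qed

lemma smu_integral_lim:
  assumes F: "\<And>n. bmeas (F n)" "\<And>n s. cmod (F n s) \<le> K" and f: "bmeas f" "\<And>s. (\<lambda>n. F n s) \<longlonglongrightarrow> f s" and x: "x \<in> \<H>"
  shows "(\<lambda>n. integral\<^sup>L (smu x) (F n)) \<longlonglongrightarrow> integral\<^sup>L (smu x) f"
proof -
  interpret finite_measure "smu x" by (rule smu_facts[OF x])
  show ?thesis
    by (rule integral_dominated_convergence[where w="\<lambda>_. K"])
       (use F f x in \<open>auto simp: smu_measurable bmeas_def\<close>)
qed

text \<open>Induction over bounded measurable functions. Indicators give the projections themselves;
  at limits the quadratic forms converge under a common bound, and \<open>weak_limit_op\<close>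
  produces the operator.\<close>

lemma J_ex: assumes "bmeas f" shows "\<exists>T\<in>\<B>. \<forall>x\<in>\<H>. \<langle>T x, x\<rangle> = integral\<^sup>L (smu x) f"
  using assms
proof (induction rule: bmeas_induct)
  case (ind S)
  have "\<langle>E S x, x\<rangle> = integral\<^sup>L (smu x) (indicator S)" if x: "x \<in> \<H>" for x
  proof -
    interpret finite_measure "smu x" by (rule smu_facts[OF x])
    show ?thesis using projD(4)[OF spec_proj[OF E ind] x] smu_facts[OF x] ind by (simp add: integral_indicator_complex)
  qed
  then show ?case using spec_op[OF E ind] by blast
next
  case (add f g)
  then obtain S T where "S \<in> \<B>" "T \<in> \<B>" "\<forall>x\<in>\<H>. \<langle>S x, x\<rangle> = integral\<^sup>L (smu x) f" "\<forall>x\<in>\<H>. \<langle>T x, x\<rangle> = integral\<^sup>L (smu x) g" by blast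
  then show ?case using add(1,2) by (intro bexI[of _ "opadd S T"]) (auto simp: ips smu_integrable)
next
  case (mult c f)
  then obtain T where "T \<in> \<B>" "\<forall>x\<in>\<H>. \<langle>T x, x\<rangle> = integral\<^sup>L (smu x) f" by blast
  then show ?case by (intro bexI[of _ "opsc c T"]) (auto simp: ips)
next
  case (lim F f K)
  then obtain T where T: "\<And>n. T n \<in> \<B>" "\<And>n x. x \<in> \<H> \<Longrightarrow> \<langle>T n x, x\<rangle> = integral\<^sup>L (smu x) (F n)" by metis
  have K: "K \<ge> 0" using lim(2) norm_ge_zero order_trans by blast
  obtain S where "S \<in> \<B>" "\<And>x. x \<in> \<H> \<Longrightarrow> \<langle>S x, x\<rangle> = integral\<^sup>L (smu x) f"
  proof (rule weak_limit_op[of T K "\<lambda>x. integral\<^sup>L (smu x) f"])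
    show "T n \<in> \<B>" for n by (rule T)
    show "cmod \<langle>T n x, x\<rangle> \<le> K * \<parallel>x\<parallel>\<^sup>2" if "x \<in> \<H>" for n x
      unfolding T(2)[OF that] by (rule smu_integral_bound[OF lim(1,2) that])
    show "(\<lambda>n. \<langle>T n x, x\<rangle>) \<longlonglongrightarrow> integral\<^sup>L (smu x) f" if "x \<in> \<H>" for x
      unfolding T(2)[OF that] by (rule smu_integral_lim[OF lim(1,2,3,4) that])
  qed (use K that in auto)
  then show ?case by blast
qed

lemma J_spec: assumes "bmeas f"
  shows J_closed: "J f \<in> \<B>" and J_quad: "\<And>x. x \<in> \<H> \<Longrightarrow> \<langle>J f x, x\<rangle> = integral\<^sup>L (smu x) f"
proof -
  obtain T where T: "T \<in> \<B>" "\<forall>x\<in>\<H>. \<langle>T x, x\<rangle> = integral\<^sup>L (smu x) f" using J_ex[OF assms] by blast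
  have "J f = T" unfolding spectral_integral_def
    by (rule the_equality) (use T in \<open>auto intro: op_eqI_quad\<close>)
  then show "J f \<in> \<B>" "\<And>x. x \<in> \<H> \<Longrightarrow> \<langle>J f x, x\<rangle> = integral\<^sup>L (smu x) f" using T by auto
qed

lemma J_ind: assumes S: "S \<in> sets borel" shows "J (indicator S) = E S"
proof (rule op_eqI_quad[OF J_closed[OF bmeas_ind[OF S]] spec_op[OF E S]])
  fix x assume x: "x \<in> \<H>"
  interpret finite_measure "smu x" by (rule smu_facts[OF x])
  show "\<langle>J (indicator S) x, x\<rangle> = \<langle>E S x, x\<rangle>"
    using projD(4)[OF spec_proj[OF E S] x] smu_facts[OF x] S by (simp add: J_quad[OF bmeas_ind[OF S] x] integral_indicator_complex)
qed

lemma J_add: assumes "bmeas f" "bmeas g" "x \<in> \<H>" shows "J (\<lambda>s. f s + g s) x = J f x \<boxplus> J g x"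
proof -
  have "J (\<lambda>s. f s + g s) = opadd (J f) (J g)"
    by (rule op_eqI_quad) (use assms(1,2) in \<open>auto simp: J_spec bmeas_add ips smu_integrable\<close>)
  then show ?thesis using assms(3) by simp
qed

lemma J_mult: assumes "bmeas f" "x \<in> \<H>" shows "J (\<lambda>s. c * f s) x = c \<star> J f x"
proof -
  have "J (\<lambda>s. c * f s) = opsc c (J f)"
    by (rule op_eqI_quad) (use assms(1) in \<open>auto simp: J_spec bmeas_mult bmeas_const ips\<close>)
  then show ?thesis using assms(2) by simp
qed

text \<open>Dominated convergence for each scalar measure gives convergence of quadratic forms,
  which polarization promotes to weak convergence.\<close>

lemma J_lim:
  assumes F: "\<And>n. bmeas (F n)" "\<And>n s. cmod (F n s) \<le> K" and f: "bmeas f" "\<And>s. (\<lambda>n. F n s) \<longlonglongrightarrow> f s"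
    and xy: "x \<in> \<H>" "y \<in> \<H>"
  shows "(\<lambda>n. \<langle>J (F n) x, y\<rangle>) \<longlonglongrightarrow> \<langle>J f x, y\<rangle>"
proof -
  have K: "K \<ge> 0" using F(2) norm_ge_zero order_trans by blast
  obtain S where S: "S \<in> \<B>" "\<And>x. x \<in> \<H> \<Longrightarrow> \<langle>S x, x\<rangle> = integral\<^sup>L (smu x) f"
    "\<And>x y. x \<in> \<H> \<Longrightarrow> y \<in> \<H> \<Longrightarrow> (\<lambda>n. \<langle>J (F n) x, y\<rangle>) \<longlonglongrightarrow> \<langle>S x, y\<rangle>"
  proof (rule weak_limit_op[of "\<lambda>n. J (F n)" K "\<lambda>x. integral\<^sup>L (smu x) f"])
    show "J (F n) \<in> \<B>" for n by (rule J_closed[OF F(1)])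
    show "cmod \<langle>J (F n) x, x\<rangle> \<le> K * \<parallel>x\<parallel>\<^sup>2" if "x \<in> \<H>" for n x
      unfolding J_quad[OF F(1) that] by (rule smu_integral_bound[OF F that])
    show "(\<lambda>n. \<langle>J (F n) x, x\<rangle>) \<longlonglongrightarrow> integral\<^sup>L (smu x) f" if "x \<in> \<H>" for x
      unfolding J_quad[OF F(1) that] by (rule smu_integral_lim[OF F f that])
  qed (use K that in auto)
  have "S = J f" by (rule op_eqI_quad[OF S(1) J_closed[OF f(1)]]) (simp add: S(2) J_quad f(1))
  then show ?thesis using S(3)[OF xy] by simp
qed

text \<open>Two inductions: on \<open>f\<close> with an indicator as second factor, starting from
  \<open>spec_int\<close>, and then on \<open>g\<close>. In the limit case for \<open>g\<close> the
  operator \<open>J f\<close> is moved to the other argument as its adjoint, so that weak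
  convergence is enough.\<close>

lemma J_prod:
  assumes f: "bmeas f" and g: "bmeas g" and x: "x \<in> \<H>"
  shows "J (\<lambda>s. f s * g s) x = J f (J g x)"
proof -
  have 1: "\<langle>J (\<lambda>s. f s * indicator T s) x, y\<rangle> = \<langle>J f (E T x), y\<rangle>" if T: "T \<in> sets borel" and xy: "x \<in> \<H>" "y \<in> \<H>" for T x y
  proof -
    have Tx: "E T x \<in> \<H>" using spec_op[OF E T] xy by auto
    show ?thesis using f
    proof (induction rule: bmeas_induct)
      case (ind S)
      have "(\<lambda>s. indicator S s * indicator T s :: complex) = indicator (S \<inter> T)" by (simp add: indicator_inter_arith fun_eq_iff)
      then show ?case using ind T xy spec_int[OF E ind T] by (simp add: J_ind)
    next
      case (add f g)
      have "J (\<lambda>s. (f s + g s) * indicator T s) x = J (\<lambda>s. f s * indicator T s) x \<boxplus> J (\<lambda>s. g s * indicator T s) x"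
        unfolding distrib_right by (rule J_add) (use add T xy in \<open>auto intro: bmeas_mult bmeas_ind\<close>)
      then show ?case using add T xy Tx by (simp add: J_add ips op_closed[OF J_closed] bmeas_mult bmeas_ind)
    next
      case (mult c f)
      have "J (\<lambda>s. (c * f s) * indicator T s) x = c \<star> J (\<lambda>s. f s * indicator T s) x"
        unfolding mult.assoc by (rule J_mult) (use mult T xy in \<open>auto intro: bmeas_mult bmeas_ind\<close>)
      then show ?case using mult T xy Tx by (simp add: J_mult ips op_closed[OF J_closed] bmeas_mult bmeas_ind)
    next
      case (lim F f K)
      have K: "K \<ge> 0" using lim(2) norm_ge_zero order_trans by blast
      have "(\<lambda>n. \<langle>J (\<lambda>s. F n s * indicator T s) x, y\<rangle>) \<longlonglongrightarrow> \<langle>J (\<lambda>s. f s * indicator T s) x, y\<rangle>"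
      proof (rule J_lim[where K=K])
        show "cmod (F n s * indicator T s) \<le> K" for n s using lim(2)[of n s] K by (simp add: indicator_def)
      qed (intro bmeas_mult bmeas_ind tendsto_intros lim T xy)+
      moreover have "(\<lambda>n. \<langle>J (F n) (E T x), y\<rangle>) \<longlonglongrightarrow> \<langle>J f (E T x), y\<rangle>"
        by (rule J_lim[OF lim(1,2,3,4) Tx xy(2)])
      ultimately show ?case using lim(5) by (simp add: LIMSEQ_unique)
    qed
  qed
  obtain L where L: "\<And>s. cmod (f s) \<le> L" using f by (auto simp: bmeas_def)
  have "\<langle>J (\<lambda>s. f s * g s) x, y\<rangle> = \<langle>J f (J g x), y\<rangle>" if y: "y \<in> \<H>" for y
    using g
  proof (induction rule: bmeas_induct)
    case (ind S)
    then show ?case using 1[OF ind x y] by (simp add: J_ind)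
  next
    case (add g h)
    have "J (\<lambda>s. f s * (g s + h s)) x = J (\<lambda>s. f s * g s) x \<boxplus> J (\<lambda>s. f s * h s) x"
      unfolding distrib_left by (rule J_add) (use add f x in \<open>auto intro: bmeas_mult\<close>)
    then show ?case using add f x y by (simp add: J_add ips opl J_closed op_closed[OF J_closed] bmeas_mult)
  next
    case (mult c g)
    have "J (\<lambda>s. f s * (c * g s)) x = c \<star> J (\<lambda>s. f s * g s) x"
      unfolding mult.left_commute[of _ c] by (rule J_mult) (use mult f x in \<open>auto intro: bmeas_mult\<close>)
    then show ?case using mult f x y by (simp add: J_mult ips opl J_closed op_closed[OF J_closed] bmeas_mult)
  next
    case (lim F g K)
    have K: "K \<ge> 0" using lim(2) norm_ge_zero order_trans by blast
    have "(\<lambda>n. \<langle>J (\<lambda>s. f s * F n s) x, y\<rangle>) \<longlonglongrightarrow> \<langle>J (\<lambda>s. f s * g s) x, y\<rangle>"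
    proof (rule J_lim[where K="L * K"])
      show "cmod (f s * F n s) \<le> L * K" for n s
        unfolding norm_mult by (rule mult_mono[OF L lim(2)]) (use order_trans[OF norm_ge_zero L] in auto)
    qed (intro bmeas_mult tendsto_intros f lim x y)+
    moreover have "(\<lambda>n. \<langle>J (F n) x, hadj (J f) y\<rangle>) \<longlonglongrightarrow> \<langle>J g x, hadj (J f) y\<rangle>"
      by (rule J_lim[OF lim(1,2,3,4) x]) (use J_closed[OF f] y in auto)
    ultimately show ?case using lim(1,3,5) f x y by (simp add: adj_ip J_closed op_closed[OF J_closed] LIMSEQ_unique)
  qed
  then show ?thesis by (intro vec_eqI) (use f g x in \<open>auto intro!: op_closed[OF J_closed] bmeas_mult\<close>)
qed

lemma J_cnj: assumes f: "bmeas f" shows "J (\<lambda>s. cnj (f s)) = hadj (J f)"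
proof (rule op_eqI_quad)
  fix x assume x: "x \<in> \<H>"
  have "\<langle>hadj (J f) x, x\<rangle> = cnj \<langle>J f x, x\<rangle>"
    using ip_commute[of "J f x" x] x J_closed[OF f] by (simp add: adj_ip2)
  then show "\<langle>J (\<lambda>s. cnj (f s)) x, x\<rangle> = \<langle>hadj (J f) x, x\<rangle>"
    using x by (simp add: J_quad f bmeas_cnj)
qed (use f in \<open>auto intro: J_closed bmeas_cnj\<close>)

lemma J_norm_sq: assumes f: "bmeas f" and x: "x \<in> \<H>"
  shows "\<parallel>J f x\<parallel>\<^sup>2 = Re (integral\<^sup>L (smu x) (\<lambda>s. cnj (f s) * f s))"
proof -
  have "\<langle>J f x, J f x\<rangle> = \<langle>J (\<lambda>s. cnj (f s) * f s) x, x\<rangle>"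
    using f x by (simp add: J_prod bmeas_cnj J_cnj adj_ip2 J_closed op_closed[OF J_closed])
  then show ?thesis using f x by (simp add: norm_sq op_closed[OF J_closed] J_quad bmeas_mult bmeas_cnj)
qed

text \<open>The squared norms add up to one integral of the sum of the
  \<open>(cmod (f n s))\<^sup>2\<close> against the scalar measure of \<open>x\<close>. A pointwise
  bound on that sum therefore carries over with no dependence on \<open>N\<close>.\<close>

lemma J_square_sum:
  assumes f: "\<And>n. n < N \<Longrightarrow> bmeas (f n)" and le: "\<And>s. (\<Sum>n<N. (cmod (f n s))\<^sup>2) \<le> C" and x: "x \<in> \<H>"
  shows "(\<Sum>n<N::nat. \<parallel>J (f n) x\<parallel>\<^sup>2) \<le> C * \<parallel>x\<parallel>\<^sup>2"
proof -
  have C: "C \<ge> 0" using le[of undefined] by (rule order_trans[rotated]) (simp add: sum_nonneg)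
  let ?g = "\<lambda>s. \<Sum>n<N. cnj (f n s) * f n s"
  have b: "bmeas ?g" by (intro bmeas_sum bmeas_mult bmeas_cnj f) auto
  have "(\<Sum>n<N. \<parallel>J (f n) x\<parallel>\<^sup>2) = Re (\<Sum>n<N. integral\<^sup>L (smu x) (\<lambda>s. cnj (f n s) * f n s))"
    using f x by (simp add: J_norm_sq)
  also have "(\<Sum>n<N. integral\<^sup>L (smu x) (\<lambda>s. cnj (f n s) * f n s)) = integral\<^sup>L (smu x) ?g"
    by (rule Bochner_Integration.integral_sum[symmetric]) (auto intro!: smu_integrable bmeas_mult bmeas_cnj f x)
  also have "Re (integral\<^sup>L (smu x) ?g) \<le> cmod (integral\<^sup>L (smu x) ?g)" by (rule complex_Re_le_cmod)
  also have "\<dots> \<le> C * \<parallel>x\<parallel>\<^sup>2"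
  proof (rule smu_integral_bound[OF b _ x])
    fix s
    have "?g s = of_real (\<Sum>n<N. (cmod (f n s))\<^sup>2)"
      unfolding of_real_sum by (rule sum.cong) (simp_all only: complex_norm_square mult.commute)
    then have "cmod (?g s) = \<bar>\<Sum>n<N. (cmod (f n s))\<^sup>2\<bar>" by (simp only: norm_of_real)
    then show "cmod (?g s) \<le> C" using le[of s] by (simp add: sum_nonneg)
  qed
  finally show ?thesis .
qed

end

subsection \<open>The double spectral measure\<close>

context complex_hilbert begin

lemma proj_comp:
  assumes P: "P \<in> projections H" and Q: "Q \<in> projections H" and c: "\<And>x. x \<in> \<H> \<Longrightarrow> P (Q x) = Q (P x)"
  shows "compose \<H> P Q \<in> projections H"
proof (rule projI)
  show "compose \<H> P Q (compose \<H> P Q x) = compose \<H> P Q x" if x: "x \<in> \<H>" for x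
  proof -
    have "P (Q (P (Q x))) = P (P (Q (Q x)))" using c[of "Q x"] projD(1)[OF Q] x by simp
    then show ?thesis using projD(1,2)[OF P] projD(1,2)[OF Q] x by simp
  qed
qed (use projD(1,3)[OF P] projD(1,3)[OF Q] c in auto)

text \<open>Countable additivity of orthogonal projections below \<open>P\<close> has to be checked
  on a total set \<open>W\<close> only: the remainders are contractions, so the vectors on which
  they tend to zero form a closed subspace.\<close>

lemma proj_sum_total:
  assumes P: "P \<in> projections H" and Pn: "\<And>n::nat. Pn n \<in> projections H"
    and orth: "\<And>n m x. n \<noteq> m \<Longrightarrow> x \<in> \<H> \<Longrightarrow> Pn n (Pn m x) = \<zero>\<^sub>H"
    and sub: "\<And>n x. x \<in> \<H> \<Longrightarrow> Pn n (P x) = Pn n x"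
    and W: "W \<subseteq> \<H>" "\<And>x. \<lbrakk>x \<in> \<H>; \<And>w. w \<in> W \<Longrightarrow> \<langle>w, x\<rangle> = 0\<rbrakk> \<Longrightarrow> x = \<zero>\<^sub>H"
    and Wsum: "\<And>w. w \<in> W \<Longrightarrow> (\<lambda>n. \<parallel>Pn n w\<parallel>\<^sup>2) sums \<parallel>P w\<parallel>\<^sup>2"
    and x: "x \<in> \<H>"
  shows "(\<lambda>n. \<parallel>Pn n x\<parallel>\<^sup>2) sums \<parallel>P x\<parallel>\<^sup>2"
proof -
  note PB = projD(1)[OF P] and PnB = projD(1)[OF Pn]
  \<comment> \<open>\<open>P\<close> minus the first \<open>n\<close> of the projections
    \<open>Pn\<close>; its squared norm at a vector is what the first \<open>n\<close> terms of the
    series leave over.\<close>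
  define R where "R n = rec_nat P (\<lambda>k T. opadd T (opsc (-1) (Pn k))) n" for n
  have R0: "R 0 = P" and RS: "R (Suc n) = opadd (R n) (opsc (-1) (Pn n))" for n by (auto simp: R_def)
  have RB: "R n \<in> \<B>" for n using PB PnB by (induction n) (auto simp: R0 RS)
  have Rip: "\<langle>R n x, y\<rangle> = \<langle>P x, y\<rangle> - (\<Sum>k<n. \<langle>Pn k x, y\<rangle>)" if "x \<in> \<H>" "y \<in> \<H>" for n x y
    using that PnB RB by (induction n) (auto simp: R0 RS ips)
  have PnP: "\<langle>P x, Pn k x\<rangle> = of_real (\<parallel>Pn k x\<parallel>\<^sup>2)" "\<langle>Pn k x, P x\<rangle> = of_real (\<parallel>Pn k x\<parallel>\<^sup>2)" if "x \<in> \<H>" for k x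
    using projD(3)[OF Pn, of "P x" x k] projD(3)[OF Pn, of x "P x" k] projD(4)[OF Pn that, of k] sub[OF that, of k] that PB PnB
      projD(3)[OF Pn, of x x k] by auto
  have PkPj: "\<langle>Pn k x, Pn j x\<rangle> = (if k = j then of_real (\<parallel>Pn k x\<parallel>\<^sup>2) else 0)" if "x \<in> \<H>" for k j x
  proof (cases "k = j")
    case False
    have "\<langle>Pn k x, Pn j x\<rangle> = \<langle>Pn j (Pn k x), x\<rangle>" using projD(3)[OF Pn, of "Pn k x" x j] that PnB by simp
    then show ?thesis using orth[of j k x] False that by simp
  qed (use that PnB in \<open>simp add: ip_self\<close>)
  have Rn: "\<parallel>R n x\<parallel>\<^sup>2 = \<parallel>P x\<parallel>\<^sup>2 - (\<Sum>k<n. \<parallel>Pn k x\<parallel>\<^sup>2)" if x: "x \<in> \<H>" for n x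
  proof -
    have "\<langle>Pn k x, R n x\<rangle> = 0" if k: "k < n" for k
    proof -
      have "\<langle>Pn k x, R n x\<rangle> = cnj \<langle>R n x, Pn k x\<rangle>" by (rule ip_commute) (use x RB PnB in auto)
      also have "\<langle>R n x, Pn k x\<rangle> = 0" using x PnB k by (simp add: Rip PnP PkPj)
      finally show ?thesis by simp
    qed
    then have "\<langle>R n x, R n x\<rangle> = \<langle>P x, R n x\<rangle>" using x RB by (simp add: Rip)
    also have "\<dots> = cnj \<langle>R n x, P x\<rangle>" by (rule ip_commute) (use x RB PB in auto)
    also have "\<langle>R n x, P x\<rangle> = of_real (\<parallel>P x\<parallel>\<^sup>2 - (\<Sum>k<n. \<parallel>Pn k x\<parallel>\<^sup>2))" using x PB by (simp add: Rip PnP ip_self)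
    finally show ?thesis using x RB by (simp add: norm_sq)
  qed
  have Rle: "\<parallel>R n x\<parallel> \<le> \<parallel>x\<parallel>" if x: "x \<in> \<H>" for n x
  proof (rule power2_le_imp_le)
    have "\<parallel>R n x\<parallel>\<^sup>2 \<le> \<parallel>P x\<parallel>\<^sup>2" unfolding Rn[OF x] by (simp add: sum_nonneg)
    also have "\<dots> \<le> \<parallel>x\<parallel>\<^sup>2" using projD(5)[OF P x] x PB by (simp add: power_mono)
    finally show "\<parallel>R n x\<parallel>\<^sup>2 \<le> \<parallel>x\<parallel>\<^sup>2" .
  qed (use x in simp)
  define V where "V = {x\<in>\<H>. (\<lambda>n. \<parallel>R n x\<parallel>) \<longlonglongrightarrow> 0}"
  have sums_iff: "((\<lambda>n. \<parallel>Pn n x\<parallel>\<^sup>2) sums \<parallel>P x\<parallel>\<^sup>2) \<longleftrightarrow> x \<in> V" if x: "x \<in> \<H>" for x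
  proof -
    have "((\<lambda>n. \<parallel>Pn n x\<parallel>\<^sup>2) sums \<parallel>P x\<parallel>\<^sup>2) \<longleftrightarrow> (\<lambda>n. \<parallel>P x\<parallel>\<^sup>2 - \<parallel>R n x\<parallel>\<^sup>2) \<longlonglongrightarrow> \<parallel>P x\<parallel>\<^sup>2"
      unfolding sums_def by (simp add: Rn[OF x])
    also have "\<dots> \<longleftrightarrow> (\<lambda>n. \<parallel>R n x\<parallel>\<^sup>2) \<longlonglongrightarrow> 0"
    proof
      assume "(\<lambda>n. \<parallel>P x\<parallel>\<^sup>2 - \<parallel>R n x\<parallel>\<^sup>2) \<longlonglongrightarrow> \<parallel>P x\<parallel>\<^sup>2"
      from tendsto_diff[OF tendsto_const[of "\<parallel>P x\<parallel>\<^sup>2"] this] show "(\<lambda>n. \<parallel>R n x\<parallel>\<^sup>2) \<longlonglongrightarrow> 0" by simp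
    next
      assume "(\<lambda>n. \<parallel>R n x\<parallel>\<^sup>2) \<longlonglongrightarrow> 0"
      from tendsto_diff[OF tendsto_const[of "\<parallel>P x\<parallel>\<^sup>2"] this] show "(\<lambda>n. \<parallel>P x\<parallel>\<^sup>2 - \<parallel>R n x\<parallel>\<^sup>2) \<longlonglongrightarrow> \<parallel>P x\<parallel>\<^sup>2" by simp
    qed
    also have "\<dots> \<longleftrightarrow> (\<lambda>n. \<parallel>R n x\<parallel>) \<longlonglongrightarrow> 0"
    proof
      assume "(\<lambda>n. \<parallel>R n x\<parallel>\<^sup>2) \<longlonglongrightarrow> 0"
      from tendsto_real_sqrt[OF this] show "(\<lambda>n. \<parallel>R n x\<parallel>) \<longlonglongrightarrow> 0" using x RB by simp
    next
      assume "(\<lambda>n. \<parallel>R n x\<parallel>) \<longlonglongrightarrow> 0"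
      from tendsto_power[OF this, of 2] show "(\<lambda>n. \<parallel>R n x\<parallel>\<^sup>2) \<longlonglongrightarrow> 0" by simp
    qed
    finally show ?thesis using x by (simp add: V_def)
  qed
  have "V = \<H>"
  proof (rule total_subsp)
    show "subsp V" unfolding subsp_def
    proof (intro conjI ballI allI)
      show "V \<subseteq> \<H>" by (auto simp: V_def)
      show "\<zero>\<^sub>H \<in> V" using op_zero[OF RB] by (simp add: V_def)
      show "x \<boxplus> y \<in> V" if "x \<in> V" "y \<in> V" for x y
      proof -
        have xy: "x \<in> \<H>" "y \<in> \<H>" "(\<lambda>n. \<parallel>R n x\<parallel>) \<longlonglongrightarrow> 0" "(\<lambda>n. \<parallel>R n y\<parallel>) \<longlonglongrightarrow> 0"
          using that by (auto simp: V_def)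
        note l = tendsto_add[OF xy(3,4)]
        have "(\<lambda>n. \<parallel>R n (x \<boxplus> y)\<parallel>) \<longlonglongrightarrow> 0"
        proof (rule Lim_null_comparison[OF always_eventually])
          show "\<forall>n. norm \<parallel>R n (x \<boxplus> y)\<parallel> \<le> \<parallel>R n x\<parallel> + \<parallel>R n y\<parallel>" using xy RB norm_add_le by (simp add: op_add[OF RB])
        qed (use l in simp)
        then show ?thesis using xy by (simp add: V_def)
      qed
      show "a \<star> x \<in> V" if "x \<in> V" for a x
      proof -
        have xH: "x \<in> \<H>" "(\<lambda>n. \<parallel>R n x\<parallel>) \<longlonglongrightarrow> 0" using that by (auto simp: V_def)
        then show ?thesis using RB tendsto_mult_left[OF xH(2), of "cmod a"] by (simp add: V_def op_scale[OF RB])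
      qed
    qed
  next
    fix X z assume X: "\<And>n. X n \<in> V" and z: "z \<in> \<H>" and lim: "hlim X z"
    have XH: "X n \<in> \<H>" and XV: "(\<lambda>k. \<parallel>R k (X n)\<parallel>) \<longlonglongrightarrow> 0" for n using X by (auto simp: V_def)
    have "(\<lambda>n. \<parallel>R n z\<parallel>) \<longlonglongrightarrow> 0"
    proof (rule LIMSEQ_I)
      fix r :: real assume r: "r > 0"
      have "\<forall>\<^sub>F n in sequentially. \<parallel>X n \<boxminus> z\<parallel> < r/2" using lim r unfolding hlim_def by (intro order_tendstoD(2)[of _ 0]) auto
      then obtain n where n: "\<parallel>X n \<boxminus> z\<parallel> < r/2" by (auto simp: eventually_sequentially)
      have "\<forall>\<^sub>F k in sequentially. \<parallel>R k (X n)\<parallel> < r/2" using XV r by (intro order_tendstoD(2)[of _ 0]) auto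
      then obtain K where K: "\<And>k. k \<ge> K \<Longrightarrow> \<parallel>R k (X n)\<parallel> < r/2" by (auto simp: eventually_sequentially)
      have "norm (\<parallel>R k z\<parallel> - 0) < r" if k: "k \<ge> K" for k
      proof -
        have "z = X n \<boxplus> (z \<boxminus> X n)" by (rule vec_eqI) (use z XH in \<open>auto simp: ips\<close>)
        then have "R k z = R k (X n) \<boxplus> R k (z \<boxminus> X n)" using op_add[OF RB[of k] XH[of n], of "z \<boxminus> X n"] z XH[of n] by simp
        then have "\<parallel>R k z\<parallel> \<le> \<parallel>R k (X n)\<parallel> + \<parallel>R k (z \<boxminus> X n)\<parallel>" using norm_add_le[of "R k (X n)" "R k (z \<boxminus> X n)"] z XH RB by simp
        also have "\<parallel>R k (z \<boxminus> X n)\<parallel> \<le> \<parallel>X n \<boxminus> z\<parallel>" using Rle[of "z \<boxminus> X n" k] z XH norm_sub_commute by simp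
        finally show ?thesis using n K[OF k] z RB by simp
      qed
      then show "\<exists>K. \<forall>k\<ge>K. norm (\<parallel>R k z\<parallel> - 0) < r" by blast
    qed
    then show "z \<in> V" using z by (simp add: V_def)
  next
    fix x assume "x \<in> \<H>" "\<And>v. v \<in> V \<Longrightarrow> \<langle>v, x\<rangle> = 0"
    then show "x = \<zero>\<^sub>H" using W Wsum sums_iff by blast
  qed
  then show ?thesis using sums_iff[OF x] x by simp
qed

end

locale two_spectral = complex_hilbert H + s1: spectral H E1 + s2: spectral H E2
  for H :: "'v hilbert" and E1 E2 :: "real set \<Rightarrow> 'v \<Rightarrow> 'v"
begin

sublocale HS: complex_hilbert "hilbert_schmidt H" by (rule hs_hilbert)

text \<open>The adjoint preserves the Hilbert-Schmidt norm, and polarization transfers this to inner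
  products. The two arguments are exchanged because the adjoint is antilinear.\<close>

lemma hs_ip_adj:
  assumes S: "S \<in> carrier \<HH>" and T: "T \<in> carrier \<HH>"
  shows "ip \<HH> (hadj T) (hadj S) = ip \<HH> S T"
proof -
  note hs_simps(3,4)[simp] and B = hsD(1)[OF S] hsD(1)[OF T]
  have pol: "4 * ip \<HH> X Y = of_real ((hnorm \<HH> (opadd X Y))\<^sup>2) - of_real ((hnorm \<HH> (X \<ominus>\<^bsub>\<HH>\<^esub> Y))\<^sup>2)
     + \<i> * of_real ((hnorm \<HH> (opadd X (opsc \<i> Y)))\<^sup>2) - \<i> * of_real ((hnorm \<HH> (X \<ominus>\<^bsub>\<HH>\<^esub> opsc \<i> Y))\<^sup>2)"
    if "X \<in> carrier \<HH>" "Y \<in> carrier \<HH>" for X Y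
    using HS.polarization[OF HS.opid_closed that] that by (simp add: HS.ip_self hs_add hs_scale)
  have nadj: "hnorm \<HH> (hadj X) = hnorm \<HH> X" if "X \<in> carrier \<HH>" for X
    using that by (simp add: hs_norm hs_adj)
  have sub: "X \<ominus>\<^bsub>\<HH>\<^esub> Y = opadd X (opsc (-1) Y)" if "X \<in> carrier \<HH>" "Y \<in> carrier \<HH>" for X Y by (rule hs_sub[OF that])
  have lin: "opadd (hadj T) (opsc a (hadj S)) = hadj (opadd T (opsc (cnj a) S))" for a
    by (rule adjI[symmetric]) (use B in \<open>auto simp: ips adj_ip\<close>)
  \<comment> \<open>For unimodular \<open>a\<close> the polarization terms of both sides come from
    operators that agree up to taking adjoints and the factor \<open>cnj a\<close>, neither of which
    changes the norm.\<close>
  have n1: "hnorm \<HH> (opadd (hadj T) (opsc a (hadj S))) = hnorm \<HH> (opadd S (opsc a T))" if a: "cmod a = 1" for a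
  proof -
    have aa: "a * cnj a = 1" using a by (simp add: complex_mult_cnj cmod_def power2_eq_square flip: of_real_add of_real_mult)
    have "opadd T (opsc (cnj a) S) = opsc (cnj a) (opadd S (opsc a T))"
      by (rule op_eqI) (use B aa in \<open>auto simp: ips algebra_simps\<close>)
    then have "hnorm \<HH> (opadd T (opsc (cnj a) S)) = hnorm \<HH> (opadd S (opsc a T))"
      using HS.norm_scale[of "opadd S (opsc a T)" "cnj a"] a S T by (simp add: hs_add hs_scale)
    then show ?thesis unfolding lin using S T by (simp add: nadj hs_add hs_scale)
  qed
  have one: "opsc 1 X = X" if "X \<in> \<B>" for X by (rule op_ext) (use that in auto)
  have sc2: "opsc a (opsc b X) = opsc (a * b) X" if "X \<in> \<B>" for X a b by (rule op_ext) (use that in auto)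
  have "4 * ip \<HH> (hadj T) (hadj S) = 4 * ip \<HH> S T"
    using n1[of 1] n1[of "-1"] n1[of "\<i>"] n1[of "-\<i>"] S T B
    by (simp add: pol hs_adj sub hs_scale sc2 one)
  then show ?thesis by simp
qed

definition lm where "lm P = (\<lambda>Q\<in>carrier \<HH>. compose \<H> P Q)"
definition rm where "rm P = (\<lambda>Q\<in>carrier \<HH>. compose \<H> Q P)"

lemma hs_ip_left:
  assumes P: "P \<in> projections H" and S: "S \<in> carrier \<HH>" and T: "T \<in> carrier \<HH>"
  shows "ip \<HH> (compose \<H> P S) T = ip \<HH> S (compose \<H> P T)"
  unfolding hs_simps(5) by (rule infsum_cong) (use projD(3)[OF P] hsD(1)[OF S] hsD(1)[OF T] in auto)

lemma lm_proj: assumes P: "P \<in> projections H" shows "lm P \<in> projections \<HH>"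
proof (rule HS.projI)
  note PB = projD(1)[OF P]
  show "lm P \<in> bounded_ops \<HH>" unfolding lm_def
  proof (rule HS.opI[where c=1])
    fix S assume S: "S \<in> carrier \<HH>"
    show "compose \<H> P S \<in> carrier \<HH>" by (rule hs_comp_left[OF PB S])
    note SB = hsD(1)[OF S]
    have "(\<Sum>\<^sub>\<infinity>e\<in>sb. \<parallel>compose \<H> P S e\<parallel>\<^sup>2) \<le> (\<Sum>\<^sub>\<infinity>e\<in>sb. \<parallel>S e\<parallel>\<^sup>2)"
    proof (rule infsum_mono)
      show "\<parallel>compose \<H> P S e\<parallel>\<^sup>2 \<le> \<parallel>S e\<parallel>\<^sup>2" if "e \<in> sb" for e
        using projD(5)[OF P, of "S e"] SB PB that by (simp add: power_mono)
    qed (use hsD(2)[OF S] hsD(2)[OF hs_comp_left[OF PB S]] in auto)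
    then show "hnorm \<HH> (compose \<H> P S) \<le> 1 * hnorm \<HH> S" by (simp add: hs_norm S hs_comp_left[OF PB S])
    fix a show "compose \<H> P (a \<odot>\<^bsub>\<HH>\<^esub> S) = a \<odot>\<^bsub>\<HH>\<^esub> compose \<H> P S" unfolding hs_simps(4)
      by (rule op_ext) (use PB SB in \<open>auto simp: opl\<close>)
  next
    fix S T assume "S \<in> carrier \<HH>" "T \<in> carrier \<HH>"
    note B = this[THEN hsD(1)]
    show "compose \<H> P (S \<oplus>\<^bsub>\<HH>\<^esub> T) = compose \<H> P S \<oplus>\<^bsub>\<HH>\<^esub> compose \<H> P T" unfolding hs_simps(3)
      by (rule op_ext) (use PB B in \<open>auto simp: opl\<close>)
  qed
  fix S assume S: "S \<in> carrier \<HH>"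
  have "compose \<H> P (compose \<H> P S) = compose \<H> P S"
    by (rule op_ext) (use PB hsD(1)[OF S] projD(2)[OF P] in auto)
  then show "lm P (lm P S) = lm P S" using S hs_comp_left[OF PB S] by (simp add: lm_def)
  fix T assume T: "T \<in> carrier \<HH>"
  show "ip \<HH> (lm P S) T = ip \<HH> S (lm P T)" using hs_ip_left[OF P S T] S T by (simp add: lm_def)
qed

text \<open>Conjugation by the adjoint exchanges right and left multiplication. As the adjoint is
  isometric on the Hilbert-Schmidt class, what is known for \<open>lm\<close> carries over to
  \<open>rm\<close>.\<close>

lemma rm_eq: assumes P: "P \<in> projections H" and S: "S \<in> carrier \<HH>" shows "compose \<H> S P = hadj (compose \<H> P (hadj S))"
proof -
  have "hadj P = P" by (rule adjI) (use projD[OF P] in auto)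
  then show ?thesis using projD(1)[OF P] hsD(1)[OF S] by (simp add: adj_comp)
qed

lemma rm_proj: assumes P: "P \<in> projections H" shows "rm P \<in> projections \<HH>"
proof (rule HS.projI)
  note PB = projD(1)[OF P]
  note c1 = hs_comp_left[OF PB hs_adj(1)] and c2 = hs_comp_right[OF PB]
  show "rm P \<in> bounded_ops \<HH>" unfolding rm_def
  proof (rule HS.opI[where c=1])
    fix S assume S: "S \<in> carrier \<HH>"
    note SB = hsD(1)[OF S]
    show "compose \<H> S P \<in> carrier \<HH>" by (rule c2[OF S])
    have "hnorm \<HH> (compose \<H> S P) = hnorm \<HH> (lm P (hadj S))"
      unfolding rm_eq[OF P S] using S by (simp add: hs_norm hs_adj c1 lm_def)
    also have "\<dots> \<le> hnorm \<HH> (hadj S)" by (rule HS.projD(5)[OF lm_proj[OF P] hs_adj(1)[OF S]])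
    finally show "hnorm \<HH> (compose \<H> S P) \<le> 1 * hnorm \<HH> S" using S by (simp add: hs_norm hs_adj)
    fix a show "compose \<H> (a \<odot>\<^bsub>\<HH>\<^esub> S) P = a \<odot>\<^bsub>\<HH>\<^esub> compose \<H> S P" unfolding hs_simps(4)
      by (rule op_ext) (use PB SB in auto)
  next
    fix S T assume "S \<in> carrier \<HH>" "T \<in> carrier \<HH>"
    note B = this[THEN hsD(1)]
    show "compose \<H> (S \<oplus>\<^bsub>\<HH>\<^esub> T) P = compose \<H> S P \<oplus>\<^bsub>\<HH>\<^esub> compose \<H> T P" unfolding hs_simps(3)
      by (rule op_ext) (use PB B in auto)
  qed
  fix S assume S: "S \<in> carrier \<HH>"
  have "compose \<H> (compose \<H> S P) P = compose \<H> S P"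
    by (rule op_ext) (use PB hsD(1)[OF S] projD(2)[OF P] in auto)
  then show "rm P (rm P S) = rm P S" using S c2[OF S] by (simp add: rm_def)
  fix T assume T: "T \<in> carrier \<HH>"
  have "ip \<HH> (compose \<H> S P) T = ip \<HH> (hadj T) (compose \<H> P (hadj S))"
    using hs_ip_adj[OF c2[OF S] T] hsD(1)[OF hs_adj(1)[OF S]] PB unfolding rm_eq[OF P S] by simp
  also have "\<dots> = ip \<HH> (compose \<H> P (hadj T)) (hadj S)" by (rule hs_ip_left[OF P hs_adj(1)[OF T] hs_adj(1)[OF S], symmetric])
  also have "\<dots> = ip \<HH> S (compose \<H> T P)"
    using hs_ip_adj[OF S c2[OF T]] hsD(1)[OF hs_adj(1)[OF T]] PB unfolding rm_eq[OF P T] by simp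
  finally show "ip \<HH> (rm P S) T = ip \<HH> S (rm P T)" using S T by (simp add: rm_def)
qed

definition rect :: "real set \<Rightarrow> real set \<Rightarrow> ('v \<Rightarrow> 'v) \<Rightarrow> ('v \<Rightarrow> 'v)" where
  "rect L D = compose (carrier \<HH>) (lm (E1 L)) (rm (E2 D))"

lemma rect_app: "\<lbrakk>L \<in> sets borel; D \<in> sets borel; Q \<in> carrier \<HH>\<rbrakk> \<Longrightarrow> rect L D Q = compose \<H> (E1 L) (compose \<H> Q (E2 D))"
  using hs_comp_right[OF spec_op[OF s2.E]] by (simp add: rect_def compose_def[of "carrier \<HH>"] lm_def rm_def)

lemma rect_proj: assumes "L \<in> sets borel" "D \<in> sets borel" shows "rect L D \<in> projections \<HH>"
  unfolding rect_def
proof (rule HS.proj_comp)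
  show "lm (E1 L) \<in> projections \<HH>" "rm (E2 D) \<in> projections \<HH>"
    using assms spec_proj[OF s1.E] spec_proj[OF s2.E] by (auto intro: lm_proj rm_proj)
  note o = spec_op[OF s1.E assms(1)] spec_op[OF s2.E assms(2)]
  fix Q assume Q: "Q \<in> carrier \<HH>"
  have "compose \<H> (E1 L) (compose \<H> Q (E2 D)) = compose \<H> (compose \<H> (E1 L) Q) (E2 D)"
    by (rule op_ext) (use o hsD(1)[OF Q] in auto)
  then show "lm (E1 L) (rm (E2 D) Q) = rm (E2 D) (lm (E1 L) Q)"
    using Q o hs_comp_left hs_comp_right by (simp add: lm_def rm_def)
qed

lemma rect_rect:
  assumes "L \<in> sets borel" "D \<in> sets borel" "L' \<in> sets borel" "D' \<in> sets borel" and Q: "Q \<in> carrier \<HH>"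
  shows "rect L D (rect L' D' Q) = rect (L \<inter> L') (D \<inter> D') Q"
proof -
  note o = spec_op[OF s1.E assms(1)] spec_op[OF s2.E assms(2)] spec_op[OF s1.E assms(3)] spec_op[OF s2.E assms(4)]
    spec_op[OF s1.E sets.Int[OF assms(1,3)]] spec_op[OF s2.E sets.Int[OF assms(2,4)]]
  have "rect L' D' Q \<in> carrier \<HH>" using HS.projD(1)[OF rect_proj[OF assms(3,4)]] Q by auto
  then have "rect L D (rect L' D' Q) = compose \<H> (E1 L) (compose \<H> (compose \<H> (E1 L') (compose \<H> Q (E2 D'))) (E2 D))"
    using assms by (simp add: rect_app)
  also have "\<dots> = compose \<H> (E1 (L \<inter> L')) (compose \<H> Q (E2 (D \<inter> D')))"
    using o hsD(1)[OF Q] spec_int[OF s1.E assms(1,3)] spec_int[OF s2.E assms(4,2)]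
    by (intro op_ext) (auto simp: Int_commute[of D D'])
  finally show ?thesis using assms by (simp add: rect_app)
qed

lemma rect_empty: assumes "L \<in> sets borel" "D \<in> sets borel" "L = {} \<or> D = {}" "Q \<in> carrier \<HH>"
  shows "rect L D Q = \<zero>\<^bsub>\<HH>\<^esub>"
  unfolding rect_app[OF assms(1,2,4)] hs_simps(2)
  by (rule op_ext)
     (use assms hsD(1)[OF assms(4)] spec_op[OF s1.E assms(1)] spec_op[OF s2.E assms(2)] spec_empty[OF s1.E] spec_empty[OF s2.E] in
      \<open>auto simp: zero_op op_zero\<close>)

lemma rect_UNIV: "Q \<in> carrier \<HH> \<Longrightarrow> rect UNIV UNIV Q = Q"
  using spec_space[OF s1.E] spec_space[OF s2.E] spec_op[OF s1.E, of UNIV] spec_op[OF s2.E, of UNIV]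
  by (simp add: rect_app) (rule op_ext, auto dest: hsD(1))

definition rank1 where "rank1 \<xi> \<eta> = (\<lambda>x\<in>\<H>. \<langle>x, \<eta>\<rangle> \<star> \<xi>)"

lemma rank1_op: assumes "\<xi> \<in> \<H>" "\<eta> \<in> \<H>" shows "rank1 \<xi> \<eta> \<in> \<B>"
  unfolding rank1_def
proof (rule opI[where c="\<parallel>\<eta>\<parallel> * \<parallel>\<xi>\<parallel>"])
  fix x y assume "x \<in> \<H>" "y \<in> \<H>"
  then show "\<langle>x \<boxplus> y, \<eta>\<rangle> \<star> \<xi> = \<langle>x, \<eta>\<rangle> \<star> \<xi> \<boxplus> \<langle>y, \<eta>\<rangle> \<star> \<xi>"
    using assms by (intro vec_eqI) (auto simp: ips algebra_simps)
next
  fix x assume x: "x \<in> \<H>"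
  then show "\<parallel>\<langle>x, \<eta>\<rangle> \<star> \<xi>\<parallel> \<le> \<parallel>\<eta>\<parallel> * \<parallel>\<xi>\<parallel> * \<parallel>x\<parallel>"
    using mult_right_mono[OF cauchy_schwarz[OF x assms(2)] norm_ge_0[OF assms(1)]] assms by (simp add: ac_simps)
qed (use assms in \<open>auto simp: ips\<close>)

lemma rank1_hs:
  assumes "\<xi> \<in> \<H>" "\<eta> \<in> \<H>"
  shows "rank1 \<xi> \<eta> \<in> carrier \<HH>" "(hnorm \<HH> (rank1 \<xi> \<eta>))\<^sup>2 = \<parallel>\<xi>\<parallel>\<^sup>2 * \<parallel>\<eta>\<parallel>\<^sup>2"
proof -
  have "((\<lambda>e. (cmod \<langle>\<eta>, e\<rangle>)\<^sup>2 * \<parallel>\<xi>\<parallel>\<^sup>2) has_sum \<parallel>\<eta>\<parallel>\<^sup>2 * \<parallel>\<xi>\<parallel>\<^sup>2) sb"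
    by (rule has_sum_cmult_left[OF parseval[OF sb assms(2)]])
  moreover have "(cmod \<langle>\<eta>, e\<rangle>)\<^sup>2 * \<parallel>\<xi>\<parallel>\<^sup>2 = \<parallel>rank1 \<xi> \<eta> e\<parallel>\<^sup>2" if "e \<in> sb" for e
    using that assms ip_commute[of \<eta> e] by (simp add: rank1_def power_mult_distrib)
  ultimately have hs: "((\<lambda>e. \<parallel>rank1 \<xi> \<eta> e\<parallel>\<^sup>2) has_sum \<parallel>\<eta>\<parallel>\<^sup>2 * \<parallel>\<xi>\<parallel>\<^sup>2) sb" by (simp cong: has_sum_cong)
  then show h: "rank1 \<xi> \<eta> \<in> carrier \<HH>" using rank1_op[OF assms] by (auto simp: hs_simps has_sum_imp_summable)
  show "(hnorm \<HH> (rank1 \<xi> \<eta>))\<^sup>2 = \<parallel>\<xi>\<parallel>\<^sup>2 * \<parallel>\<eta>\<parallel>\<^sup>2"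
    unfolding hs_norm_sq[OF h] infsumI[OF hs] by simp
qed

lemma hs_ip_rank1:
  assumes S: "S \<in> carrier \<HH>" and xy: "\<xi> \<in> \<H>" "\<eta> \<in> \<H>"
  shows "ip \<HH> S (rank1 \<xi> \<eta>) = \<langle>S \<eta>, \<xi>\<rangle>"
proof -
  note SB = hsD(1)[OF S]
  have "((\<lambda>e. \<langle>\<eta>, e\<rangle> * \<langle>e, hadj S \<xi>\<rangle>) has_sum \<langle>\<eta>, hadj S \<xi>\<rangle>) sb"
    by (rule parseval_ip[OF sb]) (use SB xy in auto)
  moreover have "\<langle>\<eta>, e\<rangle> * \<langle>e, hadj S \<xi>\<rangle> = \<langle>S e, rank1 \<xi> \<eta> e\<rangle>" if "e \<in> sb" for e
    using that xy SB ip_commute[of e \<eta>] by (simp add: rank1_def ips adj_ip)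
  ultimately have "((\<lambda>e. \<langle>S e, rank1 \<xi> \<eta> e\<rangle>) has_sum \<langle>\<eta>, hadj S \<xi>\<rangle>) sb" by (simp cong: has_sum_cong)
  then show ?thesis unfolding hs_simps(5) using infsumI xy SB by (simp add: adj_ip infsumI)
qed

text \<open>Pairing with rank one operators reads off every matrix element. They are the total set
  on which countable additivity is verified.\<close>

lemma rank1_total:
  assumes S: "S \<in> carrier \<HH>" and o: "\<And>w. w \<in> {rank1 \<xi> \<eta> | \<xi> \<eta>. \<xi> \<in> \<H> \<and> \<eta> \<in> \<H>} \<Longrightarrow> ip \<HH> w S = 0"
  shows "S = \<zero>\<^bsub>\<HH>\<^esub>"
  unfolding hs_simps(2)
proof (rule op_ext[OF hsD(1)[OF S] zero_op])
  fix x assume x: "x \<in> \<H>"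
  note SB = hsD(1)[OF S]
  have "\<langle>S x, y\<rangle> = 0" if y: "y \<in> \<H>" for y
  proof -
    have "ip \<HH> (rank1 y x) S = 0" by (rule o) (use x y in blast)
    then show ?thesis using hs_ip_rank1[OF S y x] HS.ip_commute[OF rank1_hs(1)[OF y x] S] by simp
  qed
  then show "S x = (\<lambda>x\<in>\<H>. \<zero>\<^sub>H) x" using x SB by (auto intro: vec_eqI)
qed

lemma rect_rank1:
  assumes "L \<in> sets borel" "D \<in> sets borel" "\<xi> \<in> \<H>" "\<eta> \<in> \<H>"
  shows "rect L D (rank1 \<xi> \<eta>) = rank1 (E1 L \<xi>) (E2 D \<eta>)"
proof -
  note o = spec_op[OF s1.E assms(1)] spec_op[OF s2.E assms(2)]
  show ?thesis unfolding rect_app[OF assms(1,2) rank1_hs(1)[OF assms(3,4)]]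
    by (rule op_ext) (use o assms rank1_op projD(3)[OF spec_proj[OF s2.E assms(2)]] in \<open>auto simp: rank1_def opl\<close>)
qed

text \<open>A set function has to recover the two sides from the rectangle, which the images under
  \<open>fst\<close> and \<open>snd\<close> do. If one side is empty, both images are empty,
  consistently with \<open>rect_empty\<close>.\<close>

definition rmeas :: "('v \<Rightarrow> 'v) \<Rightarrow> (real \<times> real) set \<Rightarrow> ennreal" where
  "rmeas Q S = ennreal ((hnorm \<HH> (rect (fst ` S) (snd ` S) Q))\<^sup>2)"

definition rects :: "(real \<times> real) set set" where
  "rects = {L \<times> D | L D. L \<in> sets borel \<and> D \<in> sets borel}"

lemma rects_sigma: "sigma_sets UNIV rects = sets borel"
proof -
  have "sets (borel :: (real \<times> real) measure) = sets ((borel :: real measure) \<Otimes>\<^sub>M (borel :: real measure))" unfolding borel_prod ..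
  also have "\<dots> = sigma_sets UNIV rects" unfolding sets_pair_measure rects_def by simp
  finally show ?thesis ..
qed

lemma rects_semiring: "semiring_of_sets UNIV rects"
proof
  show "{} \<in> rects" by (auto simp: rects_def intro!: exI[of _ "{}"])
  fix a b assume "a \<in> rects" "b \<in> rects"
  then obtain L D L' D' where ab: "a = L \<times> D" "b = L' \<times> D'" and m: "L \<in> sets borel" "D \<in> sets borel" "L' \<in> sets borel" "D' \<in> sets borel"
    by (auto simp: rects_def)
  have "a \<inter> b = (L \<inter> L') \<times> (D \<inter> D')" using ab by auto
  then show "a \<inter> b \<in> rects" using m by (auto simp: rects_def)
  have "a - b = \<Union>{(L - L') \<times> D, (L \<inter> L') \<times> (D - D')}" using ab by auto
  moreover have "{(L - L') \<times> D, (L \<inter> L') \<times> (D - D')} \<subseteq> rects" using m unfolding rects_def by blast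
  moreover have "disjoint {(L - L') \<times> D, (L \<inter> L') \<times> (D - D')}" by (auto simp: disjoint_def)
  ultimately show "\<exists>C\<subseteq>rects. finite C \<and> disjoint C \<and> a - b = \<Union>C" by blast
qed (auto simp: rects_def)

lemma rects_fst_snd: assumes "S \<in> rects"
  shows "fst ` S \<in> sets borel" "snd ` S \<in> sets borel" "S = fst ` S \<times> snd ` S"
proof -
  obtain L D where "S = L \<times> D" "L \<in> sets borel" "D \<in> sets borel" using assms by (auto simp: rects_def)
  then show "fst ` S \<in> sets borel" "snd ` S \<in> sets borel" "S = fst ` S \<times> snd ` S" by (cases "L = {}"; cases "D = {}"; auto)+
qed

lemma rect_fst_snd:
  assumes "L \<in> sets borel" "D \<in> sets borel" "Q \<in> carrier \<HH>"
  shows "rect (fst ` (L \<times> D)) (snd ` (L \<times> D)) Q = rect L D Q"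
  using rect_empty[OF assms(1,2) _ assms(3)] rect_empty[of "{}" "{}" Q] assms(3)
  by (cases "L = {} \<or> D = {}") auto

text \<open>The heart of the construction. On a rank one operator the set function is a product of
  two scalar measures, so it is the restriction of a product measure and countably additive;
  \<open>proj_sum_total\<close> extends this from rank one operators to the whole Hilbert-Schmidt
  class.\<close>

lemma rmeas_countably_additive:
  assumes Q: "Q \<in> carrier \<HH>"
  shows "countably_additive rects (rmeas Q)"
  unfolding countably_additive_def
proof (intro allI impI)
  fix A :: "nat \<Rightarrow> (real \<times> real) set"
  assume A: "range A \<subseteq> rects" "disjoint_family A" "(\<Union>i. A i) \<in> rects"
  define P where "P S = rect (fst ` S) (snd ` S)" for S :: "(real \<times> real) set"
  note fs = rects_fst_snd
  have An: "A n \<in> rects" for n using A(1) by auto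
  have pr: "P S \<in> projections \<HH>" if "S \<in> rects" for S unfolding P_def by (rule rect_proj) (use fs[OF that] in auto)
  have PP: "P S (P T R) = P (S \<inter> T) R" if ST: "S \<in> rects" "T \<in> rects" and R: "R \<in> carrier \<HH>" for S T R
  proof -
    have "S \<inter> T = (fst ` S \<inter> fst ` T) \<times> (snd ` S \<inter> snd ` T)"
      by (subst fs(3)[OF ST(1)], subst fs(3)[OF ST(2)]) (rule Times_Int_Times)
    then have "P (S \<inter> T) R = rect (fst ` S \<inter> fst ` T) (snd ` S \<inter> snd ` T) R"
      unfolding P_def using rect_fst_snd[of "fst ` S \<inter> fst ` T" "snd ` S \<inter> snd ` T" R] fs[OF ST(1)] fs[OF ST(2)] R by auto
    then show ?thesis unfolding P_def using rect_rect fs[OF ST(1)] fs[OF ST(2)] R by simp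
  qed
  have "(\<lambda>n. (hnorm \<HH> (P (A n) Q))\<^sup>2) sums (hnorm \<HH> (P (\<Union>i. A i) Q))\<^sup>2"
  proof (rule HS.proj_sum_total[OF pr pr, where W="{rank1 \<xi> \<eta> | \<xi> \<eta>. \<xi> \<in> \<H> \<and> \<eta> \<in> \<H>}"])
    show "P (A n) (P (A m) R) = \<zero>\<^bsub>\<HH>\<^esub>" if "n \<noteq> m" "R \<in> carrier \<HH>" for n m R
    proof -
      have "A n \<inter> A m = {}" using A(2) that by (auto simp: disjoint_family_on_def)
      then show ?thesis using PP[OF An An that(2)] rect_empty[of "{}" "{}" R] that by (simp add: P_def)
    qed
    show "P (A n) (P (\<Union>i. A i) R) = P (A n) R" if "R \<in> carrier \<HH>" for n R
    proof -
      have "A n \<inter> (\<Union>i. A i) = A n" by auto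
      then show ?thesis using PP[OF An A(3) that] by simp
    qed
    fix w assume "w \<in> {rank1 \<xi> \<eta> | \<xi> \<eta>. \<xi> \<in> \<H> \<and> \<eta> \<in> \<H>}"
    then obtain \<xi> \<eta> where w: "w = rank1 \<xi> \<eta>" and xe: "\<xi> \<in> \<H>" "\<eta> \<in> \<H>" by auto
    let ?M = "s1.smu \<xi> \<Otimes>\<^sub>M s2.smu \<eta>"
    interpret f1: finite_measure "s1.smu \<xi>" by (rule s1.smu_facts[OF xe(1)])
    interpret f2: finite_measure "s2.smu \<eta>" by (rule s2.smu_facts[OF xe(2)])
    interpret f12: pair_sigma_finite "s1.smu \<xi>" "s2.smu \<eta>" ..
    interpret f: finite_measure ?M by (rule finite_measure_pair_measure) unfold_locales
    have sM: "S \<in> sets ?M" if "S \<in> rects" for S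
      using fs[OF that] s1.smu_facts(2)[OF xe(1)] s2.smu_facts(2)[OF xe(2)] pair_measureI[of "fst ` S" "s1.smu \<xi>" "snd ` S" "s2.smu \<eta>"] by simp
    have mS: "measure ?M S = (hnorm \<HH> (P S w))\<^sup>2" if S: "S \<in> rects" for S
    proof -
      have "measure ?M (fst ` S \<times> snd ` S) = measure (s1.smu \<xi>) (fst ` S) * measure (s2.smu \<eta>) (snd ` S)"
        unfolding measure_def using fs(1,2)[OF S] s1.smu_facts(2)[OF xe(1)] s2.smu_facts(2)[OF xe(2)]
        by (simp add: f2.emeasure_pair_measure_Times enn2real_mult)
      then show ?thesis unfolding fs(3)[OF S, symmetric] using fs(1,2)[OF S] xe s1.smu_facts(4)[OF xe(1)] s2.smu_facts(4)[OF xe(2)]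
        by (simp add: P_def w rect_rank1 rank1_hs spec_op[OF s1.E] spec_op[OF s2.E] op_closed)
    qed
    show "(\<lambda>n. (hnorm \<HH> (P (A n) w))\<^sup>2) sums (hnorm \<HH> (P (\<Union>i. A i) w))\<^sup>2"
      using f.finite_measure_UNION[of A] sM An A(2,3) by (auto simp: mS)
  qed (use A(3) An rank1_hs(1) rank1_total Q in auto)
  then have "(\<lambda>n. rmeas Q (A n)) sums rmeas Q (\<Union>i. A i)"
    unfolding rmeas_def P_def by (simp add: sums_ennreal)
  then show "(\<Sum>i. rmeas Q (A i)) = rmeas Q (\<Union>i. A i)" by (rule sums_unique[symmetric])
qed

lemma rmeas_extends:
  assumes Q: "Q \<in> carrier \<HH>"
  obtains \<mu> where "sets \<mu> = sets borel" "space \<mu> = UNIV" "finite_measure \<mu>"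
    "\<And>L D. \<lbrakk>L \<in> sets borel; D \<in> sets borel\<rbrakk> \<Longrightarrow> measure \<mu> (L \<times> D) = (hnorm \<HH> (rect L D Q))\<^sup>2"
proof -
  interpret semiring_of_sets UNIV rects by (rule rects_semiring)
  have "positive rects (rmeas Q)"
    using rect_empty[of "{}" "{}" Q] Q by (simp add: positive_def rmeas_def)
  from caratheodory[OF this rmeas_countably_additive[OF Q]] obtain \<mu>' where
    \<mu>': "\<And>S. S \<in> rects \<Longrightarrow> \<mu>' S = rmeas Q S" "measure_space UNIV (sigma_sets UNIV rects) \<mu>'" by auto
  define \<mu> where "\<mu> = measure_of UNIV (sets borel) \<mu>'"
  have ms: "measure_space UNIV (sets borel) \<mu>'" using \<mu>'(2) by (simp add: rects_sigma)
  have s: "sets \<mu> = sets borel" "space \<mu> = UNIV" unfolding \<mu>_def by (auto simp: sets.sigma_sets_eq[of borel, simplified])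
  have em: "emeasure \<mu> S = \<mu>' S" if "S \<in> sets borel" for S
    using ms that unfolding \<mu>_def measure_space_def by (intro emeasure_measure_of_sigma) auto
  have r: "L \<times> D \<in> rects" "L \<times> D \<in> sets borel" if "L \<in> sets borel" "D \<in> sets borel" for L D :: "real set"
    using that rects_sigma by (auto simp: rects_def)
  have emr: "emeasure \<mu> (L \<times> D) = ennreal ((hnorm \<HH> (rect L D Q))\<^sup>2)" if "L \<in> sets borel" "D \<in> sets borel" for L D
    using em[OF r(2)[OF that]] \<mu>'(1)[OF r(1)[OF that]] rect_fst_snd[OF that Q] by (simp add: rmeas_def)
  show thesis
  proof (rule that[OF s])
    show "finite_measure \<mu>" using emr[of UNIV UNIV] by (intro finite_measureI) (simp add: s)
    show "measure \<mu> (L \<times> D) = (hnorm \<HH> (rect L D Q))\<^sup>2" if "L \<in> sets borel" "D \<in> sets borel" for L D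
      unfolding measure_def emr[OF that] by simp
  qed
qed

end

lemma cauchy_schwarz_sum_le:
  fixes f g :: "'i \<Rightarrow> real"
  assumes "(\<Sum>i\<in>A. (f i)\<^sup>2) \<le> p" "(\<Sum>i\<in>A. (g i)\<^sup>2) \<le> q"
  shows "(\<Sum>i\<in>A. f i * g i) \<le> sqrt p * sqrt q"
proof -
  have "(\<Sum>i\<in>A. f i * g i) \<le> (\<Sum>i\<in>A. \<bar>f i\<bar> * \<bar>g i\<bar>)" by (rule sum_mono) (simp flip: abs_mult)
  also have "\<dots> \<le> L2_set f A * L2_set g A" by (rule L2_set_mult_ineq)
  also have "\<dots> \<le> sqrt p * sqrt q" unfolding L2_set_def
    by (intro mult_mono real_sqrt_le_mono assms real_sqrt_ge_zero order_trans[OF _ assms(1)]) (auto simp: sum_nonneg)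
  finally show ?thesis .
qed

lemma norm_has_sum_le:
  fixes f :: "'i \<Rightarrow> complex"
  assumes f: "(f has_sum s) A" and le: "\<And>F. \<lbrakk>finite F; F \<subseteq> A\<rbrakk> \<Longrightarrow> (\<Sum>x\<in>F. cmod (f x)) \<le> B"
  shows "cmod s \<le> B"
proof (rule tendsto_upperbound)
  show "((\<lambda>F. cmod (sum f F)) \<longlongrightarrow> cmod s) (finite_subsets_at_top A)" using f unfolding has_sum_def by (rule tendsto_norm)
  have "cmod (sum f F) \<le> B" if "finite F" "F \<subseteq> A" for F
    using le[OF that] norm_sum[of f F] by linarith
  then show "\<forall>\<^sub>F F in finite_subsets_at_top A. cmod (sum f F) \<le> B"
    by (auto simp: eventually_finite_subsets_at_top intro!: exI[of _ "{}"])
qed simp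

context two_spectral begin

text \<open>The extension to all Borel sets is picked for each \<open>Q\<close> separately. Finite
  measures that agree on rectangles coincide, so there is only one candidate.\<close>

definition dmu :: "('v \<Rightarrow> 'v) \<Rightarrow> (real \<times> real) measure" where
  "dmu Q = (SOME \<mu>. sets \<mu> = sets borel \<and> space \<mu> = UNIV \<and> finite_measure \<mu> \<and>
     (\<forall>L\<in>sets borel. \<forall>D\<in>sets borel. measure \<mu> (L \<times> D) = (hnorm \<HH> (rect L D Q))\<^sup>2))"

lemma dmu:
  assumes Q: "Q \<in> carrier \<HH>"
  shows "sets (dmu Q) = sets borel" "space (dmu Q) = UNIV" "finite_measure (dmu Q)"
    "\<And>L D. \<lbrakk>L \<in> sets borel; D \<in> sets borel\<rbrakk> \<Longrightarrow> measure (dmu Q) (L \<times> D) = (hnorm \<HH> (rect L D Q))\<^sup>2"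
    "measure (dmu Q) UNIV = (hnorm \<HH> Q)\<^sup>2"
proof -
  have "\<exists>\<mu> :: (real \<times> real) measure. sets \<mu> = sets borel \<and> space \<mu> = UNIV \<and> finite_measure \<mu> \<and>
     (\<forall>L\<in>sets borel. \<forall>D\<in>sets borel. measure \<mu> (L \<times> D) = (hnorm \<HH> (rect L D Q))\<^sup>2)"
    by (rule rmeas_extends[OF Q]) blast
  from someI_ex[OF this, folded dmu_def]
  show *: "sets (dmu Q) = sets borel" "space (dmu Q) = UNIV" "finite_measure (dmu Q)"
    "\<And>L D. \<lbrakk>L \<in> sets borel; D \<in> sets borel\<rbrakk> \<Longrightarrow> measure (dmu Q) (L \<times> D) = (hnorm \<HH> (rect L D Q))\<^sup>2" by blast+
  show "measure (dmu Q) UNIV = (hnorm \<HH> Q)\<^sup>2" using *(4)[of UNIV UNIV] rect_UNIV[OF Q] by simp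
qed

lemma rects_borel: "S \<in> rects \<Longrightarrow> S \<in> sets borel"
  unfolding rects_sigma[symmetric] by (rule sigma_sets.Basic)

text \<open>Dynkin's principle for the family of rectangles, which is stable under intersection and
  generates the Borel sets of the plane.\<close>

lemma borel_rects_induct [consumes 1, case_names basic empty compl union]:
  assumes S: "S \<in> sets (borel :: (real \<times> real) measure)"
    and "\<And>A. A \<in> rects \<Longrightarrow> P A" "P {}" "\<And>A. A \<in> sets borel \<Longrightarrow> P A \<Longrightarrow> P (UNIV - A)"
    "\<And>A :: nat \<Rightarrow> (real \<times> real) set. disjoint_family A \<Longrightarrow> range A \<subseteq> sets borel \<Longrightarrow> (\<And>i. P (A i)) \<Longrightarrow> P (\<Union>i. A i)"
  shows "P S"
proof -
  have ist: "Int_stable rects" using semiring_of_sets.Int[OF rects_semiring] by (auto simp: Int_stable_def)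
  then show ?thesis
    using S by (induction rule: sigma_sets_induct_disjoint[of rects UNIV, unfolded rects_sigma]) (use assms ist in \<open>auto simp: rects_def\<close>)
qed

text \<open>Since the measures come from a separate choice for each \<open>Q\<close>, it is not
  evident that their values on a fixed set form a bounded quadratic form in \<open>Q\<close>. On
  rectangles they do by construction, and the sets with this property are closed under complements
  and disjoint countable unions.\<close>

lemma dE_ex:
  assumes "S \<in> sets borel"
  shows "\<exists>T\<in>bounded_ops \<HH>. \<forall>Q\<in>carrier \<HH>. ip \<HH> (T Q) Q = of_real (measure (dmu Q) S)"
  using assms
proof (induction rule: borel_rects_induct)
  case (basic S)
  then obtain L D where S: "S = L \<times> D" "L \<in> sets borel" "D \<in> sets borel" by (auto simp: rects_def)
  then show ?case using HS.projD(1,4)[OF rect_proj[OF S(2,3)]] dmu(4) by (intro bexI[of _ "rect L D"]) auto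
next
  case empty
  show ?case using HS.projD(1,4)[OF rect_proj[of "{}" "{}"]] dmu(4)[of _ "{}" "{}"] by (intro bexI[of _ "rect {} {}"]) auto
next
  case (compl A)
  then obtain T where T: "T \<in> bounded_ops \<HH>" "\<And>Q. Q \<in> carrier \<HH> \<Longrightarrow> ip \<HH> (T Q) Q = of_real (measure (dmu Q) A)" by blast
  have "measure (dmu Q) (UNIV - A) = (hnorm \<HH> Q)\<^sup>2 - measure (dmu Q) A" if Q: "Q \<in> carrier \<HH>" for Q
    using finite_measure.finite_measure_compl[OF dmu(3)[OF Q], of A] dmu(1,2,5)[OF Q] compl(1) by simp
  then show ?case using T
    by (intro bexI[of _ "HS.opadd HS.opid (HS.opsc (-1) T)"]) (auto simp: HS.ips HS.ip_self)
next
  case (union A)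
  then obtain T where T: "\<And>i. T i \<in> bounded_ops \<HH>" "\<And>i Q. Q \<in> carrier \<HH> \<Longrightarrow> ip \<HH> (T i Q) Q = of_real (measure (dmu Q) (A i))" by metis
  define R where "R n = rec_nat (HS.opsc 0 HS.opid) (\<lambda>k W. HS.opadd W (T k)) n" for n
  have R0: "R 0 = HS.opsc 0 HS.opid" and RS: "R (Suc n) = HS.opadd (R n) (T n)" for n by (auto simp: R_def)
  have RB: "R n \<in> bounded_ops \<HH>" for n using T(1) by (induction n) (auto simp: R0 RS)
  have Rq: "ip \<HH> (R n Q) Q = of_real (\<Sum>i<n. measure (dmu Q) (A i))" if "Q \<in> carrier \<HH>" for n Q
    using that T RB by (induction n) (auto simp: R0 RS HS.ips)
  obtain W where "W \<in> bounded_ops \<HH>" "\<And>Q. Q \<in> carrier \<HH> \<Longrightarrow> ip \<HH> (W Q) Q = of_real (measure (dmu Q) (\<Union>i. A i))"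
  proof (rule HS.weak_limit_op[of R 1 "\<lambda>Q. of_real (measure (dmu Q) (\<Union>i. A i))"])
    fix Q assume Q: "Q \<in> carrier \<HH>"
    interpret finite_measure "dmu Q" by (rule dmu(3)[OF Q])
    have s: "(\<lambda>i. measure (dmu Q) (A i)) sums measure (dmu Q) (\<Union>i. A i)"
      by (rule finite_measure_UNION) (use union dmu(1)[OF Q] in auto)
    then show "(\<lambda>n. ip \<HH> (R n Q) Q) \<longlonglongrightarrow> of_real (measure (dmu Q) (\<Union>i. A i))"
      unfolding Rq[OF Q] sums_def by (rule tendsto_of_real)
    show "cmod (ip \<HH> (R n Q) Q) \<le> 1 * (hnorm \<HH> Q)\<^sup>2" for n
    proof -
      have "(\<Sum>i<n. measure (dmu Q) (A i)) \<le> measure (dmu Q) (\<Union>i. A i)"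
        using sum_le_suminf[OF sums_summable[OF s], of "{..<n}"] sums_unique[OF s] by simp
      also have "\<dots> \<le> (hnorm \<HH> Q)\<^sup>2" using bounded_measure[of "\<Union>i. A i"] dmu(2,5)[OF Q] by simp
      finally show ?thesis unfolding Rq[OF Q] norm_of_real by (simp add: sum_nonneg)
    qed
  qed (use RB that in auto)
  then show ?case by blast
qed

definition dE :: "(real \<times> real) set \<Rightarrow> ('v \<Rightarrow> 'v) \<Rightarrow> 'v \<Rightarrow> 'v" where
  "dE S = (SOME T. T \<in> bounded_ops \<HH> \<and> (\<forall>Q\<in>carrier \<HH>. ip \<HH> (T Q) Q = of_real (measure (dmu Q) S)))"

lemma dE:
  assumes "S \<in> sets borel"
  shows dE_op: "dE S \<in> bounded_ops \<HH>" and dE_quad: "\<And>Q. Q \<in> carrier \<HH> \<Longrightarrow> ip \<HH> (dE S Q) Q = of_real (measure (dmu Q) S)"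
  using someI_ex[OF dE_ex[OF assms, unfolded Bex_def], folded dE_def] by auto

lemma dE_closed: "S \<in> sets borel \<Longrightarrow> Q \<in> carrier \<HH> \<Longrightarrow> dE S Q \<in> carrier \<HH>"
  by (rule HS.op_closed[OF dE_op])

lemma dE_rect: assumes "L \<in> sets borel" "D \<in> sets borel" shows "dE (L \<times> D) = rect L D"
proof -
  have s: "L \<times> D \<in> sets borel" using assms by (intro rects_borel) (auto simp: rects_def)
  show ?thesis
    by (rule HS.op_eqI_quad[OF dE_op[OF s] HS.projD(1)[OF rect_proj[OF assms]]])
       (simp add: dE_quad[OF s] HS.projD(4)[OF rect_proj[OF assms]] dmu(4) assms)
qed

lemma dE_UNIV: "Q \<in> carrier \<HH> \<Longrightarrow> dE UNIV Q = Q"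
  using dE_rect[of UNIV UNIV] rect_UNIV by simp

lemma dE_selfadj: assumes "S \<in> sets borel" "Q \<in> carrier \<HH>" "R \<in> carrier \<HH>" shows "ip \<HH> (dE S Q) R = ip \<HH> Q (dE S R)"
  by (rule HS.real_quad_selfadj[OF dE_op]) (use assms dE_quad[OF assms(1)] in auto)

lemma dE_diff:
  assumes "A \<in> sets borel" "B \<in> sets borel" "A \<subseteq> B" "Q \<in> carrier \<HH>" "R \<in> carrier \<HH>"
  shows "ip \<HH> (dE (B - A) Q) R = ip \<HH> (dE B Q) R - ip \<HH> (dE A Q) R"
proof -
  have "dE (B - A) = HS.opadd (dE B) (HS.opsc (-1) (dE A))"
  proof (rule HS.op_eqI_quad)
    fix Q assume Q: "Q \<in> carrier \<HH>"
    show "ip \<HH> (dE (B - A) Q) Q = ip \<HH> (HS.opadd (dE B) (HS.opsc (-1) (dE A)) Q) Q"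
      using finite_measure.finite_measure_Diff[OF dmu(3)[OF Q], of B A] assms Q dmu(1)[OF Q]
      by (simp add: dE_quad HS.ips dE_closed)
  qed (use assms dE_op in auto)
  then show ?thesis using assms by (simp add: HS.ips dE_closed)
qed

lemma dE_sums:
  assumes A: "range A \<subseteq> sets borel" "disjoint_family A" and Q: "Q \<in> carrier \<HH>" and R: "R \<in> carrier \<HH>"
  shows "(\<lambda>n. ip \<HH> (dE (A n) Q) R) sums ip \<HH> (dE (\<Union>n. A n) Q) R"
proof -
  have An: "A n \<in> sets borel" for n using A(1) by auto
  have U: "(\<Union>n. A n) \<in> sets borel" using An by auto
  have q: "(\<lambda>n. ip \<HH> (dE (A n) X) X) sums ip \<HH> (dE (\<Union>n. A n) X) X" if X: "X \<in> carrier \<HH>" for X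
    unfolding dE_quad[OF An X] dE_quad[OF U X]
    by (intro sums_of_real finite_measure.finite_measure_UNION[OF dmu(3)[OF X]]) (use A dmu(1)[OF X] in auto)
  have pol: "ip \<HH> (dE S Q) R = (ip \<HH> (dE S (Q \<oplus>\<^bsub>\<HH>\<^esub> R)) (Q \<oplus>\<^bsub>\<HH>\<^esub> R) - ip \<HH> (dE S (Q \<ominus>\<^bsub>\<HH>\<^esub> R)) (Q \<ominus>\<^bsub>\<HH>\<^esub> R)
    + \<i> * ip \<HH> (dE S (Q \<oplus>\<^bsub>\<HH>\<^esub> \<i> \<odot>\<^bsub>\<HH>\<^esub> R)) (Q \<oplus>\<^bsub>\<HH>\<^esub> \<i> \<odot>\<^bsub>\<HH>\<^esub> R)
    - \<i> * ip \<HH> (dE S (Q \<ominus>\<^bsub>\<HH>\<^esub> \<i> \<odot>\<^bsub>\<HH>\<^esub> R)) (Q \<ominus>\<^bsub>\<HH>\<^esub> \<i> \<odot>\<^bsub>\<HH>\<^esub> R)) / 4" if "S \<in> sets borel" for S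
    unfolding HS.polarization[OF dE_op[OF that] Q R, symmetric] by simp
  show ?thesis unfolding pol[OF An] pol[OF U]
    by (intro sums_divide sums_add sums_diff sums_mult q) (use Q R in auto)
qed

text \<open>First of two rounds towards multiplicativity: \<open>S\<close> runs through the Borel
  sets while \<open>T\<close> stays a rectangle. The identity is tested weakly, so that complements
  and unions reduce to sums of numbers.\<close>

lemma dE_Int_rect:
  assumes S: "S \<in> sets borel" and T: "T \<in> rects" and Q: "Q \<in> carrier \<HH>" and R: "R \<in> carrier \<HH>"
  shows "ip \<HH> (dE (S \<inter> T) Q) R = ip \<HH> (dE S (dE T Q)) R"
  using S
proof (induction rule: borel_rects_induct)
  case (basic S)
  then obtain L D L' D' where ST: "S = L \<times> D" "L \<in> sets borel" "D \<in> sets borel" "T = L' \<times> D'" "L' \<in> sets borel" "D' \<in> sets borel"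
    using T by (auto simp: rects_def)
  have "S \<inter> T = (L \<inter> L') \<times> (D \<inter> D')" using ST by auto
  then show ?case using ST rect_rect Q by (simp add: dE_rect)
next
  case empty
  have "dE {} X = \<zero>\<^bsub>\<HH>\<^esub>" if "X \<in> carrier \<HH>" for X using dE_rect[of "{}" "{}"] rect_empty[of "{}" "{}" X] that by simp
  then show ?case using Q T R by (simp add: dE_closed rects_borel)
next
  case (compl A)
  note TB = rects_borel[OF T]
  have "(UNIV - A) \<inter> T = T - (A \<inter> T)" by auto
  then show ?case using compl TB Q R dE_diff[of "A \<inter> T" T Q R] dE_diff[of A UNIV "dE T Q" R]
    by (simp add: dE_closed dE_UNIV)
next
  case (union A)
  note TB = rects_borel[OF T]
  have "(\<lambda>n. ip \<HH> (dE (A n \<inter> T) Q) R) sums ip \<HH> (dE (\<Union>n. A n \<inter> T) Q) R"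
  proof (rule dE_sums[OF _ _ Q R])
    show "range (\<lambda>n. A n \<inter> T) \<subseteq> sets borel" using union(2) TB by auto
    show "disjoint_family (\<lambda>n. A n \<inter> T)" using union(1) by (auto simp: disjoint_family_on_def)
  qed
  then have "(\<lambda>n. ip \<HH> (dE (A n) (dE T Q)) R) sums ip \<HH> (dE (\<Union>n. A n \<inter> T) Q) R"
    by (simp only: union(3))
  moreover have "(\<lambda>n. ip \<HH> (dE (A n) (dE T Q)) R) sums ip \<HH> (dE (\<Union>n. A n) (dE T Q)) R"
    by (rule dE_sums[OF union(2,1) dE_closed[OF TB Q] R])
  moreover have "(\<Union>n. A n) \<inter> T = (\<Union>n. A n \<inter> T)" by auto
  ultimately show ?case by (simp only: sums_unique2)
qed

text \<open>Second round: now \<open>T\<close> varies. Self-adjointness moves \<open>dE S\<close> to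
  the other argument, after which additivity in \<open>T\<close> applies.\<close>

lemma dE_Int:
  assumes S: "S \<in> sets borel" and T: "T \<in> sets borel" and Q: "Q \<in> carrier \<HH>"
  shows "dE (S \<inter> T) Q = dE S (dE T Q)"
proof (rule HS.vec_eqI)
  fix R assume R: "R \<in> carrier \<HH>"
  show "ip \<HH> (dE (S \<inter> T) Q) R = ip \<HH> (dE S (dE T Q)) R"
    using T
  proof (induction rule: borel_rects_induct)
    case (basic T)
    then show ?case by (rule dE_Int_rect[OF S _ Q R])
  next
    case empty
    have "dE {} X = \<zero>\<^bsub>\<HH>\<^esub>" if "X \<in> carrier \<HH>" for X using dE_rect[of "{}" "{}"] rect_empty[of "{}" "{}" X] that by simp
    then show ?case using Q S R HS.op_zero[OF dE_op[OF S]] by simp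
  next
    case (compl A)
    have "S \<inter> (UNIV - A) = S - (S \<inter> A)" by auto
    moreover have "ip \<HH> (dE (UNIV - A) Q) (dE S R) = ip \<HH> Q (dE S R) - ip \<HH> (dE A Q) (dE S R)"
      using dE_diff[of A UNIV Q "dE S R"] compl(1) S Q R by (simp add: dE_closed dE_UNIV)
    ultimately show ?case using compl S Q R dE_diff[of "S \<inter> A" S Q R]
      by (simp add: dE_selfadj[OF S] dE_closed)
  next
    case (union A)
    have An: "A n \<in> sets borel" for n using union(2) by auto
    have U: "(\<Union>n. A n) \<in> sets borel" using An by auto
    have 1: "(\<lambda>n. ip \<HH> (dE (S \<inter> A n) Q) R) sums ip \<HH> (dE (\<Union>n. S \<inter> A n) Q) R"
    proof (rule dE_sums[OF _ _ Q R])
      show "range (\<lambda>n. S \<inter> A n) \<subseteq> sets borel" using An S by auto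
      show "disjoint_family (\<lambda>n. S \<inter> A n)" using union(1) by (auto simp: disjoint_family_on_def)
    qed
    have 2: "(\<lambda>n. ip \<HH> (dE (A n) Q) (dE S R)) sums ip \<HH> (dE (\<Union>n. A n) Q) (dE S R)"
      by (rule dE_sums[OF union(2,1) Q dE_closed[OF S R]])
    have 3: "S \<inter> (\<Union>n. A n) = (\<Union>n. S \<inter> A n)" by auto
    have 4: "ip \<HH> (dE (S \<inter> A n) Q) R = ip \<HH> (dE (A n) Q) (dE S R)" for n
      unfolding union(3) by (rule dE_selfadj[OF S dE_closed[OF An Q] R])
    have "ip \<HH> (dE (S \<inter> (\<Union>n. A n)) Q) R = ip \<HH> (dE (\<Union>n. A n) Q) (dE S R)"
      using sums_unique2[OF 1[unfolded 4] 2] by (simp only: 3)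
    then show ?case by (simp only: dE_selfadj[OF S dE_closed[OF U Q] R])
  qed
qed (use S T Q dE_closed in auto)

lemma dE_spectral: "spectral_measure borel \<HH> dE"
  unfolding spectral_measure_def
proof (intro conjI ballI allI impI)
  show "dE S \<in> projections \<HH>" if S: "S \<in> sets borel" for S
  proof (rule HS.projI[OF dE_op[OF S] _ dE_selfadj[OF S]])
    show "dE S (dE S Q) = dE S Q" if "Q \<in> carrier \<HH>" for Q using dE_Int[OF S S that] by simp
  qed
  show "dE (space borel) = (\<lambda>x\<in>carrier \<HH>. x)"
    using HS.op_ext[OF dE_op[of UNIV] HS.opid_closed] dE_UNIV unfolding HS.opid_def by simp
  show "dE (S \<inter> T) = compose (carrier \<HH>) (dE S) (dE T)" if "S \<in> sets borel" "T \<in> sets borel" for S T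
    by (rule HS.op_ext) (use that dE_op dE_Int in auto)
qed (rule dE_sums)

end

section \<open>Double operator integrals of tensor products and of their series\<close>

lemma bmeas_tensor: assumes "bmeas (\<phi> :: real \<Rightarrow> complex)" "bmeas (\<psi> :: real \<Rightarrow> complex)"
  shows "bmeas (\<lambda>(s, t). \<phi> s * \<psi> t)"
proof -
  obtain K L where k: "\<And>x. cmod (\<phi> x) \<le> K" "\<And>x. cmod (\<psi> x) \<le> L" using assms by (auto simp: bmeas_def)
  have [measurable]: "\<phi> \<in> borel_measurable borel" "\<psi> \<in> borel_measurable borel" using assms by (auto simp: bmeas_def)
  have "(\<lambda>p. \<phi> (fst p) * \<psi> (snd p)) \<in> borel_measurable (borel \<Otimes>\<^sub>M borel)" by measurable
  then have m: "(\<lambda>(s, t). \<phi> s * \<psi> t) \<in> borel_measurable borel" by (simp add: borel_prod case_prod_unfold)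
  have "cmod (\<phi> s * \<psi> t) \<le> K * L" for s t unfolding norm_mult
    by (rule mult_mono[OF k]) (use order_trans[OF norm_ge_zero k(1)] in auto)
  then show ?thesis using m by (intro bmeasI) auto
qed

context two_spectral begin

abbreviation "dsm \<equiv> double_spectral_measure H E1 E2"

text \<open>The definition picks a spectral measure by \<open>SOME\<close>, and \<open>dE\<close>
  witnesses that one exists. These two properties are all that is used of it afterwards.\<close>

lemma dsm: "spectral_measure borel \<HH> dsm"
  "\<And>L D Q. \<lbrakk>L \<in> sets borel; D \<in> sets borel; Q \<in> carrier \<HH>\<rbrakk> \<Longrightarrow> dsm (L \<times> D) Q = compose \<H> (E1 L) (compose \<H> Q (E2 D))"
proof -
  have "\<exists>E. spectral_measure borel \<HH> E \<and> (\<forall>L\<in>sets borel. \<forall>D\<in>sets borel. \<forall>Q\<in>carrier \<HH>.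
        E (L \<times> D) Q = compose \<H> (E1 L) (compose \<H> Q (E2 D)))"
    using dE_spectral dE_rect rect_app by (intro exI[of _ dE]) auto
  from someI_ex[OF this, folded double_spectral_measure_def]
  show "spectral_measure borel \<HH> dsm"
    "\<And>L D Q. \<lbrakk>L \<in> sets borel; D \<in> sets borel; Q \<in> carrier \<HH>\<rbrakk> \<Longrightarrow> dsm (L \<times> D) Q = compose \<H> (E1 L) (compose \<H> Q (E2 D))" by auto
qed

sublocale DS: spectral "hilbert_schmidt H" dsm
  by (rule spectral.intro[OF hs_hilbert spectral_axioms.intro[OF dsm(1)]])

lemma DJ_hs: "bmeas \<Phi> \<Longrightarrow> Q \<in> carrier \<HH> \<Longrightarrow> DS.J \<Phi> Q \<in> carrier \<HH>"
  by (rule HS.op_closed[OF DS.J_closed])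

lemma DJ_ip: "\<lbrakk>bmeas \<Phi>; Q \<in> carrier \<HH>; x \<in> \<H>; y \<in> \<H>\<rbrakk> \<Longrightarrow> \<langle>DS.J \<Phi> Q x, y\<rangle> = ip \<HH> (DS.J \<Phi> Q) (rank1 y x)"
  by (rule hs_ip_rank1[symmetric, OF DJ_hs])

lemma DJ_add: "\<lbrakk>bmeas f; bmeas g; Q \<in> carrier \<HH>; x \<in> \<H>; y \<in> \<H>\<rbrakk> \<Longrightarrow>
    \<langle>DS.J (\<lambda>s. f s + g s) Q x, y\<rangle> = \<langle>DS.J f Q x, y\<rangle> + \<langle>DS.J g Q x, y\<rangle>"
  using DJ_ip[of "\<lambda>s. f s + g s" Q x y] DJ_ip[of f Q x y] DJ_ip[of g Q x y] DS.J_add[of f g Q]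
    HS.ip_add_left[OF DJ_hs DJ_hs rank1_hs(1), of f Q g Q y x] by (simp add: bmeas_add)

lemma DJ_mult: "\<lbrakk>bmeas f; Q \<in> carrier \<HH>; x \<in> \<H>; y \<in> \<H>\<rbrakk> \<Longrightarrow>
    \<langle>DS.J (\<lambda>s. c * f s) Q x, y\<rangle> = c * \<langle>DS.J f Q x, y\<rangle>"
  using DJ_ip[of "\<lambda>s. c * f s" Q x y] DJ_ip[of f Q x y] DS.J_mult[of f Q c]
    HS.ip_smult_left[OF DJ_hs rank1_hs(1), of f Q y x c] by (simp add: bmeas_mult bmeas_const)

lemma DJ_lim:
  assumes "\<And>n. bmeas (F n)" "\<And>n s. cmod (F n s) \<le> K" "bmeas f" "\<And>s. (\<lambda>n. F n s) \<longlonglongrightarrow> f s"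
    and "Q \<in> carrier \<HH>" "x \<in> \<H>" "y \<in> \<H>"
  shows "(\<lambda>n. \<langle>DS.J (F n) Q x, y\<rangle>) \<longlonglongrightarrow> \<langle>DS.J f Q x, y\<rangle>"
  using DS.J_lim[OF assms(1-5) rank1_hs(1)[OF assms(7,6)]] assms by (simp add: DJ_ip)

text \<open>Induction on each factor in turn, starting from two indicators, where the formula is the
  defining property on rectangles. The weak formulation lets bounded pointwise limits pass on both
  sides.\<close>

lemma tensor_formula:
  assumes p: "bmeas \<phi>" and q: "bmeas \<psi>" and Q: "Q \<in> carrier \<HH>" and x: "x \<in> \<H>" and y: "y \<in> \<H>"
  shows "\<langle>DS.J (\<lambda>(s, t). \<phi> s * \<psi> t) Q x, y\<rangle> = \<langle>s1.J \<phi> (Q (s2.J \<psi> x)), y\<rangle>"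
proof -
  note QB = hsD(1)[OF Q]
  have 1: "\<langle>DS.J (\<lambda>(s, t). \<phi> s * indicator D t) Q x, y\<rangle> = \<langle>s1.J \<phi> (Q (E2 D x)), y\<rangle>" if D: "D \<in> sets borel" for D
    using p
  proof (induction rule: bmeas_induct)
    case (ind L)
    have e: "(\<lambda>(s, t). indicator L s * indicator D t :: complex) = indicator (L \<times> D)" by (auto simp: indicator_def)
    have m: "L \<times> D \<in> sets borel" using ind D by (intro rects_borel) (auto simp: rects_def)
    show ?case unfolding e DS.J_ind[OF m] dsm(2)[OF ind D Q] s1.J_ind[OF ind]
      using x spec_op[OF s2.E D] by simp
  next
    case (add f g)
    have e: "(\<lambda>(s, t). (f s + g s) * indicator D t :: complex) = (\<lambda>p. (case p of (s, t) \<Rightarrow> f s * indicator D t) + (case p of (s, t) \<Rightarrow> g s * indicator D t))"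
      by (auto simp: algebra_simps)
    show ?case unfolding e using add D Q x y QB spec_op[OF s2.E D]
      by (subst DJ_add) (auto intro: bmeas_tensor bmeas_ind simp: s1.J_add ips op_closed[OF s1.J_closed])
  next
    case (mult c f)
    have e: "(\<lambda>(s, t). (c * f s) * indicator D t :: complex) = (\<lambda>p. c * (case p of (s, t) \<Rightarrow> f s * indicator D t))"
      by (auto simp: algebra_simps)
    show ?case unfolding e using mult D Q x y QB spec_op[OF s2.E D]
      by (subst DJ_mult) (auto intro: bmeas_tensor bmeas_ind simp: s1.J_mult ips op_closed[OF s1.J_closed])
  next
    case (lim F f K)
    have K: "K \<ge> 0" using lim(2) norm_ge_zero order_trans by blast
    have A: "(\<lambda>n. \<langle>DS.J (\<lambda>(s, t). F n s * indicator D t) Q x, y\<rangle>) \<longlonglongrightarrow> \<langle>DS.J (\<lambda>(s, t). f s * indicator D t) Q x, y\<rangle>"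
    proof (rule DJ_lim[where K=K])
      show "cmod (case p of (s, t) \<Rightarrow> F n s * indicator D t) \<le> K" for n p
        using lim(2)[of n "fst p"] K by (auto simp: indicator_def case_prod_unfold)
      show "(\<lambda>n. case p of (s, t) \<Rightarrow> F n s * indicator D t) \<longlonglongrightarrow> (case p of (s, t) \<Rightarrow> f s * indicator D t)" for p
        unfolding case_prod_unfold by (intro tendsto_intros lim)
    qed (intro bmeas_tensor bmeas_ind lim D Q x y)+
    have B: "(\<lambda>n. \<langle>s1.J (F n) (Q (E2 D x)), y\<rangle>) \<longlonglongrightarrow> \<langle>s1.J f (Q (E2 D x)), y\<rangle>"
      by (rule s1.J_lim[OF lim(1,2,3,4)]) (use QB spec_op[OF s2.E D] x y in auto)
    show ?case by (rule LIMSEQ_unique[OF A[unfolded lim(5)] B])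
  qed
  obtain L where L: "\<And>s. cmod (\<phi> s) \<le> L" using p by (auto simp: bmeas_def)
  note pJ = s1.J_closed[OF p]
  show ?thesis using q
  proof (induction rule: bmeas_induct)
    case (ind D)
    then show ?case using 1[OF ind] by (simp add: s2.J_ind)
  next
    case (add f g)
    have e: "(\<lambda>(s, t). \<phi> s * (f t + g t) :: complex) = (\<lambda>p. (case p of (s, t) \<Rightarrow> \<phi> s * f t) + (case p of (s, t) \<Rightarrow> \<phi> s * g t))"
      by (auto simp: algebra_simps)
    show ?case unfolding e using add p Q x y QB pJ
      by (subst DJ_add) (auto intro: bmeas_tensor simp: s2.J_add ips opl op_closed[OF s2.J_closed])
  next
    case (mult c f)
    have e: "(\<lambda>(s, t). \<phi> s * (c * f t) :: complex) = (\<lambda>p. c * (case p of (s, t) \<Rightarrow> \<phi> s * f t))"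
      by (auto simp: algebra_simps)
    show ?case unfolding e using mult p Q x y QB pJ
      by (subst DJ_mult) (auto intro: bmeas_tensor simp: s2.J_mult ips opl op_closed[OF s2.J_closed])
  next
    case (lim F f K)
    have A: "(\<lambda>n. \<langle>DS.J (\<lambda>(s, t). \<phi> s * F n t) Q x, y\<rangle>) \<longlonglongrightarrow> \<langle>DS.J (\<lambda>(s, t). \<phi> s * f t) Q x, y\<rangle>"
    proof (rule DJ_lim[where K="L * K"])
      show "cmod (case p of (s, t) \<Rightarrow> \<phi> s * F n t) \<le> L * K" for n p
        unfolding case_prod_unfold norm_mult by (rule mult_mono[OF L lim(2)]) (use order_trans[OF norm_ge_zero L] in auto)
      show "(\<lambda>n. case p of (s, t) \<Rightarrow> \<phi> s * F n t) \<longlonglongrightarrow> (case p of (s, t) \<Rightarrow> \<phi> s * f t)" for p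
        unfolding case_prod_unfold by (intro tendsto_intros lim)
    qed (intro bmeas_tensor p lim Q x y)+
    have B: "(\<lambda>n. \<langle>s2.J (F n) x, hadj Q (hadj (s1.J \<phi>) y)\<rangle>) \<longlonglongrightarrow> \<langle>s2.J f x, hadj Q (hadj (s1.J \<phi>) y)\<rangle>"
      by (rule s2.J_lim[OF lim(1,2,3,4) x]) (use QB pJ y in auto)
    have C: "\<langle>s2.J g x, hadj Q (hadj (s1.J \<phi>) y)\<rangle> = \<langle>s1.J \<phi> (Q (s2.J g x)), y\<rangle>" if "bmeas g" for g
      using s2.J_closed[OF that] x y QB pJ by (simp add: adj_ip)
    show ?case by (rule LIMSEQ_unique[OF A[unfolded lim(5)] B[unfolded C[OF lim(1)] C[OF lim(3)]]])
  qed
qed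

text \<open>Decompose \<open>Q\<close> into rank one pieces built from \<open>\<xi> k\<close> and
  \<open>\<eta> k\<close>. In a test sum, each piece is bounded by Bessel over the tested basis
  vectors and by Cauchy-Schwarz over \<open>n\<close>, which contributes
  \<open>sqrt a * sqrt b\<close>; Cauchy-Schwarz over \<open>k\<close> contributes \<open>c\<close>.
  The bound does not depend on where the series is truncated, and a weak limit removes the
  truncation.\<close>

theorem doi_trace_norm:
  assumes p: "\<And>n::nat. bmeas (\<phi> n)" and q: "\<And>n. bmeas (\<psi> n)" and Phi: "bmeas \<Phi>"
    and a: "\<And>N s. (\<Sum>n<N. (cmod (\<phi> n s))\<^sup>2) \<le> a" and b: "\<And>N s. (\<Sum>n<N. (cmod (\<psi> n s))\<^sup>2) \<le> b"
    and sm: "\<And>s t. (\<lambda>n. \<phi> n s * \<psi> n t) sums \<Phi> (s, t)"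
    and Q: "Q \<in> \<B>" and tr: "trace_norm H Q \<le> ennreal c" and c: "c \<ge> 0"
  shows "DS.J \<Phi> Q \<in> \<B>" "trace_norm H (DS.J \<Phi> Q) \<le> ennreal (sqrt a * sqrt b * c)"
proof -
  have Qh: "Q \<in> carrier \<HH>" using Q trace_class_square_summable[OF Q tr c] by (simp add: hs_simps)
  show JB: "DS.J \<Phi> Q \<in> \<B>" by (rule hsD(1)[OF DJ_hs[OF Phi Qh]])
  have a0: "0 \<le> a" "0 \<le> b" using a[of 0 0] b[of 0 0] by auto
  define G where "G N p = (\<Sum>n<N. \<phi> n (fst p) * \<psi> n (snd p))" for N :: nat and p :: "real \<times> real"
  have t: "bmeas (\<lambda>p. \<phi> n (fst p) * \<psi> n (snd p))" for n using bmeas_tensor[OF p q, of n n] by (simp add: case_prod_unfold)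
  have Gb: "bmeas (G N)" for N unfolding G_def by (intro bmeas_sum t)
  \<comment> \<open>Uniform in \<open>N\<close>, as needed for the passage to the limit in
    \<open>DJ_lim\<close>.\<close>
  have Gle: "cmod (G N p) \<le> sqrt a * sqrt b" for N p
  proof -
    have "cmod (G N p) \<le> (\<Sum>n<N. cmod (\<phi> n (fst p)) * cmod (\<psi> n (snd p)))" unfolding G_def by (rule order_trans[OF norm_sum]) (simp add: norm_mult)
    also have "\<dots> \<le> sqrt a * sqrt b" by (rule cauchy_schwarz_sum_le[OF a b])
    finally show ?thesis .
  qed
  have Gip: "\<langle>DS.J (G N) Q x, y\<rangle> = (\<Sum>n<N. \<langle>s1.J (\<phi> n) (Q (s2.J (\<psi> n) x)), y\<rangle>)" if x: "x \<in> \<H>" and y: "y \<in> \<H>" for N x y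
  proof (induction N)
    case 0
    have "G 0 = (\<lambda>p. 0)" by (auto simp: G_def)
    then show ?case using DJ_mult[OF Gb[of 0] Qh x y, of 0] by simp
  next
    case (Suc N)
    have "G (Suc N) = (\<lambda>p. G N p + \<phi> N (fst p) * \<psi> N (snd p))" by (auto simp: G_def)
    then show ?case using DJ_add[OF Gb t Qh x y, of N N] tensor_formula[OF p q Qh x y, of N N] Suc by (simp add: case_prod_unfold)
  qed
  obtain \<xi> \<eta> where xe: "\<And>e. e \<in> sb \<Longrightarrow> \<xi> e \<in> \<H>" "\<And>e. e \<in> sb \<Longrightarrow> \<eta> e \<in> \<H>"
    "\<And>F. \<lbrakk>finite F; F \<subseteq> sb\<rbrakk> \<Longrightarrow> (\<Sum>e\<in>F. \<parallel>\<xi> e\<parallel>\<^sup>2) \<le> c"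
    "\<And>F. \<lbrakk>finite F; F \<subseteq> sb\<rbrakk> \<Longrightarrow> (\<Sum>e\<in>F. \<parallel>\<eta> e\<parallel>\<^sup>2) \<le> c"
    "\<And>x y. \<lbrakk>x \<in> \<H>; y \<in> \<H>\<rbrakk> \<Longrightarrow> ((\<lambda>e. \<langle>x, \<eta> e\<rangle> * \<langle>\<xi> e, y\<rangle>) has_sum \<langle>Q x, y\<rangle>) sb"
  proof (rule trace_class_rep[OF Q tr c], goal_cases)
    case (1 \<xi> \<eta>)
    show ?case by (rule 1(1)[OF 1(2-6)])
  qed
  note pB = s1.J_closed[OF p] and qB = s2.J_closed[OF q]
  have "trace_bound (DS.J (G N) Q) (sqrt a * sqrt b * c)" for N
    unfolding trace_bound_def
  proof (intro allI impI)
    fix F S assume F: "finite F" "F \<subseteq> sb" and S: "S \<in> \<B>" "\<forall>y\<in>\<H>. \<parallel>S y\<parallel> \<le> \<parallel>y\<parallel>"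
    have FH: "e \<in> \<H>" if "e \<in> F" for e using F that by auto
    \<comment> \<open>The part of the test sum that is due to the \<open>k\<close>-th rank one piece
      of \<open>Q\<close>.\<close>
    define z where "z k = (\<Sum>e\<in>F. \<Sum>n<N. \<langle>s2.J (\<psi> n) e, \<eta> k\<rangle> * \<langle>\<xi> k, hadj (s1.J (\<phi> n)) (S e)\<rangle>)" for k
    have "(\<Sum>e\<in>F. \<langle>DS.J (G N) Q e, S e\<rangle>) = (\<Sum>e\<in>F. \<Sum>n<N. \<langle>Q (s2.J (\<psi> n) e), hadj (s1.J (\<phi> n)) (S e)\<rangle>)"
      using FH S pB qB Q by (simp add: Gip adj_ip)
    moreover have "(z has_sum (\<Sum>e\<in>F. \<Sum>n<N. \<langle>Q (s2.J (\<psi> n) e), hadj (s1.J (\<phi> n)) (S e)\<rangle>)) sb"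
      unfolding z_def by (intro has_sum_finite_sum xe(5)) (use F FH S pB qB in auto)
    ultimately have zs: "(z has_sum (\<Sum>e\<in>F. \<langle>DS.J (G N) Q e, S e\<rangle>)) sb" by simp
    have zk: "cmod (z k) \<le> (sqrt a * sqrt b) * (\<parallel>\<xi> k\<parallel> * \<parallel>\<eta> k\<parallel>)" if k: "k \<in> sb" for k
    proof -
      note xk = xe(1)[OF k] xe(2)[OF k]
      define u where "u n = hadj (s2.J (\<psi> n)) (\<eta> k)" for n
      define v where "v n = s1.J (\<phi> n) (\<xi> k)" for n
      have uv: "u n \<in> \<H>" "v n \<in> \<H>" for n using xk pB qB by (auto simp: u_def v_def)
      have "z k = (\<Sum>n<N. \<Sum>e\<in>F. \<langle>e, u n\<rangle> * \<langle>hadj S (v n), e\<rangle>)"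
        unfolding z_def by (subst sum.swap) (use FH S pB qB xk in \<open>auto simp: adj_ip adj_ip2 u_def v_def intro!: sum.cong\<close>)
      also have "cmod \<dots> \<le> (\<Sum>n<N. cmod (\<Sum>e\<in>F. \<langle>e, u n\<rangle> * \<langle>hadj S (v n), e\<rangle>))" by (rule norm_sum)
      also have "\<dots> \<le> (\<Sum>n<N. \<parallel>u n\<parallel> * \<parallel>v n\<parallel>)"
      proof (rule sum_mono)
        fix n
        have "cmod (\<Sum>e\<in>F. \<langle>e, u n\<rangle> * \<langle>hadj S (v n), e\<rangle>) \<le> (\<Sum>e\<in>F. cmod \<langle>e, u n\<rangle> * cmod \<langle>hadj S (v n), e\<rangle>)"
          by (rule order_trans[OF norm_sum]) (simp add: norm_mult)
        also have "\<dots> \<le> sqrt (\<parallel>u n\<parallel>\<^sup>2) * sqrt (\<parallel>hadj S (v n)\<parallel>\<^sup>2)"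
        proof (rule cauchy_schwarz_sum_le)
          have "(\<Sum>e\<in>F. (cmod \<langle>e, u n\<rangle>)\<^sup>2) = (\<Sum>e\<in>F. (cmod \<langle>u n, e\<rangle>)\<^sup>2)"
            by (rule sum.cong) (use FH uv ip_commute[of "u n"] in auto)
          then show "(\<Sum>e\<in>F. (cmod \<langle>e, u n\<rangle>)\<^sup>2) \<le> \<parallel>u n\<parallel>\<^sup>2"
            using bessel[OF F(1) onset_subset[OF sb_on F(2)] uv(1)[of n]] by simp
          show "(\<Sum>e\<in>F. (cmod \<langle>hadj S (v n), e\<rangle>)\<^sup>2) \<le> \<parallel>hadj S (v n)\<parallel>\<^sup>2"
            using bessel[OF F(1) onset_subset[OF sb_on F(2)], of "hadj S (v n)"] uv S by simp
        qed
        also have "\<dots> \<le> \<parallel>u n\<parallel> * \<parallel>v n\<parallel>"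
          using adj_bound[OF S(1), of 1 "v n"] S uv by (simp add: mult_left_mono)
        finally show "cmod (\<Sum>e\<in>F. \<langle>e, u n\<rangle> * \<langle>hadj S (v n), e\<rangle>) \<le> \<parallel>u n\<parallel> * \<parallel>v n\<parallel>" .
      qed
      also have "\<dots> \<le> sqrt (b * \<parallel>\<eta> k\<parallel>\<^sup>2) * sqrt (a * \<parallel>\<xi> k\<parallel>\<^sup>2)"
      proof (rule cauchy_schwarz_sum_le)
        show "(\<Sum>n<N. \<parallel>v n\<parallel>\<^sup>2) \<le> a * \<parallel>\<xi> k\<parallel>\<^sup>2" unfolding v_def by (rule s1.J_square_sum[OF p a xk(1)])
        show "(\<Sum>n<N. \<parallel>u n\<parallel>\<^sup>2) \<le> b * \<parallel>\<eta> k\<parallel>\<^sup>2" unfolding u_def s2.J_cnj[OF q, symmetric]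
          by (rule s2.J_square_sum[OF bmeas_cnj[OF q] _ xk(2)]) (simp add: b)
      qed
      also have "\<dots> = (sqrt a * sqrt b) * (\<parallel>\<xi> k\<parallel> * \<parallel>\<eta> k\<parallel>)" using xk by (simp add: real_sqrt_mult)
      finally show ?thesis .
    qed
    show "cmod (\<Sum>e\<in>F. \<langle>DS.J (G N) Q e, S e\<rangle>) \<le> sqrt a * sqrt b * c"
    proof (rule norm_has_sum_le[OF zs])
      fix K assume K: "finite K" "K \<subseteq> sb"
      have "(\<Sum>k\<in>K. cmod (z k)) \<le> (\<Sum>k\<in>K. (sqrt a * sqrt b) * (\<parallel>\<xi> k\<parallel> * \<parallel>\<eta> k\<parallel>))" by (rule sum_mono) (use zk K in auto)
      also have "\<dots> = (sqrt a * sqrt b) * (\<Sum>k\<in>K. \<parallel>\<xi> k\<parallel> * \<parallel>\<eta> k\<parallel>)" by (simp add: sum_distrib_left)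
      also have "\<dots> \<le> (sqrt a * sqrt b) * (sqrt c * sqrt c)"
        by (intro mult_left_mono cauchy_schwarz_sum_le xe(3,4)) (use a0 K in auto)
      finally show "(\<Sum>k\<in>K. cmod (z k)) \<le> sqrt a * sqrt b * c" using c by simp
    qed
  qed
  then have "trace_bound (DS.J \<Phi> Q) (sqrt a * sqrt b * c)"
  proof (rule trace_bound_limit)
    show "(\<lambda>N. \<langle>DS.J (G N) Q x, y\<rangle>) \<longlonglongrightarrow> \<langle>DS.J \<Phi> Q x, y\<rangle>" if "x \<in> \<H>" "y \<in> \<H>" for x y
    proof (rule DJ_lim[OF Gb Gle Phi _ Qh that])
      fix s show "(\<lambda>N. G N s) \<longlonglongrightarrow> \<Phi> s" using sm[of "fst s" "snd s"] by (simp add: sums_def G_def)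
    qed
  qed
  then show "trace_norm H (DS.J \<Phi> Q) \<le> ennreal (sqrt a * sqrt b * c)" by (rule trace_bound_trace_norm[OF JB])
qed

end

subsection \<open>Bounded analytic functions in the half-plane\<close>

lemma open_upper_hp: "open upper_hp"
  unfolding upper_hp_def by (rule open_halfspace_Im_gt)

lemma upper_subset_closed: "upper_hp \<subseteq> closed_upper_hp"
  by (auto simp: upper_hp_def closed_upper_hp_def)

lemma of_real_closed_upper [simp]: "of_real x \<in> closed_upper_hp"
  by (simp add: closed_upper_hp_def)

lemma CA_inf_holo: "f \<in> CA_inf \<Longrightarrow> f holomorphic_on upper_hp"
  and CA_inf_cont: "f \<in> CA_inf \<Longrightarrow> continuous_on closed_upper_hp f"
  by (auto simp: CA_inf_def)

lemma CA_inf_bound: assumes "f \<in> CA_inf" obtains K where "K > 0" "\<And>z. z \<in> closed_upper_hp \<Longrightarrow> cmod (f z) \<le> K"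
  using assms unfolding CA_inf_def bounded_pos by auto

lemma CA_infI: "\<lbrakk>f holomorphic_on upper_hp; continuous_on closed_upper_hp f; \<And>z. z \<in> closed_upper_hp \<Longrightarrow> cmod (f z) \<le> K\<rbrakk> \<Longrightarrow> f \<in> CA_inf"
  unfolding CA_inf_def bounded_iff by auto

lemma CA_inf_const: "(\<lambda>z. c) \<in> CA_inf"
  by (rule CA_infI[where K="cmod c"]) auto

lemma CA_inf_add: assumes "f \<in> CA_inf" "g \<in> CA_inf" shows "(\<lambda>z. f z + g z) \<in> CA_inf"
proof -
  obtain K where K: "\<And>z. z \<in> closed_upper_hp \<Longrightarrow> cmod (f z) \<le> K" using CA_inf_bound[OF assms(1)] by metis
  obtain L where L: "\<And>z. z \<in> closed_upper_hp \<Longrightarrow> cmod (g z) \<le> L" using CA_inf_bound[OF assms(2)] by metis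
  show ?thesis
    by (rule CA_infI[OF holomorphic_on_add[OF assms[THEN CA_inf_holo]] continuous_on_add[OF assms[THEN CA_inf_cont]]])
       (rule norm_triangle_mono[OF K L])
qed

lemma CA_inf_mult: assumes "f \<in> CA_inf" "g \<in> CA_inf" shows "(\<lambda>z. f z * g z) \<in> CA_inf"
proof -
  obtain K where K: "K > 0" "\<And>z. z \<in> closed_upper_hp \<Longrightarrow> cmod (f z) \<le> K" using CA_inf_bound[OF assms(1)] by metis
  obtain L where L: "\<And>z. z \<in> closed_upper_hp \<Longrightarrow> cmod (g z) \<le> L" using CA_inf_bound[OF assms(2)] by metis
  have "cmod (f z * g z) \<le> K * L" if "z \<in> closed_upper_hp" for z
    unfolding norm_mult using that K L by (intro mult_mono) auto
  then show ?thesis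
    by (rule CA_infI[OF holomorphic_on_mult[OF assms[THEN CA_inf_holo]] continuous_on_mult[OF assms[THEN CA_inf_cont]]])
qed

lemma CA_inf_sum: "(\<And>i. i \<in> I \<Longrightarrow> f i \<in> CA_inf) \<Longrightarrow> (\<lambda>z. \<Sum>i\<in>I. f i z) \<in> CA_inf"
  by (induction I rule: infinite_finite_induct) (auto intro: CA_inf_const CA_inf_add)

lemma CA_inf_diff: assumes "f \<in> CA_inf" "g \<in> CA_inf" shows "(\<lambda>z. f z - g z) \<in> CA_inf"
  using CA_inf_add[OF assms(1) CA_inf_mult[OF CA_inf_const[of "-1"] assms(2)]] by simp

lemma CA_inf_approx:
  assumes "\<And>e. e > 0 \<Longrightarrow> \<exists>g\<in>CA_inf. \<forall>z\<in>closed_upper_hp. cmod (g z - f z) < e"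
  shows "f \<in> CA_inf"
proof -
  have "\<exists>g\<in>CA_inf. \<forall>z\<in>closed_upper_hp. cmod (g z - f z) < 1 / real (Suc n)" for n by (rule assms) simp
  then obtain g where g: "\<And>n. g n \<in> CA_inf" "\<And>n z. z \<in> closed_upper_hp \<Longrightarrow> cmod (g n z - f z) < 1 / real (Suc n)" by metis
  have ul: "uniform_limit closed_upper_hp g f sequentially"
  proof (rule uniform_limitI)
    fix e :: real assume "e > 0"
    then obtain N where N: "1 / real (Suc N) < e" using nat_approx_posE by blast
    have "dist (g n z) (f z) < e" if "n \<ge> N" "z \<in> closed_upper_hp" for n z
    proof -
      have "cmod (g n z - f z) < 1 / real (Suc n)" by (rule g(2)[OF that(2)])
      also have "\<dots> \<le> 1 / real (Suc N)" using that(1) by (intro divide_left_mono) auto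
      finally show ?thesis using N by (simp add: dist_norm)
    qed
    then show "\<forall>\<^sub>F n in sequentially. \<forall>z\<in>closed_upper_hp. dist (g n z) (f z) < e"
      by (auto simp: eventually_sequentially)
  qed
  obtain K where K: "\<And>z. z \<in> closed_upper_hp \<Longrightarrow> cmod (g 0 z) \<le> K" using CA_inf_bound[OF g(1)] by metis
  show ?thesis
  proof (rule CA_infI[where K="K + 1"])
    show "f holomorphic_on upper_hp"
    proof (rule holomorphic_uniform_sequence[OF open_upper_hp CA_inf_holo[OF g(1)]])
      fix z assume "z \<in> upper_hp"
      then obtain d where d: "d > 0" "cball z d \<subseteq> upper_hp" using open_upper_hp open_contains_cball by blast
      then have "uniform_limit (cball z d) g f sequentially"
        using uniform_limit_on_subset[OF ul] upper_subset_closed by blast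
      then show "\<exists>d>0. cball z d \<subseteq> upper_hp \<and> uniform_limit (cball z d) g f sequentially" using d by blast
    qed
    show "continuous_on closed_upper_hp f"
      by (rule uniform_limit_theorem[OF _ ul]) (auto intro!: always_eventually CA_inf_cont g(1))
    fix z assume z: "z \<in> closed_upper_hp"
    have "cmod (f z) \<le> cmod (g 0 z) + cmod (g 0 z - f z)" by (metis norm_triangle_sub norm_minus_commute)
    then show "cmod (f z) \<le> K + 1" using K[OF z] g(2)[OF z, of 0] by simp
  qed
qed

text \<open>The map \<open>z \<mapsto> - cnj z\<close> reflects the half-plane in the imaginary
  axis, and conjugating the value restores analyticity. In this way analyticity of
  \<open>\<langle>u, v w\<rangle>\<close> in \<open>w\<close> becomes a statement about vectors
  \<open>v\<close> placed in the linear slot.\<close>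

definition reflect :: "(complex \<Rightarrow> complex) \<Rightarrow> complex \<Rightarrow> complex" where
  "reflect f z = cnj (f (- cnj z))"

lemma CA_inf_reflect: assumes f: "f \<in> CA_inf" shows "reflect f \<in> CA_inf"
proof -
  obtain K where K: "\<And>z. z \<in> closed_upper_hp \<Longrightarrow> cmod (f z) \<le> K" using CA_inf_bound[OF f] by metis
  have c: "- cnj z \<in> closed_upper_hp" if "z \<in> closed_upper_hp" for z using that by (simp add: closed_upper_hp_def)
  have "(\<lambda>w. f (- w)) holomorphic_on cnj ` upper_hp"
    by (rule holomorphic_on_compose_gen[OF _ CA_inf_holo[OF f], of uminus, unfolded o_def])
       (auto intro!: holomorphic_intros simp: upper_hp_def)
  then have "cnj \<circ> (\<lambda>w. f (- w)) \<circ> cnj holomorphic_on upper_hp"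
    by (rule holomorphic_on_compose_cnj_cnj[OF _ open_upper_hp])
  moreover have "cnj \<circ> (\<lambda>w. f (- w)) \<circ> cnj = reflect f" by (auto simp: reflect_def)
  ultimately have h: "reflect f holomorphic_on upper_hp" by simp
  have "continuous_on closed_upper_hp (\<lambda>z. f (- cnj z))"
    by (rule continuous_on_compose2[OF CA_inf_cont[OF f]]) (auto intro!: continuous_intros c)
  then have "continuous_on closed_upper_hp (reflect f)" unfolding reflect_def by (intro continuous_intros)
  then show ?thesis by (rule CA_infI[OF h]) (use K c in \<open>auto simp: reflect_def\<close>)
qed

text \<open>The half-plane is unbounded and \<open>f\<close> may fail to have a limit at infinity.
  Multiplication by \<open>\<i> / (\<i> + of_real e * z)\<close>, which has modulus at most 1 on the
  closed half-plane and decays at infinity, reduces the claim to a large half-disc; then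
  \<open>e\<close> tends to 0.\<close>

lemma max_principle_real:
  assumes f: "f \<in> CA_inf" and M: "\<And>x::real. cmod (f (of_real x)) \<le> M" and z0: "z0 \<in> closed_upper_hp"
  shows "cmod (f z0) \<le> M"
proof -
  have M0: "M \<ge> 0" using M[of 0] norm_ge_zero order_trans by blast
  obtain K where K: "K > 0" "\<And>z. z \<in> closed_upper_hp \<Longrightarrow> cmod (f z) \<le> K" using CA_inf_bound[OF f] by metis
  have main: "cmod (f z0) \<le> (M + e) * (1 + e * cmod z0)" if e: "e > 0" for e
  proof (cases "z0 \<in> upper_hp")
    case False
    then have "z0 = of_real (Re z0)" using z0 by (auto simp: upper_hp_def closed_upper_hp_def complex_eq_iff)
    then have "cmod (f z0) \<le> M * 1" using M[of "Re z0"] by simp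
    also have "\<dots> \<le> (M + e) * (1 + e * cmod z0)" using e M0 by (intro mult_mono) auto
    finally show ?thesis .
  next
    case True
    have Me: "M + e > 0" using M0 e by simp
    define q where "q = K / (M + e)"
    have q: "q > 0" using K(1) Me by (simp add: q_def)
    \<comment> \<open>So large that on the arc of radius \<open>R\<close> the factor
      \<open>k\<close> is at most \<open>(M + e) / K\<close>, which compensates the global bound
      \<open>K\<close> of \<open>f\<close>.\<close>
    define R where "R = cmod z0 + (q + 1) / e"
    have "e * R = e * cmod z0 + (q + 1)" using e by (simp add: R_def field_simps)
    then have R: "cmod z0 < R" "e * R \<ge> K / (M + e) + 1"
      using e q by (auto simp: R_def q_def[symmetric])
    define S where "S = upper_hp \<inter> ball 0 R"
    have oS: "open S" unfolding S_def by (intro open_Int open_upper_hp open_ball)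
    have clS: "closure S \<subseteq> closed_upper_hp \<inter> cball 0 R"
    proof (rule closure_minimal)
      show "S \<subseteq> closed_upper_hp \<inter> cball 0 R" using upper_subset_closed by (auto simp: S_def)
      show "closed (closed_upper_hp \<inter> cball 0 R)" unfolding closed_upper_hp_def by (intro closed_Int closed_halfspace_Im_ge closed_cball)
    qed
    define k where "k z = \<i> / (\<i> + of_real e * z)" for z
    have den: "cmod (\<i> + of_real e * z) \<ge> 1" if "z \<in> closed_upper_hp" for z
    proof -
      have "Im (\<i> + of_real e * z) \<ge> 1" using that e by (simp add: closed_upper_hp_def)
      then show ?thesis using abs_Im_le_cmod[of "\<i> + of_real e * z"] by linarith
    qed
    have nz: "\<i> + of_real e * z \<noteq> 0" if "z \<in> closed_upper_hp" for z using den[OF that] by auto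
    have k1: "cmod (k z) \<le> 1" if "z \<in> closed_upper_hp" for z
      using den[OF that] by (simp add: k_def norm_divide divide_le_eq_1)
    have "cmod (f z0 * k z0) \<le> M + e"
    proof (rule maximum_modulus_frontier[where S=S and f="\<lambda>z. f z * k z"])
      have SU: "S \<subseteq> upper_hp" by (auto simp: S_def)
      show "(\<lambda>z. f z * k z) holomorphic_on interior S" unfolding interior_open[OF oS] k_def
        using SU nz upper_subset_closed by (intro holomorphic_intros holomorphic_on_subset[OF CA_inf_holo[OF f]]) auto
      show "continuous_on (closure S) (\<lambda>z. f z * k z)" unfolding k_def
        using clS nz by (intro continuous_intros continuous_on_subset[OF CA_inf_cont[OF f]]) auto
      show "bounded S" unfolding S_def by (rule bounded_subset[OF bounded_ball]) auto
      show "z0 \<in> S" using True R by (auto simp: S_def)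
      fix z assume "z \<in> frontier S"
      then have z: "z \<in> closed_upper_hp" "cmod z \<le> R" "z \<notin> S" using clS by (auto simp: frontier_def interior_open[OF oS])
      show "cmod (f z * k z) \<le> M + e"
      proof (cases "Im z = 0")
        case True
        then have "z = of_real (Re z)" by (simp add: complex_eq_iff)
        then have "cmod (f z) \<le> M" using M[of "Re z"] by simp
        then have "cmod (f z) * cmod (k z) \<le> M * 1" using k1[OF z(1)] M0 by (intro mult_mono) auto
        then show ?thesis using e by (simp add: norm_mult)
      next
        case False
        then have zR: "cmod z = R" using z by (auto simp: S_def upper_hp_def closed_upper_hp_def)
        have "cmod (of_real e * z) \<le> cmod (\<i> + of_real e * z) + cmod \<i>" using norm_triangle_ineq4[of "\<i> + of_real e * z" "\<i>"] by simp
        then have d: "cmod (\<i> + of_real e * z) \<ge> K / (M + e)" using R(2) zR e by (simp add: norm_mult)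
        have "cmod (f z) * cmod (k z) \<le> K * ((M + e) / K)"
        proof (intro mult_mono K z norm_ge_zero)
          have "cmod (k z) = 1 / cmod (\<i> + of_real e * z)" by (simp add: k_def norm_divide)
          also have "\<dots> \<le> 1 / (K / (M + e))" using d K(1) Me nz[OF z(1)] by (intro divide_left_mono mult_pos_pos divide_pos_pos) auto
          finally show "cmod (k z) \<le> (M + e) / K" by simp
        qed (use K in auto)
        then show ?thesis using K(1) by (simp add: norm_mult)
      qed
    qed
    then have "cmod (f z0) \<le> (M + e) * cmod (\<i> + of_real e * z0)"
      using nz[OF z0] by (simp add: norm_mult k_def norm_divide pos_divide_le_eq)
    also have "\<dots> \<le> (M + e) * (1 + e * cmod z0)"
      using norm_triangle_ineq[of \<i> "of_real e * z0"] e Me by (intro mult_left_mono) (auto simp: norm_mult)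
    finally show ?thesis .
  qed
  have "(\<lambda>n. (M + 1 / real (Suc n)) * (1 + 1 / real (Suc n) * cmod z0)) \<longlonglongrightarrow> (M + 0) * (1 + 0 * cmod z0)"
    by (intro tendsto_intros LIMSEQ_inverse_real_of_nat[unfolded inverse_eq_divide])
  then have "cmod (f z0) \<le> (M + 0) * (1 + 0 * cmod z0)"
  proof (rule LIMSEQ_le_const)
    have "cmod (f z0) \<le> (M + 1 / real (Suc n)) * (1 + 1 / real (Suc n) * cmod z0)" for n by (rule main) simp
    then show "\<exists>N. \<forall>n\<ge>N. cmod (f z0) \<le> (M + 1 / real (Suc n)) * (1 + 1 / real (Suc n) * cmod z0)" by blast
  qed
  then show ?thesis by simp
qed

lemma max_principle:
  assumes f: "f \<in> CA_inf" and D: "closure D = (UNIV :: real set)" and M: "\<And>x. x \<in> D \<Longrightarrow> cmod (f (of_real x)) \<le> M"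
    and z: "z \<in> closed_upper_hp"
  shows "cmod (f z) \<le> M"
proof (rule max_principle_real[OF f _ z])
  fix x :: real
  have c: "continuous_on UNIV (\<lambda>x::real. cmod (f (of_real x)))"
    by (intro continuous_intros continuous_on_compose2[OF CA_inf_cont[OF f]]) auto
  then have "closed ((\<lambda>x::real. cmod (f (of_real x))) -` {..M})" by (simp add: closed_vimage)
  then have "closure D \<subseteq> (\<lambda>x::real. cmod (f (of_real x))) -` {..M}" by (rule closure_minimal[rotated]) (use M in auto)
  then show "cmod (f (of_real x)) \<le> M" using D by auto
qed

lemma CA_inf_unique:
  assumes "f \<in> CA_inf" "g \<in> CA_inf" and D: "closure D = (UNIV :: real set)" and eq: "\<And>x. x \<in> D \<Longrightarrow> f (of_real x) = g (of_real x)"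
    and z: "z \<in> closed_upper_hp"
  shows "f z = g z"
  using max_principle[OF CA_inf_diff[OF assms(1,2)] D _ z, of 0] eq by simp

subsection \<open>Haagerup tensor products are separately analytic\<close>

text \<open>Cauchy-Schwarz on the tail, with the fixed bound \<open>A\<close> spent on
  \<open>a\<close> and the small remainder on \<open>b\<close>. The estimate is uniform over all
  \<open>a\<close> with this bound, hence it gives uniform convergence in
  \<open>CA_inf_l2_series\<close>.\<close>

lemma l2_tail:
  fixes a b :: "nat \<Rightarrow> complex"
  assumes a: "\<And>N. (\<Sum>n<N. (cmod (a n))\<^sup>2) \<le> A" and b: "summable (\<lambda>n. (cmod (b n))\<^sup>2)" and s: "(\<lambda>n. a n * b n) sums s"
  shows "cmod (s - (\<Sum>n<N. a n * b n)) \<le> sqrt A * sqrt ((\<Sum>n. (cmod (b n))\<^sup>2) - (\<Sum>n<N. (cmod (b n))\<^sup>2))"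
proof -
  have "(\<lambda>m. cmod ((\<Sum>n<m. a n * b n) - (\<Sum>n<N. a n * b n))) \<longlonglongrightarrow> cmod (s - (\<Sum>n<N. a n * b n))"
    using s unfolding sums_def by (intro tendsto_intros)
  then show ?thesis
  proof (rule LIMSEQ_le_const2, intro exI[of _ N] allI impI)
    fix m assume m: "N \<le> m"
    have split: "(\<Sum>n<m. h n) - (\<Sum>n<N. h n) = (\<Sum>n\<in>{N..<m}. h n)" for h :: "nat \<Rightarrow> 'x::ab_group_add"
      using sum.atLeastLessThan_concat[of 0 N m h] m unfolding lessThan_atLeast0 by (metis add_diff_cancel_left' zero_le)
    have "cmod ((\<Sum>n<m. a n * b n) - (\<Sum>n<N. a n * b n)) \<le> (\<Sum>n\<in>{N..<m}. cmod (a n) * cmod (b n))"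
      unfolding split by (rule order_trans[OF norm_sum]) (simp add: norm_mult)
    also have "\<dots> \<le> sqrt A * sqrt ((\<Sum>n. (cmod (b n))\<^sup>2) - (\<Sum>n<N. (cmod (b n))\<^sup>2))"
    proof (rule cauchy_schwarz_sum_le)
      have "(\<Sum>n\<in>{N..<m}. (cmod (a n))\<^sup>2) \<le> (\<Sum>n<m. (cmod (a n))\<^sup>2)" by (rule sum_mono2) auto
      then show "(\<Sum>n\<in>{N..<m}. (cmod (a n))\<^sup>2) \<le> A" using a[of m] by simp
      show "(\<Sum>n\<in>{N..<m}. (cmod (b n))\<^sup>2) \<le> (\<Sum>n. (cmod (b n))\<^sup>2) - (\<Sum>n<N. (cmod (b n))\<^sup>2)"
        unfolding split[symmetric] using sum_le_suminf[OF b, of "{..<m}"] by simp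
    qed
    finally show "cmod ((\<Sum>n<m. a n * b n) - (\<Sum>n<N. a n * b n)) \<le> sqrt A * sqrt ((\<Sum>n. (cmod (b n))\<^sup>2) - (\<Sum>n<N. (cmod (b n))\<^sup>2))" .
  qed
qed

lemma CA_inf_l2_series:
  assumes \<phi>: "\<And>n. \<phi> n \<in> CA_inf" and A: "\<And>z N. z \<in> closed_upper_hp \<Longrightarrow> (\<Sum>n<N. (cmod (\<phi> n z))\<^sup>2) \<le> A"
    and b: "summable (\<lambda>n. (cmod (b n))\<^sup>2)" and s: "\<And>z. z \<in> closed_upper_hp \<Longrightarrow> (\<lambda>n. \<phi> n z * b n) sums f z"
  shows "f \<in> CA_inf"
proof (rule CA_inf_approx)
  fix e :: real assume e: "e > 0"
  have A0: "A \<ge> 0" using A[of 0 0] by (simp add: closed_upper_hp_def)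
  have "(\<lambda>N. sqrt A * sqrt ((\<Sum>n. (cmod (b n))\<^sup>2) - (\<Sum>n<N. (cmod (b n))\<^sup>2))) \<longlonglongrightarrow> sqrt A * sqrt ((\<Sum>n. (cmod (b n))\<^sup>2) - (\<Sum>n. (cmod (b n))\<^sup>2))"
    by (intro tendsto_intros summable_LIMSEQ b)
  then have "\<forall>\<^sub>F N in sequentially. sqrt A * sqrt ((\<Sum>n. (cmod (b n))\<^sup>2) - (\<Sum>n<N. (cmod (b n))\<^sup>2)) < e"
    by (rule order_tendstoD(2)) (use e in simp)
  then obtain N where N: "sqrt A * sqrt ((\<Sum>n. (cmod (b n))\<^sup>2) - (\<Sum>n<N. (cmod (b n))\<^sup>2)) < e" by (auto simp: eventually_sequentially)
  show "\<exists>g\<in>CA_inf. \<forall>z\<in>closed_upper_hp. cmod (g z - f z) < e"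
  proof (intro bexI ballI)
    show "(\<lambda>z. \<Sum>n<N. \<phi> n z * b n) \<in> CA_inf" by (intro CA_inf_sum CA_inf_mult \<phi> CA_inf_const)
    fix z assume z: "z \<in> closed_upper_hp"
    show "cmod ((\<Sum>n<N. \<phi> n z * b n) - f z) < e"
      using l2_tail[of "\<lambda>n. \<phi> n z", OF A[OF z] b s[OF z], of N] N by (simp add: norm_minus_commute)
  qed
qed

text \<open>Cauchy's estimate for the derivative on discs of radius \<open>r/4\<close>, which lie in
  the full ball when they are centred in the half ball. This is the origin of the constant
  4.\<close>

lemma holomorphic_lipschitz:
  assumes r: "r > 0" and h: "h holomorphic_on ball z r" and M: "\<And>u. u \<in> ball z r \<Longrightarrow> cmod (h u) \<le> M" and u: "u \<in> ball z (r/2)"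
  shows "cmod (h u - h z) \<le> (4 * M / r) * cmod (u - z)"
proof (rule field_differentiable_bound[of "ball z (r/2)" h "deriv h"])
  fix w assume w: "w \<in> ball z (r/2)"
  have sub: "cball w (r/4) \<subseteq> ball z r"
  proof
    fix v assume "v \<in> cball w (r/4)"
    then show "v \<in> ball z r" using w r dist_triangle[of z v w] by (auto simp: dist_commute)
  qed
  have wz: "w \<in> ball z r" using w r by auto
  show "(h has_field_derivative deriv h w) (at w within ball z (r/2))"
    by (rule has_field_derivative_at_within[OF holomorphic_derivI[OF h open_ball wz]])
  have "cmod ((deriv ^^ 1) h w) \<le> fact 1 * M / (r/4) ^ 1"
  proof (rule Cauchy_inequality)
    show "h holomorphic_on ball w (r/4)" by (rule holomorphic_on_subset[OF h]) (use sub in auto)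
    show "continuous_on (cball w (r/4)) h"
      by (rule holomorphic_on_imp_continuous_on[OF holomorphic_on_subset[OF h sub]])
    show "cmod (h x) \<le> M" if "cmod (w - x) = r/4" for x
      by (rule M) (use sub that in \<open>auto simp: dist_norm subset_iff\<close>)
  qed (use r in auto)
  then show "cmod (deriv h w) \<le> 4 * M / r" by (simp add: field_simps)
qed (use u r in auto)

text \<open>Under a uniform bound the mixed second difference is quadratically small: the Lipschitz
  estimate applies once in each variable, the second time to a difference that is already small by
  the first.\<close>

lemma separately_holomorphic:
  assumes h1: "\<And>w. w \<in> upper_hp \<Longrightarrow> (\<lambda>z. \<Phi> (z, w)) holomorphic_on upper_hp"
    and h2: "\<And>z. z \<in> upper_hp \<Longrightarrow> (\<lambda>w. \<Phi> (z, w)) holomorphic_on upper_hp"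
    and M: "\<And>z w. z \<in> upper_hp \<Longrightarrow> w \<in> upper_hp \<Longrightarrow> cmod (\<Phi> (z, w)) \<le> M"
  shows "holomorphic2_on \<Phi> (upper_hp \<times> upper_hp)"
  unfolding holomorphic2_on_def
proof
  fix p assume "p \<in> upper_hp \<times> upper_hp"
  then obtain z0 w0 where p: "p = (z0, w0)" "z0 \<in> upper_hp" "w0 \<in> upper_hp" by auto
  obtain r1 where r1: "r1 > 0" "ball z0 r1 \<subseteq> upper_hp" using open_upper_hp p(2) open_contains_ball by blast
  obtain r2 where r2: "r2 > 0" "ball w0 r2 \<subseteq> upper_hp" using open_upper_hp p(3) open_contains_ball by blast
  define r where "r = min r1 r2"
  have r: "r > 0" "ball z0 r \<subseteq> upper_hp" "ball w0 r \<subseteq> upper_hp" using r1 r2 by (auto simp: r_def)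
  have M0: "M \<ge> 0" using M[OF p(2,3)] norm_ge_zero order_trans by blast
  \<comment> \<open>The mixed second difference at \<open>p\<close>. Up to \<open>R\<close>, the
    function \<open>\<Phi>\<close> is a sum of functions of one variable and a constant, and
    \<open>R\<close> has derivative zero at \<open>p\<close>.\<close>
  define R where "R q = \<Phi> q - \<Phi> (fst q, w0) - \<Phi> (z0, snd q) + \<Phi> (z0, w0)" for q
  define C where "C = 4 * (4 * M / r) / r"
  have C0: "C \<ge> 0" using M0 r by (simp add: C_def)
  have Rb: "cmod (R q) \<le> C * (norm (q - p))\<^sup>2" if q: "q \<in> ball p (r/2)" for q
  proof -
    obtain z w where qz: "q = (z, w)" by (cases q)
    have d: "dist z z0 \<le> norm (q - p)" "dist w w0 \<le> norm (q - p)"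
      unfolding qz p dist_norm using norm_fst_le[of "z - z0" "w - w0"] norm_snd_le[of "w - w0" "z - z0"] by auto
    have n: "norm (q - p) < r/2" using q by (simp add: dist_norm norm_minus_commute)
    have zb: "z \<in> ball z0 (r/2)" and wb: "w \<in> ball w0 (r/2)" using d n by (auto simp: dist_commute)
    have wU: "w \<in> upper_hp" using wb r by (auto simp: subset_iff)
    have "cmod ((\<Phi> (z, w) - \<Phi> (z, w0)) - (\<Phi> (z0, w) - \<Phi> (z0, w0))) \<le> (4 * ((4 * M / r) * cmod (w - w0)) / r) * cmod (z - z0)"
    proof (rule holomorphic_lipschitz[OF r(1), of "\<lambda>z. \<Phi> (z, w) - \<Phi> (z, w0)"])
      show "(\<lambda>z. \<Phi> (z, w) - \<Phi> (z, w0)) holomorphic_on ball z0 r"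
        by (intro holomorphic_intros holomorphic_on_subset[OF h1 r(2)] wU p)
      fix v assume "v \<in> ball z0 r"
      then have v: "v \<in> upper_hp" using r by blast
      show "cmod (\<Phi> (v, w) - \<Phi> (v, w0)) \<le> (4 * M / r) * cmod (w - w0)"
        by (rule holomorphic_lipschitz[OF r(1), of "\<lambda>w. \<Phi> (v, w)"])
           (use v r M wb in \<open>auto intro!: holomorphic_on_subset[OF h2 r(3)]\<close>)
    qed (rule zb)
    also have "\<dots> = C * (cmod (w - w0) * cmod (z - z0))" by (simp add: C_def)
    also have "\<dots> \<le> C * (norm (q - p) * norm (q - p))"
      using d C0 by (intro mult_left_mono mult_mono) (auto simp: dist_norm)
    finally show ?thesis by (simp add: R_def qz algebra_simps power2_eq_square)
  qed
  have Rp: "R p = 0" by (simp add: R_def p)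
  have dR: "(R has_derivative (\<lambda>_. 0)) (at p)"
  proof (rule has_derivativeI[OF bounded_linear_zero])
    have "((\<lambda>q. C * norm (q - p)) \<longlongrightarrow> C * norm (p - p)) (at p)" by (intro tendsto_intros)
    then have l: "((\<lambda>q. C * norm (q - p)) \<longlongrightarrow> 0) (at p)" by simp
    show "((\<lambda>q. ((R q - R p) - 0) /\<^sub>R norm (q - p)) \<longlongrightarrow> 0) (at p)"
    proof (rule Lim_null_comparison[OF _ l])
      have "\<forall>\<^sub>F q in at p. q \<in> ball p (r/2) \<and> q \<noteq> p"
        unfolding eventually_at using r by (intro exI[of _ "r/2"]) (auto simp: dist_commute)
      then show "\<forall>\<^sub>F q in at p. norm (((R q - R p) - 0) /\<^sub>R norm (q - p)) \<le> C * norm (q - p)"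
      proof (rule eventually_mono)
        fix q assume q: "q \<in> ball p (r/2) \<and> q \<noteq> p"
        then have "cmod (R q) \<le> C * (norm (q - p) * norm (q - p))" using Rb by (simp add: power2_eq_square)
        then show "norm (((R q - R p) - 0) /\<^sub>R norm (q - p)) \<le> C * norm (q - p)" using q by (simp add: Rp field_simps)
      qed
    qed
  qed
  define a where "a = deriv (\<lambda>z. \<Phi> (z, w0)) z0"
  define b where "b = deriv (\<lambda>w. \<Phi> (z0, w)) w0"
  have da: "((\<lambda>z. \<Phi> (z, w0)) has_derivative (*) a) (at z0)"
    unfolding a_def has_field_derivative_def[symmetric] by (rule holomorphic_derivI[OF h1 open_upper_hp]) (use p in auto)
  have db: "((\<lambda>w. \<Phi> (z0, w)) has_derivative (*) b) (at w0)"
    unfolding b_def has_field_derivative_def[symmetric] by (rule holomorphic_derivI[OF h2 open_upper_hp]) (use p in auto)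
  have d1: "((\<lambda>q. \<Phi> (fst q, w0)) has_derivative (\<lambda>h. a * fst h)) (at p)"
    by (rule has_derivative_compose[OF has_derivative_fst[OF has_derivative_ident], of "\<lambda>z. \<Phi> (z, w0)" "(*) a"]) (use da p in simp)
  have d2: "((\<lambda>q. \<Phi> (z0, snd q)) has_derivative (\<lambda>h. b * snd h)) (at p)"
    by (rule has_derivative_compose[OF has_derivative_snd[OF has_derivative_ident], of "\<lambda>w. \<Phi> (z0, w)" "(*) b"]) (use db p in simp)
  have "((\<lambda>q. R q + \<Phi> (fst q, w0) + \<Phi> (z0, snd q) - \<Phi> (z0, w0)) has_derivative (\<lambda>h. 0 + a * fst h + b * snd h - 0)) (at p)"
    by (intro has_derivative_add has_derivative_diff dR d1 d2 has_derivative_const)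
  then have "(\<Phi> has_derivative (\<lambda>(h, k). a * h + b * k)) (at p)" by (simp add: R_def case_prod_unfold)
  then show "\<exists>a b. (\<Phi> has_derivative (\<lambda>(h, k). a * h + b * k)) (at p within upper_hp \<times> upper_hp)"
    using has_derivative_at_withinI by blast
qed

lemma square_boundedD:
  assumes "square_bounded \<phi>" and z: "z \<in> closed_upper_hp"
  shows "summable (\<lambda>n. (cmod (\<phi> n z))\<^sup>2)" "(\<Sum>n. (cmod (\<phi> n z))\<^sup>2) \<le> (square_sup \<phi>)\<^sup>2" "(\<Sum>n<N. (cmod (\<phi> n z))\<^sup>2) \<le> (square_sup \<phi>)\<^sup>2"
    "square_sup \<phi> \<ge> 0"
proof -
  obtain C where C: "\<forall>z\<in>closed_upper_hp. summable (\<lambda>n. (cmod (\<phi> n z))\<^sup>2) \<and> (\<Sum>n. (cmod (\<phi> n z))\<^sup>2) \<le> C"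
    using assms unfolding square_bounded_def by blast
  show s: "summable (\<lambda>n. (cmod (\<phi> n z))\<^sup>2)" using C z by blast
  have le: "sqrt (\<Sum>n. (cmod (\<phi> n z))\<^sup>2) \<le> square_sup \<phi>" unfolding square_sup_def
    by (rule cSUP_upper[OF z]) (use C in \<open>auto intro!: bdd_aboveI2[of _ _ "sqrt C"]\<close>)
  have n0: "0 \<le> (\<Sum>n. (cmod (\<phi> n z))\<^sup>2)" by (rule suminf_nonneg[OF s]) simp
  show ss: "square_sup \<phi> \<ge> 0" using le n0 order_trans real_sqrt_ge_zero by blast
  show t: "(\<Sum>n. (cmod (\<phi> n z))\<^sup>2) \<le> (square_sup \<phi>)\<^sup>2" using power_mono[OF le, of 2] n0 by simp
  show "(\<Sum>n<N. (cmod (\<phi> n z))\<^sup>2) \<le> (square_sup \<phi>)\<^sup>2"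
    by (rule order_trans[OF sum_le_suminf[OF s] t]) auto
qed

lemma haagerup_repD:
  assumes "haagerup_rep CA_inf \<Phi> \<phi> \<psi>"
  shows "\<And>n. \<phi> n \<in> CA_inf" "\<And>n. \<psi> n \<in> CA_inf" "square_bounded \<phi>" "square_bounded \<psi>"
    "\<And>z w. \<lbrakk>z \<in> closed_upper_hp; w \<in> closed_upper_hp\<rbrakk> \<Longrightarrow> (\<lambda>n. \<phi> n z * \<psi> n w) sums \<Phi> (z, w)"
  using assms by (auto simp: haagerup_rep_def)

lemma haagerup_bound:
  assumes "haagerup_rep CA_inf \<Phi> \<phi> \<psi>" "z \<in> closed_upper_hp" "w \<in> closed_upper_hp"
  shows "cmod (\<Phi> (z, w)) \<le> square_sup \<phi> * square_sup \<psi>"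
proof -
  note r = haagerup_repD[OF assms(1)]
  \<comment> \<open>The tail estimate with nothing cut off is the Cauchy-Schwarz bound for the whole
    series.\<close>
  have "cmod (\<Phi> (z, w) - (\<Sum>n<0. \<phi> n z * \<psi> n w)) \<le> sqrt ((square_sup \<phi>)\<^sup>2) * sqrt ((\<Sum>n. (cmod (\<psi> n w))\<^sup>2) - (\<Sum>n<0. (cmod (\<psi> n w))\<^sup>2))"
    by (rule l2_tail[OF square_boundedD(3)[OF r(3) assms(2)] square_boundedD(1)[OF r(4) assms(3)] r(5)[OF assms(2,3)]])
  also have "\<dots> \<le> sqrt ((square_sup \<phi>)\<^sup>2) * sqrt ((square_sup \<psi>)\<^sup>2)"
    using square_boundedD(2)[OF r(4) assms(3)] by (intro mult_left_mono real_sqrt_le_mono) auto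
  finally show ?thesis using square_boundedD(4)[OF r(3) assms(2)] square_boundedD(4)[OF r(4) assms(3)] by simp
qed

lemma haagerup_separate:
  assumes rep: "haagerup_rep CA_inf \<Phi> \<phi> \<psi>" and z: "z \<in> closed_upper_hp"
  shows "(\<lambda>w. \<Phi> (z, w)) \<in> CA_inf" "(\<lambda>w. \<Phi> (w, z)) \<in> CA_inf"
proof -
  note r = haagerup_repD[OF rep]
  show "(\<lambda>w. \<Phi> (z, w)) \<in> CA_inf"
    by (rule CA_inf_l2_series[OF r(2) square_boundedD(3)[OF r(4)] square_boundedD(1)[OF r(3) z]]) (use r(5)[OF z] in \<open>auto simp: mult.commute\<close>)
  show "(\<lambda>w. \<Phi> (w, z)) \<in> CA_inf"
    by (rule CA_inf_l2_series[OF r(1) square_boundedD(3)[OF r(3)] square_boundedD(1)[OF r(4) z]]) (use r(5)[OF _ z] in auto)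
qed

lemma haagerup_H_inf2:
  assumes rep: "haagerup_rep CA_inf \<Phi> \<phi> \<psi>" shows "\<Phi> \<in> H_inf2"
  unfolding H_inf2_def
proof (intro CollectI conjI)
  note b = haagerup_bound[OF rep]
  show "holomorphic2_on \<Phi> (upper_hp \<times> upper_hp)"
    by (rule separately_holomorphic[where M="square_sup \<phi> * square_sup \<psi>"])
       (use b haagerup_separate[OF rep] upper_subset_closed CA_inf_holo in \<open>auto simp: subset_iff\<close>)
  show "bounded (\<Phi> ` (upper_hp \<times> upper_hp))"
    unfolding bounded_iff using b upper_subset_closed by (intro exI[of _ "square_sup \<phi> * square_sup \<psi>"]) auto
qed

lemma CA_inf_vertical_limit:
  assumes f: "f \<in> CA_inf" and z: "z \<in> closed_upper_hp"
  shows "((\<lambda>t::real. f (z + of_real t * \<i>)) \<longlongrightarrow> f z) (at_right 0)"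
proof -
  have "continuous_on {0..} (\<lambda>t::real. f (z + of_real t * \<i>))"
    by (rule continuous_on_compose2[OF CA_inf_cont[OF f]]) (use z in \<open>auto intro!: continuous_intros simp: closed_upper_hp_def\<close>)
  then have "((\<lambda>t::real. f (z + of_real t * \<i>)) \<longlongrightarrow> f (z + of_real 0 * \<i>)) (at 0 within {0..})"
    unfolding continuous_on_def by (rule bspec) simp
  then have "((\<lambda>t::real. f (z + of_real t * \<i>)) \<longlongrightarrow> f (z + of_real 0 * \<i>)) (at 0 within {0<..})"
    by (rule tendsto_within_subset) auto
  then show ?thesis by simp
qed

lemma haagerup_in_spaces:
  assumes rep: "haagerup_rep CA_inf \<Phi> \<phi> \<psi>" shows "\<Phi> \<in> CSA_inf" "\<Phi> \<in> H_inf2_r"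
proof -
  show "\<Phi> \<in> CSA_inf" unfolding CSA_inf_def using haagerup_H_inf2[OF rep] haagerup_separate[OF rep] by blast
  show "\<Phi> \<in> H_inf2_r" unfolding H_inf2_r_def
    using haagerup_H_inf2[OF rep] CA_inf_vertical_limit[OF haagerup_separate(1)[OF rep]] CA_inf_vertical_limit[OF haagerup_separate(2)[OF rep]] by blast
qed

section \<open>Haagerup tensor products are Schur multipliers\<close>

lemma CA_inf_bmeas: assumes f: "f \<in> CA_inf" shows "bmeas (\<lambda>x::real. f (of_real x))"
proof -
  obtain K where K: "\<And>z. z \<in> closed_upper_hp \<Longrightarrow> cmod (f z) \<le> K" using CA_inf_bound[OF f] by metis
  have "continuous_on UNIV (\<lambda>x::real. f (of_real x))"
    by (rule continuous_on_compose2[OF CA_inf_cont[OF f]]) (auto intro!: continuous_intros)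
  then show ?thesis using K by (intro bmeasI[where K=K] borel_measurable_continuous_onI) auto
qed

text \<open>The estimate \<open>doi_trace_norm\<close> is uniform in the space and in both spectral
  measures, and its constant is exactly the product in the Haagerup norm. Hence each representation
  bounds the supremum that defines the Schur norm.\<close>

lemma haagerup_schur:
  assumes rep: "haagerup_rep CA_inf \<Phi> \<phi> \<psi>"
  shows "restrict_real2 \<Phi> \<in> borel_schur_multipliers TYPE('v)"
    "schur_norm TYPE('v) (restrict_real2 \<Phi>) \<le> ennreal (square_sup \<phi> * square_sup \<psi>)"
proof -
  note r = haagerup_repD[OF rep]
  define p where "p n x = \<phi> n (of_real x)" for n and x :: real
  define q where "q n x = \<psi> n (of_real x)" for n and x :: real
  have pb: "bmeas (p n)" and qb: "bmeas (q n)" for n unfolding p_def q_def by (intro CA_inf_bmeas r)+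
  have sm: "(\<lambda>n. p n s * q n t) sums restrict_real2 \<Phi> (s, t)" for s t
    unfolding p_def q_def restrict_real2_def using r(5) by simp
  have m: "restrict_real2 \<Phi> \<in> borel_measurable borel"
  proof (rule borel_measurable_LIMSEQ_metric)
    show "(\<lambda>x. \<Sum>n<i. (case x of (s, t) \<Rightarrow> p n s * q n t)) \<in> borel_measurable borel" for i
      by (intro borel_measurable_sum bmeas_measurable bmeas_tensor pb qb)
    show "(\<lambda>i. \<Sum>n<i. (case x of (s, t) \<Rightarrow> p n s * q n t)) \<longlonglongrightarrow> restrict_real2 \<Phi> x" for x
      using sm[of "fst x" "snd x"] by (simp add: sums_def case_prod_unfold)
  qed
  have b: "cmod (restrict_real2 \<Phi> x) \<le> square_sup \<phi> * square_sup \<psi>" for x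
    using haagerup_bound[OF rep] by (auto simp: restrict_real2_def split: prod.split)
  have bm: "bmeas (restrict_real2 \<Phi>)" by (rule bmeasI[OF m b])
  have a0: "square_sup \<phi> \<ge> 0" "square_sup \<psi> \<ge> 0" using square_boundedD(4)[OF r(3), of 0] square_boundedD(4)[OF r(4), of 0] by (auto simp: closed_upper_hp_def)
  have key: "double_operator_integral H E1 E2 (restrict_real2 \<Phi>) Q \<in> bounded_ops H"
    "trace_norm H (double_operator_integral H E1 E2 (restrict_real2 \<Phi>) Q) \<le> ennreal (square_sup \<phi> * square_sup \<psi> * c)"
    if "complex_hilbert H" "spectral_measure borel H E1" "spectral_measure borel H E2" "Q \<in> bounded_ops H"
      "trace_norm H Q \<le> ennreal c" "c \<ge> 0" for H :: "'v hilbert" and E1 E2 Q c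
  proof -
    interpret complex_hilbert H by (rule that)
    interpret two_spectral H E1 E2
      by (intro two_spectral.intro spectral.intro spectral_axioms.intro that)
    have le: "(\<Sum>n<N. (cmod (p n s))\<^sup>2) \<le> (square_sup \<phi>)\<^sup>2" "(\<Sum>n<N. (cmod (q n s))\<^sup>2) \<le> (square_sup \<psi>)\<^sup>2" for N s
      unfolding p_def q_def by (intro square_boundedD(3) r of_real_closed_upper)+
    show "double_operator_integral H E1 E2 (restrict_real2 \<Phi>) Q \<in> bounded_ops H"
      "trace_norm H (double_operator_integral H E1 E2 (restrict_real2 \<Phi>) Q) \<le> ennreal (square_sup \<phi> * square_sup \<psi> * c)"
      using doi_trace_norm[OF pb qb bm le(1) le(2) sm that(4-6)] a0 by (simp_all add: double_operator_integral_def)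
  qed
  have "is_schur_multiplier H E1 E2 (restrict_real2 \<Phi>)"
    if h: "complex_hilbert H" "spectral_measure borel H E1" "spectral_measure borel H E2" for H :: "'v hilbert" and E1 E2
    unfolding is_schur_multiplier_def
  proof
    fix Q assume Q: "Q \<in> trace_class H"
    then have "trace_norm H Q \<le> ennreal (enn2real (trace_norm H Q))" by (simp add: trace_class_def)
    from key[OF h _ this] Q show "double_operator_integral H E1 E2 (restrict_real2 \<Phi>) Q \<in> trace_class H"
      by (auto simp: trace_class_def intro: le_less_trans)
  qed
  then show "restrict_real2 \<Phi> \<in> borel_schur_multipliers TYPE('v)"
    unfolding borel_schur_multipliers_def using m b by (auto simp: bounded_iff)
  show "schur_norm TYPE('v) (restrict_real2 \<Phi>) \<le> ennreal (square_sup \<phi> * square_sup \<psi>)"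
    unfolding schur_norm_def
  proof (rule Sup_least, elim CollectE exE conjE)
    fix x and H :: "'v hilbert" and E1 E2
    assume h: "x = schur_norm_wrt H E1 E2 (restrict_real2 \<Phi>)" "complex_hilbert H" "spectral_measure borel H E1" "spectral_measure borel H E2"
    show "x \<le> ennreal (square_sup \<phi> * square_sup \<psi>)" unfolding h(1) schur_norm_wrt_def
    proof (rule SUP_least)
      fix Q assume "Q \<in> {Q \<in> trace_class H. trace_norm H Q \<le> 1}"
      then show "trace_norm H (double_operator_integral H E1 E2 (restrict_real2 \<Phi>) Q) \<le> ennreal (square_sup \<phi> * square_sup \<psi>)"
        using key(2)[OF h(2-4), of Q 1] by (simp add: trace_class_def)
    qed
  qed
qed

subsection \<open>A minimax theorem\<close>

text \<open>The pairs lying above some \<open>(f x, g x)\<close> form a convex set. If it missed the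
  open quadrant below \<open>(c, c)\<close>, a separating line would have a nonnegative normal, and
  normalizing the normal would give weights that contradict \<open>hyp\<close>. Convexity is
  expressed by a dominated point \<open>z\<close>, so that \<open>X\<close> may be any set without
  linear structure.\<close>

lemma minimax_two:
  fixes f g :: "'x \<Rightarrow> real"
  assumes conv: "\<And>x y t. \<lbrakk>x \<in> X; y \<in> X; 0 \<le> t; t \<le> 1\<rbrakk> \<Longrightarrow>
      \<exists>z\<in>X. f z \<le> (1 - t) * f x + t * f y \<and> g z \<le> (1 - t) * g x + t * g y"
    and hyp: "\<And>t. \<lbrakk>0 \<le> t; t \<le> 1\<rbrakk> \<Longrightarrow> \<exists>x\<in>X. (1 - t) * f x + t * g x < c"
  shows "\<exists>x\<in>X. f x < c \<and> g x < c"
proof (rule ccontr)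
  assume no: "\<not> (\<exists>x\<in>X. f x < c \<and> g x < c)"
  define S where "S = {(a, b). \<exists>x\<in>X. f x \<le> a \<and> g x \<le> b}"
  define T where "T = {..<c} \<times> {..<c}"
  have cS: "convex S" unfolding convex_alt
  proof (intro ballI allI impI)
    fix p q :: "real \<times> real" and t :: real assume "p \<in> S" "q \<in> S" and t: "0 \<le> t \<and> t \<le> 1"
    then obtain x y where xy: "x \<in> X" "f x \<le> fst p" "g x \<le> snd p" "y \<in> X" "f y \<le> fst q" "g y \<le> snd q"
      by (auto simp: S_def)
    obtain z where z: "z \<in> X" "f z \<le> (1 - t) * f x + t * f y" "g z \<le> (1 - t) * g x + t * g y"
      using conv[OF xy(1,4)] t by blast
    have "(1 - t) * f x + t * f y \<le> (1 - t) * fst p + t * fst q" "(1 - t) * g x + t * g y \<le> (1 - t) * snd p + t * snd q"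
      using xy t by (auto intro!: add_mono mult_left_mono)
    then have "f z \<le> fst ((1 - t) *\<^sub>R p + t *\<^sub>R q)" "g z \<le> snd ((1 - t) *\<^sub>R p + t *\<^sub>R q)" using z by auto
    then show "(1 - t) *\<^sub>R p + t *\<^sub>R q \<in> S" using z(1) unfolding S_def case_prod_unfold by blast
  qed
  have cT: "convex T" unfolding T_def by (intro convex_Times convex_real_interval)
  have "S \<noteq> {}" using hyp[of 0] unfolding S_def by auto
  moreover have "T \<noteq> {}" unfolding T_def by (auto intro!: exI[of _ "c - 1"])
  moreover have "T \<inter> S = {}" using no unfolding S_def T_def by fastforce
  ultimately obtain u \<beta> where u: "u \<noteq> 0" "\<forall>x\<in>T. inner u x \<le> \<beta>" "\<forall>x\<in>S. inner u x \<ge> \<beta>"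
    using separating_hyperplane_sets[OF cT cS] by blast
  obtain u1 u2 where u12: "u = (u1, u2)" by (cases u)
  have T: "u1 * a + u2 * b \<le> \<beta>" if "a < c" "b < c" for a b using u(2) that by (auto simp: T_def u12)
  \<comment> \<open>The quadrant is unbounded below in both directions, so a negative component of
    the normal would violate the bound \<open>\<beta>\<close> on it.\<close>
  have pos: "v \<ge> 0" if "\<And>k. k \<ge> 0 \<Longrightarrow> - v * k \<le> K" for v K :: real
  proof (rule ccontr)
    assume v: "\<not> v \<ge> 0"
    have "- v * ((\<bar>K\<bar> + 1) / (- v)) = \<bar>K\<bar> + 1" using v by simp
    moreover have "(\<bar>K\<bar> + 1) / (- v) \<ge> 0" using v by (intro divide_nonneg_pos) auto
    ultimately show False using that[of "(\<bar>K\<bar> + 1) / (- v)"] by simp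
  qed
  have "u1 \<ge> 0" by (rule pos[of _ "\<beta> - u1 * (c - 1) - u2 * (c - 1)"]) (use T[of "c - 1 - k" "c - 1" for k] in \<open>auto simp: algebra_simps\<close>)
  moreover have "u2 \<ge> 0" by (rule pos[of _ "\<beta> - u1 * (c - 1) - u2 * (c - 1)"]) (use T[of "c - 1" "c - 1 - k" for k] in \<open>auto simp: algebra_simps\<close>)
  ultimately have up: "u1 \<ge> 0" "u2 \<ge> 0" "u1 + u2 > 0" using u(1) by (auto simp: u12 zero_prod_def)
  define t where "t = u2 / (u1 + u2)"
  have t: "0 \<le> t" "t \<le> 1" "1 - t = u1 / (u1 + u2)" using up by (auto simp: t_def field_simps)
  obtain x where x: "x \<in> X" "(1 - t) * f x + t * g x < c" using hyp[OF t(1,2)] by blast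
  have "u1 * f x + u2 * g x = (u1 + u2) * ((1 - t) * f x + t * g x)" unfolding t(3) using up by (simp add: t_def distrib_left)
  also have "\<dots> < (u1 + u2) * c" using x(2) up(3) by simp
  finally have "u1 * f x + u2 * g x < (u1 + u2) * c" .
  moreover have "\<beta> \<le> u1 * f x + u2 * g x" using u(3) x(1) by (auto simp: S_def u12)
  moreover have "(u1 + u2) * c \<le> \<beta>"
  proof (rule field_le_epsilon)
    fix e :: real assume "e > 0"
    then have "u1 * (c - e / (u1 + u2)) + u2 * (c - e / (u1 + u2)) \<le> \<beta>" using up by (intro T) auto
    moreover have "u1 * (c - e / (u1 + u2)) + u2 * (c - e / (u1 + u2)) = (u1 + u2) * c - e"
    proof -
      define w where "w = e / (u1 + u2)"
      have "(u1 + u2) * w = e" using up by (simp add: w_def)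
      then show ?thesis unfolding w_def[symmetric] by (simp add: algebra_simps)
    qed
    ultimately show "(u1 + u2) * c \<le> \<beta> + e" by simp
  qed
  ultimately show False by simp
qed

text \<open>Induction on the number of functions: the bound on the new one becomes a constraint on
  \<open>X\<close>, and \<open>minimax_two\<close> shows that the constraint can be met together
  with a bound on any weighted sum of the others.\<close>

lemma minimax_finite:
  fixes f :: "'i \<Rightarrow> 'x \<Rightarrow> real"
  assumes "finite I" "I \<noteq> {}"
    and "\<And>x y t. \<lbrakk>x \<in> X; y \<in> X; 0 \<le> t; t \<le> 1\<rbrakk> \<Longrightarrow> \<exists>z\<in>X. \<forall>i\<in>I. f i z \<le> (1 - t) * f i x + t * f i y"
    and "\<And>l. \<lbrakk>\<And>i. i \<in> I \<Longrightarrow> l i \<ge> 0; sum l I = 1\<rbrakk> \<Longrightarrow> \<exists>x\<in>X. (\<Sum>i\<in>I. l i * f i x) < c"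
  shows "\<exists>x\<in>X. \<forall>i\<in>I. f i x < c"
  using assms
proof (induction I arbitrary: X rule: finite_ne_induct)
  case (singleton k)
  then show ?case using singleton(2)[of "\<lambda>_. 1"] by simp
next
  case (insert k J)
  define X' where "X' = {x \<in> X. f k x < c}"
  have "\<exists>x\<in>X'. \<forall>i\<in>J. f i x < c"
  proof (rule insert.IH)
    fix x y t assume h: "x \<in> X'" "y \<in> X'" "0 \<le> t" "t \<le> (1::real)"
    then obtain z where z: "z \<in> X" "\<forall>i\<in>insert k J. f i z \<le> (1 - t) * f i x + t * f i y"
      using insert.prems(1)[of x y t] by (auto simp: X'_def)
    have "(1 - t) * f k x + t * f k y < c"
      by (rule convex_bound_lt) (use h in \<open>auto simp: X'_def\<close>)
    then have "z \<in> X'" using z by (auto simp: X'_def)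
    then show "\<exists>z\<in>X'. \<forall>i\<in>J. f i z \<le> (1 - t) * f i x + t * f i y" using z by blast
  next
    fix l :: "'i \<Rightarrow> real" assume l: "\<And>i. i \<in> J \<Longrightarrow> l i \<ge> 0" "sum l J = 1"
    have "\<exists>x\<in>X. (\<Sum>i\<in>J. l i * f i x) < c \<and> f k x < c"
    proof (rule minimax_two)
      fix x y t assume h: "x \<in> X" "y \<in> X" "0 \<le> t" "t \<le> (1::real)"
      obtain z where z: "z \<in> X" "\<forall>i\<in>insert k J. f i z \<le> (1 - t) * f i x + t * f i y" using insert.prems(1)[OF h] by blast
      have "(\<Sum>i\<in>J. l i * f i z) \<le> (\<Sum>i\<in>J. l i * ((1 - t) * f i x + t * f i y))"
        by (intro sum_mono mult_left_mono l) (use z in auto)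
      also have "\<dots> = (1 - t) * (\<Sum>i\<in>J. l i * f i x) + t * (\<Sum>i\<in>J. l i * f i y)"
        by (simp add: sum_distrib_left sum.distrib sum_subtractf algebra_simps)
      finally show "\<exists>z\<in>X. (\<Sum>i\<in>J. l i * f i z) \<le> (1 - t) * (\<Sum>i\<in>J. l i * f i x) + t * (\<Sum>i\<in>J. l i * f i y)
          \<and> f k z \<le> (1 - t) * f k x + t * f k y" using z by blast
    next
      fix t :: real assume t: "0 \<le> t" "t \<le> 1"
      define m where "m i = (if i = k then t else (1 - t) * l i)" for i
      have mJ: "m i = (1 - t) * l i" if "i \<in> J" for i using that insert.hyps by (auto simp: m_def)
      have "\<exists>x\<in>X. (\<Sum>i\<in>insert k J. m i * f i x) < c"
      proof (rule insert.prems(2))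
        show "m i \<ge> 0" if "i \<in> insert k J" for i using that l t by (auto simp: m_def)
        have "sum m J = (1 - t) * sum l J" unfolding sum_distrib_left by (rule sum.cong) (auto simp: mJ)
        then show "sum m (insert k J) = 1" using insert.hyps l by (simp add: m_def)
      qed
      moreover have "(\<Sum>i\<in>insert k J. m i * f i x) = (1 - t) * (\<Sum>i\<in>J. l i * f i x) + t * f k x" for x
      proof -
        have "(\<Sum>i\<in>J. m i * f i x) = (1 - t) * (\<Sum>i\<in>J. l i * f i x)" unfolding sum_distrib_left by (rule sum.cong) (auto simp: mJ)
        then show ?thesis using insert.hyps by (simp add: m_def)
      qed
      ultimately show "\<exists>x\<in>X. (1 - t) * (\<Sum>i\<in>J. l i * f i x) + t * f k x < c" by simp
    qed
    then show "\<exists>x\<in>X'. (\<Sum>i\<in>J. l i * f i x) < c" by (auto simp: X'_def)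
  qed
  then show ?case by (auto simp: X'_def)
qed

text \<open>In the application weights are divided out, so the hypothesis is available for positive
  ones only. Mixing with the uniform weight moves any weight off the boundary, and the gap between
  \<open>C\<close> and \<open>c\<close> pays for it.\<close>

lemma minimax_positive_weights:
  fixes f :: "'i \<Rightarrow> 'x \<Rightarrow> real"
  assumes I: "finite I" "I \<noteq> {}"
    and conv: "\<And>x y t. \<lbrakk>x \<in> X; y \<in> X; 0 \<le> t; t \<le> 1\<rbrakk> \<Longrightarrow> \<exists>z\<in>X. \<forall>i\<in>I. f i z \<le> (1 - t) * f i x + t * f i y"
    and f0: "\<And>i x. i \<in> I \<Longrightarrow> x \<in> X \<Longrightarrow> f i x \<ge> 0"
    and hyp: "\<And>l. \<lbrakk>\<And>i. i \<in> I \<Longrightarrow> l i > 0; sum l I = 1\<rbrakk> \<Longrightarrow> \<exists>x\<in>X. (\<Sum>i\<in>I. l i * f i x) \<le> C"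
    and c: "C < c" and C: "C \<ge> 0"
  shows "\<exists>x\<in>X. \<forall>i\<in>I. f i x < c"
proof (rule minimax_finite[OF I conv])
  fix l :: "'i \<Rightarrow> real" assume l: "\<And>i. i \<in> I \<Longrightarrow> l i \<ge> 0" "sum l I = 1"
  \<comment> \<open>With this value \<open>c * (1 - \<delta>)\<close> is the midpoint of
    \<open>C\<close> and \<open>c\<close>.\<close>
  define \<delta> where "\<delta> = (c - C) / (2 * c)"
  have d: "0 < \<delta>" "\<delta> < 1" "c * (1 - \<delta>) > C" using c C by (auto simp: \<delta>_def field_simps)
  define m where "m i = (1 - \<delta>) * l i + \<delta> / card I" for i
  have cI: "card I > 0" using I by (simp add: card_gt_0_iff)
  have m1: "m i > 0" if "i \<in> I" for i unfolding m_def using d cI l(1)[OF that] by (intro add_nonneg_pos) auto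
  have "sum m I = (1 - \<delta>) * sum l I + (\<Sum>i\<in>I. \<delta> / card I)" by (simp add: m_def sum.distrib sum_distrib_left)
  also have "\<dots> = 1" using l(2) cI by simp
  finally have m2: "sum m I = 1" .
  obtain x where x: "x \<in> X" "(\<Sum>i\<in>I. m i * f i x) \<le> C" using hyp[OF m1 m2] by auto
  have "(1 - \<delta>) * (\<Sum>i\<in>I. l i * f i x) \<le> (\<Sum>i\<in>I. m i * f i x)" unfolding sum_distrib_left
    by (rule sum_mono) (use f0 x(1) d in \<open>auto simp: m_def algebra_simps\<close>)
  then have "(1 - \<delta>) * (\<Sum>i\<in>I. l i * f i x) < (1 - \<delta>) * c" using x(2) d(3) by (simp add: mult.commute)
  then show "\<exists>x\<in>X. (\<Sum>i\<in>I. l i * f i x) < c" using x(1) d by auto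
qed

subsection \<open>Positive semidefinite kernels\<close>

definition qform :: "(nat \<Rightarrow> nat \<Rightarrow> complex) \<Rightarrow> nat set \<Rightarrow> (nat \<Rightarrow> complex) \<Rightarrow> complex" where
  "qform G F c = (\<Sum>i\<in>F. \<Sum>j\<in>F. c i * cnj (c j) * G i j)"

text \<open>A kernel on all natural numbers, tested on finite sets. Realness of the form is demanded
  in place of Hermitian symmetry, which follows from it in \<open>psd_herm\<close>.\<close>

definition psd :: "(nat \<Rightarrow> nat \<Rightarrow> complex) \<Rightarrow> bool" where
  "psd G \<longleftrightarrow> (\<forall>F c. finite F \<longrightarrow> Im (qform G F c) = 0 \<and> Re (qform G F c) \<ge> 0)"

lemma psd_scale: assumes "psd G" shows "psd (\<lambda>i j. w i * cnj (w j) * G i j)"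
proof -
  have "qform (\<lambda>i j. w i * cnj (w j) * G i j) F c = qform G F (\<lambda>i. c i * w i)" for F c
    unfolding qform_def by (intro sum.cong) (auto simp: algebra_simps)
  then show ?thesis using assms by (simp add: psd_def)
qed

lemma psd_add: "psd G \<Longrightarrow> psd G' \<Longrightarrow> psd (\<lambda>i j. G i j + G' i j)"
  unfolding psd_def qform_def by (simp add: distrib_left sum.distrib)

lemma psd_cmult: assumes "psd G" "t \<ge> 0" shows "psd (\<lambda>i j. of_real t * G i j)"
  using psd_scale[OF assms(1), of "\<lambda>_. of_real (sqrt t)"] assms(2) by (simp flip: of_real_mult)

lemma psd_limit:
  assumes "\<And>n. psd (G n)" "\<And>i j. (\<lambda>n. G n i j) \<longlonglongrightarrow> L i j"
  shows "psd L"
  unfolding psd_def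
proof (intro allI impI)
  fix F c assume F: "finite (F :: nat set)"
  have l: "(\<lambda>n. qform (G n) F c) \<longlonglongrightarrow> qform L F c" unfolding qform_def by (intro tendsto_intros assms)
  have "(\<lambda>n. Im (qform (G n) F c)) \<longlonglongrightarrow> Im (qform L F c)" "(\<lambda>n. Re (qform (G n) F c)) \<longlonglongrightarrow> Re (qform L F c)"
    using l by (intro tendsto_intros; assumption)+
  moreover have "Im (qform (G n) F c) = 0" "Re (qform (G n) F c) \<ge> 0" for n using assms(1)[of n] F by (simp_all add: psd_def)
  ultimately show "Im (qform L F c) = 0 \<and> Re (qform L F c) \<ge> 0"
    using LIMSEQ_le_const[of "\<lambda>n. Re (qform (G n) F c)"] by (auto simp: LIMSEQ_const_iff)
qed

lemma qform_pair:
  assumes "i \<noteq> j"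
  shows "qform G {i, j} c = c i * cnj (c i) * G i i + c i * cnj (c j) * G i j + c j * cnj (c i) * G j i + c j * cnj (c j) * G j j"
  using assms by (simp add: qform_def)

lemma psd_diag: assumes "psd G" shows "Im (G i i) = 0" "Re (G i i) \<ge> 0"
  using assms[unfolded psd_def, rule_format, of "{i}" "\<lambda>_. 1"] by (auto simp: qform_def)

text \<open>Realness of the form at the vector \<open>(1, 1)\<close> gives the imaginary part of the
  identity, and at \<open>(\<i>, 1)\<close> the real part.\<close>

lemma psd_herm: assumes G: "psd G" shows "G j i = cnj (G i j)"
proof (cases "i = j")
  case True
  then show ?thesis using psd_diag(1)[OF G, of i] by (simp add: complex_eq_iff)
next
  case False
  have "Im (qform G {i, j} (\<lambda>_. 1)) = 0" "Im (qform G {i, j} (\<lambda>k. if k = i then \<i> else 1)) = 0"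
    using G by (auto simp: psd_def)
  then show ?thesis unfolding qform_pair[OF False] using psd_diag(1)[OF G] False by (simp add: complex_eq_iff)
qed

lemma qform_extend:
  assumes "finite F'" "F \<subseteq> F'"
  shows "qform G F c = qform G F' (\<lambda>i. if i \<in> F then c i else 0)"
proof -
  have "qform G F' (\<lambda>i. if i \<in> F then c i else 0) = (\<Sum>i\<in>F. \<Sum>j\<in>F'. c i * cnj (if j \<in> F then c j else 0) * G i j)"
    unfolding qform_def by (rule sum.mono_neutral_cong_right) (use assms in auto)
  also have "\<dots> = qform G F c" unfolding qform_def
    by (rule sum.cong[OF refl], rule sum.mono_neutral_cong_right) (use assms in auto)
  finally show ?thesis ..
qed

text \<open>The expansion for completing the square in the single coordinate
  \<open>k\<close>.\<close>

lemma qform_shift: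
  assumes G: "psd G" and F: "finite F" "k \<in> F"
  shows "qform G F (\<lambda>i. c i - (if i = k then t else 0)) =
    qform G F c - t * cnj (\<Sum>i\<in>F. c i * G i k) - cnj t * (\<Sum>i\<in>F. c i * G i k) + t * cnj t * G k k"
proof -
  have e: "(c i - (if i = k then t else 0)) * cnj (c j - (if j = k then t else 0)) * G i j
    = c i * cnj (c j) * G i j - (if i = k then t * cnj (c j) * G k j else 0)
      - (if j = k then cnj t * (c i * G i k) else 0) + (if i = k then (if j = k then t * cnj t * G k k else 0) else 0)" for i j
    by (auto simp: algebra_simps)
  have s1: "(\<Sum>i\<in>F. \<Sum>j\<in>F. if i = k then t * cnj (c j) * G k j else 0) = (\<Sum>j\<in>F. t * cnj (c j) * G k j)"
    by (subst sum.swap) (use F in simp)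
  have s2: "(\<Sum>j\<in>F. t * cnj (c j) * G k j) = t * cnj (\<Sum>i\<in>F. c i * G i k)"
    by (simp add: sum_distrib_left mult.assoc psd_herm[OF G, of k])
  have s3: "(\<Sum>i\<in>F. \<Sum>j\<in>F. if i = k then (if j = k then t * cnj t * G k k else 0) else 0) = t * cnj t * G k k"
    using F by (subst sum.swap) simp
  show ?thesis unfolding qform_def e sum.distrib sum_subtractf s1 s2 s3 using F by (simp add: sum_distrib_left)
qed

text \<open>The Schur complement of the entry at \<open>k\<close>, kept on the full index set. For
  \<open>G k k = 0\<close> division by zero leaves \<open>G\<close> unchanged, which is right for
  semidefinite \<open>G\<close>, whose row and column \<open>k\<close> then vanish.\<close>

definition schur_compl :: "(nat \<Rightarrow> nat \<Rightarrow> complex) \<Rightarrow> nat \<Rightarrow> nat \<Rightarrow> nat \<Rightarrow> complex" where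
  "schur_compl G k i j = G i j - G i k * cnj (G j k) / G k k"

lemma psd_real_diag: "psd G \<Longrightarrow> G k k = of_real (Re (G k k))"
  by (simp add: complex_eq_iff psd_diag)

text \<open>The form of the complement at \<open>c\<close> is the form of \<open>G\<close> at the
  vector obtained from \<open>c\<close> by adjusting its \<open>k\<close>-th entry so as to minimize
  that form.\<close>

lemma psd_schur_compl: assumes G: "psd G" shows "psd (schur_compl G k)"
  unfolding psd_def
proof (intro allI impI)
  fix F0 and c0 :: "nat \<Rightarrow> complex" assume F0: "finite (F0 :: nat set)"
  define F where "F = insert k F0"
  define c where "c i = (if i \<in> F0 then c0 i else 0)" for i
  have F: "finite F" "k \<in> F" using F0 by (auto simp: F_def)
  define s where "s = (\<Sum>i\<in>F. c i * G i k)"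
  define g where "g = Re (G k k)"
  have g: "G k k = of_real g" "g \<ge> 0" using psd_real_diag[OF G] psd_diag[OF G] by (auto simp: g_def)
  have "qform (schur_compl G k) F0 c0 = qform (schur_compl G k) F c"
    unfolding c_def by (rule qform_extend) (use F in \<open>auto simp: F_def\<close>)
  also have "\<dots> = qform G F c - s * cnj s / of_real g"
  proof -
    have "(\<Sum>i\<in>F. \<Sum>j\<in>F. c i * cnj (c j) * (G i k * cnj (G j k) / G k k)) = s * cnj s / of_real g"
      unfolding s_def cnj_sum sum_product sum_divide_distrib g(1) by (simp add: algebra_simps)
    then show ?thesis unfolding qform_def schur_compl_def by (simp add: right_diff_distrib sum_subtractf)
  qed
  also have "\<dots> = qform G F (\<lambda>i. c i - (if i = k then s / of_real g else 0))"
    unfolding qform_shift[OF G F] s_def[symmetric] g(1) by (cases "g = 0") (auto simp: field_simps)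
  finally show "Im (qform (schur_compl G k) F0 c0) = 0 \<and> Re (qform (schur_compl G k) F0 c0) \<ge> 0"
    using G F by (simp add: psd_def)
qed

lemma psd_zero_diag: assumes G: "psd G" and z: "G k k = 0" shows "G i k = 0"
proof (rule ccontr)
  assume nz: "G i k \<noteq> 0"
  then have ik: "i \<noteq> k" using z by auto
  define s where "s = G i k"
  \<comment> \<open>Scaled so that the two cross terms together subtract
    \<open>Re (G i i) + 1\<close>, which would make the form equal to -1.\<close>
  define t where "t = complex_of_real ((Re (G i i) + 1) / (2 * (cmod s)\<^sup>2)) * s"
  have sum1: "(\<Sum>j\<in>{i, k}. (if j = i then 1 else 0) * G j k) = s" using ik by (simp add: s_def)
  have q0: "qform G {i, k} (\<lambda>j. if j = i then 1 else 0) = G i i" using ik by (simp add: qform_pair)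
  have "Re (qform G {i, k} (\<lambda>j. (if j = i then 1 else 0) - (if j = k then t else 0))) \<ge> 0" using G by (auto simp: psd_def)
  also have "qform G {i, k} (\<lambda>j. (if j = i then 1 else 0) - (if j = k then t else 0)) = G i i - t * cnj s - cnj t * s"
    using qform_shift[OF G, of "{i, k}" k "\<lambda>j. if j = i then 1 else 0" t] unfolding sum1 q0 z by simp
  finally have ge: "Re (G i i - t * cnj s - cnj t * s) \<ge> 0" .
  have "(Re (G i i) + 1) / (2 * (cmod s)\<^sup>2) * (cmod s)\<^sup>2 = (Re (G i i) + 1) / 2" using nz by (simp add: s_def)
  moreover have "s * cnj s = of_real ((cmod s)\<^sup>2)" by (rule complex_norm_square[symmetric])
  ultimately have "t * cnj s = of_real ((Re (G i i) + 1) / 2)" unfolding t_def mult.assoc using nz by (simp add: s_def[symmetric])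
  moreover from this have "cnj t * s = of_real ((Re (G i i) + 1) / 2)"
    by (metis complex_cnj_cnj complex_cnj_complex_of_real complex_cnj_mult)
  ultimately have "Re (t * cnj s) = (Re (G i i) + 1) / 2" "Re (cnj t * s) = (Re (G i i) + 1) / 2"
    by (simp_all only: Re_complex_of_real)
  with ge have "Re (G i i) - (Re (G i i) + 1) / 2 - (Re (G i i) + 1) / 2 \<ge> 0" by (simp only: minus_complex.sel)
  then show False by (simp add: field_simps)
qed

text \<open>Schur complements are taken at 0, 1, 2 and so on; a vanishing pivot is harmless because
  its row vanishes too. Each step clears a row, so row \<open>i\<close> is exhausted after step
  \<open>i\<close> and the Gram vectors have finite support, which makes them square
  summable.\<close>

lemma cholesky:
  assumes G: "psd G"
  obtains L where "\<And>i j. G i j = (\<Sum>k\<le>i. L i k * cnj (L j k))" "\<And>i k. k > i \<Longrightarrow> L i k = 0"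
proof -
  define Gs where "Gs n = rec_nat G (\<lambda>k H. schur_compl H k) n" for n
  have G0: "Gs 0 = G" and GS: "Gs (Suc n) = schur_compl (Gs n) n" for n by (auto simp: Gs_def)
  have P: "psd (Gs n)" for n by (induction n) (auto simp: G0 GS G psd_schur_compl)
  define L where "L i k = Gs k i k / of_real (sqrt (Re (Gs k k k)))" for i k
  have step: "Gs k i j = L i k * cnj (L j k) + Gs (Suc k) i j" for i j k
  proof -
    define g where "g = Re (Gs k k k)"
    have g: "Gs k k k = of_real g" "g \<ge> 0" using psd_real_diag[OF P] psd_diag[OF P] by (auto simp: g_def)
    have "L i k * cnj (L j k) = Gs k i k * cnj (Gs k j k) / (of_real (sqrt g) * of_real (sqrt g))"
      by (simp add: L_def g_def)
    also have "of_real (sqrt g) * of_real (sqrt g) = (of_real g :: complex)" using g(2) by (simp flip: of_real_mult)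
    finally show ?thesis by (simp add: GS schur_compl_def g(1))
  qed
  have zero: "Gs n i j = 0" if "i < n" for n i j
    using that
  proof (induction n arbitrary: j)
    case (Suc n)
    show ?case
    proof (cases "i = n")
      case True
      have h: "cnj (Gs n j n) = Gs n n j" using psd_herm[OF P, of n j n] by simp
      show ?thesis
      proof (cases "Gs n n n = 0")
        case z: True
        then have "Gs n n j = 0" using psd_zero_diag[OF P z, of j] psd_herm[OF P, of n n j] by simp
        then show ?thesis using True z by (simp add: GS schur_compl_def)
      qed (use True h in \<open>simp add: GS schur_compl_def\<close>)
    next
      case False
      then have i: "i < n" using Suc.prems by simp
      then show ?thesis using Suc.IH[OF i] by (simp add: GS schur_compl_def)
    qed
  qed simp
  have sum: "G i j = (\<Sum>k<m. L i k * cnj (L j k)) + Gs m i j" for m i j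
  proof (induction m)
    case (Suc m)
    then show ?case using step[of m i j] by simp
  qed (simp add: G0)
  show thesis
  proof (rule that)
    show "G i j = (\<Sum>k\<le>i. L i k * cnj (L j k))" for i j using sum[of i j "Suc i"] zero[of i "Suc i" j] by (simp add: lessThan_Suc_atMost)
    show "L i k = 0" if "k > i" for i k using zero[OF that] by (simp add: L_def)
  qed
qed

subsection \<open>Factorization of Schur multipliers\<close>

text \<open>Even indices of \<open>G\<close> stand for the rows and odd indices for the columns of the matrix.\<close>

definition weighted_factor :: "nat \<Rightarrow> (nat \<Rightarrow> nat \<Rightarrow> complex) \<Rightarrow> (nat \<Rightarrow> real) \<Rightarrow> (nat \<Rightarrow> real) \<Rightarrow> real \<Rightarrow> bool" where
  "weighted_factor N A d e C \<longleftrightarrow> (\<exists>G. psd G \<and>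
     (\<forall>i<N. \<forall>j<N. G (2*i) (2*j+1) = of_real (d i) * A i j * of_real (e j)) \<and>
     (\<Sum>i<N. Re (G (2*i) (2*i))) \<le> C \<and> (\<Sum>j<N. Re (G (2*j+1) (2*j+1))) \<le> C)"

text \<open>\<open>wf\<close> controls the traces of completions of weighted matrices, while a
  completion with every diagonal entry small is wanted. Minimax is applied to the functionals
  indexed by pairs \<open>(i, j)\<close> that add the diagonal entries of row \<open>i\<close> and
  column \<open>j\<close>: a probability weight on pairs has two marginals, and their square roots
  are admissible as \<open>d\<close> and \<open>e\<close>.\<close>

lemma finite_factor:
  assumes wf: "\<And>d e. \<lbrakk>\<And>i. i < N \<Longrightarrow> d i > 0; \<And>i. i < N \<Longrightarrow> e i > 0; (\<Sum>i<N. (d i)\<^sup>2) \<le> 1; (\<Sum>i<N. (e i)\<^sup>2) \<le> 1\<rbrakk>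
      \<Longrightarrow> weighted_factor N A d e C"
    and C: "C \<ge> 0" and \<epsilon>: "\<epsilon> > 0" and N: "N > 0"
  obtains G where "psd G" "\<And>i j. i < N \<Longrightarrow> j < N \<Longrightarrow> G (2*i) (2*j+1) = A i j" "\<And>m. Re (G m m) \<le> C + \<epsilon>"
proof -
  define X where "X = {G. psd G \<and> (\<forall>i<N. \<forall>j<N. G (2*i) (2*j+1) = A i j)}"
  define I where "I = {..<N} \<times> {..<N}"
  define f where "f p G = Re (G (2 * fst p) (2 * fst p)) + Re (G (2 * snd p + 1) (2 * snd p + 1))" for p :: "nat \<times> nat" and G :: "nat \<Rightarrow> nat \<Rightarrow> complex"
  have "\<exists>G\<in>X. \<forall>p\<in>I. f p G < 2 * C + 2 * (\<epsilon> / 2)"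
  proof (rule minimax_positive_weights[where C="2 * C"])
    show "finite I" "I \<noteq> {}" using N by (auto simp: I_def)
    show "f p G \<ge> 0" if "G \<in> X" for p G using that psd_diag(2) by (auto simp: f_def X_def)
    fix G G' t assume h: "G \<in> X" "G' \<in> X" "0 \<le> t" "t \<le> (1::real)"
    define Z where "Z i j = of_real (1 - t) * G i j + of_real t * G' i j" for i j
    have "psd Z" unfolding Z_def by (intro psd_add psd_cmult) (use h in \<open>auto simp: X_def\<close>)
    moreover have "Z (2*i) (2*j+1) = A i j" if "i < N" "j < N" for i j
    proof -
      have "Z (2*i) (2*j+1) = of_real (1 - t) * A i j + of_real t * A i j" using h that by (simp add: Z_def X_def)
      then show ?thesis by (simp add: algebra_simps)
    qed
    ultimately have "Z \<in> X" by (simp add: X_def)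
    moreover have "\<forall>p\<in>I. f p Z \<le> (1 - t) * f p G + t * f p G'" by (simp add: f_def Z_def algebra_simps)
    ultimately show "\<exists>Z\<in>X. \<forall>p\<in>I. f p Z \<le> (1 - t) * f p G + t * f p G'" by blast
  next
    fix l :: "nat \<times> nat \<Rightarrow> real" assume l: "\<And>p. p \<in> I \<Longrightarrow> l p > 0" "sum l I = 1"
    \<comment> \<open>Square roots of the marginals of \<open>l\<close>. Once these weights are
      divided out of the completion, its two traces become the averages of the diagonal entries
      against \<open>l\<close>.\<close>
    define d where "d i = sqrt (\<Sum>j<N. l (i, j))" for i
    define e where "e j = sqrt (\<Sum>i<N. l (i, j))" for j
    have d: "d i > 0" "(d i)\<^sup>2 = (\<Sum>j<N. l (i, j))" if "i < N" for i
    proof -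
      have p: "(\<Sum>j<N. l (i, j)) > 0" by (rule sum_pos) (use l that N in \<open>auto simp: I_def\<close>)
      show "d i > 0" "(d i)\<^sup>2 = (\<Sum>j<N. l (i, j))" using p by (auto simp: d_def)
    qed
    have e: "e j > 0" "(e j)\<^sup>2 = (\<Sum>i<N. l (i, j))" if "j < N" for j
    proof -
      have p: "(\<Sum>i<N. l (i, j)) > 0" by (rule sum_pos) (use l that N in \<open>auto simp: I_def\<close>)
      show "e j > 0" "(e j)\<^sup>2 = (\<Sum>i<N. l (i, j))" using p by (auto simp: e_def)
    qed
    have lI: "(\<Sum>p\<in>I. h p) = (\<Sum>i<N. \<Sum>j<N. h (i, j))" for h :: "nat \<times> nat \<Rightarrow> real"
      unfolding I_def by (simp add: sum.cartesian_product)
    have "(\<Sum>i<N. (d i)\<^sup>2) = (\<Sum>i<N. \<Sum>j<N. l (i, j))" using d by simp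
    then have d1: "(\<Sum>i<N. (d i)\<^sup>2) \<le> 1" using l(2) by (simp add: lI)
    have "(\<Sum>i<N. (e i)\<^sup>2) = (\<Sum>j<N. \<Sum>i<N. l (i, j))" using e by simp
    also have "\<dots> = (\<Sum>i<N. \<Sum>j<N. l (i, j))" by (rule sum.swap)
    finally have e1: "(\<Sum>i<N. (e i)\<^sup>2) \<le> 1" using l(2) by (simp add: lI)
    obtain G where G: "psd G" "\<forall>i<N. \<forall>j<N. G (2*i) (2*j+1) = of_real (d i) * A i j * of_real (e j)"
      "(\<Sum>i<N. Re (G (2*i) (2*i))) \<le> C" "(\<Sum>j<N. Re (G (2*j+1) (2*j+1))) \<le> C"
      using wf[OF d(1) e(1) d1 e1] unfolding weighted_factor_def by blast
    define w where "w m = complex_of_real (if even m then 1 / d (m div 2) else 1 / e (m div 2))" for m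
    define Z where "Z i j = w i * cnj (w j) * G i j" for i j
    have we: "w (2*i) = of_real (1 / d i)" "w (2*i+1) = of_real (1 / e i)" for i by (auto simp: w_def)
    have "psd Z" unfolding Z_def by (rule psd_scale[OF G(1)])
    moreover have "Z (2*i) (2*j+1) = A i j" if "i < N" "j < N" for i j
      using G(2) that d(1)[OF that(1)] e(1)[OF that(2)] by (simp add: Z_def we[unfolded Suc_eq_plus1[symmetric]])
    ultimately have ZX: "Z \<in> X" by (simp add: X_def)
    have Ze: "(d i)\<^sup>2 * Re (Z (2*i) (2*i)) = Re (G (2*i) (2*i))" if "i < N" for i
    proof -
      have "Z (2*i) (2*i) = of_real (1 / (d i)\<^sup>2) * G (2*i) (2*i)" unfolding Z_def we by (simp add: power2_eq_square)
      then have "Re (Z (2*i) (2*i)) = 1 / (d i)\<^sup>2 * Re (G (2*i) (2*i))" by simp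
      then show ?thesis using d(1)[OF that] by simp
    qed
    have Zo: "(e i)\<^sup>2 * Re (Z (2*i+1) (2*i+1)) = Re (G (2*i+1) (2*i+1))" if "i < N" for i
    proof -
      have "Z (2*i+1) (2*i+1) = of_real (1 / (e i)\<^sup>2) * G (2*i+1) (2*i+1)" unfolding Z_def we by (simp add: power2_eq_square)
      then have "Re (Z (2*i+1) (2*i+1)) = 1 / (e i)\<^sup>2 * Re (G (2*i+1) (2*i+1))" by simp
      then show ?thesis using e(1)[OF that] by simp
    qed
    have "(\<Sum>p\<in>I. l p * f p Z) = (\<Sum>i<N. \<Sum>j<N. l (i, j) * Re (Z (2*i) (2*i))) + (\<Sum>i<N. \<Sum>j<N. l (i, j) * Re (Z (2*j+1) (2*j+1)))"
      unfolding lI by (simp add: f_def distrib_left sum.distrib)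
    also have "(\<Sum>i<N. \<Sum>j<N. l (i, j) * Re (Z (2*i) (2*i))) = (\<Sum>i<N. Re (G (2*i) (2*i)))"
      by (rule sum.cong) (use d(2) Ze in \<open>auto simp flip: sum_distrib_right\<close>)
    also have "(\<Sum>i<N. \<Sum>j<N. l (i, j) * Re (Z (2*j+1) (2*j+1))) = (\<Sum>j<N. \<Sum>i<N. l (i, j) * Re (Z (2*j+1) (2*j+1)))"
      by (rule sum.swap)
    also have "\<dots> = (\<Sum>j<N. Re (G (2*j+1) (2*j+1)))"
      by (rule sum.cong) (use e(2) Zo in \<open>auto simp flip: sum_distrib_right\<close>)
    finally show "\<exists>G\<in>X. (\<Sum>p\<in>I. l p * f p G) \<le> 2 * C" using ZX G(3,4) by (intro bexI[of _ Z]) auto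
  qed (use \<epsilon> C in auto)
  then obtain G where GX: "G \<in> X" "\<forall>p\<in>I. f p G < 2 * C + 2 * (\<epsilon> / 2)" by blast
  have G: "psd G" "\<And>i j. i < N \<Longrightarrow> j < N \<Longrightarrow> G (2*i) (2*j+1) = A i j" using GX(1) by (auto simp: X_def)
  have fG: "Re (G (2*i) (2*i)) + Re (G (2*j+1) (2*j+1)) < 2 * C + \<epsilon>" if "i < N" "j < N" for i j
    using GX(2)[rule_format, of "(i, j)"] that by (simp add: I_def f_def)
  \<comment> \<open>The largest diagonal entries among rows and among columns, raised by
    \<open>\<epsilon> / 2\<close> to make them positive. So far only the sum \<open>a + b\<close> is
    controlled, not each of them.\<close>
  define a where "a = Max ((\<lambda>i. Re (G (2*i) (2*i))) ` {..<N}) + \<epsilon> / 2"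
  define b where "b = Max ((\<lambda>j. Re (G (2*j+1) (2*j+1))) ` {..<N}) + \<epsilon> / 2"
  have fin: "finite ((\<lambda>i. Re (G (2*i) (2*i))) ` {..<N})" "(\<lambda>i. Re (G (2*i) (2*i))) ` {..<N} \<noteq> {}"
    "finite ((\<lambda>j. Re (G (2*j+1) (2*j+1))) ` {..<N})" "(\<lambda>j. Re (G (2*j+1) (2*j+1))) ` {..<N} \<noteq> {}" using N by auto
  obtain i0 where i0: "i0 < N" "a = Re (G (2*i0) (2*i0)) + \<epsilon> / 2" using Max_in[OF fin(1,2)] by (auto simp: a_def)
  obtain j0 where j0: "j0 < N" "b = Re (G (2*j0+1) (2*j0+1)) + \<epsilon> / 2" using Max_in[OF fin(3,4)] by (auto simp: b_def)
  have ab: "a + b \<le> 2 * C + 2 * \<epsilon>" using fG[OF i0(1) j0(1)] i0(2) j0(2) by simp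
  have a0: "a > 0" "b > 0" using i0(2) j0(2) psd_diag(2)[OF G(1)] \<epsilon> by (auto simp: add_nonneg_pos)
  have ale: "Re (G (2*i) (2*i)) \<le> a" "Re (G (2*i+1) (2*i+1)) \<le> b" if "i < N" for i
  proof -
    have "Re (G (2*i) (2*i)) \<le> Max ((\<lambda>i. Re (G (2*i) (2*i))) ` {..<N})" by (rule Max_ge[OF fin(1)]) (use that in auto)
    then show "Re (G (2*i) (2*i)) \<le> a" using \<epsilon> by (simp add: a_def)
    have "Re (G (2*i+1) (2*i+1)) \<le> Max ((\<lambda>j. Re (G (2*j+1) (2*j+1))) ` {..<N})" by (rule Max_ge[OF fin(3)]) (use that in auto)
    then show "Re (G (2*i+1) (2*i+1)) \<le> b" using \<epsilon> by (simp add: b_def)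
  qed
  \<comment> \<open>Scaling rows by \<open>t\<close> and columns by \<open>1 / t\<close> keeps the
    block \<open>A\<close> and changes both \<open>a\<close> and \<open>b\<close> into their
    geometric mean, which is at most half of \<open>a + b\<close>.\<close>
  define t where "t = sqrt (sqrt (b / a))"
  have t: "t > 0" "t\<^sup>2 * a = sqrt (a * b)" "b / t\<^sup>2 = sqrt (a * b)"
  proof -
    show "t > 0" using a0 by (simp add: t_def)
    have "t\<^sup>2 = sqrt (b / a)" unfolding t_def by (rule real_sqrt_pow2) (use a0 in simp)
    then have t2: "t\<^sup>2 = sqrt b / sqrt a" by (simp add: real_sqrt_divide)
    have "a = sqrt a * sqrt a" "b = sqrt b * sqrt b" using a0 by auto
    then show "t\<^sup>2 * a = sqrt (a * b)" "b / t\<^sup>2 = sqrt (a * b)" unfolding t2 using a0 by (auto simp: real_sqrt_mult field_simps)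
  qed
  have gm: "sqrt (a * b) \<le> C + \<epsilon>" using arith_geo_mean_sqrt[of a b] a0 ab by simp
  \<comment> \<open>Zero beyond the first \<open>2 * N\<close> indices, so that the diagonal bound
    holds at every index and not only on the block.\<close>
  define w where "w m = complex_of_real (if m < 2 * N then (if even m then t else 1 / t) else 0)" for m
  define Z where "Z i j = w i * cnj (w j) * G i j" for i j
  show thesis
  proof (rule that)
    show "psd Z" unfolding Z_def by (rule psd_scale[OF G(1)])
    show "Z (2*i) (2*j+1) = A i j" if "i < N" "j < N" for i j
      using G(2)[OF that] that t(1) by (simp add: Z_def w_def)
    fix m
    have "m \<ge> 2 * N \<or> (\<exists>i. m = 2 * i \<and> i < N) \<or> (\<exists>i. m = 2 * i + 1 \<and> i < N)" by presburger
    then consider "m \<ge> 2 * N" | i where "m = 2 * i" "i < N" | i where "m = 2 * i + 1" "i < N" by blast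
    then show "Re (Z m m) \<le> C + \<epsilon>"
    proof cases
      case 1
      then show ?thesis using C \<epsilon> by (simp add: Z_def w_def)
    next
      case 2
      have "Re (Z m m) = t\<^sup>2 * Re (G (2*i) (2*i))" using 2 by (simp add: Z_def w_def power2_eq_square flip: of_real_mult)
      also have "\<dots> \<le> t\<^sup>2 * a" using ale(1)[OF 2(2)] by (simp add: mult_left_mono)
      finally show ?thesis using t gm by simp
    next
      case 3
      have "Re (Z m m) = Re (G (2*i+1) (2*i+1)) / t\<^sup>2" using 3 by (simp add: Z_def w_def power2_eq_square flip: of_real_mult of_real_divide)
      also have "\<dots> \<le> b / t\<^sup>2" using ale(2)[OF 3(2)] by (simp add: divide_right_mono)
      finally show ?thesis using t gm by simp
    qed
  qed
qed

text \<open>Nonnegativity of a diagonal entry of the Schur complement.\<close>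

lemma psd_norm_le: assumes G: "psd G" shows "(cmod (G i k))\<^sup>2 \<le> Re (G i i) * Re (G k k)"
proof -
  define g where "g = Re (G k k)"
  have g: "G k k = of_real g" "g \<ge> 0" using psd_real_diag[OF G] psd_diag[OF G] by (auto simp: g_def)
  have e: "schur_compl G k i i = of_real (Re (G i i) - (cmod (G i k))\<^sup>2 / g)"
    using psd_real_diag[OF G, of i] by (simp add: schur_compl_def g(1) complex_norm_square[symmetric])
  have "Re (G i i) - (cmod (G i k))\<^sup>2 / g \<ge> 0" using psd_diag(2)[OF psd_schur_compl[OF G], of k i] unfolding e by simp
  then show ?thesis using g psd_zero_diag[OF G, of k i] by (cases "g = 0") (auto simp: g_def[symmetric] field_simps)
qed

text \<open>The completions of growing finite blocks are bounded entrywise, so a subsequence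
  converges entrywise to one kernel for the whole matrix. The slack \<open>1 / real (Suc n)\<close>
  disappears in the limit, which leaves the exact constant \<open>C\<close>, and the Cholesky
  vectors of the limit give the factorization.\<close>

theorem schur_factorization:
  assumes wf: "\<And>N d e. \<lbrakk>\<And>i. i < N \<Longrightarrow> d i > 0; \<And>i. i < N \<Longrightarrow> e i > 0; (\<Sum>i<N. (d i)\<^sup>2) \<le> 1; (\<Sum>i<N. (e i)\<^sup>2) \<le> 1\<rbrakk>
      \<Longrightarrow> weighted_factor N A d e C"
    and C: "C \<ge> 0"
  obtains L where "\<And>i k. k > i \<Longrightarrow> L i k = 0" "\<And>i j. A i j = (\<Sum>k\<le>2*i. L (2*i) k * cnj (L (2*j+1) k))"
    "\<And>i. (\<Sum>k\<le>i. (cmod (L i k))\<^sup>2) \<le> C"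
proof -
  define Q where "Q n G \<longleftrightarrow> psd G \<and> (\<forall>i\<le>n. \<forall>j\<le>n. G (2*i) (2*j+1) = A i j) \<and> (\<forall>m. Re (G m m) \<le> C + 1 / real (Suc n))" for n G
  have "\<forall>n. \<exists>G. Q n G"
  proof
    fix n
    show "\<exists>G. Q n G"
      by (rule finite_factor[of "Suc n" A C "1 / real (Suc n)"]) (use wf C in \<open>auto simp: less_Suc_eq_le Q_def\<close>)
  qed
  from choice[OF this] obtain G where GG: "\<forall>n. Q n (G n)" by (rule exE)
  have G: "psd (G n)" "i \<le> n \<Longrightarrow> j \<le> n \<Longrightarrow> G n (2*i) (2*j+1) = A i j" "Re (G n m m) \<le> C + 1 / real (Suc n)" for n i j m
    using GG[rule_format, of n] unfolding Q_def by simp_all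
  have Gd: "Re (G n m m) \<le> C + 1" for n m
  proof -
    have "1 / real (Suc n) \<le> 1" by simp
    then show ?thesis using G(3)[of n m] by linarith
  qed
  have Gb: "cmod (G n (fst p) (snd p)) \<le> C + 1" for n p
  proof (rule power2_le_imp_le)
    have "(cmod (G n (fst p) (snd p)))\<^sup>2 \<le> Re (G n (fst p) (fst p)) * Re (G n (snd p) (snd p))" by (rule psd_norm_le[OF G(1)])
    also have "\<dots> \<le> (C + 1) * (C + 1)" by (intro mult_mono Gd) (use psd_diag(2)[OF G(1)] C in auto)
    finally show "(cmod (G n (fst p) (snd p)))\<^sup>2 \<le> (C + 1)\<^sup>2" by (simp add: power2_eq_square)
  qed (use C in simp)
  obtain r where r: "strict_mono (r :: nat \<Rightarrow> nat)" "\<And>p. p \<in> UNIV \<Longrightarrow> \<exists>l. (\<lambda>n. G (r n) (fst p) (snd p)) \<longlonglongrightarrow> l"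
    by (rule function_convergent_subsequence[of "UNIV :: (nat \<times> nat) set" "\<lambda>n p. G n (fst p) (snd p)" "C + 1"]) (use Gb in auto)
  define K where "K i j = lim (\<lambda>n. G (r n) i j)" for i j
  have K: "(\<lambda>n. G (r n) i j) \<longlonglongrightarrow> K i j" for i j
    using r(2)[of "(i, j)"] unfolding K_def by (simp add: convergent_def[symmetric] convergent_LIMSEQ_iff)
  have Kp: "psd K" by (rule psd_limit[OF _ K]) (rule G(1))
  have KA: "K (2*i) (2*j+1) = A i j" for i j
  proof (rule LIMSEQ_unique[OF K])
    have "G (r n) (2*i) (2*j+1) = A i j" if "n \<ge> max i j" for n
      using G(2)[of i "r n" j] seq_suble[OF r(1), of n] that by simp
    then show "(\<lambda>n. G (r n) (2*i) (2*j+1)) \<longlonglongrightarrow> A i j"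
      by (intro tendsto_eventually) (unfold eventually_sequentially, blast)
  qed
  have Kd: "Re (K m m) \<le> C" for m
  proof -
    have "(\<lambda>n. C + 1 / real (Suc n)) \<longlonglongrightarrow> C + 0"
      by (intro tendsto_intros LIMSEQ_inverse_real_of_nat[unfolded inverse_eq_divide])
    from LIMSEQ_subseq_LIMSEQ[OF this r(1)] have "(\<lambda>n. C + 1 / real (Suc (r n))) \<longlonglongrightarrow> C" by (simp add: o_def)
    then show ?thesis by (rule LIMSEQ_le[OF tendsto_Re[OF K]]) (use G(3) in auto)
  qed
  obtain L where L: "\<And>i j. K i j = (\<Sum>k\<le>i. L i k * cnj (L j k))" "\<And>i k. k > i \<Longrightarrow> L i k = 0"
    using cholesky[OF Kp] by blast
  show thesis
  proof (rule that[of L])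
    show "A i j = (\<Sum>k\<le>2*i. L (2*i) k * cnj (L (2*j+1) k))" for i j using L(1)[of "2*i" "2*j+1"] KA by simp
    show "(\<Sum>k\<le>i. (cmod (L i k))\<^sup>2) \<le> C" for i
    proof -
      have "K i i = of_real (\<Sum>k\<le>i. (cmod (L i k))\<^sup>2)"
        unfolding L(1) of_real_sum by (rule sum.cong) (simp_all only: complex_norm_square)
      then show ?thesis using Kd[of i] by simp
    qed
  qed (rule L(2))
qed

subsection \<open>Sequence space inside a type of continuum cardinality\<close>

text \<open>A Hilbert space of the development has its carrier inside \<open>'v\<close>. Sequences
  are therefore coded by an injection \<open>\<kappa>\<close>, and every operation decodes with
  \<open>co\<close>, computes coordinatewise and codes again.\<close>

locale ell2 =
  fixes \<kappa> :: "(nat \<Rightarrow> complex) \<Rightarrow> 'v"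
  assumes inj_emb: "inj \<kappa>"
begin

definition l2 :: "(nat \<Rightarrow> complex) set" where "l2 = {a. summable (\<lambda>n. (cmod (a n))\<^sup>2)}"

definition co :: "'v \<Rightarrow> nat \<Rightarrow> complex" where "co = inv_into UNIV \<kappa>"

definition ell :: "'v hilbert" where
  "ell = \<lparr>carrier = \<kappa> ` l2, mult = undefined, one = undefined, zero = \<kappa> (\<lambda>_. 0),
     add = (\<lambda>x y. \<kappa> (\<lambda>n. co x n + co y n)), smult = (\<lambda>a x. \<kappa> (\<lambda>n. a * co x n)),
     ip = (\<lambda>x y. \<Sum>n. co x n * cnj (co y n))\<rparr>"

lemma ell_simps:
  "carrier ell = \<kappa> ` l2" "zero ell = \<kappa> (\<lambda>_. 0)" "add ell x y = \<kappa> (\<lambda>n. co x n + co y n)"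
  "smult ell a x = \<kappa> (\<lambda>n. a * co x n)" "ip ell x y = (\<Sum>n. co x n * cnj (co y n))"
  by (simp_all add: ell_def)

lemma co_emb [simp]: "co (\<kappa> a) = a"
  by (simp add: co_def inj_emb)

lemma ell_mem [simp]: "\<kappa> a \<in> carrier ell \<longleftrightarrow> a \<in> l2"
  using inj_emb by (auto simp: ell_simps inj_image_mem_iff)

lemma co_l2: "x \<in> carrier ell \<Longrightarrow> co x \<in> l2" and emb_co: "x \<in> carrier ell \<Longrightarrow> \<kappa> (co x) = x"
  by (auto simp: ell_simps)

lemma ell_eqI: "\<lbrakk>x \<in> carrier ell; y \<in> carrier ell; \<And>n. co x n = co y n\<rbrakk> \<Longrightarrow> x = y"
  using emb_co[of x] emb_co[of y] by (metis ext)

lemma l2_zero: "(\<lambda>_. 0) \<in> l2" by (simp add: l2_def)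

lemma l2_scale: "a \<in> l2 \<Longrightarrow> (\<lambda>n. c * a n) \<in> l2"
  by (simp add: l2_def norm_mult power_mult_distrib summable_mult)

lemma l2_add: assumes "a \<in> l2" "b \<in> l2" shows "(\<lambda>n. a n + b n) \<in> l2"
proof -
  have "summable (\<lambda>n. 2 * (cmod (a n))\<^sup>2 + 2 * (cmod (b n))\<^sup>2)"
    by (intro summable_add summable_mult) (use assms in \<open>auto simp: l2_def\<close>)
  moreover have "norm ((cmod (a n + b n))\<^sup>2) \<le> 2 * (cmod (a n))\<^sup>2 + 2 * (cmod (b n))\<^sup>2" for n
  proof -
    have "(cmod (a n + b n))\<^sup>2 \<le> (cmod (a n) + cmod (b n))\<^sup>2" by (intro power_mono norm_triangle_ineq) simp
    also have "\<dots> \<le> 2 * (cmod (a n))\<^sup>2 + 2 * (cmod (b n))\<^sup>2"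
      using sum_squares_bound[of "cmod (a n)" "cmod (b n)"] by (simp add: power2_sum)
    finally show ?thesis by simp
  qed
  ultimately show ?thesis unfolding l2_def by (auto intro: summable_comparison_test')
qed

lemma l2_diff: "a \<in> l2 \<Longrightarrow> b \<in> l2 \<Longrightarrow> (\<lambda>n. a n - b n) \<in> l2"
  using l2_add[of a "\<lambda>n. (-1) * b n"] l2_scale[of b "-1"] by simp

lemma l2_abs_summable: assumes "a \<in> l2" "b \<in> l2" shows "summable (\<lambda>n. norm (a n * cnj (b n)))"
proof -
  have "summable (\<lambda>n. (cmod (a n))\<^sup>2 + (cmod (b n))\<^sup>2)" using assms by (auto simp: l2_def intro: summable_add)
  moreover have "norm (norm (a n * cnj (b n))) \<le> (cmod (a n))\<^sup>2 + (cmod (b n))\<^sup>2" for n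
  proof -
    have "2 * (cmod (a n) * cmod (b n)) \<le> (cmod (a n))\<^sup>2 + (cmod (b n))\<^sup>2" using sum_squares_bound[of "cmod (a n)" "cmod (b n)"] by (simp add: mult.assoc)
    moreover have "0 \<le> cmod (a n) * cmod (b n)" by simp
    ultimately have "cmod (a n) * cmod (b n) \<le> (cmod (a n))\<^sup>2 + (cmod (b n))\<^sup>2" by linarith
    then show ?thesis by (simp add: norm_mult)
  qed
  ultimately show ?thesis by (rule summable_comparison_test')
qed

lemma l2_summable: "a \<in> l2 \<Longrightarrow> b \<in> l2 \<Longrightarrow> summable (\<lambda>n. a n * cnj (b n))"
  by (rule summable_norm_cancel[OF l2_abs_summable])

lemma l2_finite_support:
  assumes "finite S" "\<And>m. m \<notin> S \<Longrightarrow> a m = 0"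
  shows "a \<in> l2" "(\<Sum>m. (cmod (a m))\<^sup>2) = (\<Sum>m\<in>S. (cmod (a m))\<^sup>2)"
  unfolding l2_def using assms by (auto intro!: summable_finite suminf_finite)

lemma ell_module: "module complex_ring ell"
proof (rule moduleI[OF cring_complex_ring])
  show "abelian_group ell"
  proof (rule abelian_groupI)
    fix x assume x: "x \<in> carrier ell"
    show "\<exists>y\<in>carrier ell. add ell y x = zero ell"
      by (rule bexI[of _ "\<kappa> (\<lambda>n. (-1) * co x n)"]) (use l2_scale[OF co_l2[OF x], of "-1"] in \<open>auto simp: ell_simps(2,3)\<close>)
  qed (auto simp: ell_simps(2,3) co_l2 l2_add l2_zero algebra_simps emb_co)
qed (auto simp: ell_simps(3,4) co_l2 l2_scale algebra_simps emb_co)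

lemma ell_sub:
  assumes "x \<in> carrier ell" "y \<in> carrier ell" shows "x \<ominus>\<^bsub>ell\<^esub> y = \<kappa> (\<lambda>n. co x n - co y n)"
proof -
  interpret M: module complex_ring ell by (rule ell_module)
  have "\<ominus>\<^bsub>ell\<^esub> y = \<kappa> (\<lambda>n. (-1) * co y n)"
    by (rule M.M.minus_equality) (use assms l2_scale[OF co_l2[OF assms(2)], of "-1"] in \<open>auto simp: ell_simps(2,3)\<close>)
  then show ?thesis by (simp add: a_minus_def ell_simps(3))
qed

lemma ell_ip_self: assumes x: "x \<in> carrier ell" shows "ip ell x x = of_real (\<Sum>n. (cmod (co x n))\<^sup>2)"
proof -
  have "summable (\<lambda>n. (cmod (co x n))\<^sup>2)" using co_l2[OF x] by (simp add: l2_def)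
  then have "(\<lambda>n. complex_of_real ((cmod (co x n))\<^sup>2)) sums of_real (\<Sum>n. (cmod (co x n))\<^sup>2)"
    by (intro sums_of_real summable_sums)
  then show ?thesis unfolding ell_simps complex_norm_square by (rule sums_unique[symmetric])
qed

lemma ell_norm: "x \<in> carrier ell \<Longrightarrow> hnorm ell x = sqrt (\<Sum>n. (cmod (co x n))\<^sup>2)"
  by (simp add: hnorm_def ell_ip_self)

lemma ell_complete:
  assumes X: "\<And>n. X n \<in> carrier ell"
    and C: "\<And>e. e > 0 \<Longrightarrow> \<exists>N. \<forall>m\<ge>N. \<forall>n\<ge>N. hnorm ell (X m \<ominus>\<^bsub>ell\<^esub> X n) < e"
  shows "\<exists>x\<in>carrier ell. (\<lambda>n. hnorm ell (X n \<ominus>\<^bsub>ell\<^esub> x)) \<longlonglongrightarrow> 0"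
proof -
  have nrm: "hnorm ell (x \<ominus>\<^bsub>ell\<^esub> y) = sqrt (\<Sum>k. (cmod (co x k - co y k))\<^sup>2)" if "x \<in> carrier ell" "y \<in> carrier ell" for x y
    using that by (simp add: ell_sub ell_norm l2_diff co_l2)
  have fin: "(\<Sum>k\<in>F. (cmod (co (X m) k - co (X n) k))\<^sup>2) \<le> (hnorm ell (X m \<ominus>\<^bsub>ell\<^esub> X n))\<^sup>2" if "finite F" for F m n
  proof -
    have s: "summable (\<lambda>k. (cmod (co (X m) k - co (X n) k))\<^sup>2)" using l2_diff[OF co_l2[OF X] co_l2[OF X]] by (simp add: l2_def)
    have "(\<Sum>k. (cmod (co (X m) k - co (X n) k))\<^sup>2) \<ge> 0" by (rule suminf_nonneg[OF s]) simp
    then show ?thesis unfolding nrm[OF X X] using sum_le_suminf[OF s that] by simp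
  qed
  have co1: "cmod (co (X m) k - co (X n) k) \<le> hnorm ell (X m \<ominus>\<^bsub>ell\<^esub> X n)" for m n k
  proof (rule power2_le_imp_le)
    show "(cmod (co (X m) k - co (X n) k))\<^sup>2 \<le> (hnorm ell (X m \<ominus>\<^bsub>ell\<^esub> X n))\<^sup>2" using fin[of "{k}"] by simp
    show "0 \<le> hnorm ell (X m \<ominus>\<^bsub>ell\<^esub> X n)" unfolding nrm[OF X X]
      by (intro real_sqrt_ge_zero suminf_nonneg) (use l2_diff[OF co_l2[OF X] co_l2[OF X]] in \<open>auto simp: l2_def\<close>)
  qed
  have "Cauchy (\<lambda>n. co (X n) k)" for k
  proof (rule CauchyI)
    fix e :: real assume "e > 0"
    then obtain N where "\<forall>m\<ge>N. \<forall>n\<ge>N. hnorm ell (X m \<ominus>\<^bsub>ell\<^esub> X n) < e" using C by blast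
    then show "\<exists>N. \<forall>m\<ge>N. \<forall>n\<ge>N. norm (co (X m) k - co (X n) k) < e" using co1 le_less_trans by blast
  qed
  then have "\<forall>k. \<exists>l. (\<lambda>n. co (X n) k) \<longlonglongrightarrow> l" using Cauchy_convergent_iff convergent_def by blast
  from choice[OF this] obtain a where a: "\<forall>k. (\<lambda>n. co (X n) k) \<longlonglongrightarrow> a k" by (rule exE)
  \<comment> \<open>Fatou's argument: bounds on partial sums of the differences survive the
    coordinatewise limit and then hold for the full sums.\<close>
  have main: "\<exists>N. \<forall>m\<ge>N. (\<lambda>k. co (X m) k - a k) \<in> l2 \<and> (\<Sum>k. (cmod (co (X m) k - a k))\<^sup>2) \<le> e\<^sup>2" if e: "e > 0" for e
  proof -
    obtain N where N: "\<forall>m\<ge>N. \<forall>n\<ge>N. hnorm ell (X m \<ominus>\<^bsub>ell\<^esub> X n) < e" using C[OF e] by blast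
    have le: "(\<Sum>k<K. (cmod (co (X m) k - a k))\<^sup>2) \<le> e\<^sup>2" if m: "m \<ge> N" for m K
    proof (rule LIMSEQ_le_const2)
      show "(\<lambda>n. \<Sum>k<K. (cmod (co (X m) k - co (X n) k))\<^sup>2) \<longlonglongrightarrow> (\<Sum>k<K. (cmod (co (X m) k - a k))\<^sup>2)"
        by (intro tendsto_intros) (use a in blast)
      have "(\<Sum>k<K. (cmod (co (X m) k - co (X n) k))\<^sup>2) \<le> e\<^sup>2" if n: "n \<ge> N" for n
      proof -
        have "0 \<le> hnorm ell (X m \<ominus>\<^bsub>ell\<^esub> X n)" using co1[of m 0 n] norm_ge_zero order_trans by blast
        moreover have "hnorm ell (X m \<ominus>\<^bsub>ell\<^esub> X n) \<le> e" using N m n by (simp add: less_imp_le)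
        ultimately have "(hnorm ell (X m \<ominus>\<^bsub>ell\<^esub> X n))\<^sup>2 \<le> e\<^sup>2" by (intro power_mono)
        then show ?thesis using fin[of "{..<K}" m n] by simp
      qed
      then show "\<exists>N. \<forall>n\<ge>N. (\<Sum>k<K. (cmod (co (X m) k - co (X n) k))\<^sup>2) \<le> e\<^sup>2" by blast
    qed
    have "(\<lambda>k. co (X m) k - a k) \<in> l2 \<and> (\<Sum>k. (cmod (co (X m) k - a k))\<^sup>2) \<le> e\<^sup>2" if m: "m \<ge> N" for m
    proof -
      have "summable (\<lambda>k. (cmod (co (X m) k - a k))\<^sup>2)" by (rule summableI_nonneg_bounded[OF _ le[OF m]]) simp
      then show ?thesis using suminf_le_const[OF _ le[OF m]] by (simp add: l2_def)
    qed
    then show ?thesis by blast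
  qed
  obtain N where "(\<lambda>k. co (X N) k - a k) \<in> l2" using main[of 1] by auto
  from l2_diff[OF co_l2[OF X[of N]] this] have al: "a \<in> l2" by simp
  show ?thesis
  proof (rule bexI[of _ "\<kappa> a"])
    show "(\<lambda>n. hnorm ell (X n \<ominus>\<^bsub>ell\<^esub> \<kappa> a)) \<longlonglongrightarrow> 0"
    proof (rule LIMSEQ_I)
      fix e :: real assume e: "e > 0"
      then obtain N where N: "\<forall>m\<ge>N. (\<lambda>k. co (X m) k - a k) \<in> l2 \<and> (\<Sum>k. (cmod (co (X m) k - a k))\<^sup>2) \<le> (e/2)\<^sup>2" using main[of "e/2"] by auto
      have "norm (hnorm ell (X m \<ominus>\<^bsub>ell\<^esub> \<kappa> a) - 0) < e" if m: "m \<ge> N" for m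
      proof -
        have "(\<Sum>k. (cmod (co (X m) k - a k))\<^sup>2) \<ge> 0"
          by (rule suminf_nonneg) (use N m in \<open>auto simp: l2_def\<close>)
        moreover have "sqrt (\<Sum>k. (cmod (co (X m) k - a k))\<^sup>2) \<le> sqrt ((e/2)\<^sup>2)" using N m by (intro real_sqrt_le_mono) blast
        ultimately show ?thesis using e al by (simp add: nrm[OF X])
      qed
      then show "\<exists>N. \<forall>m\<ge>N. norm (hnorm ell (X m \<ominus>\<^bsub>ell\<^esub> \<kappa> a) - 0) < e" by blast
    qed
  qed (use al in simp)
qed

lemma ell_hilbert: "complex_hilbert ell"
proof (rule complex_hilbert.intro[OF ell_module], unfold_locales)
  fix x y z assume h: "x \<in> carrier ell" "y \<in> carrier ell" "z \<in> carrier ell"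
  show "ip ell (x \<oplus>\<^bsub>ell\<^esub> y) z = ip ell x z + ip ell y z"
    unfolding ell_simps by (simp add: distrib_right suminf_add[symmetric] l2_summable co_l2 h)
next
  fix x y a assume h: "x \<in> carrier ell" "y \<in> carrier ell"
  show "ip ell (a \<odot>\<^bsub>ell\<^esub> x) y = a * ip ell x y"
    unfolding ell_simps by (simp add: mult.assoc suminf_mult l2_summable co_l2 h)
next
  fix x y assume h: "x \<in> carrier ell" "y \<in> carrier ell"
  have "(\<lambda>n. cnj (co x n * cnj (co y n))) sums cnj (ip ell x y)"
    unfolding ell_simps by (intro sums_cnj[THEN iffD2] summable_sums l2_summable co_l2 h)
  then show "ip ell y x = cnj (ip ell x y)" unfolding ell_simps(5)[of y x] by (simp add: sums_iff mult.commute)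
next
  fix x assume x: "x \<in> carrier ell" "x \<noteq> \<zero>\<^bsub>ell\<^esub>"
  have s: "summable (\<lambda>n. (cmod (co x n))\<^sup>2)" using co_l2[OF x(1)] by (simp add: l2_def)
  have "\<exists>n. co x n \<noteq> 0"
  proof (rule ccontr)
    assume "\<not> (\<exists>n. co x n \<noteq> 0)"
    then have "x = \<zero>\<^bsub>ell\<^esub>" by (intro ell_eqI x(1)) (auto simp: ell_simps(2) l2_zero)
    then show False using x(2) by simp
  qed
  then obtain n where "co x n \<noteq> 0" by blast
  then have "(\<Sum>n. (cmod (co x n))\<^sup>2) > 0" by (intro suminf_pos2[OF s, of n]) auto
  then show "Re (ip ell x x) > 0" using x(1) by (simp add: ell_ip_self)
qed (use ell_complete in blast)

sublocale complex_hilbert ell by (rule ell_hilbert)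

definition unit_vec :: "nat \<Rightarrow> 'v" where "unit_vec n = \<kappa> (\<lambda>k. if k = n then 1 else 0)"

lemma unit_vec_mem [simp, intro]: "unit_vec n \<in> carrier ell"
  using l2_finite_support(1)[of "{n}" "\<lambda>k. if k = n then 1 else 0"] by (simp add: unit_vec_def)

lemma ip_unit_right: "ip ell x (unit_vec n) = co x n"
proof -
  have "(\<lambda>k. co x k * cnj (co (unit_vec n) k)) = (\<lambda>k. if k = n then co x n else 0)" by (auto simp: unit_vec_def)
  then show ?thesis unfolding ell_simps by (simp only:) (subst suminf_finite[of "{n}"]; simp)
qed

lemma ip_unit_left: "x \<in> carrier ell \<Longrightarrow> ip ell (unit_vec n) x = cnj (co x n)"
  using ip_commute[of x "unit_vec n"] by (simp add: ip_unit_right)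

lemma co_unit: "co (unit_vec n) k = (if k = n then 1 else 0)" by (simp add: unit_vec_def)

lemma ip_sums: "\<lbrakk>x \<in> carrier ell; y \<in> carrier ell\<rbrakk> \<Longrightarrow> (\<lambda>n. co x n * cnj (co y n)) sums ip ell x y"
  unfolding ell_simps(5) by (intro summable_sums l2_summable co_l2)

subsection \<open>Discrete spectral measures\<close>

text \<open>The spectral measure of the diagonal operator with entries \<open>p n\<close>. Repeated
  entries are allowed; \<open>schur_blocks\<close> relies on them to set infinitely many blocks over
  the same points.\<close>

definition dspec :: "(nat \<Rightarrow> real) \<Rightarrow> real set \<Rightarrow> 'v \<Rightarrow> 'v" where
  "dspec p L = (\<lambda>x\<in>carrier ell. \<kappa> (\<lambda>n. if p n \<in> L then co x n else 0))"

lemma l2_restrict: assumes "a \<in> l2" shows "(\<lambda>n. if P n then a n else 0) \<in> l2"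
  "(\<Sum>n. (cmod (if P n then a n else 0))\<^sup>2) \<le> (\<Sum>n. (cmod (a n))\<^sup>2)"
proof -
  have s: "summable (\<lambda>n. (cmod (a n))\<^sup>2)" using assms by (simp add: l2_def)
  have "summable (\<lambda>n. (cmod (if P n then a n else 0))\<^sup>2)" by (rule summable_comparison_test'[OF s]) auto
  then show "(\<lambda>n. if P n then a n else 0) \<in> l2" "(\<Sum>n. (cmod (if P n then a n else 0))\<^sup>2) \<le> (\<Sum>n. (cmod (a n))\<^sup>2)"
    by (auto simp: l2_def intro!: suminf_le s)
qed

lemma dspec_app: "x \<in> carrier ell \<Longrightarrow> dspec p L x = \<kappa> (\<lambda>n. if p n \<in> L then co x n else 0)"
  by (simp add: dspec_def)

lemma dspec_mem: "x \<in> carrier ell \<Longrightarrow> dspec p L x \<in> carrier ell"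
  by (simp add: dspec_app l2_restrict co_l2)

lemma dspec_co: "x \<in> carrier ell \<Longrightarrow> co (dspec p L x) n = (if p n \<in> L then co x n else 0)"
  by (simp add: dspec_app)

lemma dspec_op: "dspec p L \<in> bounded_ops ell"
  unfolding dspec_def
proof (rule opI[where c=1])
  fix x y a assume x: "x \<in> carrier ell"
  show "\<kappa> (\<lambda>n. if p n \<in> L then co x n else 0) \<in> carrier ell" using x by (simp add: l2_restrict co_l2)
  show "\<kappa> (\<lambda>n. if p n \<in> L then co (x \<oplus>\<^bsub>ell\<^esub> y) n else 0) =
      \<kappa> (\<lambda>n. if p n \<in> L then co x n else 0) \<oplus>\<^bsub>ell\<^esub> \<kappa> (\<lambda>n. if p n \<in> L then co y n else 0)"
    unfolding ell_simps by (rule arg_cong[where f=\<kappa>]) (auto simp: fun_eq_iff)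
  show "\<kappa> (\<lambda>n. if p n \<in> L then co (a \<odot>\<^bsub>ell\<^esub> x) n else 0) = a \<odot>\<^bsub>ell\<^esub> \<kappa> (\<lambda>n. if p n \<in> L then co x n else 0)"
    unfolding ell_simps by (rule arg_cong[where f=\<kappa>]) (auto simp: fun_eq_iff)
  show "hnorm ell (\<kappa> (\<lambda>n. if p n \<in> L then co x n else 0)) \<le> 1 * hnorm ell x"
    using l2_restrict[OF co_l2[OF x]] x by (simp add: ell_norm)
qed

lemma dspec_proj: "dspec p L \<in> projections ell"
proof (rule projI[OF dspec_op])
  fix x assume x: "x \<in> carrier ell"
  show "dspec p L (dspec p L x) = dspec p L x"
    by (rule ell_eqI) (auto simp: dspec_mem dspec_co x)
  fix y assume y: "y \<in> carrier ell"
  have "co (dspec p L x) n * cnj (co y n) = co x n * cnj (co (dspec p L y) n)" for n using x y by (simp add: dspec_co)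
  then show "ip ell (dspec p L x) y = ip ell x (dspec p L y)" unfolding ell_simps by simp
qed

text \<open>An exchange of two series by Tannery's theorem: each coordinate belongs to at most one
  of the disjoint sets, so its partial sums are dominated by the summable products of
  coordinates.\<close>

lemma dspec_sums:
  assumes A: "disjoint_family (A :: nat \<Rightarrow> real set)" and x: "x \<in> carrier ell" and y: "y \<in> carrier ell"
  shows "(\<lambda>m. ip ell (dspec p (A m) x) y) sums ip ell (dspec p (\<Union>m. A m) x) y"
proof -
  define c where "c k = co x k * cnj (co y k)" for k
  define a where "a k M = (\<Sum>m<M. if p k \<in> A m then c k else 0)" for k and M :: nat
  define b where "b k = (if p k \<in> (\<Union>m. A m) then c k else 0)" for k
  have c: "summable (\<lambda>k. norm (c k))" unfolding c_def by (intro l2_abs_summable co_l2 x y)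
  have ab: "(\<lambda>M. a k M) \<longlonglongrightarrow> b k \<and> (\<forall>M. norm (a k M) \<le> norm (c k))" for k
  proof (cases "p k \<in> (\<Union>m. A m)")
    case True
    then obtain m0 where m0: "p k \<in> A m0" by blast
    have "p k \<in> A m \<longleftrightarrow> m = m0" for m using A m0 by (auto simp: disjoint_family_on_def)
    then have ak: "a k M = (if m0 < M then c k else 0)" for M unfolding a_def by (simp add: sum.delta)
    have "(\<lambda>M. a k M) \<longlonglongrightarrow> b k"
      by (rule tendsto_eventually) (use True in \<open>auto simp: ak b_def eventually_sequentially intro!: exI[of _ "Suc m0"]\<close>)
    then show ?thesis by (simp add: ak)
  qed (simp add: a_def b_def)
  have "((\<lambda>M. \<Sum>k. a k M) \<longlongrightarrow> suminf b) sequentially"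
    using tannerys_theorem[of a b sequentially "\<lambda>k. norm (c k)"] ab c by (simp add: always_eventually case_prod_beta)
  moreover have "(\<Sum>k. a k M) = (\<Sum>m<M. ip ell (dspec p (A m) x) y)" for M
  proof -
    have t: "(if p k \<in> A m then c k else 0) = co (dspec p (A m) x) k * cnj (co y k)" for k m
      using x by (simp add: dspec_co c_def)
    show ?thesis unfolding a_def t ell_simps
      by (rule suminf_sum) (intro l2_summable co_l2 dspec_mem x y)
  qed
  moreover have "suminf b = ip ell (dspec p (\<Union>m. A m) x) y"
    unfolding ell_simps by (rule arg_cong[where f=suminf]) (use x in \<open>auto simp: fun_eq_iff b_def c_def dspec_co\<close>)
  ultimately show ?thesis by (simp add: sums_def)
qed

lemma dspec: "spectral_measure borel ell (dspec p)"
  unfolding spectral_measure_def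
proof (intro conjI ballI allI impI)
  show "dspec p (space borel) = (\<lambda>x\<in>carrier ell. x)"
    by (rule op_ext[OF dspec_op]) (use opid_closed[unfolded opid_def] in \<open>auto simp: dspec_app emb_co\<close>)
  show "dspec p (S \<inter> T) = compose (carrier ell) (dspec p S) (dspec p T)" for S T
    by (rule op_ext[OF dspec_op comp_closed[OF dspec_op dspec_op]])
      (auto intro!: ell_eqI simp: dspec_mem dspec_co)
qed (auto intro: dspec_proj dspec_sums)

lemma dspec_unit: "p n \<in> L \<Longrightarrow> dspec p L (unit_vec n) = unit_vec n"
  by (rule ell_eqI) (auto simp: dspec_mem dspec_co co_unit)

end

subsection \<open>Atoms of a double spectral measure\<close>

context two_spectral begin

text \<open>The rank one operator \<open>R\<close> is fixed by the spectral projection of the point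
  \<open>(s, t)\<close>, on which every function is constant, so \<open>R\<close> is an eigenvector
  of each integral. Taking the adjoint moves the integral from \<open>Q\<close> to \<open>R\<close>,
  and pairing with \<open>R\<close> reads off the matrix element.\<close>

lemma DJ_atom:
  assumes Phi: "bmeas \<Phi>" and Q: "Q \<in> carrier \<HH>" and mem: "\<xi> \<in> \<H>" "\<eta> \<in> \<H>"
    and at: "E1 {s} \<xi> = \<xi>" "E2 {t} \<eta> = \<eta>"
  shows "\<langle>DS.J \<Phi> Q \<eta>, \<xi>\<rangle> = \<Phi> (s, t) * \<langle>Q \<eta>, \<xi>\<rangle>"
proof -
  define R where "R = rank1 \<xi> \<eta>"
  define S where "S = {s} \<times> {t}"
  have R: "R \<in> carrier \<HH>" unfolding R_def by (rule rank1_hs(1)[OF mem])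
  have Sb: "S \<in> sets borel" unfolding S_def by (simp add: borel_closed closed_Times)
  have P1: "E1 {s} \<in> projections H" and P2: "E2 {t} \<in> projections H"
    by (auto intro: spec_proj[OF s1.E] spec_proj[OF s2.E])
  have "dsm S R = compose \<H> (E1 {s}) (compose \<H> R (E2 {t}))" unfolding S_def by (rule dsm(2)) (use R in auto)
  also have "\<dots> = R"
  proof (rule op_ext)
    show "compose \<H> (E1 {s}) (compose \<H> R (E2 {t})) \<in> \<B>" by (intro comp_closed projD(1)[OF P1] projD(1)[OF P2] hsD(1)[OF R])
    show "R \<in> \<B>" by (rule hsD(1)[OF R])
    fix x assume x: "x \<in> \<H>"
    have m: "E2 {t} x \<in> \<H>" using projD(1)[OF P2] x by blast
    have "\<langle>E2 {t} x, \<eta>\<rangle> = \<langle>x, \<eta>\<rangle>" using projD(3)[OF P2 x mem(2)] at by simp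
    then show "compose \<H> (E1 {s}) (compose \<H> R (E2 {t})) x = R x"
      using x m mem op_scale[OF projD(1)[OF P1] mem(1)] at by (simp add: R_def rank1_def)
  qed
  finally have SR: "DS.J (indicator S) R = R" by (simp add: DS.J_ind[OF Sb])
  define \<Psi> where "\<Psi> p = cnj (\<Phi> p)" for p
  have Psi: "bmeas \<Psi>" unfolding \<Psi>_def by (rule bmeas_cnj[OF Phi])
  have e: "(\<lambda>p. \<Psi> p * indicator S p) = (\<lambda>p. \<Psi> (s, t) * indicator S p)" by (auto simp: fun_eq_iff S_def indicator_def)
  have "DS.J \<Psi> R = DS.J (\<lambda>p. \<Psi> p * indicator S p) R" unfolding DS.J_prod[OF Psi bmeas_ind[OF Sb] R] SR ..
  also have "\<dots> = \<Psi> (s, t) \<odot>\<^bsub>\<HH>\<^esub> R" unfolding e DS.J_mult[OF bmeas_ind[OF Sb] R] SR ..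
  finally have JR: "DS.J \<Psi> R = \<Psi> (s, t) \<odot>\<^bsub>\<HH>\<^esub> R" .
  have "\<langle>DS.J \<Phi> Q \<eta>, \<xi>\<rangle> = ip \<HH> (DS.J \<Phi> Q) R" unfolding R_def by (rule DJ_ip[OF Phi Q mem(2,1)])
  also have "\<dots> = ip \<HH> Q (DS.J \<Psi> R)" unfolding \<Psi>_def DS.J_cnj[OF Phi] by (rule HS.adj_ip[symmetric, OF DS.J_closed[OF Phi] Q R])
  also have "\<dots> = \<Phi> (s, t) * ip \<HH> Q R" unfolding JR HS.ip_smult_right[OF Q R] by (simp add: \<Psi>_def)
  also have "ip \<HH> Q R = \<langle>Q \<eta>, \<xi>\<rangle>" unfolding R_def by (rule hs_ip_rank1[OF Q mem])
  finally show ?thesis .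
qed

end

subsection \<open>Trace class operators from and to matrices\<close>

context complex_hilbert begin

text \<open>The operator is defined through an absolutely convergent sum of rank one forms. Its
  modulus is not visible from such a sum, so the estimate goes through \<open>trace_bound\<close>:
  Bessel for both systems bounds the test sum of the term \<open>b\<close> by
  \<open>w b\<close>.\<close>

lemma nuclear_op:
  fixes w :: "nat \<Rightarrow> real"
  assumes w: "\<And>b. w b \<ge> 0" "summable w" and mem: "\<And>b. \<alpha> b \<in> \<H>" "\<And>b. \<beta> b \<in> \<H>"
    and nrm: "\<And>b. \<parallel>\<alpha> b\<parallel> \<le> 1" "\<And>b. \<parallel>\<beta> b\<parallel> \<le> 1"
  obtains Q where "Q \<in> \<B>" "trace_norm H Q \<le> ennreal (suminf w)"
    "\<And>x y. \<lbrakk>x \<in> \<H>; y \<in> \<H>\<rbrakk> \<Longrightarrow> (\<lambda>b. of_real (w b) * (\<langle>x, \<beta> b\<rangle> * \<langle>\<alpha> b, y\<rangle>)) sums \<langle>Q x, y\<rangle>"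
proof -
  define h where "h x y = (\<lambda>b. of_real (w b) * (\<langle>x, \<beta> b\<rangle> * \<langle>\<alpha> b, y\<rangle>))" for x y
  have W: "suminf w \<ge> 0" by (rule suminf_nonneg) (use w in auto)
  have hb: "norm (h x y b) \<le> w b * (\<parallel>x\<parallel> * \<parallel>y\<parallel>)" if "x \<in> \<H>" "y \<in> \<H>" for x y b
  proof -
    have "cmod \<langle>x, \<beta> b\<rangle> \<le> \<parallel>x\<parallel> * 1" using cauchy_schwarz[OF that(1) mem(2)[of b]] mult_left_mono[OF nrm(2)[of b] norm_ge_0[OF that(1)]] by linarith
    moreover have "cmod \<langle>\<alpha> b, y\<rangle> \<le> 1 * \<parallel>y\<parallel>" using cauchy_schwarz[OF mem(1)[of b] that(2)] mult_right_mono[OF nrm(1)[of b] norm_ge_0[OF that(2)]] by linarith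
    ultimately have "cmod \<langle>x, \<beta> b\<rangle> * cmod \<langle>\<alpha> b, y\<rangle> \<le> \<parallel>x\<parallel> * \<parallel>y\<parallel>" using that by (intro mult_mono) auto
    then show ?thesis using w(1)[of b] by (simp add: h_def norm_mult mult_left_mono)
  qed
  have ws: "summable (\<lambda>b. w b * c)" for c by (rule summable_mult2[OF w(2)])
  have hs: "summable (h x y)" if "x \<in> \<H>" "y \<in> \<H>" for x y
    by (rule summable_comparison_test'[OF ws hb[OF that]])
  show thesis
  proof (rule form_op_left[of "\<lambda>x y. suminf (h x y)" "suminf w"])
    fix x y z assume m: "x \<in> \<H>" "y \<in> \<H>" "z \<in> \<H>"
    show "suminf (h (x \<boxplus> y) z) = suminf (h x z) + suminf (h y z)"
      unfolding suminf_add[OF hs[OF m(1,3)] hs[OF m(2,3)]] using m mem by (simp add: h_def ips algebra_simps)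
    show "suminf (h x (y \<boxplus> z)) = suminf (h x y) + suminf (h x z)"
      unfolding suminf_add[OF hs[OF m(1,2)] hs[OF m(1,3)]] using m mem by (simp add: h_def ips algebra_simps)
  next
    fix a x z assume m: "x \<in> \<H>" "z \<in> \<H>"
    show "suminf (h (a \<star> x) z) = a * suminf (h x z)"
      unfolding suminf_mult[OF hs[OF m], symmetric] using m mem by (simp add: h_def ips algebra_simps)
    show "suminf (h x (a \<star> z)) = cnj a * suminf (h x z)"
      unfolding suminf_mult[OF hs[OF m], symmetric] using m mem by (simp add: h_def ips algebra_simps)
    have "norm (suminf (h x z)) \<le> (\<Sum>b. w b * (\<parallel>x\<parallel> * \<parallel>z\<parallel>))" by (rule norm_suminf_le[OF hb[OF m] ws])
    also have "\<dots> = suminf w * \<parallel>x\<parallel> * \<parallel>z\<parallel>" using suminf_mult2[OF w(2), of "\<parallel>x\<parallel> * \<parallel>z\<parallel>"] by (simp only: mult.assoc)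
    finally show "cmod (suminf (h x z)) \<le> suminf w * \<parallel>x\<parallel> * \<parallel>z\<parallel>" .
  next
    fix Q assume Q: "Q \<in> \<B>" "\<And>x y. x \<in> \<H> \<Longrightarrow> y \<in> \<H> \<Longrightarrow> \<langle>Q x, y\<rangle> = suminf (h x y)"
    have "trace_bound Q (suminf w)" unfolding trace_bound_def
    proof (intro allI impI)
      fix F S assume F: "finite F" "F \<subseteq> sb" and S: "S \<in> \<B>" "\<forall>y\<in>\<H>. \<parallel>S y\<parallel> \<le> \<parallel>y\<parallel>"
      have on: "onset F" by (rule onset_subset[OF sb_on F(2)])
      have FH: "e \<in> \<H>" if "e \<in> F" for e using that F(2) by auto
      have tb: "norm (\<Sum>e\<in>F. h e (S e) b) \<le> w b" for b
      proof -
        have adj: "\<langle>\<alpha> b, S e\<rangle> = \<langle>hadj S (\<alpha> b), e\<rangle>" if "e \<in> F" for e using adj_ip2[OF S(1) mem(1) FH[OF that]] by simp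
        have n1: "\<parallel>hadj S (\<alpha> b)\<parallel> \<le> 1"
          using adj_bound[OF S(1), of 1 "\<alpha> b"] S(2) mem(1) nrm(1)[of b] by simp
        have c: "(cmod \<langle>e, \<beta> b\<rangle>)\<^sup>2 = (cmod \<langle>\<beta> b, e\<rangle>)\<^sup>2" if "e \<in> F" for e
          using ip_commute[OF mem(2)[of b] FH[OF that]] by simp
        have "(\<Sum>e\<in>F. (cmod \<langle>e, \<beta> b\<rangle>)\<^sup>2) = (\<Sum>e\<in>F. (cmod \<langle>\<beta> b, e\<rangle>)\<^sup>2)" by (rule sum.cong[OF refl c])
        also have "\<dots> \<le> \<parallel>\<beta> b\<parallel>\<^sup>2" by (rule bessel[OF F(1) on mem(2)])
        also have "\<dots> \<le> 1" using nrm(2)[of b] mem by (simp add: power_le_one)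
        finally have b1: "(\<Sum>e\<in>F. (cmod \<langle>e, \<beta> b\<rangle>)\<^sup>2) \<le> 1" .
        have "(\<Sum>e\<in>F. (cmod \<langle>\<alpha> b, S e\<rangle>)\<^sup>2) = (\<Sum>e\<in>F. (cmod \<langle>hadj S (\<alpha> b), e\<rangle>)\<^sup>2)" by (rule sum.cong) (auto simp: adj)
        also have "\<dots> \<le> \<parallel>hadj S (\<alpha> b)\<parallel>\<^sup>2" by (rule bessel[OF F(1) on]) (use S mem in auto)
        also have "\<dots> \<le> 1" using n1 mem S by (simp add: power_le_one)
        finally have a1: "(\<Sum>e\<in>F. (cmod \<langle>\<alpha> b, S e\<rangle>)\<^sup>2) \<le> 1" .
        have "norm (\<Sum>e\<in>F. h e (S e) b) \<le> (\<Sum>e\<in>F. w b * (cmod \<langle>e, \<beta> b\<rangle> * cmod \<langle>\<alpha> b, S e\<rangle>))"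
          by (rule order_trans[OF norm_sum]) (use w(1)[of b] in \<open>simp add: h_def norm_mult\<close>)
        also have "\<dots> = w b * (\<Sum>e\<in>F. cmod \<langle>e, \<beta> b\<rangle> * cmod \<langle>\<alpha> b, S e\<rangle>)" by (simp add: sum_distrib_left)
        also have "\<dots> \<le> w b * (sqrt 1 * sqrt 1)" by (intro mult_left_mono cauchy_schwarz_sum_le a1 b1 w(1))
        finally show ?thesis by simp
      qed
      have "(\<Sum>e\<in>F. \<langle>Q e, S e\<rangle>) = (\<Sum>e\<in>F. suminf (h e (S e)))" by (rule sum.cong) (use Q FH S in auto)
      also have "\<dots> = (\<Sum>b. \<Sum>e\<in>F. h e (S e) b)" by (rule suminf_sum[symmetric]) (intro hs, use FH S in auto)
      finally show "cmod (\<Sum>e\<in>F. \<langle>Q e, S e\<rangle>) \<le> suminf w" using norm_suminf_le[OF tb w(2)] by simp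
    qed
    then have "trace_norm H Q \<le> ennreal (suminf w)" by (rule trace_bound_trace_norm[OF Q(1)])
    moreover have "(\<lambda>b. of_real (w b) * (\<langle>x, \<beta> b\<rangle> * \<langle>\<alpha> b, y\<rangle>)) sums \<langle>Q x, y\<rangle>" if "x \<in> \<H>" "y \<in> \<H>" for x y
      using summable_sums[OF hs[OF that]] unfolding Q(2)[OF that] h_def .
    ultimately show thesis using Q(1) that by blast
  qed (rule W)
qed

lemma bessel_seq:
  assumes f: "\<And>i. f i \<in> \<H>" "\<And>i j. \<langle>f i, f j\<rangle> = (if i = j then 1 else 0)" and x: "x \<in> \<H>"
  shows "(\<Sum>i<N::nat. (cmod \<langle>x, f i\<rangle>)\<^sup>2) \<le> \<parallel>x\<parallel>\<^sup>2"
proof -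
  have inj: "f i = f j \<longleftrightarrow> i = j" for i j using f(2)[of i j] f(2)[of i i] by (auto split: if_splits)
  have "(\<Sum>e\<in>f ` {..<N}. (cmod \<langle>x, e\<rangle>)\<^sup>2) \<le> \<parallel>x\<parallel>\<^sup>2"
    by (rule bessel) (use f x inj in \<open>auto simp: onset_def\<close>)
  then show ?thesis by (subst (asm) sum.reindex) (auto simp: inj_on_def inj)
qed

text \<open>A trace class operator has a matrix of inner products of two square-summable systems; their
  joint Gram matrix is the positive semidefinite completion.\<close>

lemma trace_class_gram:
  assumes T: "T \<in> \<B>" "trace_norm H T \<le> ennreal c" "c \<ge> 0"
    and f: "\<And>i. f i \<in> \<H>" "\<And>i j. \<langle>f i, f j\<rangle> = (if i = j then 1 else 0)"
  obtains G where "psd G" "\<And>i j. G (2*i) (2*j+1) = \<langle>T (f j), f i\<rangle>"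
    "\<And>N. (\<Sum>i<N. Re (G (2*i) (2*i))) \<le> c" "\<And>N. (\<Sum>j<N. Re (G (2*j+1) (2*j+1))) \<le> c"
proof -
  obtain \<xi> \<eta> where mem: "\<And>e. e \<in> sb \<Longrightarrow> \<xi> e \<in> \<H>" "\<And>e. e \<in> sb \<Longrightarrow> \<eta> e \<in> \<H>"
    and fx: "\<And>F. \<lbrakk>finite F; F \<subseteq> sb\<rbrakk> \<Longrightarrow> (\<Sum>e\<in>F. \<parallel>\<xi> e\<parallel>\<^sup>2) \<le> c"
    and fe: "\<And>F. \<lbrakk>finite F; F \<subseteq> sb\<rbrakk> \<Longrightarrow> (\<Sum>e\<in>F. \<parallel>\<eta> e\<parallel>\<^sup>2) \<le> c"
    and rep: "\<And>x y. \<lbrakk>x \<in> \<H>; y \<in> \<H>\<rbrakk> \<Longrightarrow> ((\<lambda>e. \<langle>x, \<eta> e\<rangle> * \<langle>\<xi> e, y\<rangle>) has_sum \<langle>T x, y\<rangle>) sb"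
  proof (rule trace_class_rep[OF T], goal_cases)
    case (1 \<xi> \<eta>)
    show ?case by (rule 1(1)[OF 1(2-6)])
  qed
  have sx: "(\<lambda>e. \<parallel>\<xi> e\<parallel>\<^sup>2) summable_on sb" "(\<lambda>e. \<parallel>\<eta> e\<parallel>\<^sup>2) summable_on sb"
    by (rule nonneg_bdd_above_summable_on; use fx fe in \<open>auto intro!: bdd_aboveI2[of _ _ c]\<close>)+
  have ix: "(\<Sum>\<^sub>\<infinity>e\<in>sb. \<parallel>\<xi> e\<parallel>\<^sup>2) \<le> c" "(\<Sum>\<^sub>\<infinity>e\<in>sb. \<parallel>\<eta> e\<parallel>\<^sup>2) \<le> c"
    by (rule infsum_le_finite_sums[OF sx(1)], use fx in blast) (rule infsum_le_finite_sums[OF sx(2)], use fe in blast)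
  \<comment> \<open>The even rows come from \<open>\<xi>\<close>, the odd ones from
    \<open>\<eta>\<close>, each viewed as a square-summable function on the basis. \<open>G\<close>
    below is the Gram kernel of these functions.\<close>
  define r where "r m e = (if even m then \<langle>\<xi> e, f (m div 2)\<rangle> else \<langle>\<eta> e, f (m div 2)\<rangle>)" for m e
  define h where "h e = \<parallel>\<xi> e\<parallel>\<^sup>2 + \<parallel>\<eta> e\<parallel>\<^sup>2" for e
  have r0: "r (2*i) e = \<langle>\<xi> e, f i\<rangle>" "r (2*i+1) e = \<langle>\<eta> e, f i\<rangle>" for i e by (auto simp: r_def)
  have hs: "h summable_on sb" unfolding h_def by (intro summable_on_add sx)
  have rb: "(cmod (r m e))\<^sup>2 \<le> h e" if "e \<in> sb" for m e
  proof -
    have "(cmod \<langle>x, f i\<rangle>)\<^sup>2 \<le> \<parallel>x\<parallel>\<^sup>2" if "x \<in> \<H>" for x i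
      using bessel_seq[OF f that, of "Suc i"] sum_nonneg[of "{..<i}" "\<lambda>i. (cmod \<langle>x, f i\<rangle>)\<^sup>2"] by simp
    from this[OF mem(1)[OF that]] this[OF mem(2)[OF that]] show ?thesis
      unfolding r_def h_def by (smt (verit) zero_le_power2)
  qed

  have rr: "(\<lambda>e. r m e * cnj (r m' e)) summable_on sb" for m m'
  proof (rule abs_summable_summable, rule Infinite_Sum.abs_summable_on_comparison_test'[OF hs])
    fix e assume e: "e \<in> sb"
    show "norm (r m e * cnj (r m' e)) \<le> h e"
      using sum_squares_bound[of "cmod (r m e)" "cmod (r m' e)"] rb[OF e, of m] rb[OF e, of m'] by (simp add: norm_mult)
  qed
  define G where "G m m' = (\<Sum>\<^sub>\<infinity>e\<in>sb. r m e * cnj (r m' e))" for m m'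
  have G: "((\<lambda>e. r m e * cnj (r m' e)) has_sum G m m') sb" for m m' unfolding G_def by (rule has_sum_infsum[OF rr])
  have "psd G" unfolding psd_def
  proof (intro allI impI)
    fix F a assume F: "finite (F :: nat set)"
    define g where "g e = (cmod (\<Sum>i\<in>F. a i * r i e))\<^sup>2" for e
    have "((\<lambda>e. \<Sum>i\<in>F. \<Sum>j\<in>F. a i * cnj (a j) * (r i e * cnj (r j e))) has_sum qform G F a) sb"
      unfolding qform_def by (intro has_sum_finite_sum F has_sum_cmult_right G)
    moreover have "(\<Sum>i\<in>F. \<Sum>j\<in>F. a i * cnj (a j) * (r i e * cnj (r j e))) = of_real (g e)" for e
      unfolding g_def complex_norm_square cnj_sum sum_product by (simp add: mult_ac)
    ultimately have q: "((\<lambda>e. complex_of_real (g e)) has_sum qform G F a) sb" by simp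
    have gr: "(g has_sum Re (qform G F a)) sb" and gi: "((\<lambda>e. 0) has_sum Im (qform G F a)) sb"
      using has_sum_Re[OF q] has_sum_Im[OF q] by simp_all
    have "Im (qform G F a) = 0" by (rule has_sum_unique[OF gi has_sum_0]) simp
    moreover have "Re (qform G F a) \<ge> 0" by (rule has_sum_nonneg[OF gr]) (simp add: g_def)
    ultimately show "Im (qform G F a) = 0 \<and> Re (qform G F a) \<ge> 0" ..
  qed
  moreover have "G (2*i) (2*j+1) = \<langle>T (f j), f i\<rangle>" for i j
  proof (rule has_sum_unique[OF G])
    have "r (2*i) e * cnj (r (2*j+1) e) = \<langle>f j, \<eta> e\<rangle> * \<langle>\<xi> e, f i\<rangle>" if "e \<in> sb" for e
      unfolding r0 using ip_commute[OF mem(2)[OF that] f(1)[of j]] by simp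
    then show "((\<lambda>e. r (2*i) e * cnj (r (2*j+1) e)) has_sum \<langle>T (f j), f i\<rangle>) sb"
      using rep[OF f(1)[of j] f(1)[of i]] by (simp cong: has_sum_cong)
  qed
  moreover have "(\<Sum>i<N. Re (G (k i) (k i))) \<le> c"
    if k: "\<And>i e. r (k i) e = \<langle>\<zeta> e, f i\<rangle>" and z: "\<And>e. e \<in> sb \<Longrightarrow> \<zeta> e \<in> \<H>" "(\<lambda>e. \<parallel>\<zeta> e\<parallel>\<^sup>2) summable_on sb" "(\<Sum>\<^sub>\<infinity>e\<in>sb. \<parallel>\<zeta> e\<parallel>\<^sup>2) \<le> c" for N k \<zeta>
  proof -
    have "((\<lambda>e. \<Sum>i<N. Re (r (k i) e * cnj (r (k i) e))) has_sum (\<Sum>i<N. Re (G (k i) (k i)))) sb"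
      by (intro has_sum_finite_sum has_sum_Re G) simp
    then have "(\<Sum>i<N. Re (G (k i) (k i))) \<le> (\<Sum>\<^sub>\<infinity>e\<in>sb. \<parallel>\<zeta> e\<parallel>\<^sup>2)"
    proof (rule has_sum_mono[OF _ has_sum_infsum[OF z(2)]])
      fix e assume e: "e \<in> sb"
      have "Re (r (k i) e * cnj (r (k i) e)) = (cmod \<langle>\<zeta> e, f i\<rangle>)\<^sup>2" for i
        unfolding k complex_norm_square[symmetric] by simp
      then show "(\<Sum>i<N. Re (r (k i) e * cnj (r (k i) e))) \<le> \<parallel>\<zeta> e\<parallel>\<^sup>2"
        using bessel_seq[OF f z(1)[OF e], of N] by simp
    qed
    then show ?thesis using z(3) by simp
  qed
  note this[OF r0(1) mem(1) sx(1) ix(1)] this[OF r0(2) mem(2) sx(2) ix(2)]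
  ultimately show thesis using that[of G] by blast
qed

end

context ell2 begin

text \<open>One trace class operator, block diagonal with blocks \<open>w\<^sub>b d\<^sub>b e\<^sub>b\<^sup>*\<close>, tests the multiplier
  against all pairs of weight vectors at once.\<close>

lemma schur_blocks:
  fixes w :: "nat \<Rightarrow> real" and d e :: "nat \<Rightarrow> nat \<Rightarrow> real" and N :: "nat \<Rightarrow> nat" and p :: "nat \<Rightarrow> real"
  assumes Phi: "bmeas \<Phi>" and w: "\<And>b. w b \<ge> 0" "summable w"
    and d: "\<And>b. (\<Sum>i<N b. (d b i)\<^sup>2) \<le> 1" and e: "\<And>b. (\<Sum>i<N b. (e b i)\<^sup>2) \<le> 1"
  obtains q Q where "Q \<in> bounded_ops ell" "trace_norm ell Q \<le> ennreal (suminf w)"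
    "\<And>c b. \<lbrakk>c \<ge> 0; trace_norm ell (double_operator_integral ell (dspec q) (dspec q) \<Phi> Q) \<le> ennreal c; w b > 0\<rbrakk>
      \<Longrightarrow> weighted_factor (N b) (\<lambda>i j. \<Phi> (p i, p j)) (d b) (e b) (c / w b)"
proof -
  \<comment> \<open>The coordinate coded by \<open>(b, i)\<close> sits at \<open>p i\<close>
    whatever the block \<open>b\<close> is, so one spectral measure serves all blocks.\<close>
  define q where "q m = p (snd (prod_decode m))" for m
  have q: "q (prod_encode (b, i)) = p i" for b i by (simp add: q_def)
  define bl where "bl g b = (\<lambda>m. if fst (prod_decode m) = b \<and> snd (prod_decode m) < N b then complex_of_real (g b (snd (prod_decode m))) else 0)"
    for g :: "nat \<Rightarrow> nat \<Rightarrow> real" and b :: nat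
  have bl: "bl g b \<in> l2 \<and> (\<Sum>m. (cmod (bl g b m))\<^sup>2) \<le> 1" if g: "(\<Sum>i<N b. (g b i)\<^sup>2) \<le> 1" for g b
  proof -
    define S where "S = (\<lambda>i. prod_encode (b, i)) ` {..<N b}"
    have "bl g b m = 0" if "m \<notin> S" for m
    proof (rule ccontr)
      assume "bl g b m \<noteq> 0"
      then have "fst (prod_decode m) = b" "snd (prod_decode m) < N b" by (auto simp: bl_def split: if_splits)
      then have "m = prod_encode (b, snd (prod_decode m))" by (metis prod.collapse prod_decode_inverse)
      then show False using that \<open>snd (prod_decode m) < N b\<close> by (auto simp: S_def)
    qed
    note fs = l2_finite_support[of S, OF _ this]
    have "(\<Sum>m\<in>S. (cmod (bl g b m))\<^sup>2) = (\<Sum>i<N b. (g b i)\<^sup>2)" unfolding S_def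
      by (subst sum.reindex) (auto simp: inj_on_def bl_def)
    then show ?thesis using fs g by (simp add: S_def)
  qed
  define \<alpha> where "\<alpha> b = \<kappa> (bl d b)" for b
  define \<beta> where "\<beta> b = \<kappa> (bl e b)" for b
  have bde: "bl d b \<in> l2 \<and> (\<Sum>m. (cmod (bl d b m))\<^sup>2) \<le> 1" "bl e b \<in> l2 \<and> (\<Sum>m. (cmod (bl e b m))\<^sup>2) \<le> 1" for b
    by (rule bl, rule d) (rule bl, rule e)
  have mem: "\<alpha> b \<in> carrier ell" "\<beta> b \<in> carrier ell" for b using bde by (auto simp: \<alpha>_def \<beta>_def)
  have nrm: "hnorm ell (\<alpha> b) \<le> 1" "hnorm ell (\<beta> b) \<le> 1" for b
    using bde[of b] mem[of b] by (auto simp: ell_norm \<alpha>_def \<beta>_def)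
  obtain Q where Q: "Q \<in> bounded_ops ell" "trace_norm ell Q \<le> ennreal (suminf w)"
    and Qs: "\<And>x y. \<lbrakk>x \<in> carrier ell; y \<in> carrier ell\<rbrakk> \<Longrightarrow> (\<lambda>b. of_real (w b) * (ip ell x (\<beta> b) * ip ell (\<alpha> b) y)) sums ip ell (Q x) y"
  proof (rule nuclear_op[where w=w and \<alpha>=\<alpha> and \<beta>=\<beta>, OF w mem nrm], goal_cases)
    case (1 Q)
    show ?case by (rule 1(1)[OF 1(2-4)])
  qed
  have W: "suminf w \<ge> 0" by (rule suminf_nonneg) (use w in auto)
  interpret TS: two_spectral ell "dspec q" "dspec q"
    by (intro two_spectral.intro spectral.intro spectral_axioms.intro ell_hilbert dspec)
  have Qh: "Q \<in> carrier (hilbert_schmidt ell)"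
    using Q(1) trace_class_square_summable[OF Q W] by (simp add: hs_simps)
  define T where "T = double_operator_integral ell (dspec q) (dspec q) \<Phi> Q"
  have TJ: "T = TS.DS.J \<Phi> Q" by (simp add: T_def double_operator_integral_def)
  have T: "T \<in> bounded_ops ell" unfolding TJ by (rule hsD(1)[OF TS.DJ_hs[OF Phi Qh]])
  show thesis
  proof (rule that[of Q q])
    fix c b assume c: "c \<ge> 0" and tr: "trace_norm ell (double_operator_integral ell (dspec q) (dspec q) \<Phi> Q) \<le> ennreal c" and wb: "w b > 0"
    define f where "f i = unit_vec (prod_encode (b, i))" for i
    have f: "f i \<in> carrier ell" "ip ell (f i) (f j) = (if i = j then 1 else 0)" for i j
      by (auto simp: f_def ip_unit_right co_unit)
    have Qf: "ip ell (Q (f j)) (f i) = of_real (w b) * (of_real (e b j) * of_real (d b i))" if "i < N b" "j < N b" for i j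
    proof (rule sums_unique2[OF Qs[OF f(1) f(1)]])
      have eq: "(\<lambda>b'. of_real (w b') * (ip ell (f j) (\<beta> b') * ip ell (\<alpha> b') (f i))) =
          (\<lambda>b'. if b' = b then of_real (w b) * (of_real (e b j) * of_real (d b i)) else 0)"
        using that unfolding f_def ip_unit_right ip_unit_left[OF mem(2)] by (auto simp: fun_eq_iff \<alpha>_def \<beta>_def bl_def)
      show "(\<lambda>b'. of_real (w b') * (ip ell (f j) (\<beta> b') * ip ell (\<alpha> b') (f i))) sums (of_real (w b) * (of_real (e b j) * of_real (d b i)))"
        unfolding eq by (rule sums_single)
    qed
    have Tf: "ip ell (T (f j)) (f i) = \<Phi> (p i, p j) * ip ell (Q (f j)) (f i)" for i j
      unfolding TJ by (rule TS.DJ_atom[OF Phi Qh f(1) f(1)]) (auto simp: f_def q intro!: dspec_unit)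
    obtain G where G: "psd G" "\<And>i j. G (2*i) (2*j+1) = ip ell (T (f j)) (f i)"
      "\<And>N. (\<Sum>i<N. Re (G (2*i) (2*i))) \<le> c" "\<And>N. (\<Sum>j<N. Re (G (2*j+1) (2*j+1))) \<le> c"
    proof (rule trace_class_gram[where T=T and c=c and f=f, OF T tr[folded T_def] c f], goal_cases)
      case (1 G)
      show ?case by (rule 1(1)[OF 1(2-5)])
    qed
    \<comment> \<open>Block \<open>b\<close> of \<open>Q\<close> carries the factor
      \<open>w b\<close>. Dividing by it restores the weights \<open>d\<close> and \<open>e\<close>
      and turns the trace bound \<open>c\<close> into \<open>c / w b\<close>.\<close>
    define Z where "Z i j = of_real (1 / w b) * G i j" for i j
    have "psd Z" unfolding Z_def by (rule psd_cmult[OF G(1)]) (use wb in simp)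
    moreover have "Z (2*i) (2*j+1) = of_real (d b i) * \<Phi> (p i, p j) * of_real (e b j)" if "i < N b" "j < N b" for i j
      unfolding Z_def G(2) Tf Qf[OF that] using wb by simp
    moreover have "(\<Sum>i<N b. Re (Z (2*i) (2*i))) = (\<Sum>i<N b. Re (G (2*i) (2*i))) / w b"
      "(\<Sum>i<N b. Re (Z (2*i+1) (2*i+1))) = (\<Sum>i<N b. Re (G (2*i+1) (2*i+1))) / w b"
      unfolding Z_def sum_divide_distrib by simp_all
    ultimately show "weighted_factor (N b) (\<lambda>i j. \<Phi> (p i, p j)) (d b) (e b) (c / w b)"
      unfolding weighted_factor_def using G(3)[of "N b"] G(4)[of "N b"] wb
      by (intro exI[of _ Z]) (simp add: divide_right_mono)
  qed (rule Q)+
qed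

end

subsection \<open>Analytic extension of Hilbert space valued functions\<close>

context complex_hilbert begin

text \<open>The vectors whose pairing with the \<open>u i\<close> extends analytically form a subspace, on which the
  maximum principle bounds evaluation at \<open>z\<close>.\<close>

lemma analytic_extension:
  fixes x :: "nat \<Rightarrow> real"
  assumes dense: "closure (range x) = UNIV" and u: "\<And>i. u i \<in> \<H>" "\<And>i. \<parallel>u i\<parallel> \<le> c" and c: "c \<ge> 0"
  obtains U where "\<And>z. z \<in> closed_upper_hp \<Longrightarrow> U z \<in> \<H>" "\<And>z. z \<in> closed_upper_hp \<Longrightarrow> \<parallel>U z\<parallel> \<le> c"
    "\<And>h. h \<in> \<H> \<Longrightarrow> (\<lambda>z. \<langle>U z, h\<rangle>) \<in> CA_inf"
    "\<And>F v z. \<lbrakk>F \<in> CA_inf; v \<in> \<H>; \<And>i. F (of_real (x i)) = \<langle>u i, v\<rangle>; z \<in> closed_upper_hp\<rbrakk> \<Longrightarrow> \<langle>U z, v\<rangle> = F z"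
proof -
  define V where "V = {v \<in> \<H>. \<exists>F\<in>CA_inf. \<forall>i. F (of_real (x i)) = \<langle>u i, v\<rangle>}"
  \<comment> \<open>On the closed half-plane the choice is immaterial: a function in
    \<open>CA_inf\<close> is determined there by its values at the dense points
    \<open>x i\<close>.\<close>
  define \<Psi> where "\<Psi> v = (SOME F. F \<in> CA_inf \<and> (\<forall>i. F (of_real (x i)) = \<langle>u i, v\<rangle>))" for v
  have VH: "v \<in> \<H>" if "v \<in> V" for v using that by (simp add: V_def)
  have Psi: "\<Psi> v \<in> CA_inf" "\<Psi> v (of_real (x i)) = \<langle>u i, v\<rangle>" if "v \<in> V" for v i
  proof -
    have "\<exists>F. F \<in> CA_inf \<and> (\<forall>i. F (of_real (x i)) = \<langle>u i, v\<rangle>)" using that by (auto simp: V_def)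
    from someI_ex[OF this] show "\<Psi> v \<in> CA_inf" "\<Psi> v (of_real (x i)) = \<langle>u i, v\<rangle>" unfolding \<Psi>_def by blast+
  qed
  have uniq: "F z = \<Psi> v z" if "F \<in> CA_inf" "v \<in> V" "\<And>i. F (of_real (x i)) = \<langle>u i, v\<rangle>" "z \<in> closed_upper_hp" for F v z
    by (rule CA_inf_unique[OF that(1) Psi(1)[OF that(2)] dense _ that(4)]) (use that(3) Psi(2)[OF that(2)] in auto)
  have VI: "v \<in> V" if "F \<in> CA_inf" "v \<in> \<H>" "\<And>i. F (of_real (x i)) = \<langle>u i, v\<rangle>" for F v
    unfolding V_def using that by blast
  have add: "v \<boxplus> y \<in> V" "z \<in> closed_upper_hp \<Longrightarrow> \<Psi> (v \<boxplus> y) z = \<Psi> v z + \<Psi> y z" if "v \<in> V" "y \<in> V" for v y z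
  proof -
    note F = CA_inf_add[OF Psi(1)[OF that(1)] Psi(1)[OF that(2)]]
    have e: "\<Psi> v (of_real (x i)) + \<Psi> y (of_real (x i)) = \<langle>u i, v \<boxplus> y\<rangle>" for i
      using that by (simp add: Psi VH u ips)
    show m: "v \<boxplus> y \<in> V" by (rule VI[OF F _ e]) (use that VH in blast)
    show "\<Psi> (v \<boxplus> y) z = \<Psi> v z + \<Psi> y z" if "z \<in> closed_upper_hp" by (rule uniq[OF F m e that, symmetric])
  qed
  have sc: "a \<star> v \<in> V" "z \<in> closed_upper_hp \<Longrightarrow> \<Psi> (a \<star> v) z = cnj a * \<Psi> v z" if "v \<in> V" for a v z
  proof -
    note F = CA_inf_mult[OF CA_inf_const[of "cnj a"] Psi(1)[OF that]]
    have e: "cnj a * \<Psi> v (of_real (x i)) = \<langle>u i, a \<star> v\<rangle>" for i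
      using that by (simp add: Psi VH u ips)
    show m: "a \<star> v \<in> V" by (rule VI[OF F _ e]) (use that VH in blast)
    show "\<Psi> (a \<star> v) z = cnj a * \<Psi> v z" if "z \<in> closed_upper_hp" by (rule uniq[OF F m e that, symmetric])
  qed
  have "\<zero>\<^sub>H \<in> V" by (rule VI[OF CA_inf_const[of 0]]) (use u in auto)
  then have sub: "subsp V" unfolding subsp_def using VH add(1) sc(1) by blast
  have bd: "cmod (\<Psi> v z) \<le> c * \<parallel>v\<parallel>" if "v \<in> V" "z \<in> closed_upper_hp" for v z
  proof (rule max_principle[OF Psi(1)[OF that(1)] dense _ that(2)])
    fix t assume "t \<in> range x"
    then obtain i where t: "t = x i" by blast
    have "cmod \<langle>u i, v\<rangle> \<le> \<parallel>u i\<parallel> * \<parallel>v\<parallel>" by (rule cauchy_schwarz[OF u(1) VH[OF that(1)]])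
    also have "\<dots> \<le> c * \<parallel>v\<parallel>" by (rule mult_right_mono[OF u(2)]) (use VH that in auto)
    finally show "cmod (\<Psi> v (of_real t)) \<le> c * \<parallel>v\<parallel>" unfolding t Psi(2)[OF that(1)] .
  qed
  \<comment> \<open>Conjugated because \<open>\<Psi> v\<close> is antilinear in \<open>v\<close>.
    The sequence \<open>X\<close> is kept as evidence that the Riesz vector lies in the closure of
    \<open>V\<close>.\<close>
  have "\<exists>g X. g \<in> \<H> \<and> (\<forall>n. X n \<in> V) \<and> hlim X g \<and> (\<forall>v\<in>V. cnj (\<Psi> v z) = \<langle>v, g\<rangle>) \<and> \<parallel>g\<parallel> \<le> c"
    if z: "z \<in> closed_upper_hp" for z
  proof (rule riesz_sub[OF sub, of "\<lambda>v. cnj (\<Psi> v z)" c], goal_cases)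
    case (5 g X)
    show ?case using 5 by blast
  qed (use add sc bd c z in auto)
  then have "\<forall>z\<in>closed_upper_hp. \<exists>g. \<exists>X. g \<in> \<H> \<and> (\<forall>n. X n \<in> V) \<and> hlim X g \<and> (\<forall>v\<in>V. cnj (\<Psi> v z) = \<langle>v, g\<rangle>) \<and> \<parallel>g\<parallel> \<le> c"
    by blast
  from bchoice[OF this] obtain U where U: "\<forall>z\<in>closed_upper_hp. \<exists>X. U z \<in> \<H> \<and> (\<forall>n. X n \<in> V) \<and> hlim X (U z) \<and> (\<forall>v\<in>V. cnj (\<Psi> v z) = \<langle>v, U z\<rangle>) \<and> \<parallel>U z\<parallel> \<le> c"
    by (rule exE)
  have UH: "U z \<in> \<H>" and Uc: "\<parallel>U z\<parallel> \<le> c" if "z \<in> closed_upper_hp" for z using U that by blast+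
  have UV: "\<langle>U z, v\<rangle> = \<Psi> v z" if z: "z \<in> closed_upper_hp" and v: "v \<in> V" for z v
  proof -
    have e: "cnj (\<Psi> v z) = \<langle>v, U z\<rangle>" using U z v by blast
    show ?thesis unfolding ip_commute[OF VH[OF v] UH[OF z]] e[symmetric] by simp
  qed
  show thesis
  proof (rule that[OF UH Uc])
    fix h assume h: "h \<in> \<H>"
    \<comment> \<open>As \<open>U z\<close> lies in the closure of \<open>V\<close>, only the
      component \<open>h'\<close> of \<open>h\<close> in that closure is seen. Approximating
      \<open>h'\<close> from \<open>V\<close> makes \<open>\<langle>U z, h\<rangle>\<close> a
      uniform limit of functions \<open>\<Psi> (X n)\<close>.\<close>
    obtain h' X where h': "h' \<in> \<H>" "\<And>n. X n \<in> V" "hlim X h'" "\<And>v. v \<in> V \<Longrightarrow> \<langle>v, h\<rangle> = \<langle>v, h'\<rangle>"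
    proof (rule riesz_sub[OF sub, of "\<lambda>v. \<langle>v, h\<rangle>" "\<parallel>h\<parallel>"], goal_cases)
      case (5 g X)
      show ?case by (rule 5(1)[of g X, OF 5(2-5)])
    next
      case (3 v)
      show ?case using cauchy_schwarz[OF VH[OF 3(2)] h] by (simp add: mult.commute)
    qed (use h VH in \<open>auto simp: ips\<close>)
    have eq: "\<langle>U z, h\<rangle> = \<langle>U z, h'\<rangle>" if z: "z \<in> closed_upper_hp" for z
    proof -
      obtain Y where Y: "\<forall>n. Y n \<in> V" "hlim Y (U z)" using U z by blast
      have YH: "Y n \<in> \<H>" for n using Y VH by blast
      have "(\<lambda>n. \<langle>Y n, h\<rangle>) = (\<lambda>n. \<langle>Y n, h'\<rangle>)" using Y(1) h'(4) by blast
      then show ?thesis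
        using LIMSEQ_unique[OF hlim_ip(1)[OF Y(2) YH UH[OF z] h]] hlim_ip(1)[OF Y(2) YH UH[OF z] h'(1)] by simp
    qed
    show "(\<lambda>z. \<langle>U z, h\<rangle>) \<in> CA_inf"
    proof (rule CA_inf_approx)
      fix e :: real assume e: "e > 0"
      have "(\<lambda>n. \<parallel>X n \<boxminus> h'\<parallel>) \<longlonglongrightarrow> 0" using h'(3) by (simp add: hlim_def)
      then have "\<forall>\<^sub>F n in sequentially. \<parallel>X n \<boxminus> h'\<parallel> < e / (c + 1)" by (rule order_tendstoD) (use e c in simp)
      then obtain n where n: "\<parallel>X n \<boxminus> h'\<parallel> < e / (c + 1)" by (auto simp: eventually_sequentially)
      have nH: "X n \<in> \<H>" "X n \<boxminus> h' \<in> \<H>" using VH h' by auto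
      show "\<exists>g\<in>CA_inf. \<forall>z\<in>closed_upper_hp. cmod (g z - \<langle>U z, h\<rangle>) < e"
      proof (rule bexI[of _ "\<Psi> (X n)"], rule ballI)
        fix z assume z: "z \<in> closed_upper_hp"
        have "\<Psi> (X n) z - \<langle>U z, h\<rangle> = \<langle>U z, X n \<boxminus> h'\<rangle>"
          using UH[OF z] nH(1) h'(1) by (simp add: eq[OF z] UV[OF z h'(2), symmetric] ips)
        then have "cmod (\<Psi> (X n) z - \<langle>U z, h\<rangle>) \<le> \<parallel>U z\<parallel> * \<parallel>X n \<boxminus> h'\<parallel>" using cauchy_schwarz[OF UH[OF z] nH(2)] by simp
        also have "\<dots> \<le> c * \<parallel>X n \<boxminus> h'\<parallel>" by (rule mult_right_mono[OF Uc[OF z] norm_ge_0[OF nH(2)]])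
        also have "\<dots> \<le> c * (e / (c + 1))" by (rule mult_left_mono[OF less_imp_le[OF n] c])
        also have "\<dots> < e" using c e by (simp add: field_simps)
        finally show "cmod (\<Psi> (X n) z - \<langle>U z, h\<rangle>) < e" .
      qed (rule Psi(1)[OF h'(2)])
    qed
  next
    fix F v z assume F: "F \<in> CA_inf" "v \<in> \<H>" "\<And>i. F (of_real (x i)) = \<langle>u i, v\<rangle>" "z \<in> closed_upper_hp"
    have v: "v \<in> V" by (rule VI[OF F(1-3)])
    show "\<langle>U z, v\<rangle> = F z" unfolding UV[OF F(4) v] by (rule uniq[OF F(1) v F(3,4), symmetric])
  qed
qed

end

context ell2 begin

text \<open>Each extension needs \<open>\<Phi>\<close> with one variable frozen: for
  \<open>v\<close> the first variable is one of the real points \<open>x i\<close>, for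
  \<open>u\<close> the second is any point of the closed half-plane. Both extensions preserve the
  norm bound \<open>sqrt C\<close>, so the product of the two suprema is at most
  \<open>C\<close>.\<close>

lemma factorization_haagerup:
  fixes x :: "nat \<Rightarrow> real"
  assumes Phi: "\<Phi> \<in> CSA_inf" and dense: "closure (range x) = UNIV" and C: "C \<ge> 0"
    and wf: "\<And>N d e. \<lbrakk>\<And>i. i < N \<Longrightarrow> d i > 0; \<And>i. i < N \<Longrightarrow> e i > 0; (\<Sum>i<N. (d i)\<^sup>2) \<le> 1; (\<Sum>i<N. (e i)\<^sup>2) \<le> 1\<rbrakk>
      \<Longrightarrow> weighted_factor N (\<lambda>i j. \<Phi> (of_real (x i), of_real (x j))) d e C"
  obtains \<phi> \<psi> where "haagerup_rep CA_inf \<Phi> \<phi> \<psi>" "square_sup \<phi> * square_sup \<psi> \<le> C"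
proof -
  obtain L where L: "\<And>i k. k > i \<Longrightarrow> L i k = 0"
    "\<And>i j. \<Phi> (of_real (x i), of_real (x j)) = (\<Sum>k\<le>2*i. L (2*i) k * cnj (L (2*j+1) k))"
    "\<And>i. (\<Sum>k\<le>i. (cmod (L i k))\<^sup>2) \<le> C"
  proof (rule schur_factorization[OF wf C], goal_cases)
    case (5 L)
    show ?case by (rule 5(1)[OF 5(2-4)])
  qed
  have Ll: "L i \<in> l2" "(\<Sum>k. (cmod (L i k))\<^sup>2) \<le> C" for i
    using l2_finite_support[of "{..i}" "L i"] L(1,3) by auto
  define u where "u i = \<kappa> (L (2*i))" for i
  define v where "v j = \<kappa> (L (2*j+1))" for j
  have uH: "u i \<in> carrier ell" and vH: "v i \<in> carrier ell" for i using Ll(1) by (auto simp: u_def v_def)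
  have uC: "hnorm ell (u i) \<le> sqrt C" and vC: "hnorm ell (v i) \<le> sqrt C" for i
    using Ll uH[of i] vH[of i] by (auto simp: ell_norm u_def v_def)
  have uv: "ip ell (u i) (v j) = \<Phi> (of_real (x i), of_real (x j))" for i j
  proof -
    have "(\<Sum>k. L (2*i) k * cnj (L (2*j+1) k)) = (\<Sum>k\<le>2*i. L (2*i) k * cnj (L (2*j+1) k))"
      by (rule suminf_finite) (use L(1) in auto)
    then show ?thesis unfolding ell_simps L(2) by (simp add: u_def v_def)
  qed
  have C0: "sqrt C \<ge> 0" using C by simp
  have P1: "(\<lambda>w. \<Phi> (z, w)) \<in> CA_inf" and P2: "(\<lambda>w. \<Phi> (w, z)) \<in> CA_inf" if "z \<in> closed_upper_hp" for z
    using Phi that by (auto simp: CSA_inf_def)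
  \<comment> \<open>The reflection \<open>w \<mapsto> - cnj w\<close> sends the real points
    \<open>x i\<close> to \<open>- x i\<close>, where the extension of \<open>v\<close> is therefore
    anchored.\<close>
  have "closure (range (\<lambda>i. - x i)) = uminus ` closure (range x)"
    using closure_injective_linear_image[of uminus "range x"] by (simp add: image_image linear_iff inj_def)
  then have dense': "closure (range (\<lambda>i. - x i)) = UNIV" by (simp add: dense)
  have neg: "- cnj w \<in> closed_upper_hp" if "w \<in> closed_upper_hp" for w using that by (simp add: closed_upper_hp_def)
  obtain V where VH: "\<And>z. z \<in> closed_upper_hp \<Longrightarrow> V z \<in> carrier ell" and VC: "\<And>z. z \<in> closed_upper_hp \<Longrightarrow> hnorm ell (V z) \<le> sqrt C"
    and VA: "\<And>h. h \<in> carrier ell \<Longrightarrow> (\<lambda>z. ip ell (V z) h) \<in> CA_inf"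
    and VF: "\<And>F y z. \<lbrakk>F \<in> CA_inf; y \<in> carrier ell; \<And>i. F (of_real (- x i)) = ip ell (v i) y; z \<in> closed_upper_hp\<rbrakk> \<Longrightarrow> ip ell (V z) y = F z"
  proof (rule analytic_extension[where u=v and x="\<lambda>i. - x i", OF dense' vH vC C0], goal_cases)
    case (1 U)
    show ?case by (rule 1(1)[of U]) (fact 1)+
  qed
  define v' where "v' w = V (- cnj w)" for w
  have v'H: "v' w \<in> carrier ell" if "w \<in> closed_upper_hp" for w unfolding v'_def by (rule VH[OF neg[OF that]])
  have uv': "ip ell (u i) (v' w) = \<Phi> (of_real (x i), w)" if w: "w \<in> closed_upper_hp" for i w
  proof -
    have "ip ell (v' w) (u i) = reflect (\<lambda>w. \<Phi> (of_real (x i), w)) (- cnj w)" unfolding v'_def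
    proof (rule VF[OF CA_inf_reflect[OF P1] uH _ neg[OF w]])
      show "reflect (\<lambda>w. \<Phi> (complex_of_real (x i), w)) (complex_of_real (- x j)) = ip ell (v j) (u i)" for j
        using ip_commute[OF uH vH, of j i] by (simp add: reflect_def uv)
    qed simp
    then show ?thesis using ip_commute[OF v'H[OF w] uH, of i] by (simp add: reflect_def)
  qed
  obtain U where UH: "\<And>z. z \<in> closed_upper_hp \<Longrightarrow> U z \<in> carrier ell" and UC: "\<And>z. z \<in> closed_upper_hp \<Longrightarrow> hnorm ell (U z) \<le> sqrt C"
    and UA: "\<And>h. h \<in> carrier ell \<Longrightarrow> (\<lambda>z. ip ell (U z) h) \<in> CA_inf"
    and UF: "\<And>F y z. \<lbrakk>F \<in> CA_inf; y \<in> carrier ell; \<And>i. F (of_real (x i)) = ip ell (u i) y; z \<in> closed_upper_hp\<rbrakk> \<Longrightarrow> ip ell (U z) y = F z"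
  proof (rule analytic_extension[where u=u and x=x, OF dense uH uC C0], goal_cases)
    case (1 U)
    show ?case by (rule 1(1)[of U]) (fact 1)+
  qed
  have Uv: "ip ell (U z) (v' w) = \<Phi> (z, w)" if "z \<in> closed_upper_hp" "w \<in> closed_upper_hp" for z w
    by (rule UF[OF P2[OF that(2)] v'H[OF that(2)] _ that(1)]) (rule uv'[OF that(2), symmetric])
  define \<phi> where "\<phi> n z = co (U z) n" for n z
  define \<psi> where "\<psi> n w = cnj (co (v' w) n)" for n w
  have phi: "\<phi> n \<in> CA_inf" for n using UA[OF unit_vec_mem[of n]] by (simp add: ip_unit_right \<phi>_def[abs_def])
  have psi: "\<psi> n \<in> CA_inf" for n
  proof -
    have "reflect (\<lambda>z. ip ell (V z) (unit_vec n)) \<in> CA_inf" by (rule CA_inf_reflect[OF VA[OF unit_vec_mem]])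
    then show ?thesis by (simp add: ip_unit_right reflect_def[abs_def] \<psi>_def[abs_def] v'_def)
  qed
  have sq: "summable (\<lambda>n. (cmod (co y n))\<^sup>2)" "(\<Sum>n. (cmod (co y n))\<^sup>2) \<le> C" if "y \<in> carrier ell" "hnorm ell y \<le> sqrt C" for y
    using that co_l2[OF that(1)] by (auto simp: l2_def ell_norm)
  have phis: "summable (\<lambda>n. (cmod (\<phi> n z))\<^sup>2)" "(\<Sum>n. (cmod (\<phi> n z))\<^sup>2) \<le> C" if "z \<in> closed_upper_hp" for z
    using sq[OF UH[OF that] UC[OF that]] by (auto simp: \<phi>_def)
  have psis: "summable (\<lambda>n. (cmod (\<psi> n z))\<^sup>2)" "(\<Sum>n. (cmod (\<psi> n z))\<^sup>2) \<le> C" if "z \<in> closed_upper_hp" for z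
    using sq[OF VH[OF neg[OF that]] VC[OF neg[OF that]]] by (auto simp: \<psi>_def v'_def)
  have ne: "closed_upper_hp \<noteq> {}" using of_real_closed_upper[of 0] by blast
  have le: "square_sup \<phi> \<le> sqrt C" "square_sup \<psi> \<le> sqrt C"
    unfolding square_sup_def by (rule cSUP_least[OF ne]; use phis psis in simp)+
  have rep: "haagerup_rep CA_inf \<Phi> \<phi> \<psi>" unfolding haagerup_rep_def
  proof (intro conjI ballI)
    show "square_bounded \<phi>" "square_bounded \<psi>" unfolding square_bounded_def using phis psis by blast+
    show "(\<lambda>n. \<phi> n z * \<psi> n w) sums \<Phi> (z, w)" if "z \<in> closed_upper_hp" "w \<in> closed_upper_hp" for z w
      using ip_sums[OF UH[OF that(1)] v'H[OF that(2)]] by (simp add: Uv[OF that] \<phi>_def \<psi>_def)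
  qed (use phi psi in auto)
  have "square_sup \<phi> * square_sup \<psi> \<le> sqrt C * sqrt C"
    by (rule mult_mono[OF le]) (use C square_boundedD(4)[OF haagerup_repD(4)[OF rep] of_real_closed_upper[of 0]] in auto)
  then show thesis using that[OF rep] C by simp
qed

end

section \<open>Sequence space in the universe, the exact constant, and the uniform bound\<close>

lemma haagerup_norm_le:
  assumes "haagerup_rep CA_inf \<Phi> \<phi> \<psi>"
  shows "0 \<le> haagerup_norm CA_inf \<Phi>" "haagerup_norm CA_inf \<Phi> \<le> square_sup \<phi> * square_sup \<psi>"
proof -
  have nn: "0 \<le> square_sup \<phi> * square_sup \<psi>" if "haagerup_rep CA_inf \<Phi> \<phi> \<psi>" for \<phi> \<psi>
    using square_boundedD(4)[OF haagerup_repD(3)[OF that] of_real_closed_upper[of 0]]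
      square_boundedD(4)[OF haagerup_repD(4)[OF that] of_real_closed_upper[of 0]] by simp
  show "0 \<le> haagerup_norm CA_inf \<Phi>" unfolding haagerup_norm_def
    by (rule cInf_greatest) (use assms nn in auto)
  show "haagerup_norm CA_inf \<Phi> \<le> square_sup \<phi> * square_sup \<psi>" unfolding haagerup_norm_def
    by (rule cInf_lower) (use assms nn in \<open>auto intro!: bdd_belowI[of _ 0]\<close>)
qed

lemma dense_sequence: obtains x :: "nat \<Rightarrow> real" where "closure (range x) = UNIV"
proof
  show "closure (range (\<lambda>n. real_of_rat (from_nat_into UNIV n))) = (UNIV :: real set)"
  proof -
    have "range (\<lambda>n. real_of_rat (from_nat_into UNIV n)) = (\<rat> :: real set)"
      unfolding Rats_def by (simp add: image_image[symmetric] range_from_nat_into)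
    then show ?thesis by (simp add: Rats_closure_real)
  qed
qed

text \<open>Through a bijection of reals with sets of natural numbers, a complex sequence becomes
  countably many sets, two for each index. Pairing functions merge them into a single set, with tag
  0 for real and tag 1 for imaginary parts.\<close>

lemma sequences_embed:
  assumes "inj (emb :: real \<Rightarrow> 'v)"
  obtains \<kappa> :: "(nat \<Rightarrow> complex) \<Rightarrow> 'v" where "inj \<kappa>"
proof -
  obtain f :: "nat set \<Rightarrow> real" where f: "bij f" using nat_sets_eqpoll_reals by (auto simp: eqpoll_def)
  define code where "code a = f {prod_encode (i, prod_encode (m, k)) | i m k.
      m = 0 \<and> k \<in> inv_into UNIV f (Re (a i)) \<or> m = 1 \<and> k \<in> inv_into UNIV f (Im (a i))}" for a :: "nat \<Rightarrow> complex"
  have "inj code"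
  proof (rule injI)
    fix a b assume "code a = code b"
    then have e: "{prod_encode (i, prod_encode (m, k)) | i m k.
      m = 0 \<and> k \<in> inv_into UNIV f (Re (a i)) \<or> m = 1 \<and> k \<in> inv_into UNIV f (Im (a i))} = {prod_encode (i, prod_encode (m, k)) | i m k.
      m = 0 \<and> k \<in> inv_into UNIV f (Re (b i)) \<or> m = 1 \<and> k \<in> inv_into UNIV f (Im (b i))}"
      by (intro injD[OF bij_is_inj[OF f]]) (use \<open>code a = code b\<close> in \<open>simp only: code_def\<close>)
    have "k \<in> inv_into UNIV f (Re (a i)) \<longleftrightarrow> k \<in> inv_into UNIV f (Re (b i))" "k \<in> inv_into UNIV f (Im (a i)) \<longleftrightarrow> k \<in> inv_into UNIV f (Im (b i))" for i k
      using arg_cong[OF e, of "\<lambda>S. prod_encode (i, prod_encode (0, k)) \<in> S"] arg_cong[OF e, of "\<lambda>S. prod_encode (i, prod_encode (1, k)) \<in> S"]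
      by simp_all
    then have "inv_into UNIV f (Re (a i)) = inv_into UNIV f (Re (b i))" "inv_into UNIV f (Im (a i)) = inv_into UNIV f (Im (b i))" for i by blast+
    moreover have "inv_into UNIV f s = inv_into UNIV f t \<Longrightarrow> s = t" for s t
      using bij_is_surj[OF f] by (metis surj_f_inv_f)
    ultimately show "a = b" by (auto simp: fun_eq_iff complex_eq_iff)
  qed
  then have "inj (\<lambda>a. emb (code a))" using assms by (auto simp: inj_def)
  then show thesis by (rule that)
qed

lemma restrict_real2_app: "restrict_real2 \<Phi> (s, t) = \<Phi> (of_real s, of_real t)"
  by (simp add: restrict_real2_def)

lemma sums_single_weight: "suminf (\<lambda>b::nat. if b = 0 then 1 else 0 :: real) = 1" "summable (\<lambda>b::nat. if b = 0 then 1 else 0 :: real)"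
  using sums_single[of 0 "\<lambda>_. 1::real"] by (auto simp: sums_iff)

text \<open>With a finite Schur norm in hand, a single block of weight 1 carries each test. No
  constant is lost, which is what the equality of norms needs.\<close>

lemma schur_norm_factor:
  fixes emb :: "real \<Rightarrow> 'v"
  assumes emb: "inj emb" and Phi: "\<Phi> \<in> CSA_inf" and b: "bmeas (restrict_real2 \<Phi>)" and fin: "schur_norm TYPE('v) (restrict_real2 \<Phi>) = ennreal C" and C: "C \<ge> 0"
  obtains \<phi> \<psi> where "haagerup_rep CA_inf \<Phi> \<phi> \<psi>" "square_sup \<phi> * square_sup \<psi> \<le> C"
proof -
  obtain \<kappa> :: "(nat \<Rightarrow> complex) \<Rightarrow> 'v" where k: "inj \<kappa>" by (rule sequences_embed[OF emb])
  interpret ell2 \<kappa> by (rule ell2.intro[OF k])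
  obtain x :: "nat \<Rightarrow> real" where x: "closure (range x) = UNIV" by (rule dense_sequence)
  show thesis
  proof (rule factorization_haagerup[OF Phi x C])
    fix N and d e :: "nat \<Rightarrow> real"
    assume de: "(\<Sum>i<N. (d i)\<^sup>2) \<le> 1" "(\<Sum>i<N. (e i)\<^sup>2) \<le> 1"
    let ?w = "\<lambda>b::nat. if b = 0 then 1 else 0 :: real"
    show "weighted_factor N (\<lambda>i j. \<Phi> (of_real (x i), of_real (x j))) d e C"
    proof (rule schur_blocks[OF b, where w="?w" and d="\<lambda>_. d" and e="\<lambda>_. e" and N="\<lambda>_. N" and p=x], goal_cases)
      case (5 q Q)
      have "trace_norm ell (double_operator_integral ell (dspec q) (dspec q) (restrict_real2 \<Phi>) Q)
          \<le> schur_norm_wrt ell (dspec q) (dspec q) (restrict_real2 \<Phi>)"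
        unfolding schur_norm_wrt_def
        by (rule SUP_upper) (use 5(1,2) sums_single_weight(1) in \<open>auto simp: trace_class_def top.not_eq_extremum intro: le_less_trans\<close>)
      also have "\<dots> \<le> schur_norm TYPE('v) (restrict_real2 \<Phi>)"
        unfolding schur_norm_def by (rule Sup_upper) (use ell_hilbert dspec in blast)
      finally have "trace_norm ell (double_operator_integral ell (dspec q) (dspec q) (restrict_real2 \<Phi>) Q) \<le> ennreal C" unfolding fin .
      from 5(3)[OF C this, of 0] show ?case by (simp add: restrict_real2_app)
    qed (use de sums_single_weight in auto)
  qed (rule that)
qed

lemma borel_schur_multipliers_bmeas: assumes "\<Phi> \<in> borel_schur_multipliers TYPE('v)" shows "bmeas \<Phi>"
proof -
  have m: "\<Phi> \<in> borel_measurable borel" and "bounded (range \<Phi>)" using assms by (auto simp: borel_schur_multipliers_def)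
  then obtain K where "\<forall>y\<in>range \<Phi>. cmod y \<le> K" by (auto simp: bounded_iff)
  then show ?thesis by (intro bmeasI[OF m, of K]) blast
qed

text \<open>Gliding hump: if no constant worked, the blocks violating the constants \<open>4^b\<close> would assemble to
  a trace class operator that the multiplier does not map to a trace class operator.\<close>

lemma schur_multiplier_factor:
  fixes emb :: "real \<Rightarrow> 'v"
  assumes emb: "inj emb" and Phi: "\<Phi> \<in> CSA_inf" and b: "bmeas (restrict_real2 \<Phi>)"
    and mult: "restrict_real2 \<Phi> \<in> borel_schur_multipliers TYPE('v)"
  shows "\<Phi> \<in> haagerup_tensor CA_inf"
proof -
  obtain \<kappa> :: "(nat \<Rightarrow> complex) \<Rightarrow> 'v" where k: "inj \<kappa>" by (rule sequences_embed[OF emb])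
  interpret ell2 \<kappa> by (rule ell2.intro[OF k])
  obtain x :: "nat \<Rightarrow> real" where x: "closure (range x) = UNIV" by (rule dense_sequence)
  define W where "W N d e C = weighted_factor N (\<lambda>i j. \<Phi> (of_real (x i), of_real (x j))) d e C" for N d e C
  \<comment> \<open>The candidate constants are the powers of 4, so that failure of all of them
    supplies one violating block for each \<open>b\<close>.\<close>
  have "\<exists>b::nat. \<forall>N d e. (\<Sum>i<N. (d i)\<^sup>2) \<le> 1 \<longrightarrow> (\<Sum>i<N. (e i)\<^sup>2) \<le> 1 \<longrightarrow> W N d e (4 ^ b)"
  proof (rule ccontr)
    assume "\<not> ?thesis"
    then have "\<forall>b. \<exists>t. (\<Sum>i<fst t. (fst (snd t) i)\<^sup>2) \<le> 1 \<and> (\<Sum>i<fst t. (snd (snd t) i)\<^sup>2) \<le> 1 \<and> \<not> W (fst t) (fst (snd t)) (snd (snd t)) (4 ^ b)"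
      by simp
    from choice[OF this] obtain t where t: "\<forall>b. (\<Sum>i<fst (t b). (fst (snd (t b)) i)\<^sup>2) \<le> 1 \<and> (\<Sum>i<fst (t b). (snd (snd (t b)) i)\<^sup>2) \<le> 1
        \<and> \<not> W (fst (t b)) (fst (snd (t b))) (snd (snd (t b))) (4 ^ b)" by (rule exE)
    \<comment> \<open>The weights \<open>(1/2) ^ b\<close> keep \<open>Q\<close> in the trace class.
      If its image has trace norm \<open>c < 2 ^ n\<close>, then block \<open>n\<close> is completed
      with traces at most \<open>c * 2 ^ n\<close>, which is below \<open>4 ^ n\<close> and
      contradicts the choice of that block.\<close>
    show False
    proof (rule schur_blocks[OF b, where w="\<lambda>b. (1/2) ^ b" and d="\<lambda>b. fst (snd (t b))" and e="\<lambda>b. snd (snd (t b))" and N="\<lambda>b. fst (t b)" and p=x], goal_cases)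
      case (5 q Q)
      define T where "T = double_operator_integral ell (dspec q) (dspec q) (restrict_real2 \<Phi>) Q"
      have "Q \<in> trace_class ell" using 5(1,2) by (auto simp: trace_class_def top.not_eq_extremum intro: le_less_trans)
      moreover have "is_schur_multiplier ell (dspec q) (dspec q) (restrict_real2 \<Phi>)"
        using mult ell_hilbert dspec unfolding borel_schur_multipliers_def by blast
      ultimately have "T \<in> trace_class ell" unfolding is_schur_multiplier_def T_def by blast
      then have "trace_norm ell T < \<infinity>" by (simp add: trace_class_def)
      then obtain c where c: "c \<ge> 0" "trace_norm ell T = ennreal c" by (cases "trace_norm ell T") auto
      obtain n :: nat where n: "c < 2 ^ n" using real_arch_pow[of 2 c] by auto
      have "W (fst (t n)) (fst (snd (t n))) (snd (snd (t n))) (c / (1/2) ^ n)"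
        using 5(3)[OF c(1), of n] c(2) unfolding W_def T_def by (simp add: restrict_real2_app)
      moreover have "c / (1/2) ^ n \<le> 4 ^ n"
      proof -
        have "c * 2 ^ n \<le> 2 ^ n * 2 ^ n" using n by (intro mult_right_mono) auto
        also have "\<dots> = (4 :: real) ^ n" by (simp flip: power_mult_distrib)
        finally show ?thesis by (simp add: power_divide)
      qed
      ultimately have "W (fst (t n)) (fst (snd (t n))) (snd (snd (t n))) (4 ^ n)"
        unfolding W_def weighted_factor_def by (meson order_trans)
      then show ?case using t by blast
    qed (use t in \<open>auto intro: summable_geometric\<close>)
  qed
  then obtain n :: nat where n: "\<And>N d e. (\<Sum>i<N. (d i)\<^sup>2) \<le> 1 \<Longrightarrow> (\<Sum>i<N. (e i)\<^sup>2) \<le> 1 \<Longrightarrow> W N d e (4 ^ n)" by blast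
  show ?thesis
  proof (rule factorization_haagerup[OF Phi x, of "4 ^ n"])
    show "\<Phi> \<in> haagerup_tensor CA_inf" if "haagerup_rep CA_inf \<Phi> \<phi> \<psi>" for \<phi> \<psi>
      using that unfolding haagerup_tensor_def by blast
  qed (use n in \<open>auto simp: W_def\<close>)
qed

theorem theorem2p1:
  fixes emb :: "real \<Rightarrow> 'v"
  assumes "inj emb"
  shows "analytic_schur_multipliers TYPE('v) \<inter> CSA_inf = haagerup_tensor CA_inf \<and>
    (\<forall>\<Phi>\<in>haagerup_tensor CA_inf.
       ennreal (haagerup_norm CA_inf \<Phi>) = schur_norm TYPE('v) (restrict_real2 \<Phi>))"
proof (intro conjI equalityI subsetI ballI)
  fix \<Phi> assume h: "\<Phi> \<in> analytic_schur_multipliers TYPE('v) \<inter> CSA_inf"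
  then have m: "restrict_real2 \<Phi> \<in> borel_schur_multipliers TYPE('v)" by (simp add: analytic_schur_multipliers_def)
  from borel_schur_multipliers_bmeas[OF this] show "\<Phi> \<in> haagerup_tensor CA_inf" using schur_multiplier_factor[OF assms _ _ m] h by blast
next
  fix \<Phi> assume "\<Phi> \<in> haagerup_tensor CA_inf"
  then obtain \<phi> \<psi> where rep: "haagerup_rep CA_inf \<Phi> \<phi> \<psi>" by (auto simp: haagerup_tensor_def)
  show "\<Phi> \<in> analytic_schur_multipliers TYPE('v) \<inter> CSA_inf"
    using haagerup_in_spaces[OF rep] haagerup_schur(1)[OF rep] by (simp add: analytic_schur_multipliers_def)
next
  fix \<Phi> assume "\<Phi> \<in> haagerup_tensor CA_inf"
  then obtain \<phi> \<psi> where rep: "haagerup_rep CA_inf \<Phi> \<phi> \<psi>" by (auto simp: haagerup_tensor_def)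
  note le = haagerup_schur(2)[where 'v='v]
  \<comment> \<open>The Schur norm is finite, because one representation already bounds it.\<close>
  obtain C where C: "C \<ge> 0" "schur_norm TYPE('v) (restrict_real2 \<Phi>) = ennreal C"
    by (cases "schur_norm TYPE('v) (restrict_real2 \<Phi>)") (use le[OF rep] in \<open>auto simp: top_unique\<close>)
  from borel_schur_multipliers_bmeas[OF haagerup_schur(1)[OF rep, where 'v='v]] obtain \<phi>' \<psi>' where r: "haagerup_rep CA_inf \<Phi> \<phi>' \<psi>'" "square_sup \<phi>' * square_sup \<psi>' \<le> C"
    by (rule schur_norm_factor[OF assms haagerup_in_spaces(1)[OF rep] _ C(2,1)])
  have "haagerup_norm CA_inf \<Phi> \<le> C" using haagerup_norm_le(2)[OF r(1)] r(2) by simp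
  \<comment> \<open>Every representation, not only the one at hand, bounds the Schur norm from
    above, so the infimum over representations does as well.\<close>
  moreover have "C \<le> haagerup_norm CA_inf \<Phi>" unfolding haagerup_norm_def
  proof (rule cInf_greatest)
    fix s assume "s \<in> {square_sup \<phi> * square_sup \<psi> | \<phi> \<psi>. haagerup_rep CA_inf \<Phi> \<phi> \<psi>}"
    then obtain \<phi> \<psi> where s: "s = square_sup \<phi> * square_sup \<psi>" "haagerup_rep CA_inf \<Phi> \<phi> \<psi>" by blast
    have "0 \<le> s" using haagerup_norm_le[OF s(2)] s(1) by simp
    then show "C \<le> s" using le[OF s(2)] C s(1) by simp
  qed (use rep in blast)
  ultimately show "ennreal (haagerup_norm CA_inf \<Phi>) = schur_norm TYPE('v) (restrict_real2 \<Phi>)" by (simp add: C(2))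
qed

end
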